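(* Let $N\geq 3$ and assume (V) and (K) hold with $a_0,a,b\in\mathbb{R}$ and $b_0>\underline{b}(a_0)$. Then Eq. $-\Delta u+V(|x|)u=K(|x|)f(u)$ in $\mathbb{R}^N$ has a nonnegative nontrivial radial solution for every continuous $f:\mathbb{R}\to\mathbb{R}$ with $f(0)=0$ satisfying: (f3) $\sup_{t>0}\frac{|f(t)|}{\min\{t^{q_1-1},t^{q_2-1}\}}<+\infty$ for some $q_1,q_2>2$ with $q_1\in\mathcal{I}_1(a_0,b_0)$ and $q_2\in\mathcal{I}_2(a,b)$; (f4) there exists $\theta>2$ such that $0\leq\theta F(t)\leq f(t)t$ for all $t>0$; (f5) there exists $t_0>0$ such that $F(t_0)>0$. Moreover, if $K(|\cdot|)\in L^1(\mathbb{R}^N)$, the same conclusion holds with (f4)-(f5) replaced by: (f6) there exist $\theta>2$ and $t_0>0$ such that $0<\theta F(t)\leq f(t)t$ for all $t\geq t_0$.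
   Context: Throughout, $N\geq 3$, $2^*=2N/(N-2)$, and $F(t):=\int_0^t f(s)\,ds$. (V): $V:(0,+\infty)\to[0,+\infty)$ is continuous and $\liminf_{r\to0^+}V(r)/r^{a_0}>0$, $\liminf_{r\to+\infty}V(r)/r^{a}>0$ for some $a_0,a\in\mathbb{R}$. (K): $K:(0,+\infty)\to(0,+\infty)$ is continuous and $\limsup_{r\to0^+}K(r)/r^{b_0}<\infty$, $\limsup_{r\to+\infty}K(r)/r^{b}<\infty$ for some $b_0,b\in\mathbb{R}$. $D^{1,2}(\mathbb{R}^N)=\{u\in L^{2^*}(\mathbb{R}^N):|\nabla u|\in L^2(\mathbb{R}^N)\}$; $H^1_V=\{u\in D^{1,2}(\mathbb{R}^N):\int V(|x|)u^2dx<\infty\}$ and $H^1_{V,r}$ is its subspace of radial functions, a Hilbert space with norm $\|u\|^2=\int|\nabla u|^2dx+\int V(|x|)u^2dx$. A radial solution is $u\in H^1_{V,r}$ with $\int\nabla u\cdot\nabla h\,dx+\int V(|x|)uh\,dx=\int K(|x|)f(u)h\,dx$ for all $h\in H^1_{V,r}$. $\underline{b}(a_0):=-\infty$ if $a_0<-(2N-2)$ and $\min\{a_0,-2\}$ if $a_0\geq-(2N-2)$. $b_*(a_0):=-\infty$ if $a_0<-(2N-2)$ and $\min\{a_0,-\frac{N-a_0}{2},-\frac{N+2}{2}\}$ if $a_0\ge -(2N-2)$ (note $b_*\le\underline b$). For $b_0>b_*(a_0)$: $q_*(a_0,b_0):=\max\{1,2\frac{N+b_0}{N+a_0},2\frac{2N-2+2b_0-a_0}{2N-2+a_0}\}$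 if $a_0<-(2N-2)$; $\max\{1,2\frac{N+b_0}{N+a_0}\}$ if $-(2N-2)\le a_0<-N$; $1$ if $a_0\ge -N$. $q^*(a_0,b_0):=+\infty$ if $a_0\le-(2N-2)$; $2\frac{2N-2+2b_0-a_0}{2N-2+a_0}$ if $-(2N-2)<a_0\le -N$; $\min\{2\frac{N+b_0}{N+a_0},2\frac{2N-2+2b_0-a_0}{2N-2+a_0}\}$ if $-N<a_0<-2$; $2\frac{N+b_0}{N-2}$ if $a_0\ge-2$. $\mathcal{I}_1(a_0,b_0):=(q_*(a_0,b_0),q^*(a_0,b_0))$. $q_{**}(a,b):=\max\{1,2\frac{N+b}{N-2}\}$ if $a\le-2$; $\max\{1,2\frac{N+b}{N+a},2\frac{2N-2+2b-a}{2N-2+a}\}$ if $a>-2$. $\mathcal{I}_2(a,b):=(q_{**}(a,b),+\infty)$. *)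

theory Defs
  imports "HOL-Analysis.Analysis"
begin

definition smooth_fun :: "('a::euclidean_space \<Rightarrow> real) \<Rightarrow> bool" where
  "smooth_fun \<phi> \<longleftrightarrow> (\<exists>S. \<phi> \<in> S \<and>
     (\<forall>\<psi>\<in>S. (\<forall>x. \<psi> differentiable (at x)) \<and>
        (\<forall>i\<in>Basis. (\<lambda>x. frechet_derivative \<psi> (at x) i) \<in> S)))"

definition test_fun :: "('a::euclidean_space \<Rightarrow> real) \<Rightarrow> bool" where
  "test_fun \<phi> \<longleftrightarrow> smooth_fun \<phi> \<and> bounded {x. \<phi> x \<noteq> 0}"

definition weak_grad :: "('a::euclidean_space \<Rightarrow> real) \<Rightarrow> ('a \<Rightarrow> 'a) \<Rightarrow> bool" where
  "weak_grad u G \<longleftrightarrow> G \<in> borel_measurable lebesgue \<and>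
     (\<forall>\<phi>. test_fun \<phi> \<longrightarrow> (\<forall>i\<in>Basis.
        integrable lebesgue (\<lambda>x. u x * frechet_derivative \<phi> (at x) i) \<and>
        integrable lebesgue (\<lambda>x. (G x \<bullet> i) * \<phi> x) \<and>
        (\<integral>x. u x * frechet_derivative \<phi> (at x) i \<partial>lebesgue)
          = - (\<integral>x. (G x \<bullet> i) * \<phi> x \<partial>lebesgue)))"

definition crit_exp :: "'a::euclidean_space itself \<Rightarrow> real" where
  "crit_exp _ = 2 * real DIM('a) / (real DIM('a) - 2)"

definition D12 :: "('a::euclidean_space \<Rightarrow> real) \<Rightarrow> ('a \<Rightarrow> 'a) \<Rightarrow> bool" where
  "D12 u G \<longleftrightarrow> u \<in> borel_measurable lebesgue \<and>
     integrable lebesgue (\<lambda>x. \<bar>u x\<bar> powr crit_exp TYPE('a)) \<and>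
     weak_grad u G \<and> integrable lebesgue (\<lambda>x. (norm (G x))\<^sup>2)"

definition H1V :: "(real \<Rightarrow> real) \<Rightarrow> ('a::euclidean_space \<Rightarrow> real) \<Rightarrow> ('a \<Rightarrow> 'a) \<Rightarrow> bool" where
  "H1V V u G \<longleftrightarrow> D12 u G \<and> integrable lebesgue (\<lambda>x. V (norm x) * (u x)\<^sup>2)"

definition radial :: "('a::real_normed_vector \<Rightarrow> real) \<Rightarrow> bool" where
  "radial u \<longleftrightarrow> (\<forall>x y. norm x = norm y \<longrightarrow> u x = u y)"

definition H1Vr :: "(real \<Rightarrow> real) \<Rightarrow> ('a::euclidean_space \<Rightarrow> real) \<Rightarrow> ('a \<Rightarrow> 'a) \<Rightarrow> bool" where
  "H1Vr V u G \<longleftrightarrow> H1V V u G \<and> radial u"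

definition radial_solution ::
  "(real \<Rightarrow> real) \<Rightarrow> (real \<Rightarrow> real) \<Rightarrow> (real \<Rightarrow> real) \<Rightarrow> ('a::euclidean_space \<Rightarrow> real) \<Rightarrow> bool" where
  "radial_solution V K f u \<longleftrightarrow> (\<exists>G. H1Vr V u G \<and>
     (\<forall>h H. H1Vr V h H \<longrightarrow>
        integrable lebesgue (\<lambda>x. K (norm x) * f (u x) * h x) \<and>
        (\<integral>x. G x \<bullet> H x \<partial>lebesgue) + (\<integral>x. V (norm x) * u x * h x \<partial>lebesgue)
          = (\<integral>x. K (norm x) * f (u x) * h x \<partial>lebesgue)))"

definition Fprim :: "(real \<Rightarrow> real) \<Rightarrow> real \<Rightarrow> real" where
  "Fprim f t = integral {0..t} f"

definition b_under :: "real \<Rightarrow> real \<Rightarrow> ereal" where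
  "b_under N a0 = (if a0 < -(2*N-2) then -\<infinity> else ereal (min a0 (-2)))"

definition q_low :: "real \<Rightarrow> real \<Rightarrow> real \<Rightarrow> real" where
  "q_low N a0 b0 =
    (if a0 < -(2*N-2) then Max {1, 2*(N+b0)/(N+a0), 2*(2*N-2+2*b0-a0)/(2*N-2+a0)}
     else if a0 < -N then max 1 (2*(N+b0)/(N+a0))
     else 1)"

definition q_up :: "real \<Rightarrow> real \<Rightarrow> real \<Rightarrow> ereal" where
  "q_up N a0 b0 =
    (if a0 \<le> -(2*N-2) then \<infinity>
     else if a0 \<le> -N then ereal (2*(2*N-2+2*b0-a0)/(2*N-2+a0))
     else if a0 < -2 then ereal (min (2*(N+b0)/(N+a0)) (2*(2*N-2+2*b0-a0)/(2*N-2+a0)))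
     else ereal (2*(N+b0)/(N-2)))"

definition I1 :: "real \<Rightarrow> real \<Rightarrow> real \<Rightarrow> real set" where
  "I1 N a0 b0 = {q. q_low N a0 b0 < q \<and> ereal q < q_up N a0 b0}"

definition q_low2 :: "real \<Rightarrow> real \<Rightarrow> real \<Rightarrow> real" where
  "q_low2 N a b =
    (if a \<le> -2 then max 1 (2*(N+b)/(N-2))
     else Max {1, 2*(N+b)/(N+a), 2*(2*N-2+2*b-a)/(2*N-2+a)})"

definition I2 :: "real \<Rightarrow> real \<Rightarrow> real \<Rightarrow> real set" where
  "I2 N a b = {q. q_low2 N a b < q}"

end

theory Submission
  imports Defs "HOL-Complex_Analysis.Great_Picard"
begin

text \<open>Radial elements of \<open>H\<^sup>1\<^sub>V\<close> correspond, in polar coordinates, to pairs \<open>(r\<^sup>(\<^sup>N\<^sup>-\<^sup>1\<^sup>)\<^sup>/\<^sup>2 w', (V r\<^sup>N\<^sup>-\<^sup>1)\<^sup>1\<^sup>/\<^sup>2 w)\<close>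
  forming a closed subspace of \<open>L\<^sup>2 \<times> L\<^sup>2\<close>. There the energy functional has one-dimensional integrals,
  and the growth of \<open>V\<close> improves the pointwise decay of \<open>w\<close> near \<open>0\<close> and infinity. The intervals \<open>I\<^sub>1\<close>, \<open>I\<^sub>2\<close>
  are what makes the contributions of small and large radii to the nonlinear term uniformly small on
  bounded sets, so the derivative of that term is compact. Replacing \<open>f\<close> by \<open>0\<close> on negative arguments,
  the mountain pass theorem (via Ekeland's principle) yields a nontrivial critical point, and testing with its
  negative part shows that it is nonnegative. Finally every radial \<open>D\<^sup>1\<^sup>,\<^sup>2\<close> function with a weak gradient is
  almost everywhere the profile obtained from the radial part of that gradient, so critical points on
  profiles are radial solutions.\<close>

section \<open>Hilbert space and variational tools\<close>

text \<open>Where V beats r^-2 the profile decays like r^(-(2N-2+a)/4); elsewhere Hardy plays the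
  part of V, with a replaced by -2. Extracting |w|^(q-2) by this decay from K |f(w)| |h| and
  dividing by the weight r^(N-1) r^a leaves a single power of r, whose exponent is linear in q. The
  intervals I1 and I2 make this power tend to 0 at both ends. As f is bounded by the minimum of two
  powers, q1 can be used at small radii and q2 at large ones.

  The gradient of the nonlinear term is a map T given by Riesz, so critical points are fixed points
  u = T u. Since T is compact, a bounded sequence with u_n - T u_n -> 0 has a convergent
  subsequence.

  A test function comes with a weak gradient H about which nothing radial is assumed. It enters the
  equation only through its pairings with radial gradients, so only the functional formed by these
  pairings is represented by a profile; H itself is never determined.\<close>

lemma riesz_subspace:
  fixes S :: "'h::{real_inner,complete_space} set" and l :: "'h \<Rightarrow> real"
  assumes S: "subspace S" "closed S"
    and add: "\<And>x y. x \<in> S \<Longrightarrow> y \<in> S \<Longrightarrow> l (x + y) = l x + l y"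
    and scale: "\<And>c x. x \<in> S \<Longrightarrow> l (c *\<^sub>R x) = c * l x"
    and bound: "\<And>x. x \<in> S \<Longrightarrow> \<bar>l x\<bar> \<le> B * norm x"
  shows "\<exists>z\<in>S. \<forall>h\<in>S. z \<bullet> h = l h"
proof -
  \<comment> \<open>Minimising this quadratic functional over S yields the representing vector
    directly in the subspace: the vanishing of its first variation is the equation z . h = l
    h.\<close>
  define p where "p u = (norm u)\<^sup>2 / 2 - l u" for u
  define m where "m = Inf (p ` S)"
  have S0: "0 \<in> S" using S(1) by (rule subspace_0)
  have p_ge: "p u \<ge> - B\<^sup>2 / 2" if "u \<in> S" for u
  proof -
    have "l u \<le> B * norm u" using bound[OF that] by simp
    moreover have "0 \<le> (norm u - B)\<^sup>2" by simp
    ultimately show ?thesis by (simp add: p_def power2_eq_square algebra_simps)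
  qed
  have bdd: "bdd_below (p ` S)" using p_ge by (auto intro!: bdd_belowI)
  have m_le: "m \<le> p u" if "u \<in> S" for u
    unfolding m_def using bdd that by (auto intro: cINF_lower)
  have "\<exists>u\<in>S. p u < m + 1 / real (Suc n)" for n
    using cInf_lessD[of "p ` S" "m + 1 / real (Suc n)"] S0 unfolding m_def by auto
  then obtain u where u: "\<And>n. u n \<in> S" "\<And>n. p (u n) < m + 1 / real (Suc n)" by metis
  \<comment> \<open>Parallelogram law: the midpoint lies in S, so its value is at least m, and two
    points with almost minimal values must be close to each other.\<close>
  have key: "(norm (u i - u j))\<^sup>2 \<le> 4 * (1 / real (Suc i) + 1 / real (Suc j))" for i j
  proof -
    have mid: "(1/2) *\<^sub>R (u i + u j) \<in> S" using S(1) u(1) by (simp add: subspace_add subspace_scale)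
    have lm: "l ((1/2) *\<^sub>R (u i + u j)) = (l (u i) + l (u j)) / 2"
      using scale[of "u i + u j" "1/2"] add[of "u i" "u j"] u(1) S(1) by (simp add: subspace_add)
    have par: "(norm (u i - u j))\<^sup>2 + (norm (u i + u j))\<^sup>2 = 2 * (norm (u i))\<^sup>2 + 2 * (norm (u j))\<^sup>2"
      by (simp add: power2_norm_eq_inner inner_simps inner_commute)
    have nm: "(norm ((1/2) *\<^sub>R (u i + u j)))\<^sup>2 = (norm (u i + u j))\<^sup>2 / 4"
      by (simp add: power_divide del: scaleR_right_distrib scaleR_add_right)
    have "(norm (u i - u j))\<^sup>2 / 4 = p (u i) + p (u j) - 2 * p ((1/2) *\<^sub>R (u i + u j))"
      unfolding p_def lm nm using par by argo
    also have "\<dots> \<le> 1 / real (Suc i) + 1 / real (Suc j)"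
      using u(2)[of i] u(2)[of j] m_le[OF mid] by linarith
    finally show ?thesis by simp
  qed
  have "Cauchy u"
  proof (rule metric_CauchyI)
    fix e :: real assume e: "e > 0"
    obtain n0 where n0: "1 / real (Suc n0) < e\<^sup>2 / 8"
      using nat_approx_posE[of "e\<^sup>2/8"] e by auto
    have "dist (u i) (u j) < e" if ij: "i \<ge> n0" "j \<ge> n0" for i j
    proof -
      have "1 / real (Suc i) \<le> 1 / real (Suc n0)" "1 / real (Suc j) \<le> 1 / real (Suc n0)"
        using ij by (auto intro!: divide_left_mono)
      then have "(norm (u i - u j))\<^sup>2 < e\<^sup>2" using key[of i j] n0 by argo
      then show ?thesis using e power2_less_imp_less[of "norm (u i - u j)" e] by (simp add: dist_norm)
    qed
    then show "\<exists>M. \<forall>m\<ge>M. \<forall>n\<ge>M. dist (u m) (u n) < e" by blast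
  qed
  then obtain z where z: "u \<longlonglongrightarrow> z" using Cauchy_convergent_iff convergent_def by blast
  have zS: "z \<in> S" using S(2) z u(1) closed_sequentially by blast
  have l_lim: "(\<lambda>n. l (u n)) \<longlonglongrightarrow> l z"
  proof (rule LIM_zero_cancel)
    show "(\<lambda>n. l (u n) - l z) \<longlonglongrightarrow> 0"
    proof (rule Lim_null_comparison)
      show "\<forall>\<^sub>F n in sequentially. norm (l (u n) - l z) \<le> \<bar>B\<bar> * norm (u n - z)"
      proof (intro always_eventually allI)
        fix n
        have "l (u n - z) = l (u n) - l z"
          using add[of "u n" "(-1) *\<^sub>R z"] scale[of z "-1"] u(1) zS S(1) by (simp add: subspace_neg)
        then have "\<bar>l (u n) - l z\<bar> \<le> B * norm (u n - z)"
          using bound[of "u n - z"] u(1) zS S(1) by (simp add: subspace_diff)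
        also have "\<dots> \<le> \<bar>B\<bar> * norm (u n - z)" by (intro mult_right_mono) auto
        finally show "norm (l (u n) - l z) \<le> \<bar>B\<bar> * norm (u n - z)" by simp
      qed
      show "(\<lambda>n. \<bar>B\<bar> * norm (u n - z)) \<longlonglongrightarrow> 0"
        using tendsto_mult_right_zero[OF tendsto_norm_zero[OF LIM_zero[OF z]]] by fast
    qed
  qed
  have "(\<lambda>n. p (u n)) \<longlonglongrightarrow> p z" unfolding p_def by (intro tendsto_intros z l_lim) simp
  moreover have "(\<lambda>n. m + 1 / real (Suc n)) \<longlonglongrightarrow> m"
    using tendsto_add[OF tendsto_const LIMSEQ_Suc[OF lim_1_over_n]] by simp
  ultimately have pz: "p z \<le> m"
    by (rule LIMSEQ_le) (use u(2) less_imp_le in blast)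
  have "z \<bullet> h = l h" if h: "h \<in> S" for h
  proof (rule ccontr)
    assume ne: "z \<bullet> h \<noteq> l h"
    define d where "d = z \<bullet> h - l h"
    define q where "q = (norm h)\<^sup>2"
    have "d \<noteq> 0" using ne by (simp add: d_def)
    have h0: "q > 0"
    proof -
      have "h \<noteq> 0" using ne scale[OF S0, of 0] by auto
      then show ?thesis by (simp add: q_def)
    qed
    \<comment> \<open>The minimiser of the quadratic t d + t^2 q / 2, which takes the value - d^2 /
      (2 q) there.\<close>
    define t where "t = - d / q"
    have "z + t *\<^sub>R h \<in> S" using zS h S(1) by (simp add: subspace_add subspace_scale)
    then have "p z \<le> p (z + t *\<^sub>R h)" using pz m_le by fastforce
    also have "p (z + t *\<^sub>R h) = p z + t * d + t\<^sup>2 * q / 2"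
      using add[of z "t *\<^sub>R h"] scale[of h t] zS h S(1) unfolding p_def d_def q_def power2_norm_eq_inner
      by (simp add: subspace_scale inner_simps inner_commute algebra_simps power2_eq_square)
    finally have "0 \<le> t * d + t\<^sup>2 * q / 2" by linarith
    moreover have "t * d + t\<^sup>2 * q / 2 = - (d\<^sup>2 / (2 * q))"
      using h0 unfolding t_def by (simp add: field_simps power2_eq_square)
    moreover have "d\<^sup>2 / (2 * q) > 0" using \<open>d \<noteq> 0\<close> h0 by simp
    ultimately show False by linarith
  qed
  then show ?thesis using zS by blast
qed

text \<open>Lower semicontinuity is asked as closedness of sublevel sets along sequences, the form
  in which a supremum over paths provides it. A sequence of almost minimisers is followed through
  the shrinking sets \<open>S (u n)\<close>; a point left in all of them is one from which the value
  cannot drop faster than e times the distance.\<close>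

lemma ekeland:
  fixes X :: "'m::complete_space set" and \<Psi> :: "'m \<Rightarrow> real"
  assumes X: "closed X" and x0: "x0 \<in> X" and e: "e > 0"
    and bdd: "\<And>x. x \<in> X \<Longrightarrow> b \<le> \<Psi> x"
    and lsc: "\<And>y x c. (\<And>n::nat. y n \<in> X) \<Longrightarrow> y \<longlonglongrightarrow> x \<Longrightarrow> (\<And>n. \<Psi> (y n) \<le> c) \<Longrightarrow> \<Psi> x \<le> c"
  shows "\<exists>x\<in>X. \<Psi> x \<le> \<Psi> x0 \<and> (\<forall>y\<in>X. \<Psi> x - e * dist x y \<le> \<Psi> y)"
proof -
  define S where "S x = {y\<in>X. \<Psi> y + e * dist x y \<le> \<Psi> x}" for x
  have S_self: "x \<in> S x" if "x \<in> X" for x using that by (simp add: S_def)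
  have S_trans: "z \<in> S x" if "y \<in> S x" "z \<in> S y" for x y z
  proof -
    have "e * dist x z \<le> e * dist x y + e * dist y z"
      using e dist_triangle[of x z y] by (metis distrib_left less_imp_le mult_left_mono)
    then show ?thesis using that by (auto simp: S_def)
  qed
  have ex: "\<exists>y\<in>S x. \<forall>z\<in>S x. \<Psi> y \<le> \<Psi> z + d" if "x \<in> X" "d > 0" for x d
  proof -
    have bd: "bdd_below (\<Psi> ` S x)" using bdd by (auto intro!: bdd_belowI simp: S_def)
    have "\<exists>y\<in>S x. \<Psi> y < Inf (\<Psi> ` S x) + d"
      using cInf_lessD[of "\<Psi> ` S x" "Inf (\<Psi> ` S x) + d"] S_self[OF that(1)] that(2) by auto
    then obtain y where y: "y \<in> S x" "\<Psi> y < Inf (\<Psi> ` S x) + d" by blast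
    have "\<Psi> y \<le> \<Psi> z + d" if "z \<in> S x" for z
      using cINF_lower[OF bd that] y by linarith
    then show ?thesis using y by blast
  qed
  \<comment> \<open>The tolerance 1 / (n + 1) bounds the radius of \<open>S (u (Suc n))\<close>
    about \<open>u (Suc n)\<close> by 1 / (e (n + 1)), which makes u a Cauchy sequence.\<close>
  define nxt where "nxt n x = (SOME y. y \<in> S x \<and> (\<forall>z\<in>S x. \<Psi> y \<le> \<Psi> z + 1 / real (Suc n)))" for n x
  define u where "u = rec_nat x0 nxt"
  have u0: "u 0 = x0" and uS: "\<And>n. u (Suc n) = nxt n (u n)" by (simp_all add: u_def)
  have nxt: "nxt n x \<in> S x \<and> (\<forall>z\<in>S x. \<Psi> (nxt n x) \<le> \<Psi> z + 1 / real (Suc n))" if "x \<in> X" for n x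
  proof -
    have "\<exists>y. y \<in> S x \<and> (\<forall>z\<in>S x. \<Psi> y \<le> \<Psi> z + 1 / real (Suc n))"
      using ex[OF that, of "1 / real (Suc n)"] by auto
    then show ?thesis unfolding nxt_def by (rule someI_ex)
  qed
  have uX: "u n \<in> X" for n
    by (induction n) (use x0 u0 uS nxt in \<open>auto simp: S_def\<close>)
  have mono: "u (n + k) \<in> S (u n)" for n k
    by (induction k) (use S_self uX uS nxt S_trans in \<open>auto\<close>)
  have small: "e * dist (u (Suc n)) y \<le> 1 / real (Suc n)" if "y \<in> S (u (Suc n))" for n y
  proof -
    have "y \<in> S (u n)" using S_trans[of "u (Suc n)" "u n" y] that nxt[OF uX] uS by auto
    then have "\<Psi> (u (Suc n)) \<le> \<Psi> y + 1 / real (Suc n)" using nxt[OF uX, of n n] uS by auto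
    moreover have "\<Psi> y + e * dist (u (Suc n)) y \<le> \<Psi> (u (Suc n))" using that by (simp add: S_def)
    ultimately show ?thesis by linarith
  qed
  have "Cauchy u"
  proof (rule metric_CauchyI)
    fix d :: real assume d: "d > 0"
    obtain n where n: "1 / real (Suc n) < d * e / 2" using nat_approx_posE[of "d*e/2"] d e by auto
    have cl: "dist (u (Suc n)) (u i) < d / 2" if "i \<ge> Suc n" for i
    proof -
      have "u i \<in> S (u (Suc n))" using mono[of "Suc n" "i - Suc n"] that by simp
      then have "e * dist (u (Suc n)) (u i) < e * (d/2)"
        using small[of "u i" n] n by (simp add: algebra_simps)
      then show ?thesis using e by simp
    qed
    have "dist (u i) (u j) < d" if "i \<ge> Suc n" "j \<ge> Suc n" for i j
      using cl[OF that(1)] cl[OF that(2)] dist_triangle3[of "u i" "u j" "u (Suc n)"] by linarith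
    then show "\<exists>M. \<forall>m\<ge>M. \<forall>n\<ge>M. dist (u m) (u n) < d" by blast
  qed
  then obtain x where x: "u \<longlonglongrightarrow> x" using Cauchy_convergent_iff convergent_def by blast
  have xX: "x \<in> X" using X uX x closed_sequentially by blast
  have xS: "x \<in> S (u n)" for n
  proof -
    \<comment> \<open>Semicontinuity works with a constant bound c, whereas the distances from
      \<open>u n\<close> to later members only converge; the slack d absorbs the difference.\<close>
    have "\<Psi> x \<le> \<Psi> (u n) - e * dist (u n) x + d" if d: "d > 0" for d
    proof -
      have "(\<lambda>j. dist (u n) (u (j + n))) \<longlonglongrightarrow> dist (u n) x"
        by (intro tendsto_intros LIMSEQ_ignore_initial_segment x)
      then have "\<forall>\<^sub>F j in sequentially. dist (u n) (u (j + n)) > dist (u n) x - d / e"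
        by (rule order_tendstoD) (use d e in simp)
      then obtain j0 where j0: "\<And>j. j \<ge> j0 \<Longrightarrow> dist (u n) (u (j + n)) > dist (u n) x - d / e"
        unfolding eventually_sequentially by blast
      show ?thesis
      proof (rule lsc[of "\<lambda>j. u (j + (j0 + n))"])
        show "(\<lambda>j. u (j + (j0 + n))) \<longlonglongrightarrow> x" by (intro LIMSEQ_ignore_initial_segment x)
        fix j
        show "u (j + (j0 + n)) \<in> X" by (rule uX)
        have "\<Psi> (u (j + (j0 + n))) + e * dist (u n) (u (j + j0 + n)) \<le> \<Psi> (u n)"
          using mono[of n "j + j0"] by (auto simp: S_def ac_simps)
        moreover have "e * (dist (u n) x - d / e) \<le> e * dist (u n) (u (j + j0 + n))"
          using j0[of "j + j0"] e by (intro mult_left_mono) auto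
        moreover have "e * (dist (u n) x - d / e) = e * dist (u n) x - d" using e by (simp add: field_simps)
        ultimately show "\<Psi> (u (j + (j0 + n))) \<le> \<Psi> (u n) - e * dist (u n) x + d" by linarith
      qed
    qed
    then have "\<Psi> x \<le> \<Psi> (u n) - e * dist (u n) x" by (rule field_le_epsilon)
    then show ?thesis using xX by (simp add: S_def)
  qed
  have "\<Psi> x - e * dist x y \<le> \<Psi> y" if y: "y \<in> X" for y
  proof (rule ccontr)
    assume neg: "\<not> \<Psi> x - e * dist x y \<le> \<Psi> y"
    then have "y \<in> S x" using y by (simp add: S_def)
    then have yS: "y \<in> S (u n)" for n using S_trans xS by blast
    have "(\<lambda>n. e * dist (u (Suc n)) y) \<longlonglongrightarrow> 0"
    proof (rule Lim_null_comparison)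
      show "\<forall>\<^sub>F n in sequentially. norm (e * dist (u (Suc n)) y) \<le> 1 / real (Suc n)"
        using small[OF yS] e by (intro always_eventually) simp
      show "(\<lambda>n. 1 / real (Suc n)) \<longlonglongrightarrow> 0" using LIMSEQ_Suc[OF lim_1_over_n] by simp
    qed
    moreover have "(\<lambda>n. e * dist (u (Suc n)) y) \<longlonglongrightarrow> e * dist x y"
      by (intro tendsto_intros LIMSEQ_Suc x)
    ultimately have "e * dist x y = 0" using LIMSEQ_unique by blast
    then have "x = y" using e by simp
    then show False using neg by simp
  qed
  moreover have "\<Psi> x \<le> \<Psi> x0"
    using xS[of 0] u0 mult_nonneg_nonneg[OF less_imp_le[OF e] zero_le_dist[of x0 x]] unfolding S_def by auto
  ultimately show ?thesis using xX by blast
qed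

text \<open>The energy |u|^2/2 - J u has gradient u - T u, and the mean value theorem along segments
  makes directional derivatives and continuity of T sufficient. Ekeland's principle, applied to the
  maximum of the energy along a path, yields paths that cannot be pushed down efficiently, so near
  their top there are points with small gradient. \<open>AR\<close> bounds these points, its
  additive constant C being harmless against the square of the norm, and compactness of T makes them
  converge.\<close>

theorem mountain_pass:
  fixes S :: "'h::{real_inner,complete_space} set" and J :: "'h \<Rightarrow> real" and T :: "'h \<Rightarrow> 'h"
  assumes S: "subspace S" "closed S"
    and T_in: "\<And>u. u \<in> S \<Longrightarrow> T u \<in> S"
    and T_cont: "continuous_on S T"
    and deriv: "\<And>u h. u \<in> S \<Longrightarrow> h \<in> S \<Longrightarrow>
                  ((\<lambda>t. J (u + t *\<^sub>R h)) has_real_derivative T u \<bullet> h) (at 0)"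
    and J0: "J 0 = 0"
    and compact: "\<And>x. (\<And>n::nat. x n \<in> S) \<Longrightarrow> bounded (range x) \<Longrightarrow>
                    \<exists>r z. strict_mono r \<and> (\<lambda>n. T (x (r n))) \<longlonglongrightarrow> z"
    and AR: "\<theta> > 2" "\<And>u. u \<in> S \<Longrightarrow> \<theta> * J u \<le> T u \<bullet> u + C"
    and geom: "\<rho> > 0" "\<alpha> > 0" "\<And>u. u \<in> S \<Longrightarrow> norm u = \<rho> \<Longrightarrow> \<alpha> \<le> (norm u)\<^sup>2 / 2 - J u"
    and e: "e \<in> S" "norm e > \<rho>" "(norm e)\<^sup>2 / 2 - J e \<le> 0"
  shows "\<exists>u\<in>S. T u = u \<and> u \<noteq> 0"
proof -
  define I where "I u = (norm u)\<^sup>2 / 2 - J u" for u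
  define D where "D u = u - T u" for u
  have S0: "0 \<in> S" using S(1) by (rule subspace_0)
  have lin: "u + t *\<^sub>R h \<in> S" if "u \<in> S" "h \<in> S" for u h t
    using that S(1) by (simp add: subspace_add subspace_scale)
  have derivt: "((\<lambda>t. I (u + t *\<^sub>R h)) has_real_derivative D (u + s *\<^sub>R h) \<bullet> h) (at s)"
    if "u \<in> S" "h \<in> S" for u h s
  proof -
    have "((\<lambda>t. J ((u + s *\<^sub>R h) + t *\<^sub>R h)) has_real_derivative T (u + s *\<^sub>R h) \<bullet> h) (at (s - s))"
      using deriv[OF lin[OF that] that(2)] by simp
    then have "((\<lambda>t. J ((u + s *\<^sub>R h) + (t - s) *\<^sub>R h)) has_real_derivative T (u + s *\<^sub>R h) \<bullet> h) (at s)"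
      using DERIV_shift[of "\<lambda>t. J ((u + s *\<^sub>R h) + (t - s) *\<^sub>R h)" _ 0 s] by simp
    then have 1: "((\<lambda>t. J (u + t *\<^sub>R h)) has_real_derivative T (u + s *\<^sub>R h) \<bullet> h) (at s)"
      by (simp add: algebra_simps)
    have 2: "((\<lambda>t. (norm (u + t *\<^sub>R h))\<^sup>2 / 2) has_real_derivative (u + s *\<^sub>R h) \<bullet> h) (at s)"
    proof -
      have "(\<lambda>t. (norm (u + t *\<^sub>R h))\<^sup>2 / 2) = (\<lambda>t. (u \<bullet> u + 2 * t * (u \<bullet> h) + t\<^sup>2 * (h \<bullet> h)) / 2)"
        unfolding power2_norm_eq_inner by (simp add: fun_eq_iff inner_simps inner_commute power2_eq_square algebra_simps)
      then show ?thesis by (auto intro!: derivative_eq_intros simp: inner_simps algebra_simps)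
    qed
    show ?thesis unfolding I_def D_def
      using DERIV_diff[OF 2 1] by (simp add: inner_diff_left)
  qed
  have mvt: "\<exists>\<tau>. 0 < \<tau> \<and> \<tau> < 1 \<and> I (u + h) - I u = D (u + \<tau> *\<^sub>R h) \<bullet> h" if "u \<in> S" "h \<in> S" for u h
    using MVT2[of 0 1 "\<lambda>t. I (u + t *\<^sub>R h)" "\<lambda>s. D (u + s *\<^sub>R h) \<bullet> h"] derivt[OF that] by auto
  have D_cont: "continuous_on S D" unfolding D_def by (intro continuous_intros T_cont)
  have I_cont: "continuous_on S I"
    unfolding continuous_on_iff
  proof (intro ballI allI impI)
    fix u and d :: real assume u: "u \<in> S" and d: "d > 0"
    obtain d1 where d1: "d1 > 0" "\<And>x. x \<in> S \<Longrightarrow> dist x u < d1 \<Longrightarrow> dist (D x) (D u) < 1"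
      using D_cont u unfolding continuous_on_iff by (metis zero_less_one)
    define d2 where "d2 = min d1 (d / (norm (D u) + 1))"
    have "d2 > 0" using d d1 by (simp add: d2_def add_nonneg_pos)
    moreover have "dist (I x) (I u) < d" if x: "x \<in> S" "dist x u < d2" for x
    proof -
      obtain \<tau> where \<tau>: "0 < \<tau>" "\<tau> < 1" "I x - I u = D (u + \<tau> *\<^sub>R (x - u)) \<bullet> (x - u)"
        using mvt[OF u, of "x - u"] x u S(1) by (auto simp: subspace_diff)
      have "dist (u + \<tau> *\<^sub>R (x - u)) u = \<tau> * dist x u" using \<tau> by (simp add: dist_norm)
      also have "\<dots> \<le> dist x u" using \<tau> by (simp add: mult_left_le_one_le)
      finally have "dist (D (u + \<tau> *\<^sub>R (x - u))) (D u) < 1"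
        using x u S(1) by (intro d1(2)) (auto simp: lin subspace_diff d2_def)
      then have "norm (D (u + \<tau> *\<^sub>R (x - u))) \<le> norm (D u) + 1"
        unfolding dist_norm using norm_triangle_sub[of "D (u + \<tau> *\<^sub>R (x - u))" "D u"] by linarith
      then have "\<bar>I x - I u\<bar> \<le> (norm (D u) + 1) * dist x u"
        unfolding \<tau>(3) dist_norm
        using Cauchy_Schwarz_ineq2[of "D (u + \<tau> *\<^sub>R (x - u))" "x - u"] mult_right_mono norm_ge_zero order_trans by metis
      also have "\<dots> < (norm (D u) + 1) * (d / (norm (D u) + 1))"
        using x(2) by (intro mult_strict_left_mono) (auto simp: d2_def add_nonneg_pos)
      also have "\<dots> = d" by (simp add: add_nonneg_eq_0_iff)
      finally show ?thesis by (simp add: dist_real_def)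
    qed
    ultimately show "\<exists>d'>0. \<forall>x\<in>S. dist x u < d' \<longrightarrow> dist (I x) (I u) < d" by blast
  qed
  \<comment> \<open>Paths are taken on the whole line and constant outside (0, 1), so that they form
    a closed subset of the complete space of bounded continuous functions.\<close>
  define \<Gamma> where "\<Gamma> = {g :: real \<Rightarrow>\<^sub>C 'h. (\<forall>t. g t \<in> S) \<and> (\<forall>t\<le>0. g t = 0) \<and> (\<forall>t\<ge>1. g t = e)}"
  define \<Psi> where "\<Psi> g = (SUP t\<in>{0..1}. I (apply_bcontfun g t))" for g :: "real \<Rightarrow>\<^sub>C 'h"
  have I_path: "continuous_on A (\<lambda>t. I (apply_bcontfun g t))" if "g \<in> \<Gamma>" for g A
    by (rule continuous_on_compose2[OF I_cont]) (use that in \<open>auto simp: \<Gamma>_def\<close>)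
  have bdd: "bdd_above ((\<lambda>t. I (apply_bcontfun g t)) ` {0..1})" if "g \<in> \<Gamma>" for g
    by (intro bounded_imp_bdd_above compact_imp_bounded compact_continuous_image I_path that) simp
  have le_\<Psi>: "I (g t) \<le> \<Psi> g" if "g \<in> \<Gamma>" "t \<in> {0..1}" for g t
    unfolding \<Psi>_def by (rule cSUP_upper[OF that(2) bdd[OF that(1)]])
  have \<Psi>_le: "\<Psi> g \<le> c" if "\<And>t. t \<in> {0..1} \<Longrightarrow> I (apply_bcontfun g t) \<le> c" for g c
    unfolding \<Psi>_def by (rule cSUP_least) (use that in auto)
  have \<Psi>_ge: "\<alpha> \<le> \<Psi> g" if g: "g \<in> \<Gamma>" for g
  proof -
    have "\<exists>t\<ge>0. t \<le> 1 \<and> norm (g t) = \<rho>"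
      by (rule IVT') (use g e geom(1) in \<open>auto simp: \<Gamma>_def intro!: continuous_intros\<close>)
    then obtain t where t: "t \<in> {0..1}" "norm (g t) = \<rho>" by auto
    have "\<alpha> \<le> I (g t)" unfolding I_def using geom(3)[of "g t"] g t by (auto simp: \<Gamma>_def)
    then show ?thesis using le_\<Psi>[OF g t(1)] by linarith
  qed
  have closed_\<Gamma>: "closed \<Gamma>"
    unfolding closed_sequential_limits
  proof (intro allI impI)
    fix g and l :: "real \<Rightarrow>\<^sub>C 'h" assume g: "(\<forall>n. g n \<in> \<Gamma>) \<and> g \<longlonglongrightarrow> l"
    have lim: "(\<lambda>n. g n t) \<longlonglongrightarrow> l t" for t
      using tendsto_uniform_limitI[OF tendsto_bcontfun_uniform_limit] g by blast
    have "l t \<in> S" for t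
      using closed_sequentially[OF S(2) _ lim[of t]] g by (auto simp: \<Gamma>_def)
    moreover have "l t = 0" if "t \<le> 0" for t
      using lim[of t] g that LIMSEQ_unique[OF lim[of t], of 0] by (simp add: \<Gamma>_def)
    moreover have "l t = e" if "t \<ge> 1" for t
      using lim[of t] g that LIMSEQ_unique[OF lim[of t], of e] by (simp add: \<Gamma>_def)
    ultimately show "l \<in> \<Gamma>" by (simp add: \<Gamma>_def)
  qed
  define f0 where "f0 t = (min 1 (max 0 t)) *\<^sub>R e" for t :: real
  have f0: "f0 \<in> bcontfun"
    unfolding bcontfun_def
  proof (intro CollectI conjI)
    show "continuous_on UNIV f0" unfolding f0_def by (intro continuous_intros)
    have "norm (f0 t) \<le> norm e" for t
    proof -
      have "norm (f0 t) = \<bar>min 1 (max 0 t)\<bar> * norm e" by (simp add: f0_def)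
      also have "\<dots> \<le> 1 * norm e" by (intro mult_right_mono) auto
      finally show ?thesis by simp
    qed
    then show "bounded (range f0)" by (auto simp: bounded_iff)
  qed
  define g0 where "g0 = Bcontfun f0"
  have g0: "g0 \<in> \<Gamma>"
    unfolding \<Gamma>_def g0_def using e S(1) by (auto simp: Bcontfun_inverse[OF f0] f0_def subspace_scale)
  have lsc: "\<Psi> x \<le> c" if y: "\<And>n::nat. y n \<in> \<Gamma>" "y \<longlonglongrightarrow> x" "\<And>n. \<Psi> (y n) \<le> c" for y x c
  proof (rule \<Psi>_le)
    fix t :: real assume t: "t \<in> {0..1}"
    have xG: "x \<in> \<Gamma>" using closed_sequentially[OF closed_\<Gamma> _ y(2)] y(1) by blast
    have "(\<lambda>n. y n t) \<longlonglongrightarrow> x t"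
      using tendsto_uniform_limitI[OF tendsto_bcontfun_uniform_limit[OF y(2)]] by blast
    then have "(\<lambda>n. I (y n t)) \<longlonglongrightarrow> I (x t)"
      by (rule continuous_on_tendsto_compose[OF I_cont]) (use y(1) xG in \<open>auto simp: \<Gamma>_def\<close>)
    then show "I (x t) \<le> c"
      by (rule LIMSEQ_le_const2) (use le_\<Psi>[OF y(1) t] y(3) order_trans in blast)
  qed
  have almost: "\<exists>u\<in>S. \<alpha> / 2 \<le> I u \<and> I u \<le> \<Psi> g0 \<and> norm (D u) \<le> 2 * \<epsilon>" if \<epsilon>: "\<epsilon> > 0" for \<epsilon>
  proof -
    have "\<exists>g\<in>\<Gamma>. \<Psi> g \<le> \<Psi> g0 \<and> (\<forall>y\<in>\<Gamma>. \<Psi> g - \<epsilon> * dist g y \<le> \<Psi> y)"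
      by (rule ekeland[OF closed_\<Gamma> g0 \<epsilon> \<Psi>_ge]) (use lsc in blast)+
    then obtain g where g: "g \<in> \<Gamma>" "\<Psi> g \<le> \<Psi> g0" "\<And>y. y \<in> \<Gamma> \<Longrightarrow> \<Psi> g - \<epsilon> * dist g y \<le> \<Psi> y"
      by blast
    show ?thesis
    proof (rule ccontr)
      assume "\<not> ?thesis"
      then have big: "norm (D (g t)) > 2 * \<epsilon>" if "t \<in> {0..1}" "\<alpha> / 2 \<le> I (g t)" for t
        using that g le_\<Psi>[OF g(1) that(1)] unfolding \<Gamma>_def by force
      define m where "m = \<Psi> g"
      define d where "d = \<alpha> / 2"
      have d: "d > 0" "m - d \<ge> \<alpha> / 2" using geom(2) \<Psi>_ge[OF g(1)] by (auto simp: d_def m_def)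
      \<comment> \<open>The cut-off is 1 where the energy is within d / 2 of the maximum m and 0
        below m - d. The end points have energy at most 0 < m - d, so the deformation fixes them. In
        \<open>v\<close>, dividing by the maximum with 2 * \<epsilon> keeps the field continuous and
        of norm at most 1 even where the gradient is small.\<close>
      define ct where "ct t = min 1 (max 0 ((I (g t) - (m - d)) / (d / 2)))" for t
      define v where "v t = (ct t / max (norm (D (g t))) (2 * \<epsilon>)) *\<^sub>R D (g t)" for t
      have gS: "g t \<in> S" for t using g(1) by (simp add: \<Gamma>_def)
      have DS: "D u \<in> S" if "u \<in> S" for u using that T_in S(1) by (simp add: D_def subspace_diff)
      have Dg_cont: "continuous_on A (\<lambda>t. D (g t))" for A
        by (rule continuous_on_compose2[OF D_cont]) (use gS in auto)
      have v_cont: "continuous_on A v" for A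
        unfolding v_def ct_def using \<epsilon> d
        by (intro continuous_intros Dg_cont I_path g(1)) (auto simp: max_def)
      have ct: "0 \<le> ct t" "ct t \<le> 1" for t by (auto simp: ct_def)
      have v_le: "norm (v t) \<le> 1" for t
      proof -
        have "norm (v t) = ct t * (norm (D (g t)) / max (norm (D (g t))) (2 * \<epsilon>))"
          using ct[of t] \<epsilon> by (simp add: v_def)
        also have "\<dots> \<le> 1 * 1" using ct[of t] \<epsilon> by (intro mult_mono) (auto simp: max_def divide_simps)
        finally show ?thesis by simp
      qed
      have vS: "v t \<in> S" for t using DS[OF gS] S(1) by (simp add: v_def subspace_scale)
      have v_end: "v t = 0" if "t \<le> 0 \<or> t \<ge> 1" for t
      proof -
        have "g t = 0 \<or> g t = e" using that g(1) unfolding \<Gamma>_def by blast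
        moreover have "I 0 \<le> 0" "I e \<le> 0" using e(3) J0 unfolding I_def by simp_all
        ultimately have "I (g t) \<le> 0" by metis
        then have "(I (g t) - (m - d)) / (d / 2) \<le> 0" using d geom(2) by (intro divide_nonpos_pos) auto
        then show ?thesis by (simp add: v_def ct_def)
      qed
      \<comment> \<open>Uniform continuity of this map of path parameter and step length gives one
        step length along which the gradient varies by less than \<epsilon> / 2 on the entire
        path.\<close>
      define \<Phi> where "\<Phi> p = D (g (fst p) + (- snd p) *\<^sub>R v (fst p))" for p
      have "continuous_on ({0..1} \<times> {0..1}) \<Phi>"
        unfolding \<Phi>_def
      proof (rule continuous_on_compose2[OF D_cont])
        have "continuous_on ({0..1} \<times> {0..1}) (\<lambda>p::real \<times> real. g (fst p))"
          by (rule continuous_on_compose2[of UNIV "apply_bcontfun g" _ fst]) (auto intro: continuous_intros)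
        moreover have "continuous_on ({0..1} \<times> {0..1}) (\<lambda>p::real \<times> real. v (fst p))"
          by (rule continuous_on_compose2[OF v_cont[of UNIV], of _ fst]) (auto intro: continuous_intros)
        ultimately show "continuous_on ({0..1} \<times> {0..1}) (\<lambda>p. g (fst p) + (- snd p) *\<^sub>R v (fst p))"
          by (intro continuous_intros)
      qed (use lin[OF gS vS] in blast)
      then have "uniformly_continuous_on ({0..1} \<times> {0..1}) \<Phi>"
        by (intro compact_uniformly_continuous compact_Times) auto
      then obtain s0 where s0: "s0 > 0" "\<And>p q. p \<in> {0..1} \<times> {0..1} \<Longrightarrow> q \<in> {0..1} \<times> {0..1} \<Longrightarrow>
          dist q p < s0 \<Longrightarrow> dist (\<Phi> q) (\<Phi> p) < \<epsilon> / 2"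
        unfolding uniformly_continuous_on_def using half_gt_zero[OF \<epsilon>] by blast
      \<comment> \<open>The bound d / (4 * \<epsilon>) serves the part of the path below m - d / 2:
        a step raises the energy by at most s * \<epsilon> / 2, so it stays below m - 3/2 *
        \<epsilon> * s. Near the top, descent at a rate of at least 2 * \<epsilon> gives the same
        bound, whereas Ekeland's inequality allows a loss of \<epsilon> * s only.\<close>
      define s where "s = min (min 1 (s0 / 2)) (d / (4 * \<epsilon>))"
      have s: "s > 0" "s \<le> 1" "s < s0" "s * (4 * \<epsilon>) \<le> d"
      proof -
        show "s > 0" "s \<le> 1" using s0(1) d \<epsilon> by (auto simp: s_def)
        have "s \<le> s0 / 2" by (simp add: s_def)
        then show "s < s0" using s0(1) by linarith
        have "s \<le> d / (4 * \<epsilon>)" by (simp add: s_def)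
        then show "s * (4 * \<epsilon>) \<le> d" using \<epsilon> by (simp add: field_simps)
      qed
      define f1 where "f1 t = g t + (- s) *\<^sub>R v t" for t
      have f1: "f1 \<in> bcontfun"
        unfolding bcontfun_def
      proof (intro CollectI conjI)
        show "continuous_on UNIV f1" unfolding f1_def by (intro continuous_intros v_cont) auto
        obtain B where B: "\<And>t. norm (g t) \<le> B" using bounded_apply_bcontfun[of g] by (auto simp: bounded_iff)
        have "norm (f1 t) \<le> B + 1" for t
        proof -
          have "norm (f1 t) \<le> norm (g t) + s * norm (v t)"
            unfolding f1_def using norm_triangle_ineq[of "g t" "(- s) *\<^sub>R v t"] s by simp
          also have "s * norm (v t) \<le> 1 * 1" using s v_le[of t] by (intro mult_mono) auto
          finally show ?thesis using B[of t] by simp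
        qed
        then show "bounded (range f1)" by (auto simp: bounded_iff)
      qed
      define g1 where "g1 = Bcontfun f1"
      have g1_app: "apply_bcontfun g1 = f1" by (simp add: g1_def Bcontfun_inverse[OF f1])
      have g1: "g1 \<in> \<Gamma>"
      proof -
        have "f1 t \<in> S" for t unfolding f1_def by (rule lin[OF gS vS])
        moreover have "f1 t = g t" if "t \<le> 0 \<or> t \<ge> 1" for t using v_end[OF that] by (simp add: f1_def)
        ultimately show ?thesis using g(1) by (simp add: \<Gamma>_def g1_app)
      qed
      have "dist g g1 \<le> s"
      proof (rule dist_bound)
        fix t
        have "dist (g t) (g1 t) = s * norm (v t)" using s by (simp add: g1_app f1_def dist_norm)
        also have "\<dots> \<le> s * 1" using s v_le[of t] by (intro mult_left_mono) auto
        finally show "dist (g t) (g1 t) \<le> s" by simp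
      qed
      then have "\<epsilon> * dist g g1 \<le> \<epsilon> * s" using \<epsilon> by simp
      then have lower: "m - \<epsilon> * s \<le> \<Psi> g1" using g(3)[OF g1] by (simp add: m_def)
      have "\<Psi> g1 \<le> m - 3 / 2 * \<epsilon> * s"
      proof (rule \<Psi>_le)
        fix t :: real assume t: "t \<in> {0..1}"
        obtain \<tau> where \<tau>: "0 < \<tau>" "\<tau> < 1" "I (f1 t) - I (g t) = D (g t + \<tau> *\<^sub>R ((- s) *\<^sub>R v t)) \<bullet> ((- s) *\<^sub>R v t)"
          using mvt[OF gS, of "(- s) *\<^sub>R v t" t] vS S(1) unfolding f1_def by (auto simp: subspace_scale subspace_neg)
        have ts: "0 \<le> \<tau> * s" "\<tau> * s \<le> s" using \<tau> s by (auto simp: mult_le_cancel_right1)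
        have "dist (\<Phi> (t, \<tau> * s)) (\<Phi> (t, 0)) < \<epsilon> / 2"
        proof (rule s0(2))
          have "\<tau> * s \<le> 1" "\<tau> * s < s0" using ts(2) s by linarith+
          then show "(t, 0::real) \<in> {0..1} \<times> {0..1}" "(t, \<tau> * s) \<in> {0..1} \<times> {0..1}"
            "dist (t, \<tau> * s) (t, 0) < s0" using t ts(1) by (auto simp: dist_Pair_Pair)
        qed
        then have close: "norm (D (g t + \<tau> *\<^sub>R ((- s) *\<^sub>R v t)) - D (g t)) \<le> \<epsilon> / 2"
          by (simp add: \<Phi>_def dist_norm)
        have "\<bar>(D (g t + \<tau> *\<^sub>R ((- s) *\<^sub>R v t)) - D (g t)) \<bullet> v t\<bar> \<le> \<epsilon> / 2 * 1"
          using Cauchy_Schwarz_ineq2[of "D (g t + \<tau> *\<^sub>R ((- s) *\<^sub>R v t)) - D (g t)" "v t"]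
            mult_mono[OF close v_le[of t]] \<epsilon> by auto
        then have "D (g t + \<tau> *\<^sub>R ((- s) *\<^sub>R v t)) \<bullet> v t \<ge> D (g t) \<bullet> v t - \<epsilon> / 2"
          unfolding inner_diff_left by linarith
        then have "s * (D (g t) \<bullet> v t - \<epsilon> / 2) \<le> s * (D (g t + \<tau> *\<^sub>R ((- s) *\<^sub>R v t)) \<bullet> v t)"
          using s by (intro mult_left_mono) auto
        then have step: "I (f1 t) \<le> I (g t) - s * (D (g t) \<bullet> v t) + s * \<epsilon> / 2"
          using \<tau>(3) by (simp add: algebra_simps)
        have Dv: "D (g t) \<bullet> v t = ct t * (norm (D (g t)))\<^sup>2 / max (norm (D (g t))) (2 * \<epsilon>)"
          by (simp add: v_def power2_norm_eq_inner)
        have Dv0: "D (g t) \<bullet> v t \<ge> 0" unfolding Dv using ct \<epsilon> by (intro divide_nonneg_pos) auto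
        have "I (f1 t) \<le> m - 3 / 2 * \<epsilon> * s"
        proof (cases "I (g t) \<ge> m - d / 2")
          case True
          then have "ct t = 1" using d by (simp add: ct_def field_simps)
          moreover have nb: "norm (D (g t)) > 2 * \<epsilon>" using big[OF t] True d by linarith
          ultimately have "D (g t) \<bullet> v t = norm (D (g t))" unfolding Dv using \<epsilon> by (simp add: power2_eq_square)
          then have "s * (2 * \<epsilon>) \<le> s * (D (g t) \<bullet> v t)" using nb s by (intro mult_left_mono) auto
          moreover have "I (g t) \<le> m" unfolding m_def by (rule le_\<Psi>[OF g(1) t])
          ultimately show ?thesis using step by (simp add: algebra_simps)
        next
          case False
          moreover have "0 \<le> s * (D (g t) \<bullet> v t)" using s Dv0 by simp
          ultimately show ?thesis using step s(4) by (simp add: algebra_simps)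
        qed
        then show "I (g1 t) \<le> m - 3 / 2 * \<epsilon> * s" by (simp add: g1_app)
      qed
      then have "\<epsilon> * s \<le> 0" using lower by (simp add: algebra_simps)
      then show False using \<epsilon> s(1) by (simp add: mult_le_0_iff)
    qed
  qed
  have "\<exists>u\<in>S. \<alpha> / 2 \<le> I u \<and> I u \<le> \<Psi> g0 \<and> norm (D u) \<le> 2 * (1 / real (Suc n))" for n
    by (rule almost) simp
  then obtain u where u: "\<And>n. u n \<in> S" "\<And>n. \<alpha> / 2 \<le> I (u n)" "\<And>n. I (u n) \<le> \<Psi> g0"
    "\<And>n. norm (D (u n)) \<le> 2 * (1 / real (Suc n))" by metis
  have D0: "(\<lambda>n. D (u n)) \<longlonglongrightarrow> 0"
  proof (rule Lim_null_comparison)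
    show "\<forall>\<^sub>F n in sequentially. norm (D (u n)) \<le> 2 * (1 / real (Suc n))"
      using u(4) by (intro always_eventually) simp
    show "(\<lambda>n. 2 * (1 / real (Suc n))) \<longlonglongrightarrow> 0"
      using tendsto_mult_right_zero[OF LIMSEQ_Suc[OF lim_1_over_n]] by simp
  qed
  \<comment> \<open>Subtracting D u . u from \<theta> times the energy leaves at least (\<theta>/2 -
    1) |u|^2 up to a constant. This square is thus bounded linearly in |u|, which yields the
    explicit bound B.\<close>
  define k where "k = \<theta> / 2 - 1"
  have k: "k > 0" using AR(1) by (simp add: k_def)
  define B where "B = (2 + \<bar>\<theta> * \<Psi> g0 + C\<bar>) / k + 1"
  have "norm (u n) \<le> B" for n
  proof (rule ccontr)
    assume "\<not> ?thesis"
    then have nB: "norm (u n) > B" by simp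
    have B1: "B \<ge> 1" using k by (simp add: B_def)
    have "(u n - D (u n)) \<bullet> u n = T (u n) \<bullet> u n" by (simp add: D_def)
    then have "\<theta> * J (u n) \<le> (norm (u n))\<^sup>2 - D (u n) \<bullet> u n + C"
      using AR(2)[OF u(1)[of n]] by (simp add: power2_norm_eq_inner inner_diff_left)
    moreover have "\<theta> * I (u n) \<le> \<theta> * \<Psi> g0" using u(3) AR(1) by (intro mult_left_mono) auto
    moreover have "\<theta> * I (u n) = \<theta> * (norm (u n))\<^sup>2 / 2 - \<theta> * J (u n)" by (simp add: I_def algebra_simps)
    moreover have "- (D (u n) \<bullet> u n) \<le> 2 * norm (u n)"
    proof -
      have "1 / real (Suc n) \<le> 1" by simp
      then have "norm (D (u n)) \<le> 2" using u(4)[of n] by linarith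
      then show ?thesis using Cauchy_Schwarz_ineq2[of "D (u n)" "u n"] mult_right_mono[of "norm (D (u n))" 2 "norm (u n)"] by auto
    qed
    ultimately have "k * (norm (u n))\<^sup>2 \<le> 2 * norm (u n) + (\<theta> * \<Psi> g0 + C)"
      by (simp add: k_def algebra_simps)
    also have "\<dots> \<le> 2 * norm (u n) + \<bar>\<theta> * \<Psi> g0 + C\<bar> * norm (u n)"
    proof -
      have "\<bar>\<theta> * \<Psi> g0 + C\<bar> * 1 \<le> \<bar>\<theta> * \<Psi> g0 + C\<bar> * norm (u n)"
        using nB B1 by (intro mult_left_mono) auto
      then have "\<theta> * \<Psi> g0 + C \<le> \<bar>\<theta> * \<Psi> g0 + C\<bar> * norm (u n)"
        using abs_ge_self[of "\<theta> * \<Psi> g0 + C"] by (simp only: mult_1_right)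
      then show ?thesis by (rule add_left_mono)
    qed
    finally have "(k * norm (u n)) * norm (u n) \<le> (2 + \<bar>\<theta> * \<Psi> g0 + C\<bar>) * norm (u n)"
      by (simp add: power2_eq_square algebra_simps)
    moreover have "0 < norm (u n)" using nB B1 by linarith
    ultimately have "k * norm (u n) \<le> 2 + \<bar>\<theta> * \<Psi> g0 + C\<bar>"
      by (rule mult_right_le_imp_le)
    then have "norm (u n) \<le> (2 + \<bar>\<theta> * \<Psi> g0 + C\<bar>) / k" using k by (simp add: field_simps)
    then show False using nB by (simp add: B_def)
  qed
  then have "bounded (range u)" by (auto simp: bounded_iff)
  then obtain r z where r: "strict_mono r" "(\<lambda>n. T (u (r n))) \<longlonglongrightarrow> z" using compact[of u, OF u(1)] by blast
  have "(\<lambda>n. D (u (r n)) + T (u (r n))) \<longlonglongrightarrow> 0 + z"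
    using LIMSEQ_subseq_LIMSEQ[OF D0 r(1)] by (intro tendsto_add r(2)) (simp add: o_def)
  then have uz: "(\<lambda>n. u (r n)) \<longlonglongrightarrow> z" by (simp add: D_def)
  have zS: "z \<in> S" using closed_sequentially[OF S(2) _ uz] u(1) by blast
  have "(\<lambda>n. T (u (r n))) \<longlonglongrightarrow> T z"
    by (rule continuous_on_tendsto_compose[OF T_cont uz zS]) (use u(1) in auto)
  then have "T z = z" using r(2) LIMSEQ_unique by blast
  moreover have "(\<lambda>n. I (u (r n))) \<longlonglongrightarrow> I z"
    by (rule continuous_on_tendsto_compose[OF I_cont uz zS]) (use u(1) in auto)
  then have "\<alpha> / 2 \<le> I z" by (rule LIMSEQ_le_const) (use u(2) in blast)
  then have "z \<noteq> 0" using geom(2) J0 by (auto simp: I_def)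
  ultimately show ?thesis using zS by blast
qed

section \<open>The Hilbert space of square-integrable functions on the line\<close>

definition sqint :: "(real \<Rightarrow> real) \<Rightarrow> bool" where
  "sqint f \<longleftrightarrow> f \<in> borel_measurable lborel \<and> integrable lborel (\<lambda>t. (f t)\<^sup>2)"

lemma sqintD:
  assumes "sqint f"
  shows "f \<in> borel_measurable lborel" "f \<in> borel_measurable borel" "integrable lborel (\<lambda>t. (f t)\<^sup>2)"
  using assms by (auto simp: sqint_def)

lemma sqint_mult_integrable:
  assumes "sqint f" "sqint g"
  shows "integrable lborel (\<lambda>t. f t * g t)"
proof (rule Bochner_Integration.integrable_bound)
  show "integrable lborel (\<lambda>t. (f t)\<^sup>2 + (g t)\<^sup>2)"
    using assms by (auto simp: sqint_def)
  show "(\<lambda>t. f t * g t) \<in> borel_measurable lborel"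
    using assms by (auto simp: sqint_def)
  show "AE t in lborel. norm (f t * g t) \<le> norm ((f t)\<^sup>2 + (g t)\<^sup>2)"
  proof (rule AE_I2)
    fix t
    have "2 * (\<bar>f t\<bar> * \<bar>g t\<bar>) \<le> (f t)\<^sup>2 + (g t)\<^sup>2"
      using sum_squares_bound[of "\<bar>f t\<bar>" "\<bar>g t\<bar>"] by (simp add: mult.assoc)
    moreover have "0 \<le> \<bar>f t\<bar> * \<bar>g t\<bar>" by simp
    ultimately have "\<bar>f t\<bar> * \<bar>g t\<bar> \<le> (f t)\<^sup>2 + (g t)\<^sup>2" by linarith
    then show "norm (f t * g t) \<le> norm ((f t)\<^sup>2 + (g t)\<^sup>2)" by (simp add: abs_mult)
  qed
qed

lemma sqint_add:
  assumes "sqint f" "sqint g"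
  shows "sqint (\<lambda>t. f t + g t)"
proof -
  have "(\<lambda>t. (f t + g t)\<^sup>2) = (\<lambda>t. (f t)\<^sup>2 + 2 * (f t * g t) + (g t)\<^sup>2)"
    by (auto simp: power2_eq_square algebra_simps)
  then show ?thesis
    using assms sqint_mult_integrable[OF assms] by (auto simp: sqint_def)
qed

lemma sqint_scale: "sqint f \<Longrightarrow> sqint (\<lambda>t. c * f t)"
  by (auto simp: sqint_def power_mult_distrib)

lemma sqint_diff:
  assumes "sqint f" "sqint g"
  shows "sqint (\<lambda>t. f t - g t)"
  using sqint_add[OF assms(1) sqint_scale[OF assms(2), of "-1"]] by simp

lemma sqint_bound:
  assumes "sqint f" "g \<in> borel_measurable lborel" "AE t in lborel. \<bar>g t\<bar> \<le> \<bar>f t\<bar>"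
  shows "sqint g"
  unfolding sqint_def
proof (intro conjI assms)
  show "integrable lborel (\<lambda>t. (g t)\<^sup>2)"
  proof (rule Bochner_Integration.integrable_bound)
    show "integrable lborel (\<lambda>t. (f t)\<^sup>2)" using assms by (simp add: sqint_def)
    show "AE t in lborel. norm ((g t)\<^sup>2) \<le> norm ((f t)\<^sup>2)"
      using assms(3) by eventually_elim (simp add: abs_le_square_iff)
  qed (use assms in auto)
qed

lemma sqint_zero: "sqint (\<lambda>t. 0)" by (simp add: sqint_def)

text \<open>A canonical member of the almost-everywhere class of f. The predicate under the choice
  operator depends only on that class, so equivalent functions get the same representative, and L2
  becomes a set of actual functions on which almost-everywhere equality is equality.\<close>

definition sq_normal :: "(real \<Rightarrow> real) \<Rightarrow> real \<Rightarrow> real" where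
  "sq_normal f = (SOME g. sqint g \<and> (AE t in lborel. g t = f t))"

lemma sq_normal:
  assumes "sqint f"
  shows "sqint (sq_normal f)" "AE t in lborel. sq_normal f t = f t"
proof -
  have "sqint f \<and> (AE t in lborel. f t = f t)" using assms by simp
  then have "sqint (sq_normal f) \<and> (AE t in lborel. sq_normal f t = f t)"
    unfolding sq_normal_def by (rule someI[of "\<lambda>g. sqint g \<and> (AE t in lborel. g t = f t)"])
  then show "sqint (sq_normal f)" "AE t in lborel. sq_normal f t = f t" by auto
qed

lemma sq_normal_cong:
  assumes "AE t in lborel. f t = g t"
  shows "sq_normal f = sq_normal g"
proof -
  have "(AE t in lborel. h t = f t) \<longleftrightarrow> (AE t in lborel. h t = g t)" for h
    using assms by (auto elim: eventually_elim2)
  then show ?thesis by (simp add: sq_normal_def)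
qed

typedef l2 = "sq_normal ` Collect sqint" morphisms fn Abs_l2
  using sqint_zero by blast

definition mk :: "(real \<Rightarrow> real) \<Rightarrow> l2" where "mk f = Abs_l2 (sq_normal f)"

lemma sqint_fn [simp]: "sqint (fn x)"
  using fn[of x] sq_normal by auto

lemma fn_meas [measurable]: "fn x \<in> borel_measurable borel"
  using sqintD(2)[OF sqint_fn] .

lemma fn_mk: "sqint f \<Longrightarrow> AE t in lborel. fn (mk f) t = f t"
  unfolding mk_def by (subst Abs_l2_inverse) (auto simp: sq_normal)

lemma mk_cong: "AE t in lborel. f t = g t \<Longrightarrow> mk f = mk g"
  unfolding mk_def by (metis sq_normal_cong)

lemma mk_fn: "mk (fn x) = x"
proof -
  obtain f where f: "sqint f" "fn x = sq_normal f" using fn[of x] by auto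
  have "sq_normal (sq_normal f) = sq_normal f"
    by (rule sq_normal_cong[OF sq_normal(2)[OF f(1)]])
  then show ?thesis unfolding mk_def f(2) using f(2) fn_inverse by metis
qed

lemma l2_eqI: "AE t in lborel. fn x t = fn y t \<Longrightarrow> x = y"
  by (metis mk_cong mk_fn)

instantiation l2 :: real_inner
begin

definition "0 = mk (\<lambda>t. 0)"
definition "x + y = mk (\<lambda>t. fn x t + fn y t)"
definition "x - y = mk (\<lambda>t. fn x t - fn y t)"
definition "- x = mk (\<lambda>t. - fn x t)"
definition "scaleR c x = mk (\<lambda>t. c * fn x t)"
definition "inner x y = (\<integral>t. fn x t * fn y t \<partial>lborel)"
definition norm_l2 :: "l2 \<Rightarrow> real" where "norm_l2 x = sqrt (inner x x)"
definition dist_l2 :: "l2 \<Rightarrow> l2 \<Rightarrow> real" where "dist_l2 x y = norm (x - y)"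
definition sgn_l2 :: "l2 \<Rightarrow> l2" where "sgn_l2 x = scaleR (inverse (norm x)) x"
definition uniformity_l2 :: "(l2 \<times> l2) filter" where
  "uniformity_l2 = (INF e\<in>{0 <..}. principal {(x, y). dist x y < e})"
definition open_l2 :: "l2 set \<Rightarrow> bool" where
  "open_l2 U = (\<forall>x\<in>U. \<forall>\<^sub>F (x', y) in uniformity. x' = x \<longrightarrow> y \<in> U)"

lemma fn_zero: "AE t in lborel. fn 0 t = 0"
  unfolding zero_l2_def by (rule fn_mk[OF sqint_zero])

lemma fn_add: "AE t in lborel. fn (x + y) t = fn x t + fn y t"
  unfolding plus_l2_def by (intro fn_mk sqint_add sqint_fn)

lemma fn_diff: "AE t in lborel. fn (x - y) t = fn x t - fn y t"
  unfolding minus_l2_def by (intro fn_mk sqint_diff sqint_fn)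

lemma fn_minus: "AE t in lborel. fn (- x) t = - fn x t"
  unfolding uminus_l2_def using fn_mk[OF sqint_scale[OF sqint_fn, of "-1"]] by simp

lemma fn_scale: "AE t in lborel. fn (c *\<^sub>R x) t = c * fn x t"
  unfolding scaleR_l2_def by (intro fn_mk sqint_scale sqint_fn)

instance
proof
  fix x y z :: l2 and a b :: real
  show "x + y + z = x + (y + z)"
    by (rule l2_eqI) (use fn_add[of "x + y" z] fn_add[of x y] fn_add[of x "y + z"] fn_add[of y z] in eventually_elim, simp)
  show "x + y = y + x" by (simp add: plus_l2_def add.commute)
  show "0 + x = x"
    by (rule l2_eqI) (use fn_add[of 0 x] fn_zero in eventually_elim, simp)
  show "- x + x = 0"
    by (rule l2_eqI) (use fn_add[of "- x" x] fn_zero fn_minus[of x] in eventually_elim, simp)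
  show "x - y = x + - y"
    by (rule l2_eqI) (use fn_add[of x "- y"] fn_diff[of x y] fn_minus[of y] in eventually_elim, simp)
  show "a *\<^sub>R (x + y) = a *\<^sub>R x + a *\<^sub>R y"
    by (rule l2_eqI) (use fn_add[of x y] fn_add[of "a *\<^sub>R x" "a *\<^sub>R y"] fn_scale[of a "x + y"] fn_scale[of a x] fn_scale[of a y]
        in eventually_elim, simp add: algebra_simps)
  show "(a + b) *\<^sub>R x = a *\<^sub>R x + b *\<^sub>R x"
    by (rule l2_eqI) (use fn_add[of "a *\<^sub>R x" "b *\<^sub>R x"] fn_scale[of "a + b" x] fn_scale[of a x] fn_scale[of b x]
        in eventually_elim, simp add: algebra_simps)
  show "a *\<^sub>R b *\<^sub>R x = (a * b) *\<^sub>R x"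
    by (rule l2_eqI) (use fn_scale[of "a" "b *\<^sub>R x"] fn_scale[of b x] fn_scale[of "a * b" x]
        in eventually_elim, simp add: algebra_simps)
  show "1 *\<^sub>R x = x"
    by (rule l2_eqI) (use fn_scale[of 1 x] in eventually_elim, simp)
  show "dist x y = norm (x - y)" by (rule dist_l2_def)
  show "sgn x = inverse (norm x) *\<^sub>R x" by (rule sgn_l2_def)
  show "uniformity = (INF e\<in>{0<..}. principal {(x::l2, y). dist x y < e})" by (rule uniformity_l2_def)
  show "open U = (\<forall>x\<in>U. \<forall>\<^sub>F (x', y) in uniformity. x' = x \<longrightarrow> y \<in> U)" for U :: "l2 set" by (rule open_l2_def)
  show "x \<bullet> y = y \<bullet> x" by (simp add: inner_l2_def mult.commute)
  show "(x + y) \<bullet> z = x \<bullet> z + y \<bullet> z"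
  proof -
    have "(x + y) \<bullet> z = (\<integral>t. fn x t * fn z t + fn y t * fn z t \<partial>lborel)"
      unfolding inner_l2_def
      by (rule integral_cong_AE) (measurable, use fn_add[of x y] in eventually_elim, simp add: algebra_simps)
    then show ?thesis
      by (simp add: inner_l2_def sqint_mult_integrable)
  qed
  show "a *\<^sub>R x \<bullet> y = a * (x \<bullet> y)"
  proof -
    have "a *\<^sub>R x \<bullet> y = (\<integral>t. a * (fn x t * fn y t) \<partial>lborel)"
      unfolding inner_l2_def
      by (rule integral_cong_AE) (measurable, use fn_scale[of a x] in eventually_elim, simp add: algebra_simps)
    then show ?thesis by (simp add: inner_l2_def)
  qed
  show "0 \<le> x \<bullet> x" by (simp add: inner_l2_def)
  show "x \<bullet> x = 0 \<longleftrightarrow> x = 0"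
  proof
    assume "x \<bullet> x = 0"
    then have "AE t in lborel. fn x t * fn x t = 0"
      unfolding inner_l2_def
      by (subst (asm) integral_nonneg_eq_0_iff_AE) (auto simp: sqint_mult_integrable)
    then have "AE t in lborel. fn x t = fn 0 t" using fn_zero by eventually_elim simp
    then show "x = 0" by (rule l2_eqI)
  next
    assume "x = 0"
    then have "x \<bullet> x = integral\<^sup>L lborel (\<lambda>_::real. 0 :: real)"
      unfolding inner_l2_def
      by (intro integral_cong_AE) (measurable, use fn_zero in eventually_elim, simp)
    then show "x \<bullet> x = 0" by simp
  qed
  show "norm x = sqrt (x \<bullet> x)" by (rule norm_l2_def)
qed

end

lemma inner_l2: "x \<bullet> y = (\<integral>t. fn x t * fn y t \<partial>lborel)"
  by (rule inner_l2_def)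

lemma inner_mk:
  assumes "sqint f" "sqint g"
  shows "mk f \<bullet> mk g = (\<integral>t. f t * g t \<partial>lborel)"
  unfolding inner_l2
proof (rule integral_cong_AE)
  show "AE t in lborel. fn (mk f) t * fn (mk g) t = f t * g t"
    using fn_mk[OF assms(1)] fn_mk[OF assms(2)] by eventually_elim simp
qed (use assms in \<open>auto simp: sqint_def\<close>)

lemma inner_mk_fn:
  assumes "sqint f"
  shows "mk f \<bullet> x = (\<integral>t. f t * fn x t \<partial>lborel)"
  using inner_mk[OF assms sqint_fn, of x] by (simp add: mk_fn)

lemma norm_l2_sq: "(norm x)\<^sup>2 = (\<integral>t. (fn x t)\<^sup>2 \<partial>lborel)" for x :: l2
  unfolding power2_norm_eq_inner inner_l2 by (simp add: power2_eq_square)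

lemma nn_integral_fn_sq: "(\<integral>\<^sup>+t. ennreal ((fn x t)\<^sup>2) \<partial>lborel) = ennreal ((norm x)\<^sup>2)"
  unfolding norm_l2_sq by (rule nn_integral_eq_integral) (auto intro: sqintD)

lemma mk_add: "sqint f \<Longrightarrow> sqint g \<Longrightarrow> mk (\<lambda>t. f t + g t) = mk f + mk g"
  by (rule l2_eqI) (use fn_mk[of f] fn_mk[of g] fn_mk[OF sqint_add, of f g] fn_add[of "mk f" "mk g"] in \<open>auto elim!: eventually_rev_mp\<close>)

lemma mk_scale: "sqint f \<Longrightarrow> mk (\<lambda>t. c * f t) = c *\<^sub>R mk f"
  by (rule l2_eqI) (use fn_mk[of f] fn_mk[OF sqint_scale, of f c] fn_scale[of c "mk f"] in \<open>auto elim!: eventually_rev_mp\<close>)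

lemma norm_mk_sq: "sqint f \<Longrightarrow> (norm (mk f))\<^sup>2 = (\<integral>t. (f t)\<^sup>2 \<partial>lborel)"
  unfolding power2_norm_eq_inner by (simp add: inner_mk power2_eq_square)

text \<open>Fatou's lemma turns an almost-everywhere limit of a bounded sequence into an element
  with the same norm bound. Applied to differences it also controls distances, both for completeness
  and for the closedness of the energy space.\<close>

lemma l2_fatou:
  fixes x :: "nat \<Rightarrow> l2"
  assumes c: "\<And>k. norm (x k) \<le> c"
    and lim: "AE t in lborel. (\<lambda>k. fn (x k) t) \<longlonglongrightarrow> f t"
    and f: "f \<in> borel_measurable lborel"
  shows "sqint f" "norm (mk f) \<le> c"
proof -
  have c0: "0 \<le> c" using c[of 0] norm_ge_zero order_trans by blast
  have "(\<integral>\<^sup>+t. ennreal ((f t)\<^sup>2) \<partial>lborel) = (\<integral>\<^sup>+t. liminf (\<lambda>k. ennreal ((fn (x k) t)\<^sup>2)) \<partial>lborel)"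
  proof (rule nn_integral_cong_AE)
    show "AE t in lborel. ennreal ((f t)\<^sup>2) = liminf (\<lambda>k. ennreal ((fn (x k) t)\<^sup>2))"
      using lim
    proof eventually_elim
      case (elim t)
      have "(\<lambda>k. ennreal ((fn (x k) t)\<^sup>2)) \<longlonglongrightarrow> ennreal ((f t)\<^sup>2)"
        by (intro tendsto_ennrealI tendsto_power elim)
      then show ?case using lim_imp_Liminf[OF sequentially_bot] by metis
    qed
  qed
  also have "\<dots> \<le> liminf (\<lambda>k. \<integral>\<^sup>+t. ennreal ((fn (x k) t)\<^sup>2) \<partial>lborel)"
    by (rule nn_integral_liminf) measurable
  also have "\<dots> \<le> ennreal (c\<^sup>2)"
    unfolding nn_integral_fn_sq
    by (rule Liminf_le) (use c in \<open>auto intro!: always_eventually ennreal_leI power_mono\<close>)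
  finally have le: "(\<integral>\<^sup>+t. ennreal ((f t)\<^sup>2) \<partial>lborel) \<le> ennreal (c\<^sup>2)" .
  then have "(\<integral>\<^sup>+t. ennreal ((f t)\<^sup>2) \<partial>lborel) < \<infinity>" using le_less_trans by fastforce
  then show sq: "sqint f" unfolding sqint_def using f by (auto intro!: integrableI_nonneg)
  have "(\<integral>\<^sup>+t. ennreal ((f t)\<^sup>2) \<partial>lborel) = ennreal ((norm (mk f))\<^sup>2)"
    unfolding norm_mk_sq[OF sq] by (rule nn_integral_eq_integral) (use sq in \<open>auto dest: sqintD\<close>)
  then have "(norm (mk f))\<^sup>2 \<le> c\<^sup>2" using le by (simp add: ennreal_le_iff)
  then show "norm (mk f) \<le> c" using c0 power2_le_imp_le by blast
qed

instance l2 :: complete_space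
proof
  fix X :: "nat \<Rightarrow> l2" assume X: "Cauchy X"
  have "\<exists>M. \<forall>m\<ge>M. \<forall>n\<ge>M. norm (X m - X n) < (1/4)^k" for k
    using X[unfolded Cauchy_iff] by (metis zero_less_power zero_less_divide_1_iff zero_less_numeral)
  then obtain M where M: "\<And>k m n. m \<ge> M k \<Longrightarrow> n \<ge> M k \<Longrightarrow> norm (X m - X n) < (1/4)^k" by metis
  \<comment> \<open>Partial sums of M, so that r k is at least M k and nondecreasing in k.\<close>
  define r where "r k = (\<Sum>i\<le>k. M i)" for k
  have r: "M k \<le> r k" "r k \<le> r (Suc k)" for k
    by (auto simp: r_def intro: member_le_sum)
  define Y where "Y k = X (r k)" for k
  \<comment> \<open>With squared differences below 16^-k, even their sum weighted by 4^k is
    integrable. It is therefore finite almost everywhere, which bounds the pointwise differences by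
    a multiple of 2^-k and makes the sequence converge there.\<close>
  have Ydiff: "norm (Y (Suc k) - Y k) < (1/4)^k" for k
    unfolding Y_def using r[of k] by (intro M) auto
  have "(\<integral>\<^sup>+t. (\<Sum>k. ennreal (4^k * (fn (Y (Suc k) - Y k) t)\<^sup>2)) \<partial>lborel)
      = (\<Sum>k. \<integral>\<^sup>+t. ennreal (4^k * (fn (Y (Suc k) - Y k) t)\<^sup>2) \<partial>lborel)"
    by (rule nn_integral_suminf) measurable
  also have "\<dots> = (\<Sum>k. ennreal (4^k * (norm (Y (Suc k) - Y k))\<^sup>2))"
    by (simp add: ennreal_mult nn_integral_cmult nn_integral_fn_sq)
  also have "\<dots> \<le> (\<Sum>k. ennreal ((1/4)^k))"
  proof (intro suminf_le ennreal_leI)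
    fix k
    have "(norm (Y (Suc k) - Y k))\<^sup>2 \<le> ((1/4)^k)\<^sup>2"
      using Ydiff[of k] by (intro power_mono) auto
    then have "4^k * (norm (Y (Suc k) - Y k))\<^sup>2 \<le> 4^k * ((1/4)^k)\<^sup>2" by (intro mult_left_mono) auto
    also have "\<dots> = (1/4::real)^k" by (simp add: power2_eq_square power_divide)
    finally show "4^k * (norm (Y (Suc k) - Y k))\<^sup>2 \<le> (1/4)^k" .
  qed auto
  also have "\<dots> = ennreal (\<Sum>k. (1/4)^k)"
    by (rule suminf_ennreal2) auto
  finally have "(\<integral>\<^sup>+t. (\<Sum>k. ennreal (4^k * (fn (Y (Suc k) - Y k) t)\<^sup>2)) \<partial>lborel) < \<infinity>"
    using le_less_trans by fastforce
  then have "AE t in lborel. (\<Sum>k. ennreal (4^k * (fn (Y (Suc k) - Y k) t)\<^sup>2)) \<noteq> \<infinity>"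
    by (intro nn_integral_PInf_AE) auto
  moreover have "AE t in lborel. \<forall>k. fn (Y (Suc k) - Y k) t = fn (Y (Suc k)) t - fn (Y k) t"
    by (subst AE_all_countable) (intro allI fn_diff)
  ultimately have conv: "AE t in lborel. convergent (\<lambda>k. fn (Y k) t)"
  proof eventually_elim
    case (elim t)
    define g where "g k = ennreal (4^k * (fn (Y (Suc k) - Y k) t)\<^sup>2)" for k
    have "suminf g \<noteq> \<infinity>" using elim(1) unfolding g_def by simp
    then obtain c where c: "suminf g = ennreal c" "c \<ge> 0" by (cases "suminf g") auto
    have step: "\<bar>fn (Y (Suc k)) t - fn (Y k) t\<bar> \<le> sqrt c * (1/2)^k" for k
    proof -
      have "sum g {k} \<le> suminf g" by (rule sum_le_suminf) auto
      then have "g k \<le> ennreal c" unfolding c(1) by simp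
      then have "4^k * (fn (Y (Suc k) - Y k) t)\<^sup>2 \<le> c" unfolding g_def using c(2) by (simp only: ennreal_le_iff)
      moreover have "(2^k * \<bar>fn (Y (Suc k)) t - fn (Y k) t\<bar>)\<^sup>2 = 4^k * (fn (Y (Suc k) - Y k) t)\<^sup>2"
      proof -
        have "(2^k)\<^sup>2 = (4::real)^k" by (simp add: power2_eq_square flip: power_mult_distrib)
        then show ?thesis using elim(2) by (simp add: power_mult_distrib)
      qed
      ultimately have "(2^k * \<bar>fn (Y (Suc k)) t - fn (Y k) t\<bar>)\<^sup>2 \<le> c" by simp
      then have "2^k * \<bar>fn (Y (Suc k)) t - fn (Y k) t\<bar> \<le> sqrt c"
        by (rule real_le_rsqrt)
      then show ?thesis by (simp add: power_one_over mult.commute pos_le_divide_eq flip: divide_inverse)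
    qed
    have "summable (\<lambda>k. fn (Y (Suc k)) t - fn (Y k) t)"
    proof (rule summable_comparison_test'[where N = 0])
      show "summable (\<lambda>k. sqrt c * (1/2)^k)" by (intro summable_mult summable_geometric) simp
      show "norm (fn (Y (Suc n)) t - fn (Y n) t) \<le> sqrt c * (1/2)^n" for n
        using step[of n] by (simp only: real_norm_def)
    qed
    then have "convergent (\<lambda>n. \<Sum>k<n. fn (Y (Suc k)) t - fn (Y k) t)"
      by (simp add: summable_iff_convergent)
    then have "convergent (\<lambda>n. fn (Y n) t - fn (Y 0) t)" by (simp only: sum_lessThan_telescope[of "\<lambda>k. fn (Y k) t"])
    then show ?case using convergent_add_const_right_iff[of "\<lambda>n. fn (Y n) t" "- fn (Y 0) t"] by simp
  qed
  define f where "f t = lim (\<lambda>k. fn (Y k) t)" for t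
  have f_meas: "f \<in> borel_measurable lborel"
    unfolding f_def by (rule borel_measurable_lim_metric) simp
  have lim: "AE t in lborel. (\<lambda>k. fn (Y k) t) \<longlonglongrightarrow> f t"
    using conv by eventually_elim (simp add: f_def convergent_LIMSEQ_iff)
  \<comment> \<open>Fatou applied to the differences Y (j + k) - X n, as j grows, measures the
    distance of the pointwise limit from X n.\<close>
  have key: "sqint (\<lambda>t. f t - fn (X n) t) \<and> norm (mk (\<lambda>t. f t - fn (X n) t)) \<le> (1/4)^k" if n: "n \<ge> M k" for n k
  proof -
    have 1: "norm (Y (j + k) - X n) \<le> (1/4)^k" for j
    proof -
      have "r k \<le> r (j + k)" by (induction j) (use r(2) order_trans in auto)
      then show ?thesis unfolding Y_def using M[of k "r (j + k)" n] r(1)[of k] n by simp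
    qed
    have 2: "AE t in lborel. \<forall>j. fn (Y (j + k) - X n) t = fn (Y (j + k)) t - fn (X n) t"
      by (subst AE_all_countable) (intro allI fn_diff)
    have 3: "AE t in lborel. (\<lambda>j. fn (Y (j + k) - X n) t) \<longlonglongrightarrow> f t - fn (X n) t"
      using 2 lim by eventually_elim (auto intro!: tendsto_intros LIMSEQ_ignore_initial_segment)
    show ?thesis using l2_fatou[OF 1 3] f_meas by auto
  qed
  have fs: "sqint f" using sqint_add[OF conjunct1[OF key[of 0 "M 0"]] sqint_fn[of "X (M 0)"]] by simp
  have "X \<longlonglongrightarrow> mk f"
  proof (rule metric_LIMSEQ_I)
    fix e :: real assume "e > 0"
    then obtain k where k: "(1/4)^k < e" using real_arch_pow_inv[of e "1/4"] by auto
    have "dist (X n) (mk f) < e" if "n \<ge> M k" for n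
    proof -
      have "mk f - X n = mk (\<lambda>t. f t - fn (X n) t)"
        by (rule l2_eqI) (use fn_diff[of "mk f" "X n"] fn_mk[OF fs] fn_mk[OF conjunct1[OF key[OF that]]] in eventually_elim, simp)
      then show ?thesis using key[OF that] k by (simp add: dist_norm norm_minus_commute)
    qed
    then show "\<exists>no. \<forall>n\<ge>no. dist (X n) (mk f) < e" by blast
  qed
  then show "convergent X" by (auto simp: convergent_def)
qed

section \<open>Radial profiles\<close>

lemma nn_integral_powr_tail:
  fixes p r :: real
  assumes "p < -1" "0 < r"
  shows "(\<integral>\<^sup>+s. ennreal (s powr p) * indicator {r..} s \<partial>lborel) = ennreal (r powr (p + 1) / (- p - 1))"
proof -
  have "- (r powr (p + 1)) / (p + 1) = r powr (p + 1) / (- p - 1)"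
  proof -
    have "- p - 1 = - (p + 1)" by simp
    then show ?thesis by (simp only: divide_minus_right minus_divide_left)
  qed
  then show ?thesis
    using nn_integral_has_integral_lebesgue'[OF _ has_integral_powr_to_inf[OF assms]] by simp
qed

lemma nn_integral_powr_head:
  fixes p r :: real
  assumes "p > -1" "0 \<le> r"
  shows "(\<integral>\<^sup>+s. ennreal (s powr p) * indicator {0..r} s \<partial>lborel) = ennreal (r powr (p + 1) / (p + 1))"
  using nn_integral_has_integral_lebesgue'[OF _ has_integral_powr_from_0[OF assms]] by simp

lemma sqint_nn:
  assumes [measurable]: "f \<in> borel_measurable borel"
    and le: "(\<integral>\<^sup>+s. ennreal ((f s)\<^sup>2) \<partial>lborel) \<le> ennreal c" and c: "0 \<le> c"
  shows "sqint f" "(norm (mk f))\<^sup>2 \<le> c"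
proof -
  have "(\<integral>\<^sup>+s. ennreal ((f s)\<^sup>2) \<partial>lborel) < \<infinity>" using le le_less_trans by fastforce
  then show sq: "sqint f" unfolding sqint_def by (auto intro!: integrableI_nonneg)
  have "(\<integral>\<^sup>+t. ennreal ((f t)\<^sup>2) \<partial>lborel) = ennreal ((norm (mk f))\<^sup>2)"
    unfolding norm_mk_sq[OF sq] by (rule nn_integral_eq_integral) (use sq in \<open>auto dest: sqintD\<close>)
  then show "(norm (mk f))\<^sup>2 \<le> c" using le c by (simp add: ennreal_le_iff)
qed

text \<open>With p = -(N-1)/2 the pairing with r^((N-1)/2) w' is the integral of w' from r to
  infinity. Other exponents arise when part of the power is moved to the other factor, as in Hardy's
  inequality below.\<close>

definition tail_kernel :: "real \<Rightarrow> real \<Rightarrow> real \<Rightarrow> real" where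
  "tail_kernel p r s = indicator {r..} s * s powr p"

lemma tail_kernel_meas [measurable]: "tail_kernel p r \<in> borel_measurable borel"
  unfolding tail_kernel_def by measurable

lemma tail_kernel_sqint:
  assumes "p < -1/2" "0 < r"
  shows "sqint (tail_kernel p r)" "(norm (mk (tail_kernel p r)))\<^sup>2 \<le> r powr (2 * p + 1) / (- 2 * p - 1)"
proof -
  have "(\<integral>\<^sup>+s. ennreal ((tail_kernel p r s)\<^sup>2) \<partial>lborel)
      = (\<integral>\<^sup>+s. ennreal (s powr (2 * p)) * indicator {r..} s \<partial>lborel)"
    using assms(2)
    by (intro nn_integral_cong)
       (auto simp: tail_kernel_def indicator_def power2_eq_square powr_add[symmetric])
  also have "\<dots> = ennreal (r powr (2 * p + 1) / (- 2 * p - 1))"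
    using nn_integral_powr_tail[of "2 * p" r] assms by simp
  finally have "(\<integral>\<^sup>+s. ennreal ((tail_kernel p r s)\<^sup>2) \<partial>lborel) \<le> ennreal (r powr (2 * p + 1) / (- 2 * p - 1))"
    by simp
  moreover have "0 \<le> r powr (2 * p + 1) / (- 2 * p - 1)" using assms by simp
  ultimately show "sqint (tail_kernel p r)" "(norm (mk (tail_kernel p r)))\<^sup>2 \<le> r powr (2 * p + 1) / (- 2 * p - 1)"
    using sqint_nn[OF tail_kernel_meas] by blast+
qed

text \<open>An element \<^term>\<open>x\<close> of \<^typ>\<open>l2\<close> stands for \<open>r\<^sup>(\<^sup>N\<^sup>-\<^sup>1\<^sup>)\<^sup>/\<^sup>2 w'(r)\<close>, and \<open>profile N x\<close> recovers the radial
  profile \<open>w\<close> vanishing at infinity.\<close>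

definition profile :: "real \<Rightarrow> l2 \<Rightarrow> real \<Rightarrow> real" where
  "profile N x r = (if r > 0 then - (mk (tail_kernel (-(N-1)/2) r) \<bullet> x) else 0)"

lemma profile_add: "profile N (x + y) r = profile N x r + profile N y r"
  by (simp add: profile_def inner_simps)

lemma profile_scale: "profile N (c *\<^sub>R x) r = c * profile N x r"
  by (simp add: profile_def)

lemma profile_diff: "profile N (x - y) r = profile N x r - profile N y r"
  by (simp add: profile_def inner_simps)

lemma profile_zero [simp]: "profile N 0 r = 0"
  by (simp add: profile_def)

lemma profile_integral:
  assumes "N > 2" "r > 0"
  shows "integrable lborel (\<lambda>s. tail_kernel (-(N-1)/2) r s * fn x s)"
    "profile N x r = - (\<integral>s. tail_kernel (-(N-1)/2) r s * fn x s \<partial>lborel)"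
proof -
  have sq: "sqint (tail_kernel (-(N-1)/2) r)" by (rule tail_kernel_sqint) (use assms in auto)
  show "integrable lborel (\<lambda>s. tail_kernel (-(N-1)/2) r s * fn x s)"
    by (rule sqint_mult_integrable[OF sq sqint_fn])
  show "profile N x r = - (\<integral>s. tail_kernel (-(N-1)/2) r s * fn x s \<partial>lborel)"
    using assms(2) unfolding profile_def inner_mk_fn[OF sq] by simp
qed

text \<open>Cauchy-Schwarz with the norm of the kernel, whose square is at most r^(-(N-2)) / (N-2);
  N >= 3 lets the denominator be dropped.\<close>

lemma profile_bound:
  assumes N: "N \<ge> 3" and r: "r > 0"
  shows "\<bar>profile N x r\<bar> \<le> r powr (-(N-2)/2) * norm x"
proof -
  define k where "k = mk (tail_kernel (-(N-1)/2) r)"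
  have e: "2 * (-(N-1)/2) + 1 = -(N-2)" "- 2 * (-(N-1)/2) - 1 = N - 2" by (auto simp: field_simps)
  have "(norm k)\<^sup>2 \<le> r powr (2 * (-(N-1)/2) + 1) / (- 2 * (-(N-1)/2) - 1)"
    unfolding k_def by (rule tail_kernel_sqint(2)) (use assms in auto)
  also have "\<dots> = r powr (-(N-2)) / (N - 2)" unfolding e ..
  also have "\<dots> \<le> r powr (-(N-2)) / 1" using N by (intro divide_left_mono) auto
  also have "\<dots> = (r powr (-(N-2)/2))\<^sup>2" using r by (simp add: power2_eq_square powr_add[symmetric])
  finally have "norm k \<le> r powr (-(N-2)/2)" using power2_le_imp_le powr_ge_zero by blast
  moreover have "\<bar>profile N x r\<bar> \<le> norm k * norm x"
    using r Cauchy_Schwarz_ineq2[of k x] by (simp add: profile_def k_def)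
  ultimately show ?thesis using mult_right_mono[of "norm k" _ "norm x"] norm_ge_zero order_trans by blast
qed

text \<open>The difference of the two kernels lives on [r, s), where it is at most r^(-(N-1)/2), so
  the profile is locally Hoelder with exponent 1/2. This is the source of continuity, of the
  averaging estimate and of the passage from rational to all radii in the compactness
  argument.\<close>

lemma profile_holder:
  assumes N: "N \<ge> 3" and r: "0 < r" "r \<le> s"
  shows "(profile N x s - profile N x r)\<^sup>2 \<le> (s - r) * r powr (-(N-1)) * (norm x)\<^sup>2"
proof -
  let ?p = "-(N-1)/2"
  define k where "k = (\<lambda>t. tail_kernel ?p r t - tail_kernel ?p s t)"
  have sq: "sqint (tail_kernel ?p r)" "sqint (tail_kernel ?p s)"
    using tail_kernel_sqint(1)[of ?p r] tail_kernel_sqint(1)[of ?p s] assms by auto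
  have k_meas: "k \<in> borel_measurable borel" unfolding k_def by measurable
  have "(\<integral>\<^sup>+t. ennreal ((k t)\<^sup>2) \<partial>lborel) \<le> (\<integral>\<^sup>+t. ennreal (r powr (-(N-1))) * indicator {r..s} t \<partial>lborel)"
  proof (rule nn_integral_mono)
    fix t
    have "(t powr ?p)\<^sup>2 \<le> r powr (-(N-1))" if "t \<ge> r"
    proof -
      have "(t powr ?p)\<^sup>2 = t powr (-(N-1))" using that r by (simp add: power2_eq_square powr_add[symmetric])
      also have "\<dots> \<le> r powr (-(N-1))" using that r N by (intro powr_mono2') auto
      finally show ?thesis .
    qed
    then show "ennreal ((k t)\<^sup>2) \<le> ennreal (r powr (-(N-1))) * indicator {r..s} t"
      using r by (auto simp: k_def tail_kernel_def indicator_def intro!: ennreal_leI)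
  qed
  also have "\<dots> = ennreal ((s - r) * r powr (-(N-1)))"
    using r by (subst nn_integral_cmult_indicator) (auto simp: ennreal_mult mult.commute)
  finally have le: "(\<integral>\<^sup>+t. ennreal ((k t)\<^sup>2) \<partial>lborel) \<le> ennreal ((s - r) * r powr (-(N-1)))" .
  have nk: "(norm (mk k))\<^sup>2 \<le> (s - r) * r powr (-(N-1))"
    by (rule sqint_nn(2)[OF k_meas le]) (use r in auto)
  have "mk k = mk (tail_kernel ?p r) - mk (tail_kernel ?p s)"
    unfolding k_def using mk_add[OF sq(1) sqint_scale[OF sq(2), of "-1"]] mk_scale[OF sq(2), of "-1"] by simp
  then have "profile N x s - profile N x r = mk k \<bullet> x"
    using r by (simp add: profile_def inner_diff_left)
  then have "(profile N x s - profile N x r)\<^sup>2 \<le> (norm (mk k))\<^sup>2 * (norm x)\<^sup>2"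
    using Cauchy_Schwarz_ineq[of "mk k" x] by (simp add: power2_norm_eq_inner)
  also have "\<dots> \<le> (s - r) * r powr (-(N-1)) * (norm x)\<^sup>2"
    by (rule mult_right_mono[OF nk]) simp
  finally show ?thesis .
qed

lemma profile_continuous:
  assumes N: "N \<ge> 3"
  shows "continuous_on {0<..} (profile N x)"
  unfolding continuous_on_iff
proof (intro ballI allI impI)
  fix r e :: real assume r: "r \<in> {0<..}" and e: "e > 0"
  define C where "C = (r/2) powr (-(N-1)) * (norm x)\<^sup>2 + 1"
  have C: "C > 0" using r by (simp add: C_def add_nonneg_pos)
  define d where "d = min (r/2) (e\<^sup>2 / C)"
  have "d > 0" using r e C by (simp add: d_def)
  moreover have "dist (profile N x s) (profile N x r) < e" if s: "s \<in> {0<..}" "dist s r < d" for s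
  proof -
    have gen: "(profile N x v - profile N x u)\<^sup>2 < e\<^sup>2" if uv: "r/2 \<le> u" "u \<le> v" "v - u < d" for u v
    proof -
      have "(profile N x v - profile N x u)\<^sup>2 \<le> (v - u) * u powr (-(N-1)) * (norm x)\<^sup>2"
        by (rule profile_holder[OF N]) (use uv r in auto)
      also have "\<dots> = (v - u) * (u powr (-(N-1)) * (norm x)\<^sup>2)" by simp
      also have "\<dots> \<le> (v - u) * C"
      proof (rule mult_left_mono)
        have "u powr (-(N-1)) \<le> (r/2) powr (-(N-1))" using uv r N by (intro powr_mono2') auto
        then have "u powr (-(N-1)) * (norm x)\<^sup>2 \<le> (r/2) powr (-(N-1)) * (norm x)\<^sup>2" by (intro mult_right_mono) auto
        then show "u powr (-(N-1)) * (norm x)\<^sup>2 \<le> C" by (simp add: C_def)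
      qed (use uv in auto)
      also have "\<dots> < (e\<^sup>2 / C) * C" using uv C by (intro mult_strict_right_mono) (auto simp: d_def)
      finally show ?thesis using C by simp
    qed
    have "\<bar>s - r\<bar> < d" "\<bar>s - r\<bar> < r/2" using s(2) by (auto simp: dist_real_def d_def)
    then have "(profile N x s - profile N x r)\<^sup>2 < e\<^sup>2"
      using gen[of r s] gen[of s r] r by (cases "s \<le> r") (auto simp: power2_commute)
    then have "\<bar>profile N x s - profile N x r\<bar>\<^sup>2 < e\<^sup>2" by simp
    then show ?thesis unfolding dist_real_def by (rule power2_less_imp_less) (use e in simp)
  qed
  ultimately show "\<exists>d>0. \<forall>s\<in>{0<..}. dist s r < d \<longrightarrow> dist (profile N x s) (profile N x r) < e" by blast
qed

lemma profile_meas [measurable]: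
  assumes N: "N \<ge> 3"
  shows "profile N x \<in> borel_measurable borel"
proof -
  have "(\<lambda>r. indicator {0<..} r *\<^sub>R profile N x r) \<in> borel_measurable borel"
    by (rule borel_measurable_continuous_on_indicator[OF _ profile_continuous[OF N]]) simp
  moreover have "(\<lambda>r. indicator {0<..} r *\<^sub>R profile N x r) = profile N x"
    by (auto simp: indicator_def profile_def fun_eq_iff)
  ultimately show ?thesis by simp
qed

text \<open>Hardy's inequality by Cauchy-Schwarz and Tonelli: a factor s^(-1/4) is moved from the
  kernel to \<open>fn x\<close>, the norm of the remaining kernel produces r^(-1/2) in front, and
  exchanging the integrations leaves the integral of r^(-1/2) over (0, s), that is 2 s^(1/2). The
  constant 4 serves all N >= 3.\<close>

lemma profile_hardy:
  assumes N: "N \<ge> 3"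
  shows "(\<integral>\<^sup>+r. ennreal (r powr (N-3) * (profile N x r)\<^sup>2) \<partial>lborel) \<le> ennreal (4 * (norm x)\<^sup>2)"
proof -
  define h where "h r s = indicator {r..} s * (s powr (-1/4) * fn x s)" for r s :: real
  have [measurable]: "fn x \<in> borel_measurable borel" by simp
  have h_meas: "h r \<in> borel_measurable borel" for r unfolding h_def by measurable
  have point: "r powr (N-3) * (profile N x r)\<^sup>2 \<le> 2 * r powr (-1/2) * (norm (mk (h r)))\<^sup>2 \<and> sqint (h r)"
    if r: "r > 0" for r
  proof -
    have hs: "sqint (h r)"
    proof (rule sqint_bound[OF sqint_scale[OF sqint_fn[of x], of "r powr (-1/4)"]])
      have "s powr (-1/4) \<le> r powr (-1/4)" if "s \<ge> r" for s using that r by (intro powr_mono2') auto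
      then show "AE s in lborel. \<bar>h r s\<bar> \<le> \<bar>r powr (-1/4) * fn x s\<bar>"
        by (intro AE_I2) (auto simp: h_def indicator_def abs_mult intro!: mult_right_mono)
    qed (use h_meas in simp)
    \<comment> \<open>Here -2p - 1 = N - 5/2, which is at least 1/2; this produces the factor 2
      below.\<close>
    let ?p = "-(N-1)/2 + 1/4"
    have p: "?p < -1/2" "1/2 \<le> - 2 * ?p - 1" using N by (auto simp: field_simps)
    have ks: "sqint (tail_kernel ?p r)" by (rule tail_kernel_sqint(1)[OF p(1) r])
    have "(norm (mk (tail_kernel ?p r)))\<^sup>2 \<le> r powr (2 * ?p + 1) / (- 2 * ?p - 1)"
      by (rule tail_kernel_sqint(2)[OF p(1) r])
    also have "\<dots> \<le> r powr (2 * ?p + 1) / (1/2)"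
    proof (rule divide_left_mono[OF p(2)])
      have "0 < - 2 * ?p - 1" by (rule less_le_trans[OF _ p(2)]) simp
      then show "0 < (- 2 * ?p - 1) * (1/2)" by (rule mult_pos_pos) simp
    qed simp
    finally have nk: "(norm (mk (tail_kernel ?p r)))\<^sup>2 \<le> 2 * r powr (2 * ?p + 1)" by simp
    have "profile N x r = - (\<integral>s. tail_kernel (-(N-1)/2) r s * fn x s \<partial>lborel)"
      by (rule profile_integral(2)) (use r N in auto)
    also have "(\<integral>s. tail_kernel (-(N-1)/2) r s * fn x s \<partial>lborel) = mk (tail_kernel ?p r) \<bullet> mk (h r)"
      unfolding inner_mk[OF ks hs]
    proof (rule Bochner_Integration.integral_cong[OF refl])
      fix s
      show "tail_kernel (-(N-1)/2) r s * fn x s = tail_kernel ?p r s * h r s"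
        using r by (auto simp: tail_kernel_def h_def indicator_def powr_add[symmetric] mult.assoc[symmetric])
    qed
    finally have "(profile N x r)\<^sup>2 \<le> (norm (mk (tail_kernel ?p r)))\<^sup>2 * (norm (mk (h r)))\<^sup>2"
      using Cauchy_Schwarz_ineq[of "mk (tail_kernel ?p r)" "mk (h r)"] by (simp add: power2_norm_eq_inner)
    also have "\<dots> \<le> 2 * r powr (2 * ?p + 1) * (norm (mk (h r)))\<^sup>2" by (rule mult_right_mono[OF nk]) simp
    finally have "r powr (N-3) * (profile N x r)\<^sup>2 \<le> r powr (N-3) * (2 * r powr (2 * ?p + 1) * (norm (mk (h r)))\<^sup>2)"
      by (rule mult_left_mono) simp
    also have "\<dots> = 2 * (r powr (N-3) * r powr (2 * ?p + 1)) * (norm (mk (h r)))\<^sup>2" by simp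
    also have "r powr (N-3) * r powr (2 * ?p + 1) = r powr (-1/2)"
      unfolding powr_add[symmetric] by (rule arg_cong[where f = "(powr) r"]) (simp add: field_simps)
    finally show ?thesis using hs by simp
  qed
  have "(\<integral>\<^sup>+r. ennreal (r powr (N-3) * (profile N x r)\<^sup>2) \<partial>lborel)
      \<le> (\<integral>\<^sup>+r. (\<integral>\<^sup>+s. ennreal (2 * r powr (-1/2)) * indicator {0<..} r * indicator {r..} s * ennreal (s powr (-1/2) * (fn x s)\<^sup>2) \<partial>lborel) \<partial>lborel)"
  proof (rule nn_integral_mono)
    fix r :: real
    show "ennreal (r powr (N-3) * (profile N x r)\<^sup>2) \<le> (\<integral>\<^sup>+s. ennreal (2 * r powr (-1/2)) * indicator {0<..} r * indicator {r..} s * ennreal (s powr (-1/2) * (fn x s)\<^sup>2) \<partial>lborel)"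
    proof (cases "r > 0")
      case True
      have "ennreal (r powr (N-3) * (profile N x r)\<^sup>2) \<le> ennreal (2 * r powr (-1/2)) * ennreal ((norm (mk (h r)))\<^sup>2)"
        using point[OF True] by (subst ennreal_mult[symmetric]) (auto intro: ennreal_leI)
      also have "ennreal ((norm (mk (h r)))\<^sup>2) = (\<integral>\<^sup>+s. ennreal ((h r s)\<^sup>2) \<partial>lborel)"
        using point[OF True] by (subst norm_mk_sq) (auto intro!: nn_integral_eq_integral[symmetric] dest: sqintD)
      also have "\<dots> = (\<integral>\<^sup>+s. indicator {r..} s * ennreal (s powr (-1/2) * (fn x s)\<^sup>2) \<partial>lborel)"
      proof (rule nn_integral_cong)
        fix s :: real
        have "(s powr (-1/4))\<^sup>2 = s powr (-1/2)" by (simp add: power2_eq_square powr_add[symmetric])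
        then show "ennreal ((h r s)\<^sup>2) = indicator {r..} s * ennreal (s powr (-1/2) * (fn x s)\<^sup>2)"
          by (auto simp: h_def indicator_def power_mult_distrib)
      qed
      also have "ennreal (2 * r powr (-1/2)) * \<dots> = (\<integral>\<^sup>+s. ennreal (2 * r powr (-1/2)) * (indicator {r..} s * ennreal (s powr (-1/2) * (fn x s)\<^sup>2)) \<partial>lborel)"
        by (rule nn_integral_cmult[symmetric]) measurable
      finally show ?thesis using True by (simp add: mult.assoc)
    qed (simp add: profile_def)
  qed
  also have "\<dots> = (\<integral>\<^sup>+s. (\<integral>\<^sup>+r. ennreal (2 * r powr (-1/2)) * indicator {0<..} r * indicator {r..} s * ennreal (s powr (-1/2) * (fn x s)\<^sup>2) \<partial>lborel) \<partial>lborel)"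
  proof (rule lborel_pair.Fubini'[symmetric])
    have "(\<lambda>p::real\<times>real. if fst p \<le> snd p then 1 else 0 :: ennreal) \<in> borel_measurable (lborel \<Otimes>\<^sub>M lborel)"
      by measurable
    moreover have "(\<lambda>p::real\<times>real. indicator {fst p..} (snd p) :: ennreal) = (\<lambda>p. if fst p \<le> snd p then 1 else 0)"
      by (auto simp: indicator_def)
    ultimately have [measurable]: "(\<lambda>p::real\<times>real. indicator {fst p..} (snd p) :: ennreal) \<in> borel_measurable (lborel \<Otimes>\<^sub>M lborel)"
      by simp
    show "(\<lambda>(r, s). ennreal (2 * r powr (-1/2)) * indicator {0<..} r * indicator {r..} s * ennreal (s powr (-1/2) * (fn x s)\<^sup>2))
      \<in> borel_measurable (lborel \<Otimes>\<^sub>M lborel)"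
      unfolding split_beta' by measurable
  qed
  also have "\<dots> \<le> (\<integral>\<^sup>+s. ennreal 4 * ennreal ((fn x s)\<^sup>2) \<partial>lborel)"
  proof (rule nn_integral_mono)
    fix s :: real
    show "(\<integral>\<^sup>+r. ennreal (2 * r powr (-1/2)) * indicator {0<..} r * indicator {r..} s * ennreal (s powr (-1/2) * (fn x s)\<^sup>2) \<partial>lborel) \<le> ennreal 4 * ennreal ((fn x s)\<^sup>2)"
    proof (cases "s > 0")
      case True
      have "(\<integral>\<^sup>+r. ennreal (2 * r powr (-1/2)) * indicator {0<..} r * indicator {r..} s * ennreal (s powr (-1/2) * (fn x s)\<^sup>2) \<partial>lborel)
        \<le> (\<integral>\<^sup>+r. ennreal (2 * (s powr (-1/2) * (fn x s)\<^sup>2)) * (ennreal (r powr (-1/2)) * indicator {0..s} r) \<partial>lborel)"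
        by (rule nn_integral_mono) (auto simp: indicator_def ennreal_mult[symmetric] intro!: ennreal_leI)
      also have "\<dots> = ennreal (2 * (s powr (-1/2) * (fn x s)\<^sup>2)) * ennreal (s powr (-1/2+1) / (-1/2+1))"
        by (subst nn_integral_cmult) (use nn_integral_powr_head[of "-1/2" s] True in simp_all)
      also have "\<dots> = ennreal (4 * (s powr (-1/2) * s powr (-1/2+1)) * (fn x s)\<^sup>2)"
        by (subst ennreal_mult[symmetric]) (auto simp: field_simps)
      also have "s powr (-1/2) * s powr (-1/2+1) = 1"
        using True unfolding powr_add[symmetric] by simp
      finally show ?thesis by (simp add: ennreal_mult)
    next
      case False
      then have "(\<integral>\<^sup>+r. ennreal (2 * r powr (-1/2)) * indicator {0<..} r * indicator {r..} s * ennreal (s powr (-1/2) * (fn x s)\<^sup>2) \<partial>lborel) = (\<integral>\<^sup>+r. 0 \<partial>(lborel::real measure))"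
        by (intro nn_integral_cong) (auto simp: indicator_def)
      then show ?thesis by simp
    qed
  qed
  also have "\<dots> = ennreal (4 * (norm x)\<^sup>2)"
    by (subst nn_integral_cmult) (auto simp: nn_integral_fn_sq ennreal_mult)
  finally show ?thesis .
qed

section \<open>The energy space and weighted estimates\<close>

lemma continuous_bounded_near_zero:
  fixes g :: "real \<Rightarrow> real"
  assumes "continuous_on {0<..} g" "\<forall>\<^sub>F r in at_right 0. g r \<le> C"
  shows "\<exists>C'. \<forall>r. 0 < r \<longrightarrow> r \<le> 1 \<longrightarrow> g r \<le> C'"
proof -
  obtain d where d: "d > 0" "\<And>r. 0 < r \<Longrightarrow> r < d \<Longrightarrow> g r \<le> C"
    using assms(2) unfolding eventually_at_right_field by auto
  have "compact (g ` {d..1})"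
    by (intro compact_continuous_image continuous_on_subset[OF assms(1)]) (use d in auto)
  then obtain B where B: "\<And>r. r \<in> {d..1} \<Longrightarrow> g r \<le> B"
    using compact_imp_bounded bounded_imp_bdd_above unfolding bdd_above_def by (metis imageI)
  have "g r \<le> max B C" if "0 < r" "r \<le> 1" for r
    using B[of r] d(2)[of r] that by (cases "r < d") auto
  then show ?thesis by blast
qed

lemma continuous_bounded_at_infinity:
  fixes g :: "real \<Rightarrow> real"
  assumes "continuous_on {0<..} g" "\<forall>\<^sub>F r in at_top. g r \<le> C"
  shows "\<exists>C'. \<forall>r\<ge>1. g r \<le> C'"
proof -
  obtain d where d: "\<And>r. r \<ge> d \<Longrightarrow> g r \<le> C"
    using assms(2) unfolding eventually_at_top_linorder by auto
  have "compact (g ` {1..d})"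
    by (intro compact_continuous_image continuous_on_subset[OF assms(1)]) auto
  then obtain B where B: "\<And>r. r \<in> {1..d} \<Longrightarrow> g r \<le> B"
    using compact_imp_bounded bounded_imp_bdd_above unfolding bdd_above_def by (metis imageI)
  have "g r \<le> max B C" if "1 \<le> r" for r
    using B[of r] d(1)[of r] that by (cases "r < d") auto
  then show ?thesis by blast
qed

text \<open>The second component is determined by the first. Carrying it along makes the product
  norm, for first components living on r > 0, a constant multiple of the norm of H^1_V.\<close>

definition energy_space :: "real \<Rightarrow> (real \<Rightarrow> real) \<Rightarrow> (l2 \<times> l2) set" where
  "energy_space N V = {e. AE r in lborel.
     fn (snd e) r = (if r > 0 then sqrt (V r * r powr (N-1)) * profile N (fst e) r else 0)}"

lemma energy_spaceD:
  "e \<in> energy_space N V \<Longrightarrow>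
     AE r in lborel. fn (snd e) r = (if r > 0 then sqrt (V r * r powr (N-1)) * profile N (fst e) r else 0)"
  by (simp add: energy_space_def)

lemma subspace_energy_space: "subspace (energy_space N V)"
  unfolding subspace_def
proof (intro conjI ballI allI)
  show "0 \<in> energy_space N V"
    unfolding energy_space_def using fn_zero by (simp add: zero_prod_def)
  fix x assume x: "x \<in> energy_space N V"
  show "x + y \<in> energy_space N V" if y: "y \<in> energy_space N V" for y
    unfolding energy_space_def mem_Collect_eq
    using energy_spaceD[OF x] energy_spaceD[OF y] fn_add[of "snd x" "snd y"]
    by eventually_elim (auto simp: profile_add algebra_simps)
  show "c *\<^sub>R x \<in> energy_space N V" for c
    unfolding energy_space_def mem_Collect_eq
    using energy_spaceD[OF x] fn_scale[of c "snd x"]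
    by eventually_elim (auto simp: profile_scale algebra_simps)
qed

lemma measurable_positive_part:
  fixes g :: "real \<Rightarrow> real"
  assumes "continuous_on {0<..} g"
  shows "(\<lambda>r. if r > 0 then g r else 0) \<in> borel_measurable borel"
proof -
  have "(\<lambda>r. indicator {0<..} r *\<^sub>R g r) \<in> borel_measurable borel"
    by (rule borel_measurable_continuous_on_indicator[OF _ assms]) simp
  moreover have "(\<lambda>r. indicator {0<..} r *\<^sub>R g r) = (\<lambda>r. if r > 0 then g r else 0)"
    by (auto simp: indicator_def fun_eq_iff)
  ultimately show ?thesis by simp
qed

lemma tendsto_profile:
  assumes "N \<ge> 3" "X \<longlonglongrightarrow> x"
  shows "(\<lambda>n. profile N (X n) r) \<longlonglongrightarrow> profile N x r"
  unfolding profile_def using assms(2) by (auto intro!: tendsto_intros)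

text \<open>Convergence of the first components gives pointwise convergence of the profiles, hence
  of the second components almost everywhere; \<open>l2_fatou\<close> identifies this pointwise
  limit with the limit in norm.\<close>

lemma closed_energy_space:
  assumes N: "N \<ge> 3" and V: "continuous_on {0<..} V"
  shows "closed (energy_space N V)"
  unfolding closed_sequential_limits
proof (intro allI impI)
  fix X e assume X: "(\<forall>n. X n \<in> energy_space N V) \<and> X \<longlonglongrightarrow> e"
  define g where "g r = (if r > 0 then sqrt (V r * r powr (N-1)) * profile N (fst e) r else 0)" for r
  have g_meas: "g \<in> borel_measurable borel"
    unfolding g_def by (intro measurable_positive_part continuous_intros V profile_continuous N) auto
  have f_meas: "(\<lambda>r. fn (snd e) r - g r) \<in> borel_measurable lborel" using g_meas by simp
  have lim0: "(\<lambda>n. norm (snd (X n) - snd e)) \<longlonglongrightarrow> 0"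
    using X by (intro tendsto_norm_zero LIM_zero tendsto_intros) auto
  have AEX: "AE r in lborel. \<forall>n. fn (snd e - snd (X n)) r = fn (snd e) r -
      (if r > 0 then sqrt (V r * r powr (N-1)) * profile N (fst (X n)) r else 0)"
  proof (subst AE_all_countable, intro allI)
    fix n
    have "X n \<in> energy_space N V" using X by blast
    from energy_spaceD[OF this] fn_diff[of "snd e" "snd (X n)"]
    show "AE r in lborel. fn (snd e - snd (X n)) r = fn (snd e) r -
      (if r > 0 then sqrt (V r * r powr (N-1)) * profile N (fst (X n)) r else 0)"
      by eventually_elim simp
  qed
  have conv: "AE r in lborel. (\<lambda>n. fn (snd e - snd (X (n + k))) r) \<longlonglongrightarrow> fn (snd e) r - g r" for k
    using AEX
  proof eventually_elim
    case (elim r)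
    have "(\<lambda>n. fst (X (n + k))) \<longlonglongrightarrow> fst e"
      using X by (intro LIMSEQ_ignore_initial_segment[of "\<lambda>n. fst (X n)"] tendsto_fst) auto
    then have "(\<lambda>n. profile N (fst (X (n + k))) r) \<longlonglongrightarrow> profile N (fst e) r" by (rule tendsto_profile[OF N])
    then show ?case unfolding elim[rule_format] g_def by (auto intro!: tendsto_intros)
  qed
  have sq: "sqint (\<lambda>r. fn (snd e) r - g r) \<and> norm (mk (\<lambda>r. fn (snd e) r - g r)) \<le> d" if d: "d > 0" for d
  proof -
    obtain k where k: "\<And>n. n \<ge> k \<Longrightarrow> norm (snd (X n) - snd e) < d"
      using order_tendstoD(2)[OF lim0 d] unfolding eventually_sequentially by auto
    have "norm (snd e - snd (X (n + k))) \<le> d" for n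
      using k[of "n + k"] by (simp add: norm_minus_commute)
    from l2_fatou[OF this conv f_meas] show ?thesis by blast
  qed
  have "norm (mk (\<lambda>r. fn (snd e) r - g r)) \<le> 0 + d" if "d > 0" for d using sq[OF that] by simp
  then have "norm (mk (\<lambda>r. fn (snd e) r - g r)) \<le> 0" by (rule field_le_epsilon)
  then have "mk (\<lambda>r. fn (snd e) r - g r) = 0" by simp
  then have "AE r in lborel. fn (snd e) r - g r = 0"
    using fn_mk[OF conjunct1[OF sq[of 1]]] fn_zero by (auto elim: eventually_elim2)
  then show "e \<in> energy_space N V" unfolding energy_space_def g_def by simp
qed

text \<open>Averaging over an interval of length \<open>r powr (-\<alpha>/2)\<close> balances the oscillation of the profile
  against its weighted mass.\<close>

lemma profile_pointwise:
  assumes N: "N \<ge> 3" and r: "r > 0" and l: "r powr (-\<alpha>/2) \<le> r" and B: "B \<ge> 0"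
    and le: "(\<integral>\<^sup>+s. ennreal (s powr (\<alpha> + (N-1)) * (profile N x s)\<^sup>2) * indicator {r..2*r} s \<partial>lborel) \<le> ennreal B"
  shows "min 1 (2 powr (\<alpha> + (N-1))) * (r powr (N - 1 + \<alpha>/2) * (profile N x r)\<^sup>2)
    \<le> 2 * B + 2 * (norm x)\<^sup>2"
proof -
  define l where "l = r powr (-\<alpha>/2)"
  \<comment> \<open>Compares the weight s^(\<alpha>+N-1) on [r, 2r] with its value at r: the 1
    covers nonnegative exponents, the power of 2 negative ones.\<close>
  define c where "c = min 1 (2 powr (\<alpha> + (N-1)))"
  define M where "M = c * r powr (\<alpha> + (N-1)) * ((profile N x r)\<^sup>2 - 2 * (l * r powr (-(N-1)) * (norm x)\<^sup>2))"
  have c: "0 < c" "c \<le> 1" by (auto simp: c_def)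
  have lp: "0 < l" "l \<le> r" using r l by (auto simp: l_def)
  have M_le: "M \<le> 2 * (s powr (\<alpha> + (N-1)) * (profile N x s)\<^sup>2)" if s: "s \<in> {r..r+l}" for s
  proof -
    have s2: "r \<le> s" "s \<le> 2 * r" using s lp by auto
    have "(profile N x s - profile N x r)\<^sup>2 \<le> (s - r) * r powr (-(N-1)) * (norm x)\<^sup>2"
      by (rule profile_holder[OF N r s2(1)])
    also have "\<dots> \<le> l * r powr (-(N-1)) * (norm x)\<^sup>2"
      using s by (intro mult_right_mono) auto
    finally have h: "(profile N x s - profile N x r)\<^sup>2 \<le> l * r powr (-(N-1)) * (norm x)\<^sup>2" .
    have "(profile N x r)\<^sup>2 \<le> 2 * (profile N x s)\<^sup>2 + 2 * (profile N x s - profile N x r)\<^sup>2"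
      using zero_le_power2[of "2 * profile N x s - profile N x r"] by (simp add: power2_eq_square algebra_simps)
    then have 1: "(profile N x r)\<^sup>2 - 2 * (l * r powr (-(N-1)) * (norm x)\<^sup>2) \<le> 2 * (profile N x s)\<^sup>2"
      using h by linarith
    have 2: "c * r powr (\<alpha> + (N-1)) \<le> s powr (\<alpha> + (N-1))"
    proof (cases "\<alpha> + (N-1) \<ge> 0")
      case True
      have "c * r powr (\<alpha> + (N-1)) \<le> 1 * r powr (\<alpha> + (N-1))" using c by (intro mult_right_mono) auto
      also have "\<dots> \<le> s powr (\<alpha> + (N-1))" using s2 r True by (simp add: powr_mono2)
      finally show ?thesis .
    next
      case False
      have "c * r powr (\<alpha> + (N-1)) \<le> 2 powr (\<alpha> + (N-1)) * r powr (\<alpha> + (N-1))"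
        by (intro mult_right_mono) (auto simp: c_def)
      also have "\<dots> = (2 * r) powr (\<alpha> + (N-1))" using r by (simp add: powr_mult)
      also have "\<dots> \<le> s powr (\<alpha> + (N-1))" using s2 r False by (intro powr_mono2') auto
      finally show ?thesis .
    qed
    have "M \<le> c * r powr (\<alpha> + (N-1)) * (2 * (profile N x s)\<^sup>2)"
      unfolding M_def using c by (intro mult_left_mono 1) auto
    also have "\<dots> \<le> s powr (\<alpha> + (N-1)) * (2 * (profile N x s)\<^sup>2)"
      by (intro mult_right_mono 2) auto
    finally show ?thesis by simp
  qed
  have Ml: "M * l \<le> 2 * B"
  proof (cases "M \<ge> 0")
    case True
    have [measurable]: "profile N x \<in> borel_measurable borel" by (rule profile_meas[OF N])
    have "ennreal (M * l) = (\<integral>\<^sup>+s. ennreal M * indicator {r..r+l} s \<partial>lborel)"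
      using lp True by (subst nn_integral_cmult_indicator) (auto simp: ennreal_mult)
    also have "\<dots> \<le> (\<integral>\<^sup>+s. ennreal 2 * (ennreal (s powr (\<alpha> + (N-1)) * (profile N x s)\<^sup>2) * indicator {r..2*r} s) \<partial>lborel)"
    proof (rule nn_integral_mono)
      fix s
      show "ennreal M * indicator {r..r+l} s \<le> ennreal 2 * (ennreal (s powr (\<alpha> + (N-1)) * (profile N x s)\<^sup>2) * indicator {r..2*r} s)"
      proof (cases "s \<in> {r..r+l}")
        case True
        then have "s \<in> {r..2*r}" using lp by auto
        then show ?thesis using True ennreal_leI[OF M_le[OF True]] by (simp add: ennreal_mult)
      qed simp
    qed
    also have "\<dots> = ennreal 2 * (\<integral>\<^sup>+s. ennreal (s powr (\<alpha> + (N-1)) * (profile N x s)\<^sup>2) * indicator {r..2*r} s \<partial>lborel)"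
      by (rule nn_integral_cmult) measurable
    also have "\<dots> \<le> ennreal 2 * ennreal B" by (intro mult_left_mono le) simp
    also have "\<dots> = ennreal (2 * B)" using B by (simp add: ennreal_mult)
    finally show ?thesis using B by (simp add: ennreal_le_iff)
  next
    case False
    then have "M * l \<le> 0" using lp by (simp add: mult_le_0_iff)
    then show ?thesis using B by simp
  qed
  have p1: "r powr (\<alpha> + (N-1)) * l = r powr (N - 1 + \<alpha>/2)"
    unfolding l_def powr_add[symmetric] by (rule arg_cong[where f = "(powr) r"]) (simp add: field_simps)
  \<comment> \<open>This identity is what fixes the averaging length: it says l^2 r^\<alpha> = 1, so
    that the Hoelder term contributes the square of the norm without any power of r.\<close>
  have p2: "r powr (\<alpha> + (N-1)) * l * (l * r powr (-(N-1))) = 1"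
  proof -
    have "r powr (\<alpha> + (N-1)) * l * (l * r powr (-(N-1))) = r powr ((\<alpha> + (N-1)) + (-\<alpha>/2) + ((-\<alpha>/2) + (-(N-1))))"
      unfolding l_def powr_add by simp
    also have "(\<alpha> + (N-1)) + (-\<alpha>/2) + ((-\<alpha>/2) + (-(N-1))) = 0" by (simp add: field_simps)
    finally show ?thesis using r by simp
  qed
  have "M * l = c * ((r powr (\<alpha> + (N-1)) * l) * (profile N x r)\<^sup>2)
      - 2 * c * (r powr (\<alpha> + (N-1)) * l * (l * r powr (-(N-1)))) * (norm x)\<^sup>2"
    by (simp add: M_def algebra_simps)
  also have "\<dots> = c * (r powr (N - 1 + \<alpha>/2) * (profile N x r)\<^sup>2) - 2 * c * (norm x)\<^sup>2"
    unfolding p1 p2[unfolded p1] by simp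
  finally have "c * (r powr (N - 1 + \<alpha>/2) * (profile N x r)\<^sup>2) \<le> 2 * B + 2 * c * (norm x)\<^sup>2" using Ml by linarith
  also have "2 * c * (norm x)\<^sup>2 \<le> 2 * (norm x)\<^sup>2" using c by (intro mult_right_mono) auto
  finally show ?thesis unfolding c_def by simp
qed

lemma norm_components_le: "norm (fst e) \<le> norm e" "norm (snd e) \<le> norm e"
  by (simp_all add: norm_prod_def)

section \<open>Decay of profiles forced by the growth of V\<close>

locale radial_weights =
  fixes N a0 a b0 b :: real and V K :: "real \<Rightarrow> real"
  assumes N: "N \<ge> 3"
    and V_cont: "continuous_on {0<..} V" and V_nonneg: "\<And>r. r > 0 \<Longrightarrow> V r \<ge> 0"
    and V0: "Liminf (at_right 0) (\<lambda>r. ereal (V r / r powr a0)) > 0"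
    and Vinf: "Liminf at_top (\<lambda>r. ereal (V r / r powr a)) > 0"
    and K_cont: "continuous_on {0<..} K" and K_pos: "\<And>r. r > 0 \<Longrightarrow> K r > 0"
    and K0: "Limsup (at_right 0) (\<lambda>r. ereal (K r / r powr b0)) < \<infinity>"
    and Kinf: "Limsup at_top (\<lambda>r. ereal (K r / r powr b)) < \<infinity>"
begin

abbreviation E where "E \<equiv> energy_space N V"
abbreviation w where "w e \<equiv> profile N (fst e)"

text \<open>Exponents of the potential effectively available near the origin and near infinity: Hardy's inequality
  supplies the weight \<open>r\<^sup>-\<^sup>2\<close> whenever it is stronger than \<open>V\<close>.\<close>

definition "al0 = min a0 (-2)"
definition "al1 = max a (-2)"
definition "wt r = r powr (N-1) * (if r < 1 then r powr al0 else r powr al1)"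
text \<open>The exponent is minus half of that in \<open>profile_pointwise\<close>, where
  r^(N-1+\<alpha>/2) multiplies the square of the profile.\<close>

definition "pt r = (if r < 1 then r powr (-(2*N-2+al0)/4) else r powr (-(2*N-2+al1)/4))"

lemma K_bound: "\<exists>C\<ge>0. \<forall>r>0. K r \<le> C * (if r < 1 then r powr b0 else r powr b)"
proof -
  have c: "continuous_on {0<..} (\<lambda>r. K r / r powr p)" for p
    by (intro continuous_intros K_cont) auto
  obtain C0 where "Limsup (at_right 0) (\<lambda>r. ereal (K r / r powr b0)) < ereal C0"
    using ereal_dense2[OF K0] by blast
  then have "\<forall>\<^sub>F r in at_right 0. K r / r powr b0 \<le> C0"
    by (auto dest!: Limsup_lessD elim: eventually_mono)
  then obtain C1 where C1: "\<And>r. 0 < r \<Longrightarrow> r \<le> 1 \<Longrightarrow> K r / r powr b0 \<le> C1"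
    using continuous_bounded_near_zero[OF c] by blast
  obtain C2 where "Limsup at_top (\<lambda>r. ereal (K r / r powr b)) < ereal C2"
    using ereal_dense2[OF Kinf] by blast
  then have "\<forall>\<^sub>F r in at_top. K r / r powr b \<le> C2"
    by (auto dest!: Limsup_lessD elim: eventually_mono)
  then obtain C3 where C3: "\<And>r. 1 \<le> r \<Longrightarrow> K r / r powr b \<le> C3"
    using continuous_bounded_at_infinity[OF c] by blast
  define C where "C = max 0 (max C1 C3)"
  have "K r \<le> C * (if r < 1 then r powr b0 else r powr b)" if r: "r > 0" for r
  proof (cases "r < 1")
    case True
    then have "K r / r powr b0 \<le> C" using C1[of r] r by (auto simp: C_def)
    then show ?thesis using True r by (simp add: divide_le_eq)
  next
    case False
    then have "K r / r powr b \<le> C" using C3[of r] by (auto simp: C_def)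
    then show ?thesis using False r by (simp add: divide_le_eq)
  qed
  moreover have "C \<ge> 0" by (simp add: C_def)
  ultimately show ?thesis by blast
qed

text \<open>Near 0 the power r^al0 is the larger of r^a0 and r^-2, and r^al1 is so at infinity; up
  to a constant (V) dominates the former and the second summand is the latter. On compact ranges of
  radii the quotient is bounded because V + r^-2 is continuous and positive.\<close>

lemma V_bound: "\<exists>C\<ge>0. \<forall>r>0. (if r < 1 then r powr al0 else r powr al1) \<le> C * (V r + r powr (-2))"
proof -
  have pos: "V r + r powr (-2) > 0" if "r > 0" for r using V_nonneg[OF that] that by (simp add: add_nonneg_pos)
  have c: "continuous_on {0<..} (\<lambda>r. r powr p / (V r + r powr (-2)))" for p
    by (intro continuous_intros V_cont) (use pos in \<open>auto simp: less_imp_neq[symmetric] order_less_imp_not_eq2\<close>)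
  have e0: "\<exists>C. \<forall>\<^sub>F r in at_right 0. r powr al0 / (V r + r powr (-2)) \<le> C"
  proof (cases "a0 \<le> -2")
    case True
    obtain c where c: "0 < ereal c" "ereal c < Liminf (at_right 0) (\<lambda>r. ereal (V r / r powr a0))"
      using ereal_dense2[OF V0] by blast
    have "\<forall>\<^sub>F r in at_right 0. c < V r / r powr a0" using less_LiminfD[OF c(2)] by simp
    moreover have "\<forall>\<^sub>F r in at_right (0::real). 0 < r" by (rule eventually_at_right_less)
    ultimately have "\<forall>\<^sub>F r in at_right 0. r powr al0 / (V r + r powr (-2)) \<le> 1 / c"
    proof eventually_elim
      case (elim r)
      then have "c * r powr a0 \<le> V r" by (simp add: less_divide_eq)
      then have "c * r powr al0 \<le> V r + r powr (-2)" using True by (simp add: al0_def min_def add_increasing2)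
      then show ?case using pos[OF elim(2)] c(1) by (simp add: divide_simps mult.commute)
    qed
    then show ?thesis by blast
  next
    case False
    have "\<forall>\<^sub>F r in at_right (0::real). 0 < r" by (rule eventually_at_right_less)
    then have "\<forall>\<^sub>F r in at_right 0. r powr al0 / (V r + r powr (-2)) \<le> 1"
    proof eventually_elim
      case (elim r)
      then show ?case using pos[OF elim] V_nonneg[OF elim] False by (simp add: al0_def min_def divide_le_eq)
    qed
    then show ?thesis by blast
  qed
  have e1: "\<exists>C. \<forall>\<^sub>F r in at_top. r powr al1 / (V r + r powr (-2)) \<le> C"
  proof (cases "a \<ge> -2")
    case True
    obtain c where c: "0 < ereal c" "ereal c < Liminf at_top (\<lambda>r. ereal (V r / r powr a))"
      using ereal_dense2[OF Vinf] by blast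
    have "\<forall>\<^sub>F r in at_top. c < V r / r powr a" using less_LiminfD[OF c(2)] by simp
    moreover have "\<forall>\<^sub>F r in at_top. (0::real) < r" by (rule eventually_gt_at_top)
    ultimately have "\<forall>\<^sub>F r in at_top. r powr al1 / (V r + r powr (-2)) \<le> 1 / c"
    proof eventually_elim
      case (elim r)
      then have "c * r powr a \<le> V r" by (simp add: less_divide_eq)
      then have "c * r powr al1 \<le> V r + r powr (-2)" using True by (simp add: al1_def max_def add_increasing2)
      then show ?case using pos[OF elim(2)] c(1) by (simp add: divide_simps mult.commute)
    qed
    then show ?thesis by blast
  next
    case False
    have "\<forall>\<^sub>F r in at_top. (0::real) < r" by (rule eventually_gt_at_top)
    then have "\<forall>\<^sub>F r in at_top. r powr al1 / (V r + r powr (-2)) \<le> 1"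
    proof eventually_elim
      case (elim r)
      then show ?case using pos[OF elim] V_nonneg[OF elim] False by (simp add: al1_def max_def divide_le_eq)
    qed
    then show ?thesis by blast
  qed
  obtain C1 where C1: "\<And>r. 0 < r \<Longrightarrow> r \<le> 1 \<Longrightarrow> r powr al0 / (V r + r powr (-2)) \<le> C1"
    using e0 continuous_bounded_near_zero[OF c] by blast
  obtain C3 where C3: "\<And>r. 1 \<le> r \<Longrightarrow> r powr al1 / (V r + r powr (-2)) \<le> C3"
    using e1 continuous_bounded_at_infinity[OF c] by blast
  define C where "C = max 0 (max C1 C3)"
  have "(if r < 1 then r powr al0 else r powr al1) \<le> C * (V r + r powr (-2))" if r: "r > 0" for r
  proof (cases "r < 1")
    case True
    then have "r powr al0 / (V r + r powr (-2)) \<le> C" using C1[of r] r by (auto simp: C_def)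
    then show ?thesis using True pos[OF r] by (simp add: divide_le_eq)
  next
    case False
    then have "r powr al1 / (V r + r powr (-2)) \<le> C" using C3[of r] by (auto simp: C_def)
    then show ?thesis using False pos[OF r] by (simp add: divide_le_eq)
  qed
  moreover have "C \<ge> 0" by (simp add: C_def)
  ultimately show ?thesis by blast
qed

lemma w_meas [measurable]: "w e \<in> borel_measurable borel"
  by (rule profile_meas[OF N])

lemma w_nonpos: "r \<le> 0 \<Longrightarrow> w e r = 0" by (simp add: profile_def)

lemma V_energy:
  assumes "e \<in> E"
  shows "(\<integral>\<^sup>+r. ennreal (V r * r powr (N-1) * (w e r)\<^sup>2) \<partial>lborel) = ennreal ((norm (snd e))\<^sup>2)"
  unfolding nn_integral_fn_sq[symmetric]
proof (rule nn_integral_cong_AE)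
  show "AE r in lborel. ennreal (V r * r powr (N-1) * (w e r)\<^sup>2) = ennreal ((fn (snd e) r)\<^sup>2)"
    using energy_spaceD[OF assms]
  proof eventually_elim
    case (elim r)
    show ?case
    proof (cases "r > 0")
      case True
      then show ?thesis using elim V_nonneg[OF True] by (simp add: power_mult_distrib)
    qed (use elim w_nonpos[of r e] in auto)
  qed
qed

lemma wt_meas [measurable]: "wt \<in> borel_measurable borel"
  unfolding wt_def by measurable

text \<open>\<open>V_bound\<close> splits the weight between the potential energy and Hardy's
  inequality; their constants 1 and 4 add up to the factor 5.\<close>

lemma weighted_energy: "\<exists>C\<ge>0. \<forall>e\<in>E. (\<integral>\<^sup>+r. ennreal (wt r * (w e r)\<^sup>2) \<partial>lborel) \<le> ennreal (C * (norm e)\<^sup>2)"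
proof -
  obtain C where C: "C \<ge> 0" "\<And>r. r > 0 \<Longrightarrow> (if r < 1 then r powr al0 else r powr al1) \<le> C * (V r + r powr (-2))"
    using V_bound by blast
  have "(\<integral>\<^sup>+r. ennreal (wt r * (w e r)\<^sup>2) \<partial>lborel) \<le> ennreal ((5 * C) * (norm e)\<^sup>2)" if e: "e \<in> E" for e
  proof -
    have vm: "(\<lambda>r. V r * r powr (N-1) * (w e r)\<^sup>2) \<in> borel_measurable borel"
    proof -
      have "(\<lambda>r. V r * r powr (N-1) * (w e r)\<^sup>2) = (\<lambda>r. (if r > 0 then V r else 0) * r powr (N-1) * (w e r)\<^sup>2)"
        by (auto simp: fun_eq_iff w_nonpos)
      moreover have "(\<lambda>r. if r > 0 then V r else 0) \<in> borel_measurable borel"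
        by (rule measurable_positive_part[OF V_cont])
      ultimately show ?thesis by simp
    qed
    have nn: "0 \<le> V r * r powr (N-1) * (w e r)\<^sup>2" for r
      using V_nonneg[of r] w_nonpos[of r e] by (cases "r > 0") auto
    have "(\<integral>\<^sup>+r. ennreal (wt r * (w e r)\<^sup>2) \<partial>lborel)
      \<le> (\<integral>\<^sup>+r. ennreal C * (ennreal (V r * r powr (N-1) * (w e r)\<^sup>2) + ennreal (r powr (N-3) * (w e r)\<^sup>2)) \<partial>lborel)"
    proof (rule nn_integral_mono)
      fix r :: real
      have "wt r * (w e r)\<^sup>2 \<le> C * (V r * r powr (N-1) * (w e r)\<^sup>2 + r powr (N-3) * (w e r)\<^sup>2)"
      proof (cases "r > 0")
        case True
        have "wt r * (w e r)\<^sup>2 \<le> r powr (N-1) * (C * (V r + r powr (-2))) * (w e r)\<^sup>2"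
          unfolding wt_def using C(2)[OF True] by (intro mult_right_mono mult_left_mono) auto
        also have "\<dots> = C * (V r * r powr (N-1) * (w e r)\<^sup>2 + (r powr (N-1) * r powr (-2)) * (w e r)\<^sup>2)"
          by (simp add: algebra_simps)
        also have "r powr (N-1) * r powr (-2) = r powr (N-3)" by (simp add: powr_add[symmetric])
        finally show ?thesis .
      qed (simp add: w_nonpos)
      then have "ennreal (wt r * (w e r)\<^sup>2) \<le> ennreal (C * (V r * r powr (N-1) * (w e r)\<^sup>2 + r powr (N-3) * (w e r)\<^sup>2))"
        by (rule ennreal_leI)
      also have "\<dots> = ennreal C * (ennreal (V r * r powr (N-1) * (w e r)\<^sup>2) + ennreal (r powr (N-3) * (w e r)\<^sup>2))"
        using C(1) nn[of r] by (subst ennreal_mult, simp, simp, subst ennreal_plus) auto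
      finally show "ennreal (wt r * (w e r)\<^sup>2) \<le> \<dots>" .
    qed
    also have "\<dots> = ennreal C * ((\<integral>\<^sup>+r. ennreal (V r * r powr (N-1) * (w e r)\<^sup>2) \<partial>lborel) + (\<integral>\<^sup>+r. ennreal (r powr (N-3) * (w e r)\<^sup>2) \<partial>lborel))"
    proof -
      have m1: "(\<lambda>r. ennreal (V r * r powr (N-1) * (w e r)\<^sup>2)) \<in> borel_measurable lborel"
        using measurable_compose[OF vm measurable_ennreal] by simp
      have m2: "(\<lambda>r. ennreal (r powr (N-3) * (w e r)\<^sup>2)) \<in> borel_measurable lborel" by measurable
      show ?thesis
        by (subst nn_integral_cmult[OF borel_measurable_add[OF m1 m2]]) (simp only: nn_integral_add[OF m1 m2])
    qed
    also have "\<dots> \<le> ennreal C * (ennreal ((norm (snd e))\<^sup>2) + ennreal (4 * (norm (fst e))\<^sup>2))"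
      unfolding V_energy[OF e] by (intro mult_left_mono add_left_mono profile_hardy[OF N]) simp
    also have "\<dots> = ennreal (C * ((norm (snd e))\<^sup>2 + 4 * (norm (fst e))\<^sup>2))"
      using C(1) by (subst ennreal_mult, simp, simp, subst ennreal_plus) auto
    also have "\<dots> \<le> ennreal ((5 * C) * (norm e)\<^sup>2)"
    proof (rule ennreal_leI)
      have "(norm (snd e))\<^sup>2 \<le> (norm e)\<^sup>2" "(norm (fst e))\<^sup>2 \<le> (norm e)\<^sup>2"
        by (intro power_mono norm_components_le norm_ge_zero)+
      then have "(norm (snd e))\<^sup>2 + 4 * (norm (fst e))\<^sup>2 \<le> 5 * (norm e)\<^sup>2" by linarith
      then have "C * ((norm (snd e))\<^sup>2 + 4 * (norm (fst e))\<^sup>2) \<le> C * (5 * (norm e)\<^sup>2)"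
        using C(1) by (rule mult_left_mono)
      then show "C * ((norm (snd e))\<^sup>2 + 4 * (norm (fst e))\<^sup>2) \<le> (5 * C) * (norm e)\<^sup>2" by simp
    qed
    finally show ?thesis .
  qed
  then show ?thesis using C(1) by (intro exI[of _ "5 * C"]) auto
qed

text \<open>The averaging interval [r, 2r] must lie on one side of the radius 1, where the weight is
  a pure power. This leaves out [1/2, 1), where the available decay rates differ by a bounded factor
  and \<open>profile_bound\<close> suffices.\<close>

lemma pt_bound: "\<exists>C\<ge>0. \<forall>e\<in>E. \<forall>r>0. \<bar>w e r\<bar> \<le> C * pt r * norm e"
proof -
  obtain C where C: "C \<ge> 0" "\<And>e. e \<in> E \<Longrightarrow> (\<integral>\<^sup>+r. ennreal (wt r * (w e r)\<^sup>2) \<partial>lborel) \<le> ennreal (C * (norm e)\<^sup>2)"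
    using weighted_energy by blast
  define c0 where "c0 = min 1 (2 powr (al0 + (N-1)))"
  define c1 where "c1 = min 1 (2 powr (al1 + (N-1)))"
  define D where "D = (2 * C + 2) / min c0 c1"
  \<comment> \<open>Bounds r^y on [1/2, 1) for the exponent y by which the rate of
    \<open>profile_bound\<close> differs from that of \<open>pt\<close>, whatever its sign.\<close>
  define D2 where "D2 = 2 powr \<bar>(2*N-2+al0)/4 - (N-2)/2\<bar>"
  have cp: "c0 > 0" "c1 > 0" by (auto simp: c0_def c1_def)
  have D: "D \<ge> 0" using cp C by (simp add: D_def)
  have power_case: "\<bar>w e r\<bar> \<le> sqrt D * r powr (-(2*N-2+\<alpha>)/4) * norm e"
    if e: "e \<in> E" and r: "r > 0" and \<alpha>: "\<alpha> = al0 \<and> r < 1/2 \<or> \<alpha> = al1 \<and> r \<ge> 1" for e r \<alpha>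
  proof -
    \<comment> \<open>The averaging length is at most r because al0 <= -2 below radius 1 and al1 >=
      -2 above it: a second use of cutting the exponents at -2.\<close>
    have l: "r powr (-\<alpha>/2) \<le> r"
    proof -
      have "r powr (-\<alpha>/2) \<le> r powr 1"
      proof (cases "r < 1")
        case True
        then show ?thesis using \<alpha> r by (intro powr_mono') (auto simp: al0_def)
      next
        case False
        then show ?thesis using \<alpha> r by (intro powr_mono) (auto simp: al1_def)
      qed
      then show ?thesis using r by simp
    qed
    have "(\<integral>\<^sup>+s. ennreal (s powr (\<alpha> + (N-1)) * (profile N (fst e) s)\<^sup>2) * indicator {r..2*r} s \<partial>lborel)
        \<le> (\<integral>\<^sup>+r. ennreal (wt r * (w e r)\<^sup>2) \<partial>lborel)"
    proof (rule nn_integral_mono)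
      fix s
      show "ennreal (s powr (\<alpha> + (N-1)) * (profile N (fst e) s)\<^sup>2) * indicator {r..2*r} s \<le> ennreal (wt s * (w e s)\<^sup>2)"
      proof (cases "s \<in> {r..2*r}")
        case True
        then have "wt s = s powr (\<alpha> + (N-1))"
          using \<alpha> r by (auto simp: wt_def powr_add mult.commute)
        then show ?thesis by (simp add: indicator_def)
      qed simp
    qed
    also have "\<dots> \<le> ennreal (C * (norm e)\<^sup>2)" by (rule C(2)[OF e])
    finally have le: "(\<integral>\<^sup>+s. ennreal (s powr (\<alpha> + (N-1)) * (profile N (fst e) s)\<^sup>2) * indicator {r..2*r} s \<partial>lborel) \<le> ennreal (C * (norm e)\<^sup>2)" .
    have B: "0 \<le> C * (norm e)\<^sup>2" using C by simp
    have "min c0 c1 * (r powr (N - 1 + \<alpha>/2) * (w e r)\<^sup>2) \<le> min 1 (2 powr (\<alpha> + (N-1))) * (r powr (N - 1 + \<alpha>/2) * (w e r)\<^sup>2)"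
      using \<alpha> by (intro mult_right_mono) (auto simp: c0_def c1_def)
    also have "\<dots> \<le> 2 * (C * (norm e)\<^sup>2) + 2 * (norm (fst e))\<^sup>2"
      by (rule profile_pointwise[OF N r l B le])
    also have "\<dots> \<le> (2 * C + 2) * (norm e)\<^sup>2"
      using power_mono[OF norm_components_le(1) norm_ge_zero, of e 2] by (simp add: algebra_simps)
    finally have "r powr (N - 1 + \<alpha>/2) * (w e r)\<^sup>2 \<le> D * (norm e)\<^sup>2"
      using cp by (simp add: D_def field_simps)
    then have "r powr (-(N - 1 + \<alpha>/2)) * (r powr (N - 1 + \<alpha>/2) * (w e r)\<^sup>2) \<le> r powr (-(N - 1 + \<alpha>/2)) * (D * (norm e)\<^sup>2)"
      by (intro mult_left_mono) auto
    then have "(w e r)\<^sup>2 \<le> r powr (-(N - 1 + \<alpha>/2)) * (D * (norm e)\<^sup>2)"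
      unfolding mult.assoc[symmetric] powr_add[symmetric] using r by simp
    also have "r powr (-(N - 1 + \<alpha>/2)) = (r powr (-(2*N-2+\<alpha>)/4))\<^sup>2"
      unfolding power2_eq_square powr_add[symmetric] by (rule arg_cong[where f = "(powr) r"]) (simp add: field_simps)
    also have "(r powr (-(2*N-2+\<alpha>)/4))\<^sup>2 * (D * (norm e)\<^sup>2) = (sqrt D * r powr (-(2*N-2+\<alpha>)/4) * norm e)\<^sup>2"
      using D by (simp add: power_mult_distrib)
    finally have "\<bar>w e r\<bar>\<^sup>2 \<le> (sqrt D * r powr (-(2*N-2+\<alpha>)/4) * norm e)\<^sup>2" by simp
    then show ?thesis by (rule power2_le_imp_le) (use D in simp)
  qed
  have mid_case: "\<bar>w e r\<bar> \<le> D2 * r powr (-(2*N-2+al0)/4) * norm e" if r: "1/2 \<le> r" "r < 1" for e r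
  proof -
    define y where "y = (2*N-2+al0)/4 - (N-2)/2"
    have "r powr y \<le> D2"
    proof (cases "y \<ge> 0")
      case True
      have "r powr y \<le> 1 powr y" using r True by (intro powr_mono2) auto
      also have "\<dots> \<le> 2 powr \<bar>y\<bar>" by (simp add: ge_one_powr_ge_zero)
      finally show ?thesis by (simp add: D2_def y_def)
    next
      case False
      have "r powr y \<le> (1/2) powr y" using r False by (intro powr_mono2') auto
      also have "\<dots> = 2 powr \<bar>y\<bar>" using False by (simp add: powr_divide powr_minus divide_simps)
      finally show ?thesis by (simp add: D2_def y_def)
    qed
    have "\<bar>w e r\<bar> \<le> r powr (-(N-2)/2) * norm (fst e)" using r by (intro profile_bound[OF N]) auto
    also have "\<dots> \<le> r powr (-(N-2)/2) * norm e" by (intro mult_left_mono norm_components_le) auto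
    also have "r powr (-(N-2)/2) = r powr y * r powr (-(2*N-2+al0)/4)"
      unfolding powr_add[symmetric] by (rule arg_cong[where f = "(powr) r"]) (simp add: y_def field_simps)
    also have "\<dots> * norm e \<le> D2 * r powr (-(2*N-2+al0)/4) * norm e"
      using \<open>r powr y \<le> D2\<close> by (intro mult_right_mono) auto
    finally show ?thesis .
  qed
  have "\<bar>w e r\<bar> \<le> (sqrt D + D2) * pt r * norm e" if e: "e \<in> E" and r: "r > 0" for e r
  proof -
    have D2: "D2 \<ge> 0" by (simp add: D2_def)
    have p: "pt r \<ge> 0" by (simp add: pt_def)
    have "\<bar>w e r\<bar> \<le> sqrt D * pt r * norm e \<or> \<bar>w e r\<bar> \<le> D2 * pt r * norm e"
      using power_case[OF e r, of al0] power_case[OF e r, of al1] mid_case[of r e] unfolding pt_def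
      by (cases "r < 1/2"; cases "r < 1") auto
    moreover have "sqrt D * pt r * norm e \<le> (sqrt D + D2) * pt r * norm e" "D2 * pt r * norm e \<le> (sqrt D + D2) * pt r * norm e"
      using D D2 p by (auto intro!: mult_right_mono)
    ultimately show ?thesis by linarith
  qed
  moreover have "sqrt D + D2 \<ge> 0" using D by (simp add: D2_def)
  ultimately show ?thesis by blast
qed

end

section \<open>The variational problem\<close>

text \<open>For t < 0 the interval {0..t} is empty and \<open>Fprim f t\<close> is 0; as f vanishes
  there, this still is the primitive. Moving the base point to some c < t reduces the claim to the
  fundamental theorem on an ordinary interval.\<close>

lemma Fprim_DERIV:
  assumes f: "continuous_on UNIV f" "\<And>t. t \<le> 0 \<Longrightarrow> f t = 0"
  shows "(Fprim f has_real_derivative f t) (at t)"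
proof -
  define c where "c = - \<bar>t\<bar> - 1"
  define d where "d = \<bar>t\<bar> + 1"
  have fc: "continuous_on A f" for A using f(1) continuous_on_subset by blast
  have eq: "Fprim f x = integral {c..x} f" if x: "x \<in> {c..d}" for x
  proof (cases "x \<ge> 0")
    case True
    have "integral {c..0} f + integral {0..x} f = integral {c..x} f"
      by (intro Henstock_Kurzweil_Integration.integral_combine integrable_continuous_interval fc) (use True in \<open>auto simp: c_def\<close>)
    moreover have "integral {c..0} f = integral {c..0} (\<lambda>_. 0)"
      by (rule integral_cong) (use f in auto)
    ultimately show ?thesis by (simp add: Fprim_def)
  next
    case False
    then have "integral {c..x} f = integral {c..x} (\<lambda>_. 0)" by (intro integral_cong) (use f in auto)
    then show ?thesis using False by (simp add: Fprim_def)
  qed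
  have t: "t \<in> {c<..<d}" "t \<in> {c..d}" by (auto simp: c_def d_def)
  have "((\<lambda>x. integral {c..x} f) has_real_derivative f t) (at t within {c..d})"
    by (rule integral_has_real_derivative[OF fc t(2)])
  then have "((\<lambda>x. integral {c..x} f) has_real_derivative f t) (at t within {c<..<d})"
    by (rule DERIV_subset) auto
  then have "((\<lambda>x. integral {c..x} f) has_real_derivative f t) (at t)"
    using t(1) by (simp add: at_within_open[OF t(1)])
  then show ?thesis
    by (rule has_field_derivative_transform_within_open[where S = "{c<..<d}"]) (use t eq in auto)
qed

lemma sqint_abs: "sqint f \<Longrightarrow> sqint (\<lambda>t. \<bar>f t\<bar>)"
  by (auto simp: sqint_def)

lemma norm_mk_abs: "sqint f \<Longrightarrow> norm (mk (\<lambda>t. \<bar>f t\<bar>)) = norm (mk f)"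
  by (rule power2_eq_imp_eq) (simp_all add: norm_mk_sq sqint_abs)

lemma sqint_cauchy_schwarz:
  assumes "sqint f" "sqint g"
  shows "integrable lborel (\<lambda>t. \<bar>f t\<bar> * \<bar>g t\<bar>)" "(\<integral>t. \<bar>f t\<bar> * \<bar>g t\<bar> \<partial>lborel) \<le> norm (mk f) * norm (mk g)"
proof -
  show "integrable lborel (\<lambda>t. \<bar>f t\<bar> * \<bar>g t\<bar>)"
    by (intro sqint_mult_integrable sqint_abs assms)
  have "mk (\<lambda>t. \<bar>f t\<bar>) \<bullet> mk (\<lambda>t. \<bar>g t\<bar>) = (\<integral>t. \<bar>f t\<bar> * \<bar>g t\<bar> \<partial>lborel)"
    by (intro inner_mk sqint_abs assms)
  then show "(\<integral>t. \<bar>f t\<bar> * \<bar>g t\<bar> \<partial>lborel) \<le> norm (mk f) * norm (mk g)"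
    using norm_cauchy_schwarz[of "mk (\<lambda>t. \<bar>f t\<bar>)" "mk (\<lambda>t. \<bar>g t\<bar>)"] assms by (simp add: norm_mk_abs)
qed

text \<open>The constant \<open>c0\<close> is \<open>0\<close> under (f4); under (f6) it absorbs the failure of the
  Ambrosetti-Rabinowitz condition on \<open>[0, t0]\<close>, at the price of the integrability of \<open>K\<close>.\<close>

locale radial_problem = radial_weights +
  fixes f :: "real \<Rightarrow> real" and q1 q2 Cf \<theta> c0 c1 t1 :: real
  assumes f_cont: "continuous_on UNIV f" and f_nonpos: "\<And>t. t \<le> 0 \<Longrightarrow> f t = 0"
    and q: "q1 > 2" "q2 > 2"
    and f_growth: "\<And>t. t > 0 \<Longrightarrow> \<bar>f t\<bar> \<le> Cf * min (t powr (q1-1)) (t powr (q2-1))" and Cf: "Cf \<ge> 0"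
    and eps0: "b0 - al0 - (q1-2) * (2*N-2+al0)/4 > 0"
    and eps1: "al1 - b + (q2-2) * (2*N-2+al1)/4 > 0"
    and AR: "\<theta> > 2" "\<And>t. \<theta> * Fprim f t \<le> f t * t + c0" "\<And>t. Fprim f t \<ge> - c0"
    and c0: "c0 \<ge> 0" "integrable lborel (\<lambda>r. c0 * (if r > 0 then K r * r powr (N-1) else 0))"
    and F_growth: "c1 > 0" "t1 > 0" "\<And>t. t \<ge> t1 \<Longrightarrow> Fprim f t \<ge> c1 * t powr \<theta>"
begin

definition "kk r = (if r > 0 then K r * r powr (N-1) else 0)"
text \<open>What is left of r^b0 pt(r)^(q1-2) after division by the effective potential r^al0, and
  its counterpart for r >= 1. The conditions \<open>eps0\<close> and \<open>eps1\<close> make it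
  tend to 0 at both ends.\<close>

definition "decay r = (if r < 1 then r powr (b0 - al0 - (q1-2) * (2*N-2+al0)/4)
                        else r powr (- (al1 - b + (q2-2) * (2*N-2+al1)/4)))"
text \<open>The factor M^(q-2) gained from a norm bound, with both exponents at once. It vanishes as
  M -> 0 because q1 and q2 exceed 2, which gives the mountain pass geometry near 0.\<close>

definition "grow M = M powr (q1-2) + M powr (q2-2)"

lemma kk_nonneg: "kk r \<ge> 0" using K_pos[of r] by (auto simp: kk_def)

lemma kk_meas [measurable]: "kk \<in> borel_measurable borel"
  unfolding kk_def by (intro measurable_positive_part continuous_intros K_cont) auto

lemma wt_nonneg: "wt r \<ge> 0" by (simp add: wt_def)
lemma pt_nonneg: "pt r \<ge> 0" by (simp add: pt_def)
lemma grow_nonneg: "grow M \<ge> 0" by (simp add: grow_def)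
lemma decay_nonneg: "decay r \<ge> 0" by (simp add: decay_def)

lemma decay_le_1: "r > 0 \<Longrightarrow> decay r \<le> 1"
proof (cases "r < 1")
  case True
  assume "r > 0"
  then have "r powr (b0 - al0 - (q1-2) * (2*N-2+al0)/4) \<le> 1 powr (b0 - al0 - (q1-2) * (2*N-2+al0)/4)"
    using True eps0 by (intro powr_mono2) auto
  then show ?thesis using True by (simp add: decay_def)
next
  case False
  then have "r powr (- (al1 - b + (q2-2) * (2*N-2+al1)/4)) \<le> r powr 0"
    using eps1 by (intro powr_mono) auto
  then show ?thesis using False by (simp add: decay_def)
qed

lemma decay_small:
  assumes d: "d > 0"
  shows "\<exists>A B. 0 < A \<and> A < B \<and> (\<forall>r>0. r < A \<or> r > B \<longrightarrow> decay r \<le> d)"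
proof -
  define p where "p = b0 - al0 - (q1-2) * (2*N-2+al0)/4"
  define s where "s = al1 - b + (q2-2) * (2*N-2+al1)/4"
  have ps: "p > 0" "s > 0" using eps0 eps1 by (auto simp: p_def s_def)
  define A where "A = min (1/2) (d powr (1/p))"
  define B where "B = max 1 (d powr (- 1/s))"
  have A: "A > 0" "A < 1" "A \<le> d powr (1/p)" using d by (auto simp: A_def)
  have B: "B \<ge> 1" "B \<ge> d powr (-1/s)" by (auto simp: B_def)
  have "decay r \<le> d" if r: "r > 0" "r < A \<or> r > B" for r
  proof (cases "r < A")
    case True
    then have "r powr p \<le> (d powr (1/p)) powr p" using r A ps by (intro powr_mono2) auto
    also have "\<dots> = d" using d ps by (simp add: powr_powr)
    finally show ?thesis using True A by (simp add: decay_def p_def)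
  next
    case False
    then have rB: "r > B" using r by simp
    have "r powr (-s) \<le> (d powr (-1/s)) powr (-s)" using rB B ps d by (intro powr_mono2') auto
    also have "\<dots> = d" using d ps by (simp add: powr_powr)
    finally show ?thesis using rB B by (simp add: decay_def s_def)
  qed
  then show ?thesis using A B by (intro exI[of _ A] exI[of _ B]) auto
qed

definition "CK = (SOME C. C \<ge> 0 \<and> (\<forall>r>0. K r \<le> C * (if r < 1 then r powr b0 else r powr b)))"
definition "CP = (SOME C. C \<ge> 0 \<and> (\<forall>e\<in>E. \<forall>r>0. \<bar>w e r\<bar> \<le> C * pt r * norm e))"
definition "CW = (SOME C. C \<ge> 0 \<and> (\<forall>e\<in>E. (\<integral>\<^sup>+r. ennreal (wt r * (w e r)\<^sup>2) \<partial>lborel) \<le> ennreal (C * (norm e)\<^sup>2)))"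

lemma CK: "CK \<ge> 0" "r > 0 \<Longrightarrow> K r \<le> CK * (if r < 1 then r powr b0 else r powr b)"
  using someI_ex[OF K_bound[unfolded Bex_def]] unfolding CK_def by auto

lemma CP: "CP \<ge> 0" "e \<in> E \<Longrightarrow> r > 0 \<Longrightarrow> \<bar>w e r\<bar> \<le> CP * pt r * norm e"
  using someI_ex[OF pt_bound[unfolded Bex_def]] unfolding CP_def by auto

lemma CW: "CW \<ge> 0" "e \<in> E \<Longrightarrow> (\<integral>\<^sup>+r. ennreal (wt r * (w e r)\<^sup>2) \<partial>lborel) \<le> ennreal (CW * (norm e)\<^sup>2)"
  using someI_ex[OF weighted_energy[unfolded Bex_def]] unfolding CW_def by auto

text \<open>One factor t is kept and the remaining t^(q-2) is estimated by the pointwise bound,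
  which turns the weight K r^(N-1) into \<open>decay r * wt r\<close>. The minimum in the growth
  condition allows q1 for r < 1 and q2 for r >= 1.\<close>

lemma kk_growth:
  assumes r: "r > 0" and t: "0 \<le> t" "t \<le> pt r * M" and M: "M \<ge> 0"
  shows "kk r * min (t powr (q1-1)) (t powr (q2-1)) \<le> CK * decay r * grow M * (wt r * t)"
proof (cases "t = 0")
  case True
  then show ?thesis by simp
next
  case False
  then have tp: "t > 0" using t by simp
  have split: "t powr (p-1) \<le> pt r powr (p-2) * M powr (p-2) * t" if "p > 2" for p
  proof -
    have "t powr (p-1) = t powr (p-2) * t powr 1" unfolding powr_add[symmetric] by simp
    also have "\<dots> = t powr (p-2) * t" using tp by simp
    also have "t powr (p-2) \<le> (pt r * M) powr (p-2)" using t that by (intro powr_mono2) auto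
    also have "(pt r * M) powr (p-2) = pt r powr (p-2) * M powr (p-2)" using pt_nonneg M by (simp add: powr_mult)
    finally show ?thesis using tp by simp
  qed
  show ?thesis
  proof (cases "r < 1")
    case True
    have "kk r * min (t powr (q1-1)) (t powr (q2-1)) \<le> (CK * r powr b0 * r powr (N-1)) * (pt r powr (q1-2) * M powr (q1-2) * t)"
      using CK(2)[of r] CK(1) True r split[OF q(1)] by (intro mult_mono) (auto simp: kk_def min_le_iff_disj)
    also have "\<dots> = CK * (r powr b0 * pt r powr (q1-2)) * M powr (q1-2) * (r powr (N-1) * t)"
      by simp
    also have "r powr b0 * pt r powr (q1-2) = decay r * r powr al0"
    proof -
      have "r powr b0 * pt r powr (q1-2) = r powr (b0 + (-(2*N-2+al0)/4) * (q1-2))"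
        using True r by (simp add: pt_def powr_powr powr_add)
      also have "b0 + (-(2*N-2+al0)/4) * (q1-2) = (b0 - al0 - (q1-2) * (2*N-2+al0)/4) + al0"
        by (simp add: field_simps)
      also have "r powr \<dots> = decay r * r powr al0" unfolding powr_add using True by (simp add: decay_def)
      finally show ?thesis .
    qed
    also have "CK * (decay r * r powr al0) * M powr (q1-2) * (r powr (N-1) * t)
        = CK * decay r * M powr (q1-2) * (wt r * t)" using True by (simp add: wt_def)
    also have "\<dots> \<le> CK * decay r * grow M * (wt r * t)"
      using CK(1) tp by (intro mult_right_mono mult_left_mono) (auto simp: grow_def decay_nonneg wt_nonneg)
    finally show ?thesis .
  next
    case False
    have "kk r * min (t powr (q1-1)) (t powr (q2-1)) \<le> (CK * r powr b * r powr (N-1)) * (pt r powr (q2-2) * M powr (q2-2) * t)"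
      using CK(2)[of r] CK(1) False r split[OF q(2)] by (intro mult_mono) (auto simp: kk_def min_le_iff_disj)
    also have "\<dots> = CK * (r powr b * pt r powr (q2-2)) * M powr (q2-2) * (r powr (N-1) * t)"
      by simp
    also have "r powr b * pt r powr (q2-2) = decay r * r powr al1"
    proof -
      have "r powr b * pt r powr (q2-2) = r powr (b + (-(2*N-2+al1)/4) * (q2-2))"
        using False r by (simp add: pt_def powr_powr powr_add)
      also have "b + (-(2*N-2+al1)/4) * (q2-2) = - (al1 - b + (q2-2) * (2*N-2+al1)/4) + al1"
        by (simp add: field_simps)
      also have "r powr \<dots> = decay r * r powr al1" unfolding powr_add using False by (simp add: decay_def)
      finally show ?thesis .
    qed
    also have "CK * (decay r * r powr al1) * M powr (q2-2) * (r powr (N-1) * t)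
        = CK * decay r * M powr (q2-2) * (wt r * t)" using False by (simp add: wt_def)
    also have "\<dots> \<le> CK * decay r * grow M * (wt r * t)"
      using CK(1) tp by (intro mult_right_mono mult_left_mono) (auto simp: grow_def decay_nonneg wt_nonneg)
    finally show ?thesis .
  qed
qed

lemma f_meas [measurable]: "f \<in> borel_measurable borel"
  using borel_measurable_continuous_onI[OF f_cont] .

lemma F_DERIV: "(Fprim f has_real_derivative f t) (at t)"
  by (rule Fprim_DERIV[OF f_cont f_nonpos])

lemma F_meas [measurable]: "Fprim f \<in> borel_measurable borel"
  by (rule borel_measurable_continuous_onI) (use F_DERIV in \<open>auto intro!: continuous_at_imp_continuous_on DERIV_isCont\<close>)

lemma F_nonpos: "t \<le> 0 \<Longrightarrow> Fprim f t = 0"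
  unfolding Fprim_def by (cases "t = 0") auto

lemma F_bound: "\<bar>Fprim f t\<bar> \<le> Cf * min (\<bar>t\<bar> powr (q1-1)) (\<bar>t\<bar> powr (q2-1)) * \<bar>t\<bar>"
proof (cases "t > 0")
  case True
  obtain s where s: "0 < s" "s < t" "Fprim f t - Fprim f 0 = (t - 0) * f s"
    using MVT2[OF True, of "Fprim f" f] F_DERIV by auto
  have "\<bar>f s\<bar> \<le> Cf * min (s powr (q1-1)) (s powr (q2-1))" by (rule f_growth[OF s(1)])
  also have "\<dots> \<le> Cf * min (t powr (q1-1)) (t powr (q2-1))"
    using s q by (intro mult_left_mono[OF _ Cf] min.mono powr_mono2) auto
  finally have "t * \<bar>f s\<bar> \<le> t * (Cf * min (t powr (q1-1)) (t powr (q2-1)))" using True by (intro mult_left_mono) auto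
  then show ?thesis using s(3) True F_nonpos[of 0] by (simp add: abs_mult mult.commute)
next
  case False
  have "0 \<le> Cf * min (\<bar>t\<bar> powr (q1-1)) (\<bar>t\<bar> powr (q2-1)) * \<bar>t\<bar>"
    using Cf by (intro mult_nonneg_nonneg) auto
  then show ?thesis using F_nonpos[of t] False by simp
qed

lemma f_bound: "\<bar>f t\<bar> \<le> Cf * min (\<bar>t\<bar> powr (q1-1)) (\<bar>t\<bar> powr (q2-1))"
  using f_growth[of t] f_nonpos[of t] Cf by (cases "t > 0") auto

lemma kk_bound:
  assumes e: "e \<in> E" and M: "CP * norm e \<le> M"
  shows "kk r * (Cf * min (\<bar>w e r\<bar> powr (q1-1)) (\<bar>w e r\<bar> powr (q2-1))) \<le> Cf * CK * decay r * grow M * (wt r * \<bar>w e r\<bar>)"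
proof (cases "r > 0")
  case True
  have "\<bar>w e r\<bar> \<le> pt r * (CP * norm e)" using CP(2)[OF e True] by (simp add: ac_simps)
  also have "\<dots> \<le> pt r * M" by (intro mult_left_mono M pt_nonneg)
  finally have "kk r * min (\<bar>w e r\<bar> powr (q1-1)) (\<bar>w e r\<bar> powr (q2-1)) \<le> CK * decay r * grow M * (wt r * \<bar>w e r\<bar>)"
    by (intro kk_growth[OF True]) (use M CP(1) order_trans[OF mult_nonneg_nonneg[OF CP(1) norm_ge_zero] M] in auto)
  then have "Cf * (kk r * min (\<bar>w e r\<bar> powr (q1-1)) (\<bar>w e r\<bar> powr (q2-1))) \<le> Cf * (CK * decay r * grow M * (wt r * \<bar>w e r\<bar>))"
    by (rule mult_left_mono[OF _ Cf])
  then show ?thesis by (simp add: ac_simps)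
qed (simp add: kk_def w_nonpos)

lemma kk_f_bound:
  assumes e: "e \<in> E" and M: "CP * norm e \<le> M"
  shows "kk r * \<bar>f (w e r)\<bar> \<le> Cf * CK * decay r * grow M * (wt r * \<bar>w e r\<bar>)"
  by (rule order_trans[OF mult_left_mono[OF f_bound kk_nonneg] kk_bound[OF assms]])

lemma kk_f_bound1:
  assumes e: "e \<in> E" and M: "CP * norm e \<le> M"
  shows "kk r * \<bar>f (w e r)\<bar> \<le> Cf * CK * grow M * (wt r * \<bar>w e r\<bar>)"
proof (cases "r > 0")
  case True
  have "Cf * CK * decay r * grow M * (wt r * \<bar>w e r\<bar>) \<le> Cf * CK * 1 * grow M * (wt r * \<bar>w e r\<bar>)"
    using decay_le_1[OF True] CK(1) Cf by (intro mult_right_mono mult_left_mono) (auto simp: grow_nonneg wt_nonneg)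
  then show ?thesis using kk_f_bound[OF assms, of r] by simp
qed (simp add: kk_def w_nonpos)

lemma kk_F_bound:
  assumes e: "e \<in> E" and M: "CP * norm e \<le> M"
  shows "kk r * \<bar>Fprim f (w e r)\<bar> \<le> Cf * CK * grow M * (wt r * (w e r)\<^sup>2)"
proof (cases "r > 0")
  case True
  have "kk r * \<bar>Fprim f (w e r)\<bar> \<le> kk r * (Cf * min (\<bar>w e r\<bar> powr (q1-1)) (\<bar>w e r\<bar> powr (q2-1))) * \<bar>w e r\<bar>"
    using mult_left_mono[OF F_bound[of "w e r"] kk_nonneg[of r]] by (simp add: ac_simps)
  also have "\<dots> \<le> Cf * CK * decay r * grow M * (wt r * \<bar>w e r\<bar>) * \<bar>w e r\<bar>"
    by (rule mult_right_mono[OF kk_bound[OF assms]]) simp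
  also have "\<dots> \<le> Cf * CK * 1 * grow M * (wt r * \<bar>w e r\<bar>) * \<bar>w e r\<bar>"
    using decay_le_1[OF True] CK(1) Cf by (intro mult_right_mono mult_left_mono) (auto simp: grow_nonneg wt_nonneg)
  finally show ?thesis by (simp add: power2_eq_square)
qed (simp add: kk_def w_nonpos)

lemma sqint_wt:
  assumes e: "e \<in> E"
  shows "sqint (\<lambda>r. sqrt (wt r) * w e r)" "norm (mk (\<lambda>r. sqrt (wt r) * w e r)) \<le> sqrt CW * norm e"
proof -
  have eq: "(sqrt (wt r) * w e r)\<^sup>2 = wt r * (w e r)\<^sup>2" for r using wt_nonneg[of r] by (simp add: power_mult_distrib)
  have m: "(\<lambda>r. sqrt (wt r) * w e r) \<in> borel_measurable borel" by measurable
  have le: "(\<integral>\<^sup>+r. ennreal ((sqrt (wt r) * w e r)\<^sup>2) \<partial>lborel) \<le> ennreal (CW * (norm e)\<^sup>2)"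
    unfolding eq by (rule CW(2)[OF e])
  have nn: "0 \<le> CW * (norm e)\<^sup>2" using CW(1) by simp
  show "sqint (\<lambda>r. sqrt (wt r) * w e r)" by (rule sqint_nn(1)[OF m le nn])
  have "(norm (mk (\<lambda>r. sqrt (wt r) * w e r)))\<^sup>2 \<le> (sqrt CW * norm e)\<^sup>2"
    using sqint_nn(2)[OF m le nn] CW(1) by (simp add: power_mult_distrib)
  then show "norm (mk (\<lambda>r. sqrt (wt r) * w e r)) \<le> sqrt CW * norm e"
    by (rule power2_le_imp_le) (use CW(1) in simp)
qed

lemma wt_pair:
  assumes e: "e \<in> E" and h: "h \<in> E"
  shows "integrable lborel (\<lambda>r. wt r * \<bar>w e r\<bar> * \<bar>w h r\<bar>)" "(\<integral>r. wt r * \<bar>w e r\<bar> * \<bar>w h r\<bar> \<partial>lborel) \<le> CW * norm e * norm h"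
proof -
  have eq: "(\<lambda>r. \<bar>sqrt (wt r) * w e r\<bar> * \<bar>sqrt (wt r) * w h r\<bar>) = (\<lambda>r. wt r * \<bar>w e r\<bar> * \<bar>w h r\<bar>)"
  proof
    fix r
    have "\<bar>sqrt (wt r) * w e r\<bar> * \<bar>sqrt (wt r) * w h r\<bar> = (sqrt (wt r) * sqrt (wt r)) * \<bar>w e r\<bar> * \<bar>w h r\<bar>"
      using wt_nonneg[of r] by (simp add: abs_mult)
    then show "\<bar>sqrt (wt r) * w e r\<bar> * \<bar>sqrt (wt r) * w h r\<bar> = wt r * \<bar>w e r\<bar> * \<bar>w h r\<bar>"
      using wt_nonneg[of r] by simp
  qed
  show "integrable lborel (\<lambda>r. wt r * \<bar>w e r\<bar> * \<bar>w h r\<bar>)"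
    using sqint_cauchy_schwarz(1)[OF sqint_wt(1)[OF e] sqint_wt(1)[OF h]] unfolding eq .
  have "(\<integral>r. wt r * \<bar>w e r\<bar> * \<bar>w h r\<bar> \<partial>lborel) \<le> norm (mk (\<lambda>r. sqrt (wt r) * w e r)) * norm (mk (\<lambda>r. sqrt (wt r) * w h r))"
    using sqint_cauchy_schwarz(2)[OF sqint_wt(1)[OF e] sqint_wt(1)[OF h]] unfolding eq .
  also have "\<dots> \<le> (sqrt CW * norm e) * (sqrt CW * norm h)"
    using CW(1) by (intro mult_mono sqint_wt(2) e h) auto
  also have "\<dots> = CW * norm e * norm h" using CW(1) by simp
  finally show "(\<integral>r. wt r * \<bar>w e r\<bar> * \<bar>w h r\<bar> \<partial>lborel) \<le> CW * norm e * norm h" .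
qed

lemma w_add: "w (e + h) r = w e r + w h r" by (simp add: profile_add)
lemma w_scale: "w (c *\<^sub>R e) r = c * w e r" by (simp add: profile_scale)
lemma E_lin: "e \<in> E \<Longrightarrow> h \<in> E \<Longrightarrow> e + t *\<^sub>R h \<in> E"
  using subspace_energy_space by (simp add: subspace_add subspace_scale)

lemma kk_f_integrable:
  assumes e: "e \<in> E" and h: "h \<in> E"
  shows "integrable lborel (\<lambda>r. kk r * f (w e r) * w h r)"
    "(\<integral>r. \<bar>kk r * f (w e r) * w h r\<bar> \<partial>lborel) \<le> Cf * CK * grow (CP * norm e) * (CW * norm e * norm h)"
proof -
  have bd: "\<bar>kk r * f (w e r) * w h r\<bar> \<le> Cf * CK * grow (CP * norm e) * (wt r * \<bar>w e r\<bar> * \<bar>w h r\<bar>)" for r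
    using mult_right_mono[OF kk_f_bound1[OF e order_refl, of r], of "\<bar>w h r\<bar>"] kk_nonneg[of r] by (simp add: abs_mult ac_simps)
  have i: "integrable lborel (\<lambda>r. Cf * CK * grow (CP * norm e) * (wt r * \<bar>w e r\<bar> * \<bar>w h r\<bar>))"
    by (intro integrable_mult_right wt_pair e h)
  show int: "integrable lborel (\<lambda>r. kk r * f (w e r) * w h r)"
    by (rule Bochner_Integration.integrable_bound[OF i]) (measurable, use bd in \<open>auto intro!: AE_I2 order_trans[OF _ abs_ge_self]\<close>)
  have "(\<integral>r. \<bar>kk r * f (w e r) * w h r\<bar> \<partial>lborel) \<le> (\<integral>r. Cf * CK * grow (CP * norm e) * (wt r * \<bar>w e r\<bar> * \<bar>w h r\<bar>) \<partial>lborel)"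
    by (intro integral_mono int i integrable_abs bd)
  also have "\<dots> \<le> Cf * CK * grow (CP * norm e) * (CW * norm e * norm h)"
    using Cf CK(1) by (simp add: mult_left_mono[OF wt_pair(2)[OF e h]] grow_nonneg)
  finally show "(\<integral>r. \<bar>kk r * f (w e r) * w h r\<bar> \<partial>lborel) \<le> Cf * CK * grow (CP * norm e) * (CW * norm e * norm h)" .
qed

lemma kk_F_integrable:
  assumes e: "e \<in> E"
  shows "integrable lborel (\<lambda>r. kk r * Fprim f (w e r))"
    "\<bar>\<integral>r. kk r * Fprim f (w e r) \<partial>lborel\<bar> \<le> Cf * CK * grow (CP * norm e) * (CW * (norm e)\<^sup>2)"
proof -
  have bd: "\<bar>kk r * Fprim f (w e r)\<bar> \<le> Cf * CK * grow (CP * norm e) * (wt r * \<bar>w e r\<bar> * \<bar>w e r\<bar>)" for r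
    using kk_F_bound[OF e order_refl, of r] kk_nonneg[of r] by (simp add: abs_mult power2_eq_square ac_simps)
  have i: "integrable lborel (\<lambda>r. Cf * CK * grow (CP * norm e) * (wt r * \<bar>w e r\<bar> * \<bar>w e r\<bar>))"
    by (intro integrable_mult_right wt_pair e)
  show int: "integrable lborel (\<lambda>r. kk r * Fprim f (w e r))"
    by (rule Bochner_Integration.integrable_bound[OF i]) (measurable, use bd in \<open>auto intro!: AE_I2 order_trans[OF _ abs_ge_self]\<close>)
  have "\<bar>\<integral>r. kk r * Fprim f (w e r) \<partial>lborel\<bar> \<le> (\<integral>r. \<bar>kk r * Fprim f (w e r)\<bar> \<partial>lborel)"
    by (rule integral_abs_bound)
  also have "\<dots> \<le> (\<integral>r. Cf * CK * grow (CP * norm e) * (wt r * \<bar>w e r\<bar> * \<bar>w e r\<bar>) \<partial>lborel)"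
    by (intro integral_mono int i integrable_abs bd)
  also have "\<dots> \<le> Cf * CK * grow (CP * norm e) * (CW * norm e * norm e)"
    using Cf CK(1) by (simp add: mult_left_mono[OF wt_pair(2)[OF e e]] grow_nonneg)
  finally show "\<bar>\<integral>r. kk r * Fprim f (w e r) \<partial>lborel\<bar> \<le> Cf * CK * grow (CP * norm e) * (CW * (norm e)\<^sup>2)"
    by (simp add: power2_eq_square ac_simps)
qed

end

section \<open>Differentiability of the nonlinear term and its gradient map\<close>

context radial_problem begin

definition "J e = (\<integral>r. kk r * Fprim f (w e r) \<partial>lborel)"
text \<open>The Riesz representative in \<open>E\<close> of the derivative of \<open>J\<close> at e,
  so that critical points of the energy are the fixed points of \<open>T\<close>.\<close>

definition "T e = (SOME z. z \<in> E \<and> (\<forall>h\<in>E. z \<bullet> h = (\<integral>r. kk r * f (w e r) * w h r \<partial>lborel)))"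

lemma E_subspace: "subspace E" by (rule subspace_energy_space)
lemma E_closed: "closed E" by (rule closed_energy_space[OF N V_cont])

lemma T:
  assumes e: "e \<in> E"
  shows "T e \<in> E" "h \<in> E \<Longrightarrow> T e \<bullet> h = (\<integral>r. kk r * f (w e r) * w h r \<partial>lborel)"
proof -
  have "\<exists>z\<in>E. \<forall>h\<in>E. z \<bullet> h = (\<integral>r. kk r * f (w e r) * w h r \<partial>lborel)"
  proof (rule riesz_subspace[OF E_subspace E_closed])
    fix x y assume x: "x \<in> E" and y: "y \<in> E"
    show "(\<integral>r. kk r * f (w e r) * w (x + y) r \<partial>lborel) = (\<integral>r. kk r * f (w e r) * w x r \<partial>lborel) + (\<integral>r. kk r * f (w e r) * w y r \<partial>lborel)"
      unfolding w_add distrib_left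
      by (rule Bochner_Integration.integral_add) (intro kk_f_integrable(1) e x y)+
  next
    fix c x
    have "(\<lambda>r. kk r * f (w e r) * w (c *\<^sub>R x) r) = (\<lambda>r. c * (kk r * f (w e r) * w x r))"
      unfolding w_scale by (simp add: ac_simps)
    then show "(\<integral>r. kk r * f (w e r) * w (c *\<^sub>R x) r \<partial>lborel) = c * (\<integral>r. kk r * f (w e r) * w x r \<partial>lborel)"
      by simp
  next
    fix x assume x: "x \<in> E"
    have "\<bar>\<integral>r. kk r * f (w e r) * w x r \<partial>lborel\<bar> \<le> (\<integral>r. \<bar>kk r * f (w e r) * w x r\<bar> \<partial>lborel)"
      by (rule integral_abs_bound)
    also note kk_f_integrable(2)[OF e x]
    finally show "\<bar>\<integral>r. kk r * f (w e r) * w x r \<partial>lborel\<bar> \<le> (Cf * CK * grow (CP * norm e) * (CW * norm e)) * norm x"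
      by (simp add: ac_simps)
  qed
  then have "\<exists>z. z \<in> E \<and> (\<forall>h\<in>E. z \<bullet> h = (\<integral>r. kk r * f (w e r) * w h r \<partial>lborel))" by blast
  from someI_ex[OF this]
  have "T e \<in> E \<and> (\<forall>h\<in>E. T e \<bullet> h = (\<integral>r. kk r * f (w e r) * w h r \<partial>lborel))"
    unfolding T_def .
  then show "T e \<in> E" "h \<in> E \<Longrightarrow> T e \<bullet> h = (\<integral>r. kk r * f (w e r) * w h r \<partial>lborel)" by auto
qed

lemma grow_mono: "0 \<le> M \<Longrightarrow> M \<le> M' \<Longrightarrow> grow M \<le> grow M'"
  unfolding grow_def using q by (intro add_mono powr_mono2) auto

text \<open>Dominated convergence along sequences of t in (-1, 1). By the mean value theorem the
  difference quotient involves f at u + \<tau> h with |\<tau>| <= 1, again an element of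
  \<open>E\<close>, of norm at most |u| + |h|, so that \<open>kk_f_bound1\<close> provides a
  majorant independent of t.\<close>

lemma J_deriv:
  assumes u: "u \<in> E" and h: "h \<in> E"
  shows "((\<lambda>t. J (u + t *\<^sub>R h)) has_real_derivative T u \<bullet> h) (at 0)"
proof -
  define D where "D t r = kk r * ((Fprim f (w (u + t *\<^sub>R h) r) - Fprim f (w u r)) / t)" for t r
  define M where "M = CP * (norm u + norm h)"
  have "((\<lambda>t. (J (u + t *\<^sub>R h) - J u) / t) \<longlongrightarrow> T u \<bullet> h) (at 0 within {-1<..<1})"
    unfolding tendsto_at_iff_sequentially
  proof (intro allI impI)
    fix X :: "nat \<Rightarrow> real" assume X: "\<forall>i. X i \<in> {-1<..<1} - {0}" "X \<longlonglongrightarrow> 0"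
    have Jq: "(J (u + X i *\<^sub>R h) - J u) / X i = (\<integral>r. D (X i) r \<partial>lborel)" for i
    proof -
      have "J (u + X i *\<^sub>R h) - J u = (\<integral>r. kk r * Fprim f (w (u + X i *\<^sub>R h) r) - kk r * Fprim f (w u r) \<partial>lborel)"
        unfolding J_def by (intro Bochner_Integration.integral_diff[symmetric] kk_F_integrable E_lin u h)
      then have "(J (u + X i *\<^sub>R h) - J u) / X i = (\<integral>r. kk r * Fprim f (w (u + X i *\<^sub>R h) r) - kk r * Fprim f (w u r) \<partial>lborel) / X i"
        by (rule arg_cong)
      also have "\<dots> = (\<integral>r. (kk r * Fprim f (w (u + X i *\<^sub>R h) r) - kk r * Fprim f (w u r)) / X i \<partial>lborel)"
        by (rule integral_divide_zero[symmetric])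
      also have "\<dots> = (\<integral>r. D (X i) r \<partial>lborel)"
        by (rule Bochner_Integration.integral_cong[OF refl])
          (simp only: D_def right_diff_distrib[symmetric] times_divide_eq_right)
      finally show ?thesis .
    qed
    have "(\<lambda>i. \<integral>r. D (X i) r \<partial>lborel) \<longlonglongrightarrow> (\<integral>r. kk r * f (w u r) * w h r \<partial>lborel)"
    proof (rule integral_dominated_convergence)
      show "(\<lambda>r. kk r * f (w u r) * w h r) \<in> borel_measurable lborel" by measurable
      show "D (X i) \<in> borel_measurable lborel" for i unfolding D_def by measurable
      show "integrable lborel (\<lambda>r. Cf * CK * grow M * (wt r * \<bar>w u r\<bar> * \<bar>w h r\<bar> + wt r * \<bar>w h r\<bar> * \<bar>w h r\<bar>))"
        by (intro integrable_mult_right Bochner_Integration.integrable_add wt_pair u h)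
      show "AE r in lborel. (\<lambda>i. D (X i) r) \<longlonglongrightarrow> kk r * f (w u r) * w h r"
      proof (rule AE_I2)
        fix r
        have "((\<lambda>t. Fprim f (w u r + t * w h r)) has_real_derivative f (w u r + 0 * w h r) * w h r) (at 0)"
          by (rule DERIV_chain'[OF _ F_DERIV]) (auto intro!: derivative_eq_intros)
        then have "((\<lambda>t. (Fprim f (w u r + t * w h r) - Fprim f (w u r)) / t) \<longlongrightarrow> f (w u r) * w h r) (at 0)"
          unfolding has_field_derivative_iff by simp
        then have "(\<lambda>i. (Fprim f (w u r + X i * w h r) - Fprim f (w u r)) / X i) \<longlonglongrightarrow> f (w u r) * w h r"
          unfolding tendsto_at_iff_sequentially comp_def using X by auto
        then show "(\<lambda>i. D (X i) r) \<longlonglongrightarrow> kk r * f (w u r) * w h r"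
          unfolding D_def w_add w_scale mult.assoc by (rule tendsto_mult_left)
      qed
      show "AE r in lborel. norm (D (X i) r) \<le> Cf * CK * grow M * (wt r * \<bar>w u r\<bar> * \<bar>w h r\<bar> + wt r * \<bar>w h r\<bar> * \<bar>w h r\<bar>)" for i
      proof (rule AE_I2)
        fix r
        have Xi: "X i \<noteq> 0" "\<bar>X i\<bar> < 1" using X(1)[rule_format, of i] by auto
        have "\<exists>\<tau>. \<bar>\<tau>\<bar> \<le> 1 \<and> (Fprim f (w u r + X i * w h r) - Fprim f (w u r)) / X i = f (w u r + \<tau> * w h r) * w h r"
        proof -
          have d: "((\<lambda>t. Fprim f (w u r + t * w h r)) has_real_derivative f (w u r + t * w h r) * w h r) (at t)" for t
            by (rule DERIV_chain'[OF _ F_DERIV]) (auto intro!: derivative_eq_intros)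
          show ?thesis
          proof (cases "X i > 0")
            case True
            from MVT2[OF True d]
            obtain z where "0 < z" "z < X i" "Fprim f (w u r + X i * w h r) - Fprim f (w u r + 0 * w h r) = (X i - 0) * (f (w u r + z * w h r) * w h r)" by blast
            then show ?thesis using Xi by (intro exI[of _ z]) auto
          next
            case False
            then have neg: "X i < 0" using Xi by simp
            from MVT2[OF neg d]
            obtain z where "X i < z" "z < 0" "Fprim f (w u r + 0 * w h r) - Fprim f (w u r + X i * w h r) = (0 - X i) * (f (w u r + z * w h r) * w h r)" by blast
            then show ?thesis using Xi by (intro exI[of _ z]) (auto simp: field_simps)
          qed
        qed
        then obtain \<tau> where \<tau>: "\<bar>\<tau>\<bar> \<le> 1" "(Fprim f (w u r + X i * w h r) - Fprim f (w u r)) / X i = f (w u r + \<tau> * w h r) * w h r"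
          by blast
        have nl: "norm (u + \<tau> *\<^sub>R h) \<le> norm u + norm h"
        proof -
          have "norm (u + \<tau> *\<^sub>R h) \<le> norm u + \<bar>\<tau>\<bar> * norm h" using norm_triangle_ineq[of u "\<tau> *\<^sub>R h"] by simp
          also have "\<bar>\<tau>\<bar> * norm h \<le> 1 * norm h" by (rule mult_right_mono[OF \<tau>(1)]) simp
          finally show ?thesis by simp
        qed
        have "kk r * \<bar>f (w (u + \<tau> *\<^sub>R h) r)\<bar> \<le> Cf * CK * grow M * (wt r * \<bar>w (u + \<tau> *\<^sub>R h) r\<bar>)"
          by (rule kk_f_bound1[OF E_lin[OF u h]]) (simp add: M_def mult_left_mono[OF nl CP(1)])
        also have "\<dots> \<le> Cf * CK * grow M * (wt r * (\<bar>w u r\<bar> + \<bar>w h r\<bar>))"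
        proof (intro mult_left_mono)
          have "\<bar>w (u + \<tau> *\<^sub>R h) r\<bar> \<le> \<bar>w u r\<bar> + \<bar>\<tau>\<bar> * \<bar>w h r\<bar>" unfolding w_add w_scale abs_mult[symmetric] by (rule abs_triangle_ineq)
          also have "\<bar>\<tau>\<bar> * \<bar>w h r\<bar> \<le> 1 * \<bar>w h r\<bar>" by (rule mult_right_mono[OF \<tau>(1)]) simp
          finally show "\<bar>w (u + \<tau> *\<^sub>R h) r\<bar> \<le> \<bar>w u r\<bar> + \<bar>w h r\<bar>" by simp
        qed (use Cf CK(1) in \<open>auto simp: grow_nonneg wt_nonneg\<close>)
        finally have "kk r * \<bar>f (w (u + \<tau> *\<^sub>R h) r)\<bar> * \<bar>w h r\<bar> \<le> Cf * CK * grow M * (wt r * (\<bar>w u r\<bar> + \<bar>w h r\<bar>)) * \<bar>w h r\<bar>"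
          by (rule mult_right_mono) simp
        moreover have "norm (D (X i) r) = kk r * \<bar>f (w (u + \<tau> *\<^sub>R h) r)\<bar> * \<bar>w h r\<bar>"
          using kk_nonneg[of r] \<tau>(2) unfolding D_def w_add w_scale by (simp add: abs_mult)
        ultimately show "norm (D (X i) r) \<le> Cf * CK * grow M * (wt r * \<bar>w u r\<bar> * \<bar>w h r\<bar> + wt r * \<bar>w h r\<bar> * \<bar>w h r\<bar>)"
          by (simp add: algebra_simps)
      qed
    qed
    then show "((\<lambda>t. (J (u + t *\<^sub>R h) - J u) / t) \<circ> X) \<longlonglongrightarrow> T u \<bullet> h"
      unfolding comp_def Jq T(2)[OF u h] .
  qed
  moreover have "at (0::real) within {-1<..<1} = at 0" by (rule at_within_open) auto
  ultimately have "((\<lambda>t. (J (u + t *\<^sub>R h) - J u) / t) \<longlongrightarrow> T u \<bullet> h) (at 0)"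
    by (simp only:)
  then show ?thesis unfolding has_field_derivative_iff by simp
qed

lemma powr_between:
  assumes "0 < A" "A \<le> r" "r \<le> (B::real)"
  shows "r powr p \<le> A powr p + B powr p"
proof (cases "p \<ge> 0")
  case True
  then have "r powr p \<le> B powr p" using assms by (intro powr_mono2) auto
  then show ?thesis using powr_ge_zero[of A p] by linarith
next
  case False
  then have "r powr p \<le> A powr p" using assms by (intro powr_mono2') auto
  then show ?thesis using powr_ge_zero[of B p] by linarith
qed

lemma wt_pt_bounded:
  assumes "0 < A"
  shows "\<exists>C\<ge>0. \<forall>r. A \<le> r \<longrightarrow> r \<le> B \<longrightarrow> wt r \<le> C \<and> pt r \<le> C"
proof -
  define p where "p = (\<lambda>s. A powr s + B powr s)"
  have p0: "p s \<ge> 0" for s by (simp add: p_def)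
  define C where "C = p (N-1) * (p al0 + p al1) + p (-(2*N-2+al0)/4) + p (-(2*N-2+al1)/4)"
  have "wt r \<le> C \<and> pt r \<le> C" if r: "A \<le> r" "r \<le> B" for r
  proof -
    have b: "r powr s \<le> p s" for s unfolding p_def by (rule powr_between[OF assms r])
    have "(if r < 1 then r powr al0 else r powr al1) \<le> p al0 + p al1"
      using b[of al0] b[of al1] p0[of al0] p0[of al1] by (smt (verit))
    then have "wt r \<le> p (N-1) * (p al0 + p al1)"
      unfolding wt_def using p0 by (intro mult_mono b) auto
    moreover have "pt r \<le> p (-(2*N-2+al0)/4) + p (-(2*N-2+al1)/4)"
      unfolding pt_def using b[of "-(2*N-2+al0)/4"] b[of "-(2*N-2+al1)/4"] p0[of "-(2*N-2+al0)/4"] p0[of "-(2*N-2+al1)/4"] by auto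
    moreover have "0 \<le> p (N-1) * (p al0 + p al1)" using p0 by simp
    ultimately show ?thesis unfolding C_def using p0[of "-(2*N-2+al0)/4"] p0[of "-(2*N-2+al1)/4"] by linarith
  qed
  moreover have "C \<ge> 0" unfolding C_def using p0 by simp
  ultimately show ?thesis by blast
qed

text \<open>Pointwise convergence suffices on a compact range of radii; on the rest the factor \<^term>\<open>decay\<close> is small.\<close>

lemma T_diff_tendsto:
  fixes u v :: "nat \<Rightarrow> l2 \<times> l2"
  assumes u: "\<And>n. u n \<in> E" "\<And>n. norm (u n) \<le> M" and v: "\<And>n. v n \<in> E" "\<And>n. norm (v n) \<le> M"
    and conv: "\<And>r. r > 0 \<Longrightarrow> (\<lambda>n. w (u n) r - w (v n) r) \<longlonglongrightarrow> 0"
  shows "(\<lambda>n. norm (T (u n) - T (v n))) \<longlonglongrightarrow> 0"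
proof (rule LIMSEQ_I)
  fix d :: real assume d: "d > 0"
  have M0: "M \<ge> 0" using u(2)[of 0] norm_ge_zero order_trans by blast
  define G where "G = Cf * CK * grow (CP * M)"
  have G0: "G \<ge> 0" using Cf CK(1) by (simp add: G_def grow_nonneg)
  \<comment> \<open>Small enough for the radii outside [A, B] to contribute less than half of d; the
    + 1 avoids division by 0.\<close>
  define d1 where "d1 = d / (4 * (G * CW * M + 1))"
  have GC: "G * CW * M + 1 > 0" using G0 CW(1) M0 by (simp add: add_nonneg_pos)
  have d1: "d1 > 0" using d GC by (simp add: d1_def)
  obtain A B where AB: "0 < A" "A < B" "\<And>r. r > 0 \<Longrightarrow> r < A \<or> r > B \<Longrightarrow> decay r \<le> d1"
    using decay_small[OF d1] by blast
  obtain C where C: "C \<ge> 0" "\<And>r. A \<le> r \<Longrightarrow> r \<le> B \<Longrightarrow> wt r \<le> C \<and> pt r \<le> C"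
    using wt_pt_bounded[OF AB(1)] by blast
  \<comment> \<open>The factor CP * pt r is the pointwise bound for the profile of a direction of
    norm 1. Using it in place of the direction makes the integrand independent of the latter, so one
    dominated convergence serves all directions.\<close>
  define s where "s n r = indicator {A..B} r * (kk r * \<bar>f (w (u n) r) - f (w (v n) r)\<bar> * (CP * pt r))" for n r
  have grow_le: "kk r * \<bar>f (w e r)\<bar> \<le> G * decay r * (wt r * \<bar>w e r\<bar>)" if "e \<in> E" "norm e \<le> M" for e r
    using kk_f_bound[OF that(1) mult_left_mono[OF that(2) CP(1)], of r] by (simp add: G_def ac_simps)
  have [measurable]: "pt \<in> borel_measurable borel" unfolding pt_def by measurable
  have s_meas: "s n \<in> borel_measurable borel" for n unfolding s_def by measurable
  have s_bound: "\<bar>s n r\<bar> \<le> indicator {A..B} r * (2 * (G * 1 * (C * (CP * C * M))) * (CP * C))" for n r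
  proof (cases "r \<in> {A..B}")
    case True
    then have r: "r > 0" using AB by auto
    have one: "kk r * \<bar>f (w e r)\<bar> \<le> G * 1 * (C * (CP * C * M))" if e: "e \<in> E" "norm e \<le> M" for e
    proof -
      have "\<bar>w e r\<bar> \<le> CP * pt r * norm e" by (rule CP(2)[OF e(1) r])
      also have "\<dots> \<le> CP * C * M" using C True CP(1) e(2) pt_nonneg by (intro mult_mono) auto
      finally have we: "\<bar>w e r\<bar> \<le> CP * C * M" .
      have "kk r * \<bar>f (w e r)\<bar> \<le> G * decay r * (wt r * \<bar>w e r\<bar>)" by (rule grow_le[OF e])
      also have "\<dots> \<le> G * 1 * (C * (CP * C * M))"
        using G0 decay_le_1[OF r] C True we by (intro mult_mono) (auto simp: decay_nonneg wt_nonneg)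
      finally show ?thesis .
    qed
    have "\<bar>s n r\<bar> = kk r * \<bar>f (w (u n) r) - f (w (v n) r)\<bar> * (CP * pt r)"
      using True kk_nonneg CP(1) pt_nonneg by (simp add: s_def abs_mult)
    also have "\<dots> \<le> (kk r * \<bar>f (w (u n) r)\<bar> + kk r * \<bar>f (w (v n) r)\<bar>) * (CP * pt r)"
      unfolding distrib_left[symmetric] using CP(1) pt_nonneg kk_nonneg by (intro mult_right_mono mult_left_mono abs_triangle_ineq4) auto
    also have "\<dots> \<le> (2 * (G * 1 * (C * (CP * C * M)))) * (CP * C)"
      using one[OF u(1)[of n] u(2)[of n]] one[OF v(1)[of n] v(2)[of n]] CP(1) C True pt_nonneg G0 M0
      by (intro mult_mono) auto
    finally show ?thesis using True by simp
  qed (simp add: s_def)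
  have bound_int: "integrable lborel (\<lambda>r. indicator {A..B} r * (2 * (G * 1 * (C * (CP * C * M))) * (CP * C)))"
    by (intro integrable_mult_left integrable_real_indicator) (auto simp: emeasure_lborel_Icc_eq)
  have s_int: "integrable lborel (s n)" for n
  proof (rule Bochner_Integration.integrable_bound[OF bound_int])
    show "AE r in lborel. norm (s n r) \<le> norm (indicator {A..B} r * (2 * (G * 1 * (C * (CP * C * M))) * (CP * C)))"
      using order_trans[OF s_bound abs_ge_self] by (intro AE_I2) (simp only: real_norm_def)
  qed (use s_meas in simp)
  have "(\<lambda>n. \<integral>r. s n r \<partial>lborel) \<longlonglongrightarrow> (\<integral>r. (0::real) \<partial>(lborel :: real measure))"
  proof (rule integral_dominated_convergence[OF _ _ bound_int])
    show "AE r in lborel. (\<lambda>n. s n r) \<longlonglongrightarrow> 0"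
    proof (rule AE_I2)
      fix r
      show "(\<lambda>n. s n r) \<longlonglongrightarrow> 0"
      proof (cases "r \<in> {A..B}")
        case True
        then have r: "r > 0" using AB by auto
        define R where "R = CP * pt r * M"
        have wR: "w e r \<in> {-R..R}" if "e \<in> E" "norm e \<le> M" for e
        proof -
          have "\<bar>w e r\<bar> \<le> CP * pt r * norm e" by (rule CP(2)[OF that(1) r])
          also have "\<dots> \<le> R" unfolding R_def using that CP(1) pt_nonneg by (intro mult_left_mono) auto
          finally show ?thesis by auto
        qed
        \<comment> \<open>Neither w (u n) r nor w (v n) r has to converge; only their difference
          tends to 0, so f is used through uniform continuity on a bounded interval.\<close>
        have uc: "uniformly_continuous_on {-R..R} f"
          by (intro compact_uniformly_continuous continuous_on_subset[OF f_cont]) auto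
        have "(\<lambda>n. dist (f (w (u n) r)) (f (w (v n) r))) \<longlonglongrightarrow> 0"
        proof (rule LIMSEQ_I)
          fix x :: real assume "x > 0"
          then obtain y where y: "y > 0" "\<And>p q. p \<in> {-R..R} \<Longrightarrow> q \<in> {-R..R} \<Longrightarrow> dist q p < y \<Longrightarrow> dist (f q) (f p) < x"
            using uc unfolding uniformly_continuous_on_def by metis
          obtain n0 where "\<And>n. n \<ge> n0 \<Longrightarrow> \<bar>w (u n) r - w (v n) r\<bar> < y"
            using LIMSEQ_D[OF conv[OF r] y(1)] by auto
          then show "\<exists>no. \<forall>n\<ge>no. norm (dist (f (w (u n) r)) (f (w (v n) r)) - 0) < x"
            using y(2)[OF wR[OF v(1,2)] wR[OF u(1,2)]] by (intro exI[of _ n0]) (auto simp: dist_real_def)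
        qed
        then have "(\<lambda>n. (kk r * (CP * pt r)) * dist (f (w (u n) r)) (f (w (v n) r))) \<longlonglongrightarrow> 0"
          by (rule tendsto_mult_right_zero)
        then show ?thesis using True by (simp add: s_def dist_real_def ac_simps)
      qed (simp add: s_def)
    qed
    show "AE r in lborel. norm (s n r) \<le> indicator {A..B} r * (2 * (G * 1 * (C * (CP * C * M))) * (CP * C))" for n
      using s_bound by (intro AE_I2) simp
  qed (use s_meas in simp_all)
  then have "(\<lambda>n. \<integral>r. s n r \<partial>lborel) \<longlonglongrightarrow> 0" by simp
  then obtain n0 where n0: "\<And>n. n \<ge> n0 \<Longrightarrow> \<bar>\<integral>r. s n r \<partial>lborel\<bar> < d / 2"
    using LIMSEQ_D[of _ 0 "d/2"] d by fastforce
  have "norm (T (u n) - T (v n)) < d" if n: "n \<ge> n0" for n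
  proof -
    \<comment> \<open>Testing the difference with itself gives its norm: |h|^2 is at most |h| times
      a quantity below d.\<close>
    define h where "h = T (u n) - T (v n)"
    have h: "h \<in> E" unfolding h_def by (intro subspace_diff[OF E_subspace] T u v)
    have iu: "integrable lborel (\<lambda>r. kk r * f (w (u n) r) * w h r)" and iv: "integrable lborel (\<lambda>r. kk r * f (w (v n) r) * w h r)"
      by (intro kk_f_integrable u v h)+
    have "(norm h)\<^sup>2 = T (u n) \<bullet> h - T (v n) \<bullet> h"
      unfolding power2_norm_eq_inner by (simp add: h_def inner_diff_left)
    also have "\<dots> = (\<integral>r. kk r * f (w (u n) r) * w h r - kk r * f (w (v n) r) * w h r \<partial>lborel)"
      unfolding T(2)[OF u(1) h] T(2)[OF v(1) h] by (rule Bochner_Integration.integral_diff[OF iu iv, symmetric])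
    also have "\<dots> \<le> (\<integral>r. G * d1 * (wt r * \<bar>w (u n) r\<bar> * \<bar>w h r\<bar> + wt r * \<bar>w (v n) r\<bar> * \<bar>w h r\<bar>) + norm h * s n r \<partial>lborel)"
    proof (rule integral_mono)
      fix r
      show "kk r * f (w (u n) r) * w h r - kk r * f (w (v n) r) * w h r
        \<le> G * d1 * (wt r * \<bar>w (u n) r\<bar> * \<bar>w h r\<bar> + wt r * \<bar>w (v n) r\<bar> * \<bar>w h r\<bar>) + norm h * s n r"
      proof (cases "r \<in> {A..B}")
        case True
        then have r: "r > 0" using AB by auto
        have "kk r * f (w (u n) r) * w h r - kk r * f (w (v n) r) * w h r \<le> \<bar>kk r * (f (w (u n) r) - f (w (v n) r)) * w h r\<bar>"
          by (simp add: algebra_simps)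
        also have "\<dots> = kk r * \<bar>f (w (u n) r) - f (w (v n) r)\<bar> * \<bar>w h r\<bar>" using kk_nonneg by (simp add: abs_mult)
        also have "\<dots> \<le> kk r * \<bar>f (w (u n) r) - f (w (v n) r)\<bar> * (CP * pt r * norm h)"
          using kk_nonneg by (intro mult_left_mono CP(2)[OF h r]) auto
        also have "\<dots> = norm h * s n r" using True by (simp add: s_def)
        also have "\<dots> \<le> G * d1 * (wt r * \<bar>w (u n) r\<bar> * \<bar>w h r\<bar> + wt r * \<bar>w (v n) r\<bar> * \<bar>w h r\<bar>) + norm h * s n r"
          using G0 d1 wt_nonneg[of r] by (simp add: add_nonneg_nonneg)
        finally show ?thesis .
      next
        case False
        have one: "\<bar>kk r * f (w e r) * w h r\<bar> \<le> G * d1 * (wt r * \<bar>w e r\<bar> * \<bar>w h r\<bar>)" if e: "e \<in> E" "norm e \<le> M" for e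
        proof (cases "r > 0")
          case True
          have "kk r * \<bar>f (w e r)\<bar> \<le> G * decay r * (wt r * \<bar>w e r\<bar>)" by (rule grow_le[OF e])
          also have "\<dots> \<le> G * d1 * (wt r * \<bar>w e r\<bar>)"
            using AB(3)[OF True] False G0 by (intro mult_right_mono mult_left_mono) (auto simp: wt_nonneg)
          finally have "kk r * \<bar>f (w e r)\<bar> * \<bar>w h r\<bar> \<le> G * d1 * (wt r * \<bar>w e r\<bar>) * \<bar>w h r\<bar>"
            by (rule mult_right_mono) simp
          then show ?thesis using kk_nonneg[of r] by (simp add: abs_mult ac_simps)
        qed (simp add: w_nonpos)
        have "norm h * s n r = 0" using False by (simp add: s_def)
        then show ?thesis
          using abs_le_D1[OF one[OF u(1)[of n] u(2)[of n]]] abs_le_D2[OF one[OF v(1)[of n] v(2)[of n]]]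
          unfolding distrib_left by linarith
      qed
    qed (intro Bochner_Integration.integrable_diff Bochner_Integration.integrable_add integrable_mult_right wt_pair u v h iu iv s_int)+
    also have "\<dots> = G * d1 * ((\<integral>r. wt r * \<bar>w (u n) r\<bar> * \<bar>w h r\<bar> \<partial>lborel) + (\<integral>r. wt r * \<bar>w (v n) r\<bar> * \<bar>w h r\<bar> \<partial>lborel))
        + norm h * (\<integral>r. s n r \<partial>lborel)"
    proof -
      have i1: "integrable lborel (\<lambda>r. wt r * \<bar>w (u n) r\<bar> * \<bar>w h r\<bar>)" "integrable lborel (\<lambda>r. wt r * \<bar>w (v n) r\<bar> * \<bar>w h r\<bar>)"
        by (intro wt_pair u v h)+
      show ?thesis using i1 s_int[of n]
        by (simp add: Bochner_Integration.integral_add Bochner_Integration.integrable_add)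
    qed
    also have "\<dots> \<le> G * d1 * (CW * M * norm h + CW * M * norm h) + norm h * (d/2)"
    proof (intro add_mono mult_left_mono)
      have le: "(\<integral>r. wt r * \<bar>w e r\<bar> * \<bar>w h r\<bar> \<partial>lborel) \<le> CW * M * norm h" if e: "e \<in> E" "norm e \<le> M" for e
        using wt_pair(2)[OF e(1) h] mult_right_mono[OF mult_left_mono[OF e(2) CW(1)] norm_ge_zero[of h]] by linarith
      show "(\<integral>r. wt r * \<bar>w (u n) r\<bar> * \<bar>w h r\<bar> \<partial>lborel) \<le> CW * M * norm h" "(\<integral>r. wt r * \<bar>w (v n) r\<bar> * \<bar>w h r\<bar> \<partial>lborel) \<le> CW * M * norm h"
        by (intro le u v)+
      show "(\<integral>r. s n r \<partial>lborel) \<le> d / 2" using n0[OF n] by linarith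
    qed (use G0 d1 in auto)
    also have "\<dots> = norm h * (2 * (G * CW * M) * d1 + d/2)" by (simp add: algebra_simps)
    finally have sq: "norm h * norm h \<le> norm h * (2 * (G * CW * M) * d1 + d/2)" by (simp add: power2_eq_square)
    have "2 * (G * CW * M) * d1 < d / 2"
    proof -
      have "2 * (G * CW * M) * d1 < 2 * (G * CW * M + 1) * d1" using d1 by (intro mult_strict_right_mono) auto
      also have "\<dots> = d / 2" using GC by (simp add: d1_def field_simps)
      finally show ?thesis .
    qed
    then have "2 * (G * CW * M) * d1 + d/2 < d" by linarith
    moreover have "norm h \<le> 2 * (G * CW * M) * d1 + d/2 \<or> norm h = 0"
      using sq by (cases "norm h = 0") (auto simp: mult_le_cancel_left)
    ultimately show ?thesis unfolding h_def using d by linarith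
  qed
  then show "\<exists>no. \<forall>n\<ge>no. norm (norm (T (u n) - T (v n)) - 0) < d" by auto
qed

end

text \<open>Takes the place of weak compactness: a diagonal sequence over the positive rationals,
  extended to all radii by the Hoelder bound, which is uniform in n. The factor r^((N-2)/2) makes
  the bound on the diagonal family the same for all radii.\<close>

lemma profile_convergent_subsequence:
  fixes X :: "nat \<Rightarrow> l2"
  assumes N: "N \<ge> 3" and X: "\<And>n. norm (X n) \<le> M"
  shows "\<exists>k. strict_mono k \<and> (\<forall>r>0. convergent (\<lambda>n. profile N (X (k n)) r))"
proof -
  define S where "S = {r \<in> \<rat>. r > (0::real)}"
  have cS: "countable S" unfolding S_def using countable_rat by (rule countable_subset[rotated]) auto
  have M0: "M \<ge> 0" using X[of 0] norm_ge_zero order_trans by blast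
  have b: "norm (profile N (X n) r * r powr ((N-2)/2)) \<le> M" if "r \<in> S" for n r
  proof -
    have r: "r > 0" using that by (simp add: S_def)
    have "\<bar>profile N (X n) r\<bar> * r powr ((N-2)/2) \<le> (r powr (-(N-2)/2) * norm (X n)) * r powr ((N-2)/2)"
      by (intro mult_right_mono profile_bound[OF N r]) auto
    also have "\<dots> = (r powr (-(N-2)/2) * r powr ((N-2)/2)) * norm (X n)" by simp
    also have "r powr (-(N-2)/2) * r powr ((N-2)/2) = 1" unfolding powr_add[symmetric] minus_divide_left[symmetric] using r by simp
    finally show ?thesis using X[of n] by (simp add: abs_mult)
  qed
  obtain k where k: "strict_mono k" "\<And>r. r \<in> S \<Longrightarrow> \<exists>l. (\<lambda>n. profile N (X (k n)) r * r powr ((N-2)/2)) \<longlonglongrightarrow> l"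
    by (rule function_convergent_subsequence[OF cS, of "\<lambda>n r. profile N (X n) r * r powr ((N-2)/2)" M]) (use b in blast)+
  have convS: "convergent (\<lambda>n. profile N (X (k n)) r)" if rS: "r \<in> S" for r
  proof -
    have r: "r powr ((N-2)/2) \<noteq> 0" using rS by (simp add: S_def)
    obtain l where "(\<lambda>n. profile N (X (k n)) r * r powr ((N-2)/2)) \<longlonglongrightarrow> l" using k(2)[OF rS] by blast
    then have "(\<lambda>n. profile N (X (k n)) r * r powr ((N-2)/2) / r powr ((N-2)/2)) \<longlonglongrightarrow> l / r powr ((N-2)/2)"
      by (intro tendsto_divide tendsto_const r)
    then show ?thesis using r by (auto simp: convergent_def)
  qed
  have "Cauchy (\<lambda>n. profile N (X (k n)) r)" if r: "r > 0" for r
  proof (rule metric_CauchyI)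
    fix e :: real assume e: "e > 0"
    define C where "C = r powr (-(N-1)) * M\<^sup>2 + 1"
    have C: "C > 0" by (simp add: C_def add_nonneg_pos)
    define d where "d = (e/3)\<^sup>2 / C"
    have d: "d > 0" using e C by (simp add: d_def)
    obtain q where q: "q \<in> \<rat>" "r < q" "q < r + d" using Rats_dense_in_real[of r "r + d"] d by auto
    have close: "\<bar>profile N (X n) q - profile N (X n) r\<bar> < e / 3" for n
    proof -
      have "(profile N (X n) q - profile N (X n) r)\<^sup>2 \<le> (q - r) * r powr (-(N-1)) * (norm (X n))\<^sup>2"
        by (rule profile_holder[OF N r]) (use q in simp)
      also have "\<dots> \<le> (q - r) * (r powr (-(N-1)) * M\<^sup>2)"
        unfolding mult.assoc using q by (intro mult_left_mono power_mono X) auto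
      also have "\<dots> \<le> (q - r) * C" using q by (intro mult_left_mono) (auto simp: C_def)
      also have "\<dots> < d * C" using q C by (intro mult_strict_right_mono) auto
      also have "\<dots> = (e/3)\<^sup>2" using C by (simp add: d_def)
      finally have "\<bar>profile N (X n) q - profile N (X n) r\<bar>\<^sup>2 < (e/3)\<^sup>2" by simp
      then show ?thesis by (rule power2_less_imp_less) (use e in simp)
    qed
    have "Cauchy (\<lambda>n. profile N (X (k n)) q)"
      using convS[of q] q r by (intro convergent_Cauchy) (auto simp: S_def)
    then obtain n0 where n0: "\<And>m n. m \<ge> n0 \<Longrightarrow> n \<ge> n0 \<Longrightarrow> dist (profile N (X (k m)) q) (profile N (X (k n)) q) < e / 3"
      using e unfolding Cauchy_def by (metis divide_pos_pos zero_less_numeral)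
    have "dist (profile N (X (k m)) r) (profile N (X (k n)) r) < e" if "m \<ge> n0" "n \<ge> n0" for m n
      using close[of "k m"] close[of "k n"] n0[OF that] unfolding dist_real_def by linarith
    then show "\<exists>M. \<forall>m\<ge>M. \<forall>n\<ge>M. dist (profile N (X (k m)) r) (profile N (X (k n)) r) < e" by blast
  qed
  then show ?thesis using k(1) by (intro exI[of _ k]) (auto simp: Cauchy_convergent_iff)
qed

text \<open>The hat function with support [1, 3] and peak 1 at 2, written as a difference of two
  tails because this is what integrating the kernel against its derivative produces.\<close>

definition tent :: "real \<Rightarrow> real" where
  "tent r = max 0 (3 - max r 2) - max 0 (2 - max r 1)"

definition tent_l2 :: "real \<Rightarrow> l2" where
  "tent_l2 N = mk (\<lambda>r. (indicator {1..2} r - indicator {2..3} r) * r powr ((N-1)/2))"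

lemma profile_tent:
  assumes N: "N \<ge> 3" and r: "r > 0"
  shows "profile N (tent_l2 N) r = tent r"
proof -
  define g where "g r = (indicator {1..2} r - indicator {2..3} r) * r powr ((N-1)/2)" for r :: real
  have g_meas: "g \<in> borel_measurable borel" unfolding g_def by measurable
  have sq: "sqint g"
  proof (rule sqint_nn(1)[OF g_meas])
    have "(\<integral>\<^sup>+s. ennreal ((g s)\<^sup>2) \<partial>lborel) \<le> (\<integral>\<^sup>+s. ennreal ((3 powr ((N-1)/2))\<^sup>2) * indicator {1..3::real} s \<partial>lborel)"
    proof (rule nn_integral_mono)
      fix s :: real
      show "ennreal ((g s)\<^sup>2) \<le> ennreal ((3 powr ((N-1)/2))\<^sup>2) * indicator {1..3::real} s"
      proof (cases "s \<in> {1..3}")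
        case True
        have "\<bar>g s\<bar> \<le> 1 * s powr ((N-1)/2)" unfolding g_def abs_mult by (intro mult_mono) (auto simp: indicator_def)
        also have "\<dots> \<le> 3 powr ((N-1)/2)" using True N by (auto intro!: powr_mono2)
        finally have "\<bar>g s\<bar>\<^sup>2 \<le> (3 powr ((N-1)/2))\<^sup>2" by (intro power_mono) auto
        then show ?thesis using True by (simp add: ennreal_leI)
      next
        case False
        then show ?thesis by (auto simp: g_def indicator_def)
      qed
    qed
    also have "\<dots> = ennreal ((3 powr ((N-1)/2))\<^sup>2 * 2)"
      by (subst nn_integral_cmult_indicator) (auto simp: ennreal_mult)
    finally show "(\<integral>\<^sup>+s. ennreal ((g s)\<^sup>2) \<partial>lborel) \<le> ennreal ((3 powr ((N-1)/2))\<^sup>2 * 2)" .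
  qed simp
  have ks: "sqint (tail_kernel (-(N-1)/2) r)" by (rule tail_kernel_sqint(1)) (use N r in auto)
  have "profile N (tent_l2 N) r = - (\<integral>s. tail_kernel (-(N-1)/2) r s * g s \<partial>lborel)"
  proof -
    have "tent_l2 N = mk g" unfolding tent_l2_def g_def ..
    then show ?thesis using r inner_mk[OF ks sq] unfolding profile_def by simp
  qed
  also have "(\<integral>s. tail_kernel (-(N-1)/2) r s * g s \<partial>lborel) = (\<integral>s. indicator {max r 1..2} s - indicator {max r 2..3} s \<partial>lborel)"
  proof (rule Bochner_Integration.integral_cong[OF refl])
    fix s :: real
    show "tail_kernel (-(N-1)/2) r s * g s = indicator {max r 1..2} s - indicator {max r 2..3} s"
    proof (cases "s \<ge> r \<and> s \<in> {1..3}")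
      case True
      have "s powr (-(N-1)/2) * s powr ((N-1)/2) = 1"
        unfolding powr_add[symmetric] minus_divide_left[symmetric] using True by simp
      then show ?thesis using True by (auto simp: tail_kernel_def g_def indicator_def)
    qed (auto simp: tail_kernel_def g_def indicator_def)
  qed
  also have "\<dots> = max 0 (2 - max r 1) - max 0 (3 - max r 2)"
  proof -
    have m: "measure lborel {x..y} = max 0 (y - x)" for x y :: real by (cases "x \<le> y") auto
    show ?thesis by (subst Bochner_Integration.integral_diff) (auto simp: m emeasure_lborel_Icc_eq)
  qed
  finally show ?thesis by (simp add: tent_def)
qed

section \<open>Compactness of the gradient and existence of a critical point\<close>

context radial_problem begin

text \<open>If the images failed to be Cauchy along k, two index sequences with separated images
  would have profiles with the same pointwise limits, against \<open>T_diff_tendsto\<close>. No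
  limit of x itself has to be identified.\<close>

lemma T_compact:
  assumes x: "\<And>n::nat. x n \<in> E" "bounded (range x)"
  shows "\<exists>r z. strict_mono r \<and> (\<lambda>n. T (x (r n))) \<longlonglongrightarrow> z"
proof -
  obtain M where M: "\<And>n. norm (x n) \<le> M" using x(2) by (auto simp: bounded_iff)
  have "norm (fst (x n)) \<le> M" for n using norm_components_le(1) M order_trans by blast
  from profile_convergent_subsequence[where X = "\<lambda>n. fst (x n)", OF N this]
  obtain k where k: "strict_mono k" "\<And>r. r > 0 \<Longrightarrow> convergent (\<lambda>n. w (x (k n)) r)" by blast
  have "Cauchy (\<lambda>n. T (x (k n)))"
  proof (rule ccontr)
    assume "\<not> ?thesis"
    then obtain e where e: "e > 0" "\<forall>j. \<exists>m\<ge>j. \<exists>n\<ge>j. \<not> norm (T (x (k m)) - T (x (k n))) < e"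
      unfolding Cauchy_iff by blast
    then obtain p s where ps: "\<And>j. p j \<ge> j" "\<And>j. s j \<ge> j" "\<And>j. \<not> norm (T (x (k (p j))) - T (x (k (s j)))) < e"
      by metis
    have pinf: "filterlim p at_top sequentially" "filterlim s at_top sequentially"
      using ps by (auto intro!: filterlim_at_top_mono[OF filterlim_ident])
    have "(\<lambda>j. norm (T (x (k (p j))) - T (x (k (s j))))) \<longlonglongrightarrow> 0"
    proof (rule T_diff_tendsto[where M = M])
      fix r :: real assume "r > 0"
      then obtain l where l: "(\<lambda>n. w (x (k n)) r) \<longlonglongrightarrow> l" using k(2) by (auto simp: convergent_def)
      have "(\<lambda>j. w (x (k (p j))) r - w (x (k (s j))) r) \<longlonglongrightarrow> l - l"
        by (intro tendsto_diff filterlim_compose[OF l pinf(1)] filterlim_compose[OF l pinf(2)])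
      then show "(\<lambda>j. w (x (k (p j))) r - w (x (k (s j))) r) \<longlonglongrightarrow> 0" by simp
    qed (use x M in auto)
    then have "\<forall>\<^sub>F j in sequentially. norm (T (x (k (p j))) - T (x (k (s j)))) < e"
      using e(1) by (rule order_tendstoD)
    then show False using ps(3) by auto
  qed
  then show ?thesis using k(1) Cauchy_convergent_iff convergent_def by blast
qed

lemma T_continuous: "continuous_on E T"
  unfolding continuous_on_sequentially
proof (intro allI ballI impI)
  fix X u assume u: "u \<in> E" and X: "(\<forall>n. X n \<in> E) \<and> X \<longlonglongrightarrow> u"
  have "bounded (range X)" using X convergent_imp_bounded by blast
  then obtain M0 where M0: "\<And>n. norm (X n) \<le> M0" by (auto simp: bounded_iff)
  define M where "M = max M0 (norm u)"
  have "(\<lambda>n. norm (T (X n) - T u)) \<longlonglongrightarrow> 0"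
  proof (rule T_diff_tendsto[where M = M])
    fix r :: real
    have "(\<lambda>n. fst (X n)) \<longlonglongrightarrow> fst u" using X by (intro tendsto_fst) auto
    then have "(\<lambda>n. w (X n) r) \<longlonglongrightarrow> w u r" by (rule tendsto_profile[OF N])
    then show "(\<lambda>n. w (X n) r - w u r) \<longlonglongrightarrow> 0" by (rule LIM_zero)
  qed (use u X M0 in \<open>auto simp: M_def le_max_iff_disj\<close>)
  then show "(T \<circ> X) \<longlonglongrightarrow> T u"
    unfolding comp_def by (intro LIM_zero_cancel[of "\<lambda>n. T (X n)"] tendsto_norm_zero_cancel[of "\<lambda>n. T (X n) - T u"])
qed

text \<open>Support away from 0 and infinity makes the potential energy finite whatever V does
  there. This element gives the direction in which the energy becomes negative.\<close>

lemma tent_element: "\<exists>e\<in>E. \<forall>r>0. w e r = tent r"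
proof -
  define y where "y = (\<lambda>r. if r > 0 then sqrt (V r * r powr (N-1)) * tent r else 0)"
  have t0: "tent r = 0" if "r \<notin> {1..3}" for r using that by (auto simp: tent_def max_def)
  have tc: "continuous_on A tent" for A unfolding tent_def by (intro continuous_intros)
  have y_meas: "y \<in> borel_measurable borel"
    unfolding y_def by (intro measurable_positive_part continuous_intros V_cont tc) auto
  have "integrable lborel (\<lambda>r. indicator {1..3} r *\<^sub>R (V r * r powr (N-1) * (tent r)\<^sup>2))"
    by (intro borel_integrable_compact continuous_intros continuous_on_subset[OF V_cont] tc) auto
  moreover have "(\<lambda>r. indicator {1..3} r *\<^sub>R (V r * r powr (N-1) * (tent r)\<^sup>2)) = (\<lambda>r. (y r)\<^sup>2)"
    using t0 V_nonneg by (auto simp: fun_eq_iff y_def indicator_def power_mult_distrib)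
  ultimately have sq: "sqint y" using y_meas by (simp add: sqint_def)
  define e where "e = (tent_l2 N, mk y)"
  have we: "w e r = tent r" if "r > 0" for r using that by (simp add: e_def profile_tent[OF N])
  have "e \<in> E" unfolding energy_space_def mem_Collect_eq
    using fn_mk[OF sq] by eventually_elim (auto simp: e_def y_def profile_tent[OF N])
  then show ?thesis using we by blast
qed

lemma grow_small:
  assumes "d > 0" shows "\<exists>M>0. grow M < d"
proof -
  have "((\<lambda>M. M powr (q1-2) + M powr (q2-2)) \<longlongrightarrow> 0 + 0) (at_right 0)"
    by (intro tendsto_add tendsto_zero_powrI[OF _ tendsto_const]) (use q in \<open>auto intro!: tendsto_eq_intros eventually_at_right_less[THEN eventually_mono]\<close>)
  then have "\<forall>\<^sub>F M in at_right 0. grow M < d"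
    unfolding grow_def using assms by (intro order_tendstoD(2)) auto
  then have "\<forall>\<^sub>F M in at_right 0. grow M < d \<and> M > 0" by (intro eventually_conj eventually_at_right_less)
  then show ?thesis using eventually_happens'[OF trivial_limit_at_right_real] by blast
qed

theorem critical_point: "\<exists>u\<in>E. u \<noteq> 0 \<and> (\<forall>h\<in>E. u \<bullet> h = (\<integral>r. kk r * f (w u r) * w h r \<partial>lborel))"
proof -
  define G where "G = Cf * CK * CW"
  have G: "G \<ge> 0" using Cf CK(1) CW(1) by (simp add: G_def)
  \<comment> \<open>Chosen so that J u <= |u|^2 / 4 on the sphere of radius \<rho>; since
    \<open>grow\<close> is evaluated at CP * norm u, the radius below is taken with CP * \<rho> <=
    M.\<close>
  obtain M where M: "M > 0" "grow M < 1 / (4 * (G + 1))" using grow_small[of "1 / (4 * (G + 1))"] G by auto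
  define \<rho> where "\<rho> = M / (CP + 1)"
  have \<rho>: "\<rho> > 0" "CP * \<rho> \<le> M" using M CP(1) by (auto simp: \<rho>_def field_simps)
  have geom: "\<rho>\<^sup>2 / 4 \<le> (norm u)\<^sup>2 / 2 - J u" if u: "u \<in> E" "norm u = \<rho>" for u
  proof -
    have "J u \<le> Cf * CK * grow (CP * norm u) * (CW * (norm u)\<^sup>2)"
      using kk_F_integrable(2)[OF u(1)] unfolding J_def by linarith
    also have "\<dots> = G * grow (CP * \<rho>) * \<rho>\<^sup>2" by (simp add: G_def u)
    also have "\<dots> \<le> G * (1 / (4 * (G + 1))) * \<rho>\<^sup>2"
      using grow_mono[of "CP * \<rho>" M] \<rho> CP(1) M G by (intro mult_right_mono mult_left_mono) auto
    also have "\<dots> \<le> 1 / 4 * \<rho>\<^sup>2" using G by (intro mult_right_mono) (auto simp: field_simps)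
    finally show ?thesis using u(2) by simp
  qed
  obtain e where e: "e \<in> E" "\<And>r. r > 0 \<Longrightarrow> w e r = tent r" using tent_element by blast
  \<comment> \<open>On [3/2, 5/2] the tent is at least 1/2, so s times the tent passes t1 once s >=
    2 * t1, and \<open>F_growth\<close> applies. Elsewhere the primitive is at least -c0, which
    costs no more than D in total.\<close>
  define k where "k = (\<integral>r. indicator {3/2..5/2} r * kk r \<partial>lborel)"
  define D where "D = (\<integral>r. c0 * kk r \<partial>lborel)"
  have c0_int: "integrable lborel (\<lambda>r. c0 * kk r)" using c0(2) unfolding kk_def .
  have k_int: "integrable lborel (\<lambda>r. indicator {3/2..5/2} r * kk r)"
  proof -
    have "integrable lborel (\<lambda>r. indicator {3/2..5/2} r *\<^sub>R (K r * r powr (N-1)))"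
      by (intro borel_integrable_compact continuous_intros continuous_on_subset[OF K_cont]) auto
    moreover have "(\<lambda>r. indicator {3/2..5/2} r *\<^sub>R (K r * r powr (N-1))) = (\<lambda>r. indicator {3/2..5/2} r * kk r)"
      by (auto simp: fun_eq_iff kk_def indicator_def)
    ultimately show ?thesis by simp
  qed
  have k: "k > 0"
  proof -
    have "k \<ge> 0" unfolding k_def using kk_nonneg by (intro integral_nonneg_AE AE_I2) auto
    moreover have "k \<noteq> 0"
    proof
      assume "k = 0"
      then have "AE r in lborel. indicator {3/2..5/2} r * kk r = 0"
        unfolding k_def by (subst (asm) integral_nonneg_eq_0_iff_AE[OF k_int]) (use kk_nonneg in \<open>auto intro!: AE_I2\<close>)
      then have "AE r in lborel. r \<notin> {3/2..5/2::real}"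
      proof eventually_elim
        case (elim r)
        show ?case
        proof
          assume r: "r \<in> {3/2..5/2}"
          then have "kk r > 0" using K_pos[of r] by (simp add: kk_def)
          then show False using elim r by simp
        qed
      qed
      then have "emeasure lborel {3/2..5/2::real} = 0"
        by (subst (asm) AE_iff_null_sets[symmetric]) (auto dest: null_setsD1)
      moreover have "emeasure lborel {3/2..5/2::real} = ennreal (5/2 - 3/2)" by (rule emeasure_lborel_Icc) simp
      ultimately have "ennreal (5/2 - 3/2) = 0" by (simp only:)
      then show False by simp
    qed
    ultimately show ?thesis by simp
  qed
  have J_lower: "J (s *\<^sub>R e) \<ge> c1 * (s/2) powr \<theta> * k - D" if s: "s \<ge> 2 * t1" for s
  proof -
    have sp: "s > 0" using s F_growth(2) by linarith
    have "c1 * (s/2) powr \<theta> * k - D = (\<integral>r. c1 * (s/2) powr \<theta> * (indicator {3/2..5/2} r * kk r) - c0 * kk r \<partial>lborel)"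
      unfolding k_def D_def using k_int c0_int by simp
    also have "\<dots> \<le> J (s *\<^sub>R e)" unfolding J_def
    proof (rule integral_mono)
      show "integrable lborel (\<lambda>r. kk r * Fprim f (w (s *\<^sub>R e) r))"
        by (rule kk_F_integrable(1)) (use e E_subspace in \<open>simp add: subspace_scale\<close>)
      fix r
      show "c1 * (s/2) powr \<theta> * (indicator {3/2..5/2} r * kk r) - c0 * kk r \<le> kk r * Fprim f (w (s *\<^sub>R e) r)"
      proof (cases "r \<in> {3/2..5/2}")
        case True
        then have "tent r \<ge> 1/2" by (auto simp: tent_def max_def)
        then have "s * tent r \<ge> s * (1/2)" using sp by (intro mult_left_mono) auto
        then have wr: "w (s *\<^sub>R e) r \<ge> s / 2" unfolding w_scale using True e(2)[of r] by simp
        then have "Fprim f (w (s *\<^sub>R e) r) \<ge> c1 * (w (s *\<^sub>R e) r) powr \<theta>" using s by (intro F_growth(3)) auto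
        moreover have "c1 * (w (s *\<^sub>R e) r) powr \<theta> \<ge> c1 * (s/2) powr \<theta>"
          using wr sp F_growth(1) AR(1) by (intro mult_left_mono powr_mono2) auto
        ultimately have "kk r * (c1 * (s/2) powr \<theta>) \<le> kk r * Fprim f (w (s *\<^sub>R e) r)"
          by (intro mult_left_mono kk_nonneg) auto
        moreover have "0 \<le> c0 * kk r" using c0(1) kk_nonneg by simp
        ultimately show ?thesis using True by (simp add: ac_simps)
      next
        case False
        have "kk r * (- c0) \<le> kk r * Fprim f (w (s *\<^sub>R e) r)" by (intro mult_left_mono AR(3) kk_nonneg)
        then show ?thesis using False by (simp add: ac_simps)
      qed
    qed (use k_int c0_int in simp)
    finally show ?thesis .
  qed
  define c where "c = c1 * k / 2 powr \<theta>"
  have c: "c > 0" using F_growth(1) k by (simp add: c_def)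
  define A where "A = (norm e)\<^sup>2 / 2 + \<bar>D\<bar>"
  have ep: "norm e > 0"
  proof -
    have "w e 2 = 1" using e(2)[of 2] by (simp add: tent_def)
    then show ?thesis by (metis fst_zero profile_zero zero_less_norm_iff zero_neq_one)
  qed
  \<comment> \<open>The four terms ensure, in this order: |D| <= |D| s^2, the range of
    \<open>F_growth\<close> on [3/2, 5/2], an end point outside the sphere of radius \<rho>, and A
    s^2 <= c s^\<theta>.\<close>
  define s where "s = max (max 1 (2 * t1)) (max (\<rho> / norm e + 1) ((A / c) powr (1 / (\<theta> - 2))))"
  have s: "s \<ge> 1" "s \<ge> 2 * t1" "s \<ge> \<rho> / norm e + 1" "s \<ge> (A / c) powr (1 / (\<theta> - 2))" by (auto simp: s_def)
  have A: "A > 0" using ep by (simp add: A_def add_pos_nonneg)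
  have "A / c = ((A / c) powr (1 / (\<theta> - 2))) powr (\<theta> - 2)"
    using A c AR(1) by (simp add: powr_powr)
  also have "\<dots> \<le> s powr (\<theta> - 2)" using s AR(1) by (intro powr_mono2) auto
  finally have "A \<le> c * s powr (\<theta> - 2)" using c by (simp add: field_simps)
  then have "A * s\<^sup>2 \<le> c * s powr (\<theta> - 2) * s\<^sup>2" by (intro mult_right_mono) auto
  also have "\<dots> = c * (s powr (\<theta> - 2) * s powr 2)" using s(1) by simp
  also have "\<dots> = c * s powr \<theta>" unfolding powr_add[symmetric] by simp
  finally have As: "A * s\<^sup>2 \<le> c * s powr \<theta>" .
  have I_neg: "(norm (s *\<^sub>R e))\<^sup>2 / 2 - J (s *\<^sub>R e) \<le> 0"
  proof -
    have "c1 * (s/2) powr \<theta> * k = c * s powr \<theta>" using s(1) by (simp add: c_def powr_divide)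
    then have "J (s *\<^sub>R e) \<ge> A * s\<^sup>2 - D" using J_lower[OF s(2)] As by linarith
    moreover have "A * s\<^sup>2 = (norm (s *\<^sub>R e))\<^sup>2 / 2 + \<bar>D\<bar> * s\<^sup>2" by (simp add: A_def power_mult_distrib algebra_simps)
    moreover have "\<bar>D\<bar> * 1 \<le> \<bar>D\<bar> * s\<^sup>2" using s(1) by (intro mult_left_mono) auto
    ultimately show ?thesis by linarith
  qed
  have "\<rho> / norm e * norm e < s * norm e" using s(3) ep by (intro mult_strict_right_mono) auto
  then have big: "norm (s *\<^sub>R e) > \<rho>" using ep s(1) by simp
  have J0: "J 0 = 0" unfolding J_def by (simp add: F_nonpos)
  have ARJ: "\<theta> * J u \<le> T u \<bullet> u + D" if u: "u \<in> E" for u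
  proof -
    have "\<theta> * J u = (\<integral>r. \<theta> * (kk r * Fprim f (w u r)) \<partial>lborel)" unfolding J_def by simp
    also have "\<dots> \<le> (\<integral>r. kk r * f (w u r) * w u r + c0 * kk r \<partial>lborel)"
    proof (rule integral_mono)
      fix r
      have "kk r * (\<theta> * Fprim f (w u r)) \<le> kk r * (f (w u r) * w u r + c0)" by (intro mult_left_mono AR(2) kk_nonneg)
      then show "\<theta> * (kk r * Fprim f (w u r)) \<le> kk r * f (w u r) * w u r + c0 * kk r" by (simp add: algebra_simps)
    qed (intro integrable_mult_right kk_F_integrable Bochner_Integration.integrable_add kk_f_integrable c0_int u)+
    also have "\<dots> = T u \<bullet> u + D"
      unfolding D_def T(2)[OF u u] by (intro Bochner_Integration.integral_add kk_f_integrable c0_int u)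
    finally show ?thesis .
  qed
  have "\<exists>u\<in>E. T u = u \<and> u \<noteq> 0"
  proof (rule mountain_pass[where \<rho> = \<rho> and \<alpha> = "\<rho>\<^sup>2/4" and e = "s *\<^sub>R e" and C = D and \<theta> = \<theta> and J = J])
    show "\<rho>\<^sup>2 / 4 > 0" using \<rho> by simp
    show "s *\<^sub>R e \<in> E" using e E_subspace by (simp add: subspace_scale)
  qed (fact E_subspace E_closed T(1) T_continuous J_deriv J0 T_compact AR(1) ARJ \<rho>(1) geom big I_neg)+
  then show ?thesis using T(2) by metis
qed

end

subsection \<open>Chain rule and nonnegativity\<close>

lemma profile_increment:
  assumes N: "N > 2" and r: "0 < r" "r \<le> s"
  shows "integrable lborel (\<lambda>t. indicator {r..<s} t * (t powr (-(N-1)/2) * fn x t))"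
    "profile N x s - profile N x r = (\<integral>t. indicator {r..<s} t * (t powr (-(N-1)/2) * fn x t) \<partial>lborel)"
proof -
  have s: "0 < s" using r by simp
  have eq: "(\<lambda>t. indicator {r..<s} t * (t powr (-(N-1)/2) * fn x t))
      = (\<lambda>t. tail_kernel (-(N-1)/2) r t * fn x t - tail_kernel (-(N-1)/2) s t * fn x t)"
    using r by (auto simp: fun_eq_iff tail_kernel_def indicator_def)
  note i = profile_integral[OF N r(1), of x] profile_integral[OF N s, of x]
  show "integrable lborel (\<lambda>t. indicator {r..<s} t * (t powr (-(N-1)/2) * fn x t))"
    unfolding eq by (intro Bochner_Integration.integrable_diff i)
  show "profile N x s - profile N x r = (\<integral>t. indicator {r..<s} t * (t powr (-(N-1)/2) * fn x t) \<partial>lborel)"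
    unfolding eq i(2) i(4) by (subst Bochner_Integration.integral_diff[OF i(1) i(3)]) simp
qed

lemma profile_tendsto_0:
  assumes N: "N \<ge> 3"
  shows "(profile N x \<longlongrightarrow> 0) at_top"
proof (rule Lim_null_comparison)
  show "\<forall>\<^sub>F r in at_top. norm (profile N x r) \<le> r powr (-(N-2)/2) * norm x"
    using eventually_gt_at_top[of 0] by eventually_elim (simp only: real_norm_def profile_bound[OF N])
  have "((\<lambda>r. r powr (-(N-2)/2)) \<longlongrightarrow> 0) at_top"
    by (rule tendsto_neg_powr[OF _ filterlim_ident]) (use N in simp)
  then show "((\<lambda>r. r powr (-(N-2)/2) * norm x) \<longlongrightarrow> 0) at_top"
    by (rule tendsto_mult_left_zero)
qed

text \<open>A discrete form of the fact that an absolutely continuous function with zero derivative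
  is constant: increments of at most e times an additive A on short intervals add up over a
  partition to e times A a b, for every e > 0.\<close>

lemma small_increments_constant:
  fixes D :: "real \<Rightarrow> real" and A :: "real \<Rightarrow> real \<Rightarrow> real"
  assumes ab: "a \<le> b"
    and add: "\<And>r s t. a \<le> r \<Longrightarrow> r \<le> s \<Longrightarrow> s \<le> t \<Longrightarrow> t \<le> b \<Longrightarrow> A r t = A r s + A s t"
    and small: "\<And>e. e > 0 \<Longrightarrow> \<exists>d>0. \<forall>r s. a \<le> r \<longrightarrow> r \<le> s \<longrightarrow> s \<le> b \<longrightarrow> s - r < d \<longrightarrow> \<bar>D s - D r\<bar> \<le> e * A r s"
  shows "D b = D a"
proof -
  have le: "\<bar>D b - D a\<bar> \<le> 0 + e * A a b" if e: "e > 0" for e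
  proof -
    obtain d where d: "d > 0" "\<And>r s. a \<le> r \<Longrightarrow> r \<le> s \<Longrightarrow> s \<le> b \<Longrightarrow> s - r < d \<Longrightarrow> \<bar>D s - D r\<bar> \<le> e * A r s"
      using small[OF e] by blast
    have "\<exists>n::nat. (b - a) / d < real n" by (rule reals_Archimedean2)
    then obtain n :: nat where n: "(b - a) / d < real n" by blast
    have n0: "real n > 0" using n d(1) ab by (meson divide_nonneg_pos diff_ge_0_iff_ge le_less_trans)
    define h where "h = (b - a) / real n"
    have h: "0 \<le> h" "h < d" using n n0 d(1) ab by (auto simp: h_def field_simps)
    have nh: "a + real n * h = b" using n0 by (simp add: h_def)
    have "i \<le> n \<Longrightarrow> \<bar>D (a + real i * h) - D a\<bar> \<le> e * A a (a + real i * h)" for i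
    proof (induction i)
      case 0
      then show ?case using d(2)[of a a] ab d(1) by simp
    next
      case (Suc i)
      have b1: "a \<le> a + real i * h" "a + real i * h \<le> a + real (Suc i) * h" using h by (auto simp: algebra_simps)
      have b2: "a + real (Suc i) * h \<le> b"
      proof -
        have "real (Suc i) * h \<le> real n * h" using Suc.prems h(1) by (intro mult_right_mono) auto
        then show ?thesis using nh by linarith
      qed
      have "\<bar>D (a + real (Suc i) * h) - D (a + real i * h)\<bar> \<le> e * A (a + real i * h) (a + real (Suc i) * h)"
        using h(2) by (intro d(2) b1 b2) (simp add: algebra_simps)
      moreover have "A a (a + real (Suc i) * h) = A a (a + real i * h) + A (a + real i * h) (a + real (Suc i) * h)"
        by (rule add) (use b1 b2 in auto)
      ultimately show ?case using Suc by (simp add: distrib_left)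
    qed
    from this[of n] show ?thesis unfolding nh by simp
  qed
  have "\<bar>D b - D a\<bar> \<le> 0"
  proof (rule ccontr)
    assume "\<not> ?thesis"
    then have p: "\<bar>D b - D a\<bar> > 0" by simp
    define q where "q = \<bar>A a b\<bar> + 1"
    have q: "q > 0" "A a b \<le> q" by (auto simp: q_def)
    define e where "e = \<bar>D b - D a\<bar> / (2 * q)"
    have e: "e > 0" using p q by (simp add: e_def)
    have "e * A a b \<le> e * q" using e q by (intro mult_left_mono) auto
    also have "\<dots> = \<bar>D b - D a\<bar> / 2" using q by (simp add: e_def)
    finally have "\<bar>D b - D a\<bar> \<le> \<bar>D b - D a\<bar> / 2" using le[OF e] by (metis add_0 order_trans)
    then show False using p by simp
  qed
  then show ?thesis by simp
qed

text \<open>The chain rule is proved on increments, without differentiating almost everywhere. On a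
  short interval the mean value theorem and the integral formula show that \<phi>(w) and the profile
  built from \<phi>'(w) times \<open>fn x\<close> differ in their increments by at most the
  oscillation of \<phi>'(w) times the variation of w. Their difference is therefore constant, and it
  tends to 0 at infinity.\<close>

lemma profile_chain:
  assumes N: "N \<ge> 3" and r: "r > 0"
    and \<phi>: "\<And>t. (\<phi> has_real_derivative \<phi>' t) (at t)" "continuous_on UNIV \<phi>'" "\<And>t. \<bar>\<phi>' t\<bar> \<le> B" "\<phi> 0 = 0"
  shows "sqint (\<lambda>t. \<phi>' (profile N x t) * fn x t)"
    "profile N (mk (\<lambda>t. \<phi>' (profile N x t) * fn x t)) r = \<phi> (profile N x r)"
proof -
  let ?W = "profile N x"
  define p where "p = -(N-1)/2"
  have N2: "N > 2" using N by simp
  have Wm [measurable]: "?W \<in> borel_measurable borel" by (rule profile_meas[OF N])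
  have \<phi>m [measurable]: "\<phi>' \<in> borel_measurable borel" by (rule borel_measurable_continuous_onI[OF \<phi>(2)])
  have mW: "(\<lambda>t. \<phi>' (?W t)) \<in> borel_measurable lborel" using measurable_compose[OF Wm \<phi>m] by simp
  have sq: "sqint (\<lambda>t. \<phi>' (?W t) * fn x t)"
  proof (rule sqint_bound[OF sqint_scale[OF sqint_fn[of x], of B]])
    show "AE t in lborel. \<bar>\<phi>' (?W t) * fn x t\<bar> \<le> \<bar>B * fn x t\<bar>"
      using order_trans[OF \<phi>(3) abs_ge_self] by (intro AE_I2) (auto simp: abs_mult intro!: mult_right_mono)
  qed simp
  then show "sqint (\<lambda>t. \<phi>' (?W t) * fn x t)" .
  define y where "y = mk (\<lambda>t. \<phi>' (?W t) * fn x t)"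
  have fy: "AE t in lborel. fn y t = \<phi>' (?W t) * fn x t" unfolding y_def by (rule fn_mk[OF sq])
  define D where "D t = \<phi> (?W t) - profile N y t" for t
  \<comment> \<open>The total variation of the profile over [s, t).\<close>
  define A where "A s t = (\<integral>\<tau>. \<bar>indicator {s..<t} \<tau> * (\<tau> powr p * fn x \<tau>)\<bar> \<partial>lborel)" for s t
  have D_const: "D b = D a" if ab: "0 < a" "a \<le> b" for a b
  proof (rule small_increments_constant[OF ab(2), of A])
    fix r s t assume rst: "a \<le> r" "r \<le> s" "s \<le> t" "t \<le> b"
    have i: "integrable lborel (\<lambda>\<tau>. \<bar>indicator {r..<s} \<tau> * (\<tau> powr p * fn x \<tau>)\<bar>)" "integrable lborel (\<lambda>\<tau>. \<bar>indicator {s..<t} \<tau> * (\<tau> powr p * fn x \<tau>)\<bar>)"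
      unfolding p_def by (intro integrable_abs profile_increment(1)[OF N2]; use rst ab in linarith)+
    show "A r t = A r s + A s t"
      unfolding A_def Bochner_Integration.integral_add[OF i, symmetric]
      by (rule Bochner_Integration.integral_cong[OF refl]) (use rst in \<open>auto simp: indicator_def\<close>)
  next
    fix e :: real assume e: "e > 0"
    have Wc: "continuous_on {a..b} ?W" by (rule continuous_on_subset[OF profile_continuous[OF N]]) (use ab in auto)
    have "bounded (?W ` {a..b})" by (intro compact_imp_bounded compact_continuous_image Wc) simp
    then obtain R where R: "\<And>t. t \<in> {a..b} \<Longrightarrow> \<bar>?W t\<bar> \<le> R" unfolding bounded_iff by (metis imageI real_norm_def)
    have "uniformly_continuous_on {-R..R} \<phi>'"
      by (intro compact_uniformly_continuous continuous_on_subset[OF \<phi>(2)]) auto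
    then obtain d1 where d1: "d1 > 0" "\<And>p q. p \<in> {-R..R} \<Longrightarrow> q \<in> {-R..R} \<Longrightarrow> dist q p < d1 \<Longrightarrow> dist (\<phi>' q) (\<phi>' p) < e"
      using e unfolding uniformly_continuous_on_def by metis
    have "uniformly_continuous_on {a..b} ?W" by (rule compact_uniformly_continuous[OF Wc]) simp
    then obtain d where d: "d > 0" "\<And>p q. p \<in> {a..b} \<Longrightarrow> q \<in> {a..b} \<Longrightarrow> dist q p < d \<Longrightarrow> dist (?W q) (?W p) < d1/2"
      using d1(1) half_gt_zero[OF d1(1)] unfolding uniformly_continuous_on_def by metis
    have "\<bar>D s - D r\<bar> \<le> e * A r s" if rs: "a \<le> r" "r \<le> s" "s \<le> b" "s - r < d" for r s
    proof -
      have r0: "0 < r" using rs ab by linarith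
      note inc = profile_increment[OF N2 r0 rs(2), folded p_def]
      have "\<exists>c. \<phi> (?W s) - \<phi> (?W r) = \<phi>' c * (?W s - ?W r) \<and> min (?W r) (?W s) \<le> c \<and> c \<le> max (?W r) (?W s)"
      proof (cases "?W r" "?W s" rule: linorder_cases)
        case less
        obtain c where "?W r < c" "c < ?W s" "\<phi> (?W s) - \<phi> (?W r) = (?W s - ?W r) * \<phi>' c"
          using MVT2[OF less \<phi>(1)] by blast
        then show ?thesis by (intro exI[of _ c]) auto
      next
        case greater
        obtain c where "?W s < c" "c < ?W r" "\<phi> (?W r) - \<phi> (?W s) = (?W r - ?W s) * \<phi>' c"
          using MVT2[OF greater \<phi>(1)] by blast
        then show ?thesis by (intro exI[of _ c]) (auto simp: algebra_simps)
      qed auto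
      then obtain c where c: "\<phi> (?W s) - \<phi> (?W r) = \<phi>' c * (?W s - ?W r)" "min (?W r) (?W s) \<le> c" "c \<le> max (?W r) (?W s)" by blast
      have rsab: "r \<in> {a..b}" "s \<in> {a..b}" using rs by auto
      have near: "\<bar>\<phi>' c - \<phi>' (?W t)\<bar> \<le> e" if t: "t \<in> {r..<s}" for t
      proof -
        have tab: "t \<in> {a..b}" using t rs by auto
        have "dist (?W r) (?W t) < d1/2" "dist (?W s) (?W t) < d1/2"
          using d(2)[OF tab rsab(1)] d(2)[OF tab rsab(2)] t rs by (auto simp: dist_real_def)
        then have "dist c (?W t) < d1" using c(2,3) d1(1) unfolding dist_real_def by linarith
        moreover have "c \<in> {-R..R}" using c(2,3) R[OF rsab(1)] R[OF rsab(2)] by (auto simp: min_def max_def split: if_splits)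
        moreover have "?W t \<in> {-R..R}" using R[OF tab] by auto
        ultimately show ?thesis using d1(2)[of "?W t" c] by (simp add: dist_real_def)
      qed
      have m1: "(\<lambda>t. indicator {r..<s} t * (t powr p * fn y t)) \<in> borel_measurable lborel"
        by (rule borel_measurable_integrable[OF inc(1)])
      have m2: "(\<lambda>t. \<phi>' (?W t) * (indicator {r..<s} t * (t powr p * fn x t))) \<in> borel_measurable lborel"
        by (rule borel_measurable_times[OF mW borel_measurable_integrable[OF inc(1)]])
      have eqAE: "AE t in lborel. indicator {r..<s} t * (t powr p * fn y t) = \<phi>' (?W t) * (indicator {r..<s} t * (t powr p * fn x t))"
        using fy by eventually_elim simp
      have "D s - D r = \<phi>' c * (\<integral>t. indicator {r..<s} t * (t powr p * fn x t) \<partial>lborel) - (\<integral>t. indicator {r..<s} t * (t powr p * fn y t) \<partial>lborel)"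
        using c(1) inc(2)[of x] inc(2)[of y] by (simp add: D_def)
      also have "(\<integral>t. indicator {r..<s} t * (t powr p * fn y t) \<partial>lborel) = (\<integral>t. \<phi>' (?W t) * (indicator {r..<s} t * (t powr p * fn x t)) \<partial>lborel)"
        by (rule integral_cong_AE[OF m1 m2 eqAE])
      also have "\<phi>' c * (\<integral>t. indicator {r..<s} t * (t powr p * fn x t) \<partial>lborel) - \<dots>
          = (\<integral>t. \<phi>' c * (indicator {r..<s} t * (t powr p * fn x t)) - \<phi>' (?W t) * (indicator {r..<s} t * (t powr p * fn x t)) \<partial>lborel)"
      proof (subst Bochner_Integration.integral_diff)
        show "integrable lborel (\<lambda>t. \<phi>' (?W t) * (indicator {r..<s} t * (t powr p * fn x t)))"
          using inc(1)[of y] integrable_cong_AE[OF m1 m2 eqAE] by blast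
      qed (use inc(1)[of x] in simp_all)
      finally have Dd: "D s - D r = (\<integral>t. \<phi>' c * (indicator {r..<s} t * (t powr p * fn x t)) - \<phi>' (?W t) * (indicator {r..<s} t * (t powr p * fn x t)) \<partial>lborel)" .
      have "\<bar>D s - D r\<bar> \<le> (\<integral>t. e * \<bar>indicator {r..<s} t * (t powr p * fn x t)\<bar> \<partial>lborel)"
        unfolding Dd real_norm_def[symmetric]
      proof (rule Bochner_Integration.integral_norm_bound_integral)
        show "integrable lborel (\<lambda>t. e * norm (indicator {r..<s} t * (t powr p * fn x t)))"
          by (intro integrable_mult_right integrable_norm inc(1))
        show "integrable lborel (\<lambda>t. \<phi>' c * (indicator {r..<s} t * (t powr p * fn x t)) - \<phi>' (?W t) * (indicator {r..<s} t * (t powr p * fn x t)))"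
        proof (rule Bochner_Integration.integrable_bound[of lborel "\<lambda>t. e * norm (indicator {r..<s} t * (t powr p * fn x t))"])
          show "integrable lborel (\<lambda>t. e * norm (indicator {r..<s} t * (t powr p * fn x t)))"
            by (intro integrable_mult_right integrable_norm inc(1))
          show "AE t in lborel. norm (\<phi>' c * (indicator {r..<s} t * (t powr p * fn x t)) - \<phi>' (?W t) * (indicator {r..<s} t * (t powr p * fn x t)))
            \<le> norm (e * norm (indicator {r..<s} t * (t powr p * fn x t)))"
          proof (rule AE_I2)
            fix t
            show "norm (\<phi>' c * (indicator {r..<s} t * (t powr p * fn x t)) - \<phi>' (?W t) * (indicator {r..<s} t * (t powr p * fn x t)))
              \<le> norm (e * norm (indicator {r..<s} t * (t powr p * fn x t)))"
              using near[of t] e by (cases "t \<in> {r..<s}") (auto simp: left_diff_distrib[symmetric] abs_mult intro!: mult_right_mono)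
          qed
        qed measurable
        fix t
        show "norm (\<phi>' c * (indicator {r..<s} t * (t powr p * fn x t)) - \<phi>' (?W t) * (indicator {r..<s} t * (t powr p * fn x t)))
          \<le> e * norm (indicator {r..<s} t * (t powr p * fn x t))"
          using near[of t] by (cases "t \<in> {r..<s}") (auto simp: left_diff_distrib[symmetric] abs_mult intro!: mult_right_mono)
      qed
      then show ?thesis by (simp add: A_def)
    qed
    then show "\<exists>d>0. \<forall>r s. a \<le> r \<longrightarrow> r \<le> s \<longrightarrow> s \<le> b \<longrightarrow> s - r < d \<longrightarrow> \<bar>D s - D r\<bar> \<le> e * A r s" using d(1) by blast
  qed
  have "((\<lambda>t. \<phi> (?W t)) \<longlongrightarrow> \<phi> 0) at_top"
    by (rule isCont_tendsto_compose[OF DERIV_isCont[OF \<phi>(1)] profile_tendsto_0[OF N]])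
  then have "(D \<longlongrightarrow> 0 - 0) at_top"
    unfolding D_def \<phi>(4) by (rule tendsto_diff[OF _ profile_tendsto_0[OF N]])
  moreover have "\<forall>\<^sub>F t in at_top. D t = D r"
    using eventually_ge_at_top[of r] by eventually_elim (rule D_const[OF r])
  ultimately have "((\<lambda>_. D r) \<longlongrightarrow> 0) (at_top :: real filter)"
    by (simp add: tendsto_cong)
  then have "D r = 0" using tendsto_const_iff[OF trivial_limit_at_top_linorder] by blast
  then show "profile N (mk (\<lambda>t. \<phi>' (?W t) * fn x t)) r = \<phi> (?W r)" by (simp add: D_def y_def)
qed

text \<open>A \<open>C\<^sup>1\<close> substitute for the negative part.\<close>

definition negpart :: "real \<Rightarrow> real" where
  "negpart t = (if t < 0 then t^3 / (1 + t\<^sup>2) else 0)"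

definition negpart' :: "real \<Rightarrow> real" where
  "negpart' t = (if t < 0 then (3 * t\<^sup>2 + t^4) / (1 + t\<^sup>2)\<^sup>2 else 0)"

lemma negpart_abs_le: "\<bar>negpart t\<bar> \<le> \<bar>t\<bar>"
proof (cases "t < 0")
  case True
  have p: "1 + t\<^sup>2 > 0" by (simp add: add_pos_nonneg)
  have "\<bar>negpart t\<bar> = \<bar>t\<bar> * (t\<^sup>2 / (1 + t\<^sup>2))"
    using True p by (simp add: negpart_def abs_mult power3_eq_cube power2_eq_square)
  also have "\<dots> \<le> \<bar>t\<bar> * 1" using p by (intro mult_left_mono) auto
  finally show ?thesis by simp
qed (simp add: negpart_def)

lemma negpart_DERIV: "(negpart has_real_derivative negpart' t) (at t)"
proof (cases t "0::real" rule: linorder_cases)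
  case less
  have p: "1 + t\<^sup>2 \<noteq> 0" by (metis add_pos_nonneg less_numeral_extra(1,3) zero_le_power2)
  have "((\<lambda>t. t^3 / (1 + t\<^sup>2)) has_real_derivative negpart' t) (at t)"
    using less p unfolding negpart'_def
    by (auto intro!: derivative_eq_intros simp: power2_eq_square power3_eq_cube power4_eq_xxxx algebra_simps)
  then show ?thesis
    by (rule has_field_derivative_transform_within_open[where S = "{..<0}"]) (use less in \<open>auto simp: negpart_def\<close>)
next
  case equal
  have "((\<lambda>h. negpart h / h) \<longlongrightarrow> 0) (at 0)"
  proof (rule Lim_null_comparison)
    have "norm (negpart h / h) \<le> h\<^sup>2" if "h \<noteq> 0" for h
    proof (cases "h < 0")
      case True
      have p: "1 + h\<^sup>2 \<ge> 1" by simp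
      have "negpart h / h = h\<^sup>2 / (1 + h\<^sup>2)" using True by (simp add: negpart_def power3_eq_cube power2_eq_square)
      moreover have "h\<^sup>2 / (1 + h\<^sup>2) \<le> h\<^sup>2 / 1" using p by (intro divide_left_mono) (auto intro: add_pos_nonneg)
      ultimately show ?thesis by simp
    qed (simp add: negpart_def)
    then show "\<forall>\<^sub>F h in at 0. norm (negpart h / h) \<le> h\<^sup>2"
      unfolding eventually_at by (intro exI[of _ 1]) auto
    show "((\<lambda>h::real. h\<^sup>2) \<longlongrightarrow> 0) (at 0)" by (auto intro!: tendsto_eq_intros)
  qed
  then show ?thesis using equal by (simp add: has_field_derivative_iff negpart_def negpart'_def)
next
  case greater
  have "((\<lambda>t. 0) has_real_derivative negpart' t) (at t)" using greater by (simp add: negpart'_def)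
  then show ?thesis
    by (rule has_field_derivative_transform_within_open[where S = "{0<..}"]) (use greater in \<open>auto simp: negpart_def\<close>)
qed

lemma negpart'_cont: "continuous_on UNIV negpart'"
proof -
  have eq: "negpart' = (\<lambda>t. (3 * (min t 0)\<^sup>2 + (min t 0)^4) / (1 + (min t 0)\<^sup>2)\<^sup>2)"
    by (auto simp: negpart'_def fun_eq_iff min_def)
  have ne: "1 + (min t 0)\<^sup>2 \<noteq> (0::real)" for t by (metis add_pos_nonneg less_numeral_extra(1,3) zero_le_power2)
  show ?thesis unfolding eq by (intro continuous_intros) (use ne in auto)
qed

lemma negpart'_bounds: "0 \<le> negpart' t" "\<bar>negpart' t\<bar> \<le> 3"
proof -
  show nn: "0 \<le> negpart' t" by (simp add: negpart'_def)
  have "3 * (1 + t\<^sup>2)\<^sup>2 = 3 + 6 * t\<^sup>2 + 3 * t^4"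
    by (simp add: power2_eq_square power4_eq_xxxx algebra_simps)
  moreover have "0 \<le> t\<^sup>2" "0 \<le> t^4" by simp_all
  ultimately have "3 * t\<^sup>2 + t^4 \<le> 3 * (1 + t\<^sup>2)\<^sup>2" by linarith
  then have "negpart' t \<le> 3"
    by (simp add: negpart'_def divide_le_eq add_nonneg_eq_0_iff)
  then show "\<bar>negpart' t\<bar> \<le> 3" using nn by simp
qed

context radial_problem begin

theorem nonneg_critical_point:
  "\<exists>u\<in>E. u \<noteq> 0 \<and> (\<forall>r. w u r \<ge> 0) \<and> (\<forall>h\<in>E. u \<bullet> h = (\<integral>r. kk r * f (w u r) * w h r \<partial>lborel))"
proof -
  obtain u where u: "u \<in> E" "u \<noteq> 0" "\<And>h. h \<in> E \<Longrightarrow> u \<bullet> h = (\<integral>r. kk r * f (w u r) * w h r \<partial>lborel)"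
    using critical_point by blast
  define x where "x = fst u"
  note chain = profile_chain[OF N _ negpart_DERIV negpart'_cont negpart'_bounds(2), of _ x]
  have n0: "negpart 0 = 0" by (simp add: negpart_def)
  have [measurable]: "negpart \<in> borel_measurable borel" unfolding negpart_def by measurable
  have [measurable]: "negpart' \<in> borel_measurable borel" unfolding negpart'_def by measurable
  have [measurable]: "profile N x \<in> borel_measurable borel" by (rule profile_meas[OF N])
  have sqy: "sqint (\<lambda>t. negpart' (profile N x t) * fn x t)" using chain(1)[OF zero_less_one n0] .
  define y where "y = mk (\<lambda>t. negpart' (profile N x t) * fn x t)"
  have py: "profile N y r = negpart (profile N x r)" if "r > 0" for r
    unfolding y_def by (rule chain(2)[OF that n0])
  define z where "z r = (if r > 0 then sqrt (V r * r powr (N-1)) * profile N y r else 0)" for r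
  have z_meas: "z \<in> borel_measurable borel"
    unfolding z_def by (intro measurable_positive_part continuous_intros V_cont profile_continuous N) auto
  \<comment> \<open>The new profile is dominated pointwise by that of u, so its potential energy is
    finite.\<close>
  have sqz: "sqint z"
  proof (rule sqint_bound[OF sqint_fn[of "snd u"]])
    show "AE r in lborel. \<bar>z r\<bar> \<le> \<bar>fn (snd u) r\<bar>"
      using energy_spaceD[OF u(1)]
    proof eventually_elim
      case (elim r)
      then show ?case using negpart_abs_le[of "profile N x r"]
        by (auto simp: z_def py abs_mult x_def intro!: mult_left_mono)
    qed
  qed (use z_meas in simp)
  define h where "h = (y, mk z)"
  have h: "h \<in> E"
    unfolding energy_space_def mem_Collect_eq using fn_mk[OF sqz] by eventually_elim (simp add: h_def z_def)
  have "(\<integral>r. kk r * f (w u r) * w h r \<partial>lborel) = (\<integral>r. 0 \<partial>(lborel :: real measure))"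
  proof (rule Bochner_Integration.integral_cong[OF refl])
    fix r
    show "kk r * f (w u r) * w h r = 0"
      using f_nonpos[of "w u r"] by (cases "r > 0"; cases "w u r \<le> 0") (auto simp: h_def py negpart_def x_def kk_def)
  qed
  then have uh: "u \<bullet> h = 0" using u(3)[OF h] by simp
  \<comment> \<open>The equation tested with h says that the gradient and potential parts add up to
    0. Both are nonnegative, since t * negpart t and negpart' are, so the gradient part vanishes;
    this forces the profile of h, and with it the negative part of u, to be 0.\<close>
  have "0 \<le> snd u \<bullet> mk z"
  proof -
    have "snd u \<bullet> mk z = (\<integral>r. fn (snd u) r * fn (mk z) r \<partial>lborel)" by (rule inner_l2)
    also have "\<dots> \<ge> 0"
    proof (rule integral_nonneg_AE)
      show "AE r in lborel. 0 \<le> fn (snd u) r * fn (mk z) r"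
        using energy_spaceD[OF u(1)] fn_mk[OF sqz]
      proof eventually_elim
        case (elim r)
        have "0 \<le> profile N x r * negpart (profile N x r)"
          by (auto simp: negpart_def mult_nonpos_nonpos divide_nonpos_nonneg)
        then have "0 \<le> sqrt (V r * r powr (N-1)) * sqrt (V r * r powr (N-1)) * (profile N x r * negpart (profile N x r))" if "r > 0"
          using V_nonneg[OF that] by simp
        then show ?case unfolding elim by (auto simp: z_def py x_def ac_simps)
      qed
    qed
    finally show ?thesis .
  qed
  then have "y \<bullet> x \<le> 0" using uh by (simp add: h_def inner_prod_def x_def inner_commute)
  moreover have yx: "y \<bullet> x = (\<integral>t. negpart' (profile N x t) * fn x t * fn x t \<partial>lborel)"
    unfolding y_def by (rule inner_mk_fn[OF sqy])
  moreover have nn: "0 \<le> negpart' (profile N x t) * fn x t * fn x t" for t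
    using negpart'_bounds(1) by (simp add: mult.assoc)
  moreover have "0 \<le> (\<integral>t. negpart' (profile N x t) * fn x t * fn x t \<partial>lborel)"
    by (rule integral_nonneg_AE) (use nn in simp)
  ultimately have "(\<integral>t. negpart' (profile N x t) * fn x t * fn x t \<partial>lborel) = 0" by linarith
  then have "AE t in lborel. negpart' (profile N x t) * fn x t * fn x t = 0"
    by (subst (asm) integral_nonneg_eq_0_iff_AE) (auto intro!: sqint_mult_integrable[OF sqy sqint_fn] nn)
  then have "AE t in lborel. fn y t = fn 0 t"
    using fn_mk[OF sqy, folded y_def] fn_zero by eventually_elim auto
  then have "y = 0" by (rule l2_eqI)
  then have "negpart (profile N x r) = 0" if "r > 0" for r using py[OF that] by simp
  then have "w u r \<ge> 0" for r
  proof (cases "r > 0")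
    case True
    then have n: "negpart (w u r) = 0" using \<open>\<And>r. r > 0 \<Longrightarrow> negpart (profile N x r) = 0\<close> by (simp add: x_def)
    show ?thesis
    proof (rule ccontr)
      assume "\<not> ?thesis"
      then have neg: "w u r < 0" by simp
      have "1 + (w u r)\<^sup>2 \<noteq> 0" by (metis add_pos_nonneg less_numeral_extra(1,3) zero_le_power2)
      then show False using n neg by (simp add: negpart_def)
    qed
  qed (simp add: w_nonpos)
  then show ?thesis using u by blast
qed

end

section \<open>Radial functions in Euclidean space\<close>

definition sphere_const :: "'a::euclidean_space itself \<Rightarrow> real" where
  "sphere_const _ = real DIM('a) * unit_ball_vol (real DIM('a))"

definition polar_density :: "'a::euclidean_space itself \<Rightarrow> real \<Rightarrow> real" where
  "polar_density _ r = (if r > 0 then sphere_const TYPE('a) * r powr (real DIM('a) - 1) else 0)"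

lemma sphere_const_pos: "sphere_const TYPE('a::euclidean_space) > 0"
  by (simp add: sphere_const_def)

lemma polar_density_nonneg: "polar_density TYPE('a::euclidean_space) r \<ge> 0"
  using sphere_const_pos[where 'a='a] by (simp add: polar_density_def)

lemma polar_density_meas [measurable]: "polar_density TYPE('a::euclidean_space) \<in> borel_measurable borel"
  unfolding polar_density_def by measurable

text \<open>Polar integration of functions of |x| amounts to knowing the image of Lebesgue measure
  under the norm. Half-lines generate the Borel sets and their preimages are balls, so the formula
  reduces to the volume of a ball; the area of the unit sphere enters as DIM times the volume of the
  unit ball.\<close>

lemma distr_norm_lborel:
  "distr (lborel :: 'a::euclidean_space measure) borel norm = density lborel (polar_density TYPE('a))"
proof (rule measure_eqI_generator_eq[where E = "range (\<lambda>a::real. {..a})" and \<Omega> = UNIV and A = "\<lambda>i::nat. {..real i}"])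
  show "Int_stable (range (\<lambda>a::real. {..a}))" by (auto simp: Int_stable_def)
  have eq: "emeasure (distr (lborel :: 'a measure) borel norm) {..a} = emeasure (density lborel (polar_density TYPE('a))) {..a}
      \<and> emeasure (distr (lborel :: 'a measure) borel norm) {..a} \<noteq> \<infinity>" for a :: real
  proof (cases "a \<ge> 0")
    case True
    let ?n = "real DIM('a)"
    have "emeasure (distr (lborel :: 'a measure) borel norm) {..a} = emeasure lborel (norm -` {..a} :: 'a set)"
      by (subst emeasure_distr) auto
    also have "norm -` {..a} = (cball 0 a :: 'a set)" by auto
    also have "emeasure lborel (cball 0 a :: 'a set) = ennreal (unit_ball_vol ?n * a ^ DIM('a))"
      by (rule emeasure_cball[OF True])
    finally have 1: "emeasure (distr (lborel :: 'a measure) borel norm) {..a} = ennreal (unit_ball_vol ?n * a ^ DIM('a))" .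
    have "emeasure (density lborel (polar_density TYPE('a))) {..a}
        = (\<integral>\<^sup>+r. ennreal (polar_density TYPE('a) r) * indicator {..a} r \<partial>lborel)"
      by (rule emeasure_density) auto
    also have "\<dots> = (\<integral>\<^sup>+r. ennreal (sphere_const TYPE('a)) * (ennreal (r powr (?n - 1)) * indicator {0..a} r) \<partial>lborel)"
    proof (rule nn_integral_cong_AE)
      have "AE r in lborel. r \<noteq> (0::real)" by (rule AE_lborel_singleton)
      then show "AE r in lborel. ennreal (polar_density TYPE('a) r) * indicator {..a} r
          = ennreal (sphere_const TYPE('a)) * (ennreal (r powr (?n - 1)) * indicator {0..a} r)"
        by eventually_elim (use sphere_const_pos[where 'a='a] in \<open>auto simp: polar_density_def indicator_def ennreal_mult\<close>)
    qed
    also have "\<dots> = ennreal (sphere_const TYPE('a)) * (\<integral>\<^sup>+r. ennreal (r powr (?n - 1)) * indicator {0..a} r \<partial>lborel)"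
      by (rule nn_integral_cmult) measurable
    also have "(\<integral>\<^sup>+r. ennreal (r powr (?n - 1)) * indicator {0..a} r \<partial>lborel) = ennreal (a powr (?n - 1 + 1) / (?n - 1 + 1))"
      by (rule nn_integral_powr_head[OF _ True]) simp
    also have "ennreal (sphere_const TYPE('a)) * \<dots> = ennreal (sphere_const TYPE('a) * (a powr ?n / ?n))"
      using sphere_const_pos[where 'a='a] by (subst ennreal_mult[symmetric]) auto
    also have "sphere_const TYPE('a) * (a powr ?n / ?n) = unit_ball_vol ?n * a ^ DIM('a)"
      using True by (cases "a = 0") (simp_all add: sphere_const_def powr_realpow)
    finally show ?thesis using 1 by simp
  next
    case False
    have "norm -` {..a} = ({} :: 'a set)" using False by (auto dest: order_trans[OF norm_ge_zero])
    then have 1: "emeasure (distr (lborel :: 'a measure) borel norm) {..a} = 0"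
      by (subst emeasure_distr) auto
    have "emeasure (density lborel (polar_density TYPE('a))) {..a}
        = (\<integral>\<^sup>+r. ennreal (polar_density TYPE('a) r) * indicator {..a} r \<partial>lborel)"
      by (rule emeasure_density) auto
    also have "\<dots> = (\<integral>\<^sup>+r. 0 \<partial>(lborel :: real measure))"
      by (rule nn_integral_cong) (use False in \<open>auto simp: polar_density_def indicator_def\<close>)
    finally show ?thesis using 1 by simp
  qed
  show "emeasure (distr (lborel :: 'a measure) borel norm) X = emeasure (density lborel (polar_density TYPE('a))) X"
    if "X \<in> range (\<lambda>a::real. {..a})" for X using eq that by auto
  show "emeasure (distr (lborel :: 'a measure) borel norm) {..real i} \<noteq> \<infinity>" for i using eq[of "real i"] by blast
  show "(\<Union>i::nat. {..real i}) = UNIV" using real_arch_simple by auto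
  show "sets (distr (lborel :: 'a measure) borel norm) = sigma_sets UNIV (range (\<lambda>a::real. {..a}))"
    "sets (density lborel (polar_density TYPE('a))) = sigma_sets UNIV (range (\<lambda>a::real. {..a}))"
    by (simp_all add: borel_eq_atMost)
qed auto

lemma polar_nn_integral:
  fixes F :: "real \<Rightarrow> ennreal"
  assumes [measurable]: "F \<in> borel_measurable borel"
  shows "(\<integral>\<^sup>+x. F (norm x) \<partial>(lborel :: 'a::euclidean_space measure)) = (\<integral>\<^sup>+r. ennreal (polar_density TYPE('a) r) * F r \<partial>lborel)"
proof -
  have "(\<integral>\<^sup>+x. F (norm x) \<partial>(lborel :: 'a measure)) = integral\<^sup>N (distr (lborel :: 'a measure) borel norm) F"
    by (rule nn_integral_distr[symmetric]) auto
  then show ?thesis unfolding distr_norm_lborel by (subst (asm) nn_integral_density) auto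
qed

lemma polar_integral:
  fixes F :: "real \<Rightarrow> real"
  assumes [measurable]: "F \<in> borel_measurable borel"
  shows "integrable lborel (\<lambda>x::'a::euclidean_space. F (norm x)) \<longleftrightarrow> integrable lborel (\<lambda>r. polar_density TYPE('a) r * F r)"
    "(\<integral>x. F (norm x) \<partial>(lborel :: 'a::euclidean_space measure)) = (\<integral>r. polar_density TYPE('a) r * F r \<partial>lborel)"
proof -
  have "integrable lborel (\<lambda>x::'a. F (norm x)) \<longleftrightarrow> integrable (distr (lborel :: 'a measure) borel norm) F"
    by (rule integrable_distr_eq[symmetric]) auto
  also have "\<dots> \<longleftrightarrow> integrable lborel (\<lambda>r. polar_density TYPE('a) r * F r)"
    unfolding distr_norm_lborel
    by (subst integrable_density) (auto simp: polar_density_nonneg)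
  finally show "integrable lborel (\<lambda>x::'a. F (norm x)) \<longleftrightarrow> integrable lborel (\<lambda>r. polar_density TYPE('a) r * F r)" .
  have "(\<integral>x. F (norm x) \<partial>(lborel :: 'a measure)) = integral\<^sup>L (distr (lborel :: 'a measure) borel norm) F"
    by (rule integral_distr[symmetric]) auto
  also have "\<dots> = (\<integral>r. polar_density TYPE('a) r * F r \<partial>lborel)"
    unfolding distr_norm_lborel
    by (subst integral_density) (auto simp: polar_density_nonneg)
  finally show "(\<integral>x. F (norm x) \<partial>(lborel :: 'a measure)) = (\<integral>r. polar_density TYPE('a) r * F r \<partial>lborel)" .
qed

lemma polar_AE:
  assumes "AE r in lborel. r > 0 \<longrightarrow> P r"
  shows "AE x::'a::euclidean_space in lborel. P (norm x)"
proof -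
  have "AE r in density lborel (polar_density TYPE('a)). P r"
    by (subst AE_density) (use assms in \<open>auto simp: polar_density_def elim!: eventually_mono\<close>)
  then have "AE r in distr (lborel :: 'a measure) borel norm. P r" by (simp only: distr_norm_lborel)
  then show ?thesis by (rule AE_distrD[rotated]) auto
qed

text \<open>The density is strictly positive for r > 0, so null sets of radii can be read back from
  null sets in space.\<close>

lemma polar_AE_converse:
  assumes P: "Measurable.pred borel P" and AE: "AE x::'a::euclidean_space in lborel. P (norm x)"
  shows "AE r in lborel. r > 0 \<longrightarrow> P r"
proof -
  have "AE r in distr (lborel :: 'a measure) borel norm. P r"
    by (subst AE_distr_iff) (use P AE in auto)
  then have "AE r in density lborel (polar_density TYPE('a)). P r" by (simp only: distr_norm_lborel)
  then show ?thesis
    by (subst (asm) AE_density) (use sphere_const_pos[where 'a='a] in \<open>auto simp: polar_density_def elim!: eventually_mono\<close>)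
qed

lemma lebesgue_integral_lborel:
  fixes f :: "'a::euclidean_space \<Rightarrow> real"
  assumes "f \<in> borel_measurable borel"
  shows "integrable lebesgue f \<longleftrightarrow> integrable lborel f" "(\<integral>x. f x \<partial>lebesgue) = (\<integral>x. f x \<partial>lborel)"
  using assms by (auto intro!: integrable_completion integral_completion)

text \<open>The norm image of the compact pieces of an \<open>F\<^sub>\<sigma>\<close> set filling a radial set up to a null set
  is a Borel set of radii; this makes radial Lebesgue measurable functions Borel functions of the norm.\<close>

lemma radial_set_inner:
  fixes A :: "'a::euclidean_space set"
  assumes A: "A \<in> sets lebesgue" and rad: "\<And>x y. norm x = norm y \<Longrightarrow> x \<in> A \<Longrightarrow> y \<in> A"
  shows "\<exists>B\<in>sets borel. (\<forall>x. norm x \<in> B \<longrightarrow> x \<in> A) \<and> (AE x in lebesgue. x \<in> A \<longrightarrow> norm x \<in> B)"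
proof -
  obtain C T where C: "fsigma C" "T \<in> null_sets lebesgue" "C \<union> T = A" using lebesgue_set_almost_fsigma[OF A] by metis
  obtain F :: "nat \<Rightarrow> 'a set" where F: "\<And>n. closed (F n)" "C = \<Union>(range F)"
    using C(1) by (auto elim!: fsigma.cases)
  define B where "B = (\<Union>n. \<Union>m. norm ` (F n \<inter> cball 0 (real m)))"
  have "compact (norm ` (F n \<inter> cball 0 (real m)))" for n m
    by (intro compact_continuous_image closed_Int_compact F) (auto intro: continuous_intros)
  then have "B \<in> sets borel" unfolding B_def by (intro sets.countable_UN) (auto intro: borel_compact)
  moreover have "x \<in> A" if "norm x \<in> B" for x
  proof -
    obtain n y where "y \<in> F n" "norm x = norm y" using \<open>norm x \<in> B\<close> unfolding B_def by auto
    then show ?thesis using rad[of y x] F(2) C(3) by auto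
  qed
  moreover have "AE x in lebesgue. x \<in> A \<longrightarrow> norm x \<in> B"
  proof -
    have "AE x in lebesgue. x \<notin> T" by (rule AE_not_in[OF C(2)])
    then show ?thesis
    proof eventually_elim
      case (elim x)
      show ?case
      proof
        assume "x \<in> A"
        then obtain n where n: "x \<in> F n" using elim C(3) F(2) by auto
        obtain m :: nat where "norm x \<le> real m" using real_arch_simple by blast
        then have "x \<in> F n \<inter> cball 0 (real m)" using n by simp
        then show "norm x \<in> B" unfolding B_def by blast
      qed
    qed
  qed
  ultimately show ?thesis by blast
qed

text \<open>Inner approximation of A and of its complement squeezes B between two Borel sets of
  radii whose difference is null for the image measure.\<close>

lemma radial_set_borel:
  fixes A :: "'a::euclidean_space set"
  assumes A: "A \<in> sets lebesgue" and rad: "\<And>x y. norm x = norm y \<Longrightarrow> x \<in> A \<Longrightarrow> y \<in> A"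
    and B: "\<And>x. x \<in> A \<longleftrightarrow> norm x \<in> B" "B \<subseteq> {0..}"
  shows "B \<in> sets (completion (distr (lborel :: 'a measure) borel norm))"
proof -
  have "\<exists>B\<in>sets borel. (\<forall>x. norm x \<in> B \<longrightarrow> x \<in> A) \<and> (AE x in lebesgue. x \<in> A \<longrightarrow> norm x \<in> B)"
    by (rule radial_set_inner[OF A]) (rule rad)
  then obtain B1 where B1: "B1 \<in> sets borel" "\<And>x::'a. norm x \<in> B1 \<Longrightarrow> x \<in> A" "AE x in lebesgue. x \<in> A \<longrightarrow> norm x \<in> B1"
    by blast
  have nA: "- A \<in> sets lebesgue" using A by (simp add: Compl_in_sets_lebesgue)
  have "\<exists>B\<in>sets borel. (\<forall>x. norm x \<in> B \<longrightarrow> x \<in> - A) \<and> (AE x in lebesgue. x \<in> - A \<longrightarrow> norm x \<in> B)"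
    by (rule radial_set_inner[OF nA]) (use rad in \<open>metis ComplD ComplI\<close>)
  then obtain B2 where B2: "B2 \<in> sets borel" "\<And>x::'a. norm x \<in> B2 \<Longrightarrow> x \<in> - A" "AE x in lebesgue. x \<in> - A \<longrightarrow> norm x \<in> B2"
    by blast
  define B1' where "B1' = B1 \<inter> {0..}"
  define N where "N = {0..} - B1 - B2"
  have ex: "\<exists>x::'a. norm x = r" if "r \<ge> 0" for r
    using vector_choose_size[OF that] by blast
  have sub: "B1' \<subseteq> B" "B - B1' \<subseteq> N"
  proof -
    have "r \<in> B" if r: "r \<in> B1'" for r
    proof -
      obtain x :: 'a where "norm x = r" using ex[of r] r by (auto simp: B1'_def)
      then show ?thesis using B1(2)[of x] B(1)[of x] r by (simp add: B1'_def)
    qed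
    then show "B1' \<subseteq> B" by blast
    have "r \<in> N" if r: "r \<in> B" "r \<notin> B1'" for r
    proof -
      have r0: "r \<ge> 0" using r(1) B(2) by auto
      then obtain x :: 'a where "norm x = r" using ex by blast
      then have "r \<notin> B2" using B2(2)[of x] B(1)[of x] r(1) by auto
      then show ?thesis using r r0 by (simp add: N_def B1'_def)
    qed
    then show "B - B1' \<subseteq> N" by blast
  qed
  have "AE x in lborel. norm (x::'a) \<notin> N"
    using B1(3) B2(3) unfolding AE_completion_iff by eventually_elim (auto simp: N_def)
  then have "AE r in distr (lborel :: 'a measure) borel norm. r \<notin> N"
    by (subst AE_distr_iff) (use B1 B2 in \<open>auto simp: N_def\<close>)
  then have "N \<in> null_sets (distr (lborel :: 'a measure) borel norm)"
    by (subst AE_iff_null_sets) (use B1 B2 in \<open>auto simp: N_def\<close>)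
  then show ?thesis
    by (intro sets_completionI[of B B1' "B - B1'" N]) (use sub B1 in \<open>auto simp: B1'_def\<close>)
qed

text \<open>The restriction of h to a ray is measurable for the completed image measure of the norm,
  but perhaps not Borel; a Borel representative is taken there and pulled back.\<close>

lemma radial_borel:
  fixes h :: "'a::euclidean_space \<Rightarrow> real"
  assumes h: "h \<in> borel_measurable lebesgue" and rad: "radial h"
  shows "\<exists>k\<in>borel_measurable borel. AE x in lebesgue. h x = k (norm x)"
proof -
  let ?M = "distr (lborel :: 'a measure) borel norm"
  obtain e :: 'a where e: "norm e = 1" using vector_choose_size[of 1] by auto
  define k0 where "k0 r = (if r \<ge> 0 then h (r *\<^sub>R e) else 0)" for r
  have hk: "h x = k0 (norm x)" for x
  proof -
    have "norm x = norm (norm x *\<^sub>R e)" using e by simp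
    then have "h x = h (norm x *\<^sub>R e)" using rad unfolding radial_def by blast
    then show ?thesis by (simp add: k0_def)
  qed
  have "k0 \<in> borel_measurable (completion ?M)"
  proof (rule measurableI)
    fix U :: "real set" assume U: "U \<in> sets borel"
    let ?A = "h -` U"
    have A: "?A \<in> sets lebesgue" using measurable_sets[OF h U] by simp
    define B where "B = k0 -` U \<inter> {0..}"
    have "B \<in> sets (completion ?M)"
    proof (rule radial_set_borel[OF A])
      show "norm x = norm y \<Longrightarrow> x \<in> ?A \<Longrightarrow> y \<in> ?A" for x y by (simp add: hk)
      show "x \<in> ?A \<longleftrightarrow> norm x \<in> B" for x by (simp add: hk B_def)
    qed (simp add: B_def)
    moreover have "k0 -` U \<inter> {..<0} \<in> sets (completion ?M)"
    proof -
      have "k0 -` U \<inter> {..<0} = (if 0 \<in> U then {..<0} else {})" by (auto simp: k0_def)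
      then show ?thesis by auto
    qed
    moreover have "k0 -` U \<inter> space (completion ?M) = B \<union> (k0 -` U \<inter> {..<0})"
      by (auto simp: B_def)
    ultimately show "k0 -` U \<inter> space (completion ?M) \<in> sets (completion ?M)"
      by (simp only: sets.Un)
  qed auto
  then obtain k where k: "k \<in> borel_measurable ?M" "AE r in ?M. k0 r = k r"
    using completion_ex_borel_measurable_real by metis
  have "AE x in lborel. k0 (norm x) = k (norm (x::'a))"
    by (rule AE_distrD[OF _ k(2)]) simp
  then have "AE x in lebesgue. h x = k (norm x)" unfolding AE_completion_iff hk .
  then show ?thesis using k(1) by auto
qed

text \<open>The positive and negative parts of z are densities of two finite measures that agree on
  all half-lines, hence everywhere, and densities are unique almost everywhere.\<close>

lemma AE_zero_of_intervals:
  fixes z :: "real \<Rightarrow> real"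
  assumes ab: "a < b" and int: "integrable lborel (\<lambda>t. indicator {a<..<b} t * z t)"
    and zero: "\<And>c. a \<le> c \<Longrightarrow> c < b \<Longrightarrow> (\<integral>t. indicator {c<..<b} t * z t \<partial>lborel) = 0"
  shows "AE t in lborel. a < t \<and> t < b \<longrightarrow> z t = 0"
proof -
  define y where "y t = indicator {a<..<b} t * z t" for t
  have y_int: "integrable lborel y" using int unfolding y_def .
  have [measurable]: "y \<in> borel_measurable borel" using borel_measurable_integrable[OF y_int] by simp
  define p where "p t = ennreal (max 0 (y t))" for t
  define m where "m t = ennreal (max 0 (- y t))" for t
  have [measurable]: "p \<in> borel_measurable borel" "m \<in> borel_measurable borel" unfolding p_def m_def by measurable
  have pi: "integrable lborel (\<lambda>t. max 0 (y t))" "integrable lborel (\<lambda>t. max 0 (- y t))"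
    by (intro Bochner_Integration.integrable_max y_int; simp add: y_int)+
  have tail: "(\<integral>t. indicator {c<..} t * y t \<partial>lborel) = 0" for c
  proof (cases "c < b")
    case True
    have "(\<lambda>t. indicator {c<..} t * y t) = (\<lambda>t. indicator {max a c<..<b} t * z t)"
      by (auto simp: y_def indicator_def fun_eq_iff)
    then show ?thesis using zero[of "max a c"] True ab by simp
  next
    case False
    then have "(\<lambda>t. indicator {c<..} t * y t) = (\<lambda>t. 0)" by (auto simp: y_def indicator_def fun_eq_iff)
    then show ?thesis by simp
  qed
  have tail_set: "{c<..} \<in> sets lborel" for c :: real by simp
  have em: "emeasure (density lborel (\<lambda>t. ennreal (v t))) {c<..} = ennreal (\<integral>t. indicator {c<..} t * v t \<partial>lborel)"
    if v: "integrable lborel v" "\<And>t. v t \<ge> 0" for v :: "real \<Rightarrow> real" and c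
  proof -
    have i: "integrable lborel (\<lambda>t. indicator {c<..} t * v t)"
      using integrable_real_mult_indicator[OF tail_set v(1)] by (simp add: mult.commute)
    have "emeasure (density lborel (\<lambda>t. ennreal (v t))) {c<..} = (\<integral>\<^sup>+t. ennreal (v t) * indicator {c<..} t \<partial>lborel)"
      by (rule emeasure_density) (use v in auto)
    also have "\<dots> = (\<integral>\<^sup>+t. ennreal (indicator {c<..} t * v t) \<partial>lborel)"
      by (rule nn_integral_cong) (auto simp: indicator_def)
    also have "\<dots> = ennreal (\<integral>t. indicator {c<..} t * v t \<partial>lborel)"
      by (rule nn_integral_eq_integral[OF i]) (use v in auto)
    finally show ?thesis .
  qed
  have "density lborel p = density lborel m"
  proof (rule measure_eqI_lessThan)
    fix c
    have ip: "integrable lborel (\<lambda>t. indicator {c<..} t * max 0 (y t))" "integrable lborel (\<lambda>t. indicator {c<..} t * max 0 (- y t))"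
      using integrable_real_mult_indicator[OF tail_set pi(1)] integrable_real_mult_indicator[OF tail_set pi(2)]
      by (simp_all add: mult.commute)
    have "(\<integral>t. indicator {c<..} t * max 0 (y t) \<partial>lborel) - (\<integral>t. indicator {c<..} t * max 0 (- y t) \<partial>lborel)
      = (\<integral>t. indicator {c<..} t * max 0 (y t) - indicator {c<..} t * max 0 (- y t) \<partial>lborel)"
      by (rule Bochner_Integration.integral_diff[OF ip, symmetric])
    also have "\<dots> = (\<integral>t. indicator {c<..} t * y t \<partial>lborel)"
      by (rule Bochner_Integration.integral_cong[OF refl]) (auto simp: max_def right_diff_distrib[symmetric])
    finally have "(\<integral>t. indicator {c<..} t * max 0 (y t) \<partial>lborel) = (\<integral>t. indicator {c<..} t * max 0 (- y t) \<partial>lborel)"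
      using tail by simp
    then show "emeasure (density lborel p) {c<..} = emeasure (density lborel m) {c<..}"
      unfolding p_def m_def by (simp add: em[OF pi(1)] em[OF pi(2)])
    show "emeasure (density lborel p) {c<..} < \<infinity>" unfolding p_def by (simp add: em[OF pi(1)])
  qed auto
  moreover have "integral\<^sup>N lborel p \<noteq> \<infinity>"
    unfolding p_def using nn_integral_eq_integral[OF pi(1)] by simp
  ultimately have "AE t in lborel. p t = m t"
    by (subst (asm) finite_density_unique) auto
  then show ?thesis
  proof eventually_elim
    case (elim t)
    then have "max 0 (y t) = max 0 (- y t)" unfolding p_def m_def by (subst (asm) ennreal_inj) auto
    then have "y t = 0" by (auto simp: max_def split: if_splits)
    then show ?case by (auto simp: y_def indicator_def)
  qed
qed

lemma AE_pos_zero_of_intervals: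
  fixes z :: "real \<Rightarrow> real"
  assumes int: "\<And>c d. 0 < c \<Longrightarrow> c < d \<Longrightarrow> integrable lborel (\<lambda>t. indicator {c<..<d} t * z t)"
    and zero: "\<And>c d. 0 < c \<Longrightarrow> c < d \<Longrightarrow> (\<integral>t. indicator {c<..<d} t * z t \<partial>lborel) = 0"
  shows "AE t in lborel. 0 < t \<longrightarrow> z t = 0"
proof -
  \<comment> \<open>The intervals (1/(n+1), n+2) exhaust the half line; n + 2 keeps the first of
    them nonempty.\<close>
  have "AE t in lborel. \<forall>n::nat. 1 / real (Suc n) < t \<and> t < real n + 2 \<longrightarrow> z t = 0"
  proof (subst AE_all_countable, intro allI)
    fix n :: nat
    have "1 / real (Suc n) \<le> 1" by simp
    then have ab: "1 / real (Suc n) < real n + 2" by (smt (verit) of_nat_0_le_iff)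
    show "AE t in lborel. 1 / real (Suc n) < t \<and> t < real n + 2 \<longrightarrow> z t = 0"
    proof (rule AE_zero_of_intervals[OF ab int[OF _ ab]])
      fix c assume c: "1 / real (Suc n) \<le> c" "c < real n + 2"
      have "0 < 1 / real (Suc n)" by simp
      then have "0 < c" using c(1) by linarith
      then show "(\<integral>t. indicator {c<..<real n + 2} t * z t \<partial>lborel) = 0" by (rule zero[OF _ c(2)])
    qed simp
  qed
  then show ?thesis
  proof eventually_elim
    case (elim t)
    show ?case
    proof
      assume t: "0 < t"
      obtain n1 where n1: "1 / real (Suc n1) < t" using nat_approx_posE[OF t] by blast
      obtain n2 :: nat where n2: "t < real n2" using reals_Archimedean2 by blast
      define n where "n = max n1 n2"
      have "1 / real (Suc n) \<le> 1 / real (Suc n1)" by (intro divide_left_mono) (auto simp: n_def)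
      moreover have "t < real n + 2" using n2 by (simp add: n_def)
      ultimately show "z t = 0" using elim[rule_format, of n] n1 by linarith
    qed
  qed
qed

text \<open>Difference quotients integrate to 0 by translation invariance, and the Lipschitz bound
  with bounded support dominates them. Applied to a product this is integration by parts in the
  direction i.\<close>

lemma integral_derivative_zero:
  fixes F f :: "'a::euclidean_space \<Rightarrow> real"
  assumes F: "integrable lborel F" and f: "f \<in> borel_measurable borel"
    and lip: "\<And>x t. 0 < t \<Longrightarrow> t \<le> 1 \<Longrightarrow> \<bar>F (x + t *\<^sub>R i) - F x\<bar> \<le> t * (C * indicator (cball 0 R) x)"
    and deriv: "AE x in lborel. ((\<lambda>t. F (x + t *\<^sub>R i)) has_real_derivative f x) (at 0)"
  shows "integrable lborel f" "(\<integral>x. f x \<partial>lborel) = 0"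
proof -
  define \<tau> where "\<tau> n = 1 / real (Suc n)" for n
  have \<tau>: "0 < \<tau> n" "\<tau> n \<le> 1" for n by (auto simp: \<tau>_def)
  have \<tau>0: "\<tau> \<longlonglongrightarrow> 0" unfolding \<tau>_def using LIMSEQ_Suc[OF lim_1_over_n] by simp
  define D where "D n x = (F (x + \<tau> n *\<^sub>R i) - F x) / \<tau> n" for n x
  have [measurable]: "F \<in> borel_measurable borel" using borel_measurable_integrable[OF F] by simp
  have shift: "integrable lborel (\<lambda>x. F (x + c))" "(\<integral>x. F (x + c) \<partial>lborel) = (\<integral>x. F x \<partial>lborel)" for c
  proof -
    have "integrable (distr lborel borel ((+) c)) F" using F by (simp add: lborel_distr_plus)
    then show "integrable lborel (\<lambda>x. F (x + c))" by (subst (asm) integrable_distr_eq) (auto simp: add.commute)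
    have "(\<integral>x. F x \<partial>distr lborel borel ((+) c)) = (\<integral>x. F (c + x) \<partial>lborel)" by (rule integral_distr) auto
    then show "(\<integral>x. F (x + c) \<partial>lborel) = (\<integral>x. F x \<partial>lborel)" by (simp add: lborel_distr_plus add.commute)
  qed
  have D0: "(\<integral>x. D n x \<partial>lborel) = 0" for n
    unfolding D_def integral_divide_zero using shift[of "\<tau> n *\<^sub>R i"] F by simp
  have bound: "integrable lborel (\<lambda>x. C * indicator (cball 0 R) x :: real)"
    by (intro integrable_mult_right integrable_real_indicator) (use emeasure_bounded_finite[OF bounded_cball[of 0 R]] in auto)
  have conv: "AE x in lborel. (\<lambda>n. D n x) \<longlonglongrightarrow> f x"
    using deriv
  proof eventually_elim
    case (elim x)
    then have "((\<lambda>t. (F (x + t *\<^sub>R i) - F x) / t) \<longlongrightarrow> f x) (at 0)"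
      by (simp add: has_field_derivative_iff)
    then show ?case unfolding tendsto_at_iff_sequentially comp_def D_def using \<tau>(1) \<tau>0 by (auto simp: less_imp_neq[symmetric])
  qed
  have dom: "AE x in lborel. norm (D n x) \<le> C * indicator (cball 0 R) x" for n
  proof (rule AE_I2)
    fix x
    have "\<bar>F (x + \<tau> n *\<^sub>R i) - F x\<bar> / \<tau> n \<le> (\<tau> n * (C * indicator (cball 0 R) x)) / \<tau> n"
      using lip[OF \<tau>] \<tau>(1)[of n] by (intro divide_right_mono) auto
    then show "norm (D n x) \<le> C * indicator (cball 0 R) x" using \<tau>(1)[of n] by (simp add: D_def)
  qed
  have Dm: "D n \<in> borel_measurable lborel" for n unfolding D_def by measurable
  have fm: "f \<in> borel_measurable lborel" using f by simp
  show "integrable lborel f" by (rule integrable_dominated_convergence[OF fm Dm bound conv dom])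
  have "(\<lambda>n. \<integral>x. D n x \<partial>lborel) \<longlonglongrightarrow> (\<integral>x. f x \<partial>lborel)"
    by (rule integral_dominated_convergence[OF fm Dm bound conv dom])
  then show "(\<integral>x. f x \<partial>lborel) = 0" unfolding D0 by (simp add: LIMSEQ_const_iff)
qed

section \<open>Radial test fields\<close>

lemma power_poly_exp_tendsto_0:
  fixes p :: "real poly" and \<epsilon> :: real
  assumes "\<epsilon> > 0"
  shows "((\<lambda>x. x^k * poly p x * exp (- \<epsilon> * x)) \<longlongrightarrow> 0) at_top"
proof (induction p arbitrary: k)
  case 0
  then show ?case by simp
next
  case (pCons a p)
  have "((\<lambda>x. (\<epsilon> * x)^k / exp (\<epsilon> * x)) \<longlongrightarrow> 0) at_top"
    by (rule filterlim_compose[OF tendsto_power_div_exp_0])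
       (rule filterlim_tendsto_pos_mult_at_top[OF tendsto_const assms filterlim_ident])
  then have "((\<lambda>x. (a / \<epsilon>^k) * ((\<epsilon> * x)^k / exp (\<epsilon> * x))) \<longlongrightarrow> 0) at_top"
    by (rule tendsto_mult_right_zero)
  moreover have "(\<lambda>x. (a / \<epsilon>^k) * ((\<epsilon> * x)^k / exp (\<epsilon> * x))) = (\<lambda>x. x^k * a * exp (- \<epsilon> * x))"
    using assms by (auto simp: fun_eq_iff power_mult_distrib exp_minus field_simps)
  ultimately have "((\<lambda>x. x^k * a * exp (- \<epsilon> * x) + x^(Suc k) * poly p x * exp (- \<epsilon> * x)) \<longlongrightarrow> 0 + 0) at_top"
    using pCons.IH[of "Suc k"] by (intro tendsto_add) simp_all
  then show ?case by (simp add: algebra_simps)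
qed

text \<open>Polynomials in 1/t times exp(-\<epsilon>/t) form a family closed under differentiation
  that contains the standard smooth function flat at 0. The parameter \<epsilon> later tends to 0 to
  recover indicators of intervals.\<close>

definition flat :: "real \<Rightarrow> real poly \<Rightarrow> real \<Rightarrow> real" where
  "flat \<epsilon> p t = (if t > 0 then poly p (1/t) * exp (- \<epsilon> / t) else 0)"

text \<open>The new polynomial is the product rule written in the variable 1/t. At 0 the difference
  quotient only gains another factor 1/t, which the exponential beats.\<close>

lemma flat_DERIV:
  assumes \<epsilon>: "\<epsilon> > 0"
  shows "(flat \<epsilon> p has_real_derivative flat \<epsilon> ([:0, 0, 1:] * (smult \<epsilon> p - pderiv p)) t) (at t)"
proof (cases t "0::real" rule: linorder_cases)
  case less
  have "((\<lambda>t. 0) has_real_derivative flat \<epsilon> ([:0, 0, 1:] * (smult \<epsilon> p - pderiv p)) t) (at t)"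
    using less by (simp add: flat_def)
  then show ?thesis
    by (rule has_field_derivative_transform_within_open[where S = "{..<0}"]) (use less in \<open>auto simp: flat_def\<close>)
next
  case equal
  have "((\<lambda>h. flat \<epsilon> p h / h) \<longlongrightarrow> 0) (at 0)"
  proof (rule filterlim_split_at)
    have "\<forall>\<^sub>F h in at_left 0. flat \<epsilon> p h / h = (0::real)"
      unfolding eventually_at_filter by (intro always_eventually) (auto simp: flat_def)
    then show "((\<lambda>h. flat \<epsilon> p h / h) \<longlongrightarrow> 0) (at_left 0)"
      by (subst tendsto_cong) auto
    have "((\<lambda>h. (inverse h)^1 * poly p (inverse h) * exp (- \<epsilon> * inverse h)) \<longlongrightarrow> 0) (at_right 0)"
      by (rule filterlim_compose[OF power_poly_exp_tendsto_0[OF \<epsilon>] filterlim_inverse_at_top_right])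
    moreover have "\<forall>\<^sub>F h in at_right 0. flat \<epsilon> p h / h = (inverse h)^1 * poly p (inverse h) * exp (- \<epsilon> * inverse h)"
      by (rule eventually_mono[OF eventually_at_right_less]) (simp add: flat_def field_simps)
    ultimately show "((\<lambda>h. flat \<epsilon> p h / h) \<longlongrightarrow> 0) (at_right 0)"
      by (subst tendsto_cong) auto
  qed
  then show ?thesis using equal by (simp add: has_field_derivative_iff flat_def)
next
  case greater
  have "((\<lambda>t. poly p (1/t) * exp (- \<epsilon> / t)) has_real_derivative flat \<epsilon> ([:0, 0, 1:] * (smult \<epsilon> p - pderiv p)) t) (at t)"
  proof -
    have d1: "((\<lambda>t. 1 / t) has_real_derivative - (1 / t\<^sup>2)) (at t)"
      using greater by (auto intro!: derivative_eq_intros simp: power2_eq_square)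
    have d2: "((\<lambda>t. poly p (1/t)) has_real_derivative poly (pderiv p) (1/t) * (- (1 / t\<^sup>2))) (at t)"
      by (rule DERIV_chain2[OF poly_DERIV d1])
    have d3: "((\<lambda>t. exp (- \<epsilon> / t)) has_real_derivative exp (- \<epsilon> / t) * (\<epsilon> / t\<^sup>2)) (at t)"
      using greater by (auto intro!: derivative_eq_intros simp: power2_eq_square)
    show ?thesis
      by (rule DERIV_cong[OF DERIV_mult[OF d2 d3]])
        (use greater in \<open>simp add: flat_def power2_eq_square algebra_simps\<close>)
  qed
  then show ?thesis
    by (rule has_field_derivative_transform_within_open[where S = "{0<..}"]) (use greater in \<open>auto simp: flat_def\<close>)
qed

text \<open>Smooth, positive exactly on (c, d), and converging to the indicator of that interval as
  \<epsilon> -> 0.\<close>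

definition bump :: "real \<Rightarrow> real \<Rightarrow> real \<Rightarrow> real \<Rightarrow> real" where
  "bump \<epsilon> c d t = flat \<epsilon> 1 (t - c) * flat \<epsilon> 1 (d - t)"

lemma bump_bounds: "\<epsilon> > 0 \<Longrightarrow> 0 \<le> bump \<epsilon> c d t" "\<epsilon> > 0 \<Longrightarrow> bump \<epsilon> c d t \<le> indicator {c<..<d} t"
proof -
  assume \<epsilon>: "\<epsilon> > 0"
  have f: "0 \<le> flat \<epsilon> 1 s \<and> flat \<epsilon> 1 s \<le> 1" for s using \<epsilon> by (simp add: flat_def)
  show "0 \<le> bump \<epsilon> c d t" unfolding bump_def using f by simp
  have "bump \<epsilon> c d t \<le> 1" unfolding bump_def using f by (simp add: mult_le_one)
  then show "bump \<epsilon> c d t \<le> indicator {c<..<d} t"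
    by (auto simp: indicator_def bump_def flat_def)
qed

lemma bump_pos: "c < t \<Longrightarrow> t < d \<Longrightarrow> bump \<epsilon> c d t > 0"
  by (simp add: bump_def flat_def)

lemma bump_outside: "t \<le> c \<or> d \<le> t \<Longrightarrow> bump \<epsilon> c d t = 0"
  by (auto simp: bump_def flat_def)

lemma bump_cont:
  assumes "\<epsilon> > 0" shows "continuous_on UNIV (bump \<epsilon> c d)"
proof -
  have "continuous_on UNIV (flat \<epsilon> 1)"
    using flat_DERIV[OF assms] by (auto intro!: continuous_at_imp_continuous_on DERIV_isCont)
  then have "continuous_on UNIV (\<lambda>t. flat \<epsilon> 1 (t - c))" "continuous_on UNIV (\<lambda>t. flat \<epsilon> 1 (d - t))"
    by (auto intro!: continuous_on_compose2[of UNIV "flat \<epsilon> 1"] continuous_intros)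
  then show ?thesis unfolding bump_def by (intro continuous_intros)
qed

lemma bump_tendsto:
  assumes "\<And>n. \<epsilon> n > (0::real)" "\<epsilon> \<longlonglongrightarrow> 0"
  shows "(\<lambda>n. bump (\<epsilon> n) c d t) \<longlonglongrightarrow> indicator {c<..<d} t"
proof (cases "c < t \<and> t < d")
  case True
  have "(\<lambda>n. exp (- \<epsilon> n / (t - c)) * exp (- \<epsilon> n / (d - t))) \<longlonglongrightarrow> exp (- 0 / (t - c)) * exp (- 0 / (d - t))"
    using True by (intro tendsto_intros assms) auto
  then show ?thesis using True by (simp add: bump_def flat_def)
next
  case False
  then have "bump (\<epsilon> n) c d t = 0" for n by (intro bump_outside) auto
  then show ?thesis using False by (auto simp: indicator_def)
qed

text \<open>Functions that are smooth on the positive half line: the algebra generated by powers,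
  shifted flat functions, and a given primitive \<open>Z\<close> of one of its members.\<close>

inductive_set pos_alg :: "(real \<Rightarrow> real) \<Rightarrow> (real \<Rightarrow> real) set" for Z where
  pos_alg_powr: "(\<lambda>t. t powr s) \<in> pos_alg Z"
| pos_alg_flat: "\<epsilon> > 0 \<Longrightarrow> (\<lambda>t. flat \<epsilon> p (\<alpha> * t + \<beta>)) \<in> pos_alg Z"
| pos_alg_prim: "Z \<in> pos_alg Z"
| pos_alg_const: "(\<lambda>t. k) \<in> pos_alg Z"
| pos_alg_add: "f \<in> pos_alg Z \<Longrightarrow> g \<in> pos_alg Z \<Longrightarrow> (\<lambda>t. f t + g t) \<in> pos_alg Z"
| pos_alg_mult: "f \<in> pos_alg Z \<Longrightarrow> g \<in> pos_alg Z \<Longrightarrow> (\<lambda>t. f t * g t) \<in> pos_alg Z"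

lemma pos_alg_DERIV:
  assumes z: "z \<in> pos_alg Z" "\<And>t. (Z has_real_derivative z t) (at t)" and f: "f \<in> pos_alg Z"
  shows "\<exists>f'\<in>pos_alg Z. \<forall>t>0. (f has_real_derivative f' t) (at t)"
  using f
proof induction
  case (pos_alg_powr s)
  show ?case
  proof (intro bexI allI impI)
    show "(\<lambda>t. s * t powr (s - 1)) \<in> pos_alg Z"
      by (intro pos_alg.intros)
    show "((\<lambda>t. t powr s) has_real_derivative s * t powr (s - 1)) (at t)" if "t > 0" for t
      using that by (rule has_real_derivative_powr)
  qed
next
  case (pos_alg_flat \<epsilon> p \<alpha> \<beta>)
  show ?case
  proof (intro bexI allI impI)
    show "(\<lambda>t. flat \<epsilon> ([:0, 0, 1:] * (smult \<epsilon> p - pderiv p)) (\<alpha> * t + \<beta>) * \<alpha>) \<in> pos_alg Z"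
      by (intro pos_alg.intros pos_alg_flat)
    show "((\<lambda>t. flat \<epsilon> p (\<alpha> * t + \<beta>)) has_real_derivative flat \<epsilon> ([:0, 0, 1:] * (smult \<epsilon> p - pderiv p)) (\<alpha> * t + \<beta>) * \<alpha>) (at t)" for t
      by (rule DERIV_chain2[OF flat_DERIV[OF pos_alg_flat]]) (auto intro!: derivative_eq_intros)
  qed
next
  case pos_alg_prim
  show ?case using z by blast
next
  case (pos_alg_const k)
  show ?case by (rule bexI[of _ "\<lambda>t. 0"]) (auto intro: pos_alg.intros)
next
  case (pos_alg_add f g)
  then obtain f' g' where *: "f' \<in> pos_alg Z" "g' \<in> pos_alg Z" "\<And>t. t > 0 \<Longrightarrow> (f has_real_derivative f' t) (at t)"
    "\<And>t. t > 0 \<Longrightarrow> (g has_real_derivative g' t) (at t)" by blast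
  then show ?case by (intro bexI[of _ "\<lambda>t. f' t + g' t"] allI impI DERIV_add pos_alg.pos_alg_add) auto
next
  case (pos_alg_mult f g)
  then obtain f' g' where *: "f' \<in> pos_alg Z" "g' \<in> pos_alg Z" "\<And>t. t > 0 \<Longrightarrow> (f has_real_derivative f' t) (at t)"
    "\<And>t. t > 0 \<Longrightarrow> (g has_real_derivative g' t) (at t)" by blast
  have "(\<lambda>t. f' t * g t + g' t * f t) \<in> pos_alg Z"
    by (intro pos_alg.pos_alg_add pos_alg.pos_alg_mult * pos_alg_mult.hyps)
  then show ?case using *(3,4) by (intro bexI[of _ "\<lambda>t. f' t * g t + g' t * f t"] allI impI DERIV_mult) auto
qed

section \<open>Smoothness of radial test functions\<close>

definition deriv_closed :: "(real \<Rightarrow> real) set \<Rightarrow> bool" where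
  "deriv_closed S \<longleftrightarrow> (\<forall>f\<in>S. \<exists>f'\<in>S. \<forall>t. (f has_real_derivative f' t) (at t))"

text \<open>Vanishing for t < c keeps the functions away from the singularity of powers at 0, so
  that membership in \<open>pos_alg\<close> on t > 0 yields differentiability on the whole line,
  with derivatives of the same kind.\<close>

lemma deriv_closed_pos_alg:
  assumes z: "z \<in> pos_alg Z" "\<And>t. (Z has_real_derivative z t) (at t)" and c: "c > 0"
  shows "deriv_closed {f. (\<forall>t<c. f t = 0) \<and> (\<exists>g\<in>pos_alg Z. \<forall>t>0. f t = g t)}"
  unfolding deriv_closed_def
proof
  fix f assume "f \<in> {f. (\<forall>t<c. f t = 0) \<and> (\<exists>g\<in>pos_alg Z. \<forall>t>0. f t = g t)}"
  then obtain g where f: "\<And>t. t < c \<Longrightarrow> f t = 0" and g: "g \<in> pos_alg Z" "\<And>t. t > 0 \<Longrightarrow> f t = g t" by blast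
  obtain g' where g': "g' \<in> pos_alg Z" "\<And>t. t > 0 \<Longrightarrow> (g has_real_derivative g' t) (at t)"
    using pos_alg_DERIV[OF z g(1)] by blast
  define f' where "f' t = (if t > 0 then g' t else 0)" for t
  have d: "(f has_real_derivative f' t) (at t)" for t
  proof (cases "t > 0")
    case True
    show ?thesis
      by (rule has_field_derivative_transform_within_open[where S = "{0<..}" and f = g])
         (use True g g'(2)[OF True] in \<open>auto simp: f'_def\<close>)
  next
    case False
    show ?thesis
      by (rule has_field_derivative_transform_within_open[where S = "{..<c}" and f = "\<lambda>t. 0"])
         (use False f c in \<open>auto simp: f'_def\<close>)
  qed
  have "f' t = 0" if t: "t < c" for t
  proof -
    have "(f has_real_derivative 0) (at t)"
      by (rule has_field_derivative_transform_within_open[where S = "{..<c}" and f = "\<lambda>t. 0"]) (use t f in auto)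
    then show ?thesis using d DERIV_unique by blast
  qed
  then have "f' \<in> {f. (\<forall>t<c. f t = 0) \<and> (\<exists>g\<in>pos_alg Z. \<forall>t>0. f t = g t)}"
    using g'(1) by (auto simp: f'_def)
  then show "\<exists>f'\<in>{f. (\<forall>t<c. f t = 0) \<and> (\<exists>g\<in>pos_alg Z. \<forall>t>0. f t = g t)}. \<forall>t. (f has_real_derivative f' t) (at t)"
    using d by blast
qed

text \<open>\<open>smooth_fun\<close> asks for a set closed under partial derivatives, and this
  algebra is that set. Composition is with |x|^2 rather than |x| to stay differentiable at the
  origin.\<close>

inductive_set rad_alg :: "(real \<Rightarrow> real) set \<Rightarrow> ('a::euclidean_space \<Rightarrow> real) set" for S where
  rad_alg_const: "(\<lambda>x. k) \<in> rad_alg S"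
| rad_alg_coord: "(\<lambda>x. x \<bullet> j) \<in> rad_alg S"
| rad_alg_comp: "f \<in> S \<Longrightarrow> (\<lambda>x. f (x \<bullet> x)) \<in> rad_alg S"
| rad_alg_add: "f \<in> rad_alg S \<Longrightarrow> g \<in> rad_alg S \<Longrightarrow> (\<lambda>x. f x + g x) \<in> rad_alg S"
| rad_alg_mult: "f \<in> rad_alg S \<Longrightarrow> g \<in> rad_alg S \<Longrightarrow> (\<lambda>x. f x * g x) \<in> rad_alg S"

lemma radial_comp_derivative:
  assumes "(f has_real_derivative f') (at (x \<bullet> x))"
  shows "((\<lambda>x::'a::euclidean_space. f (x \<bullet> x)) has_derivative (\<lambda>h. f' * (2 * (x \<bullet> h)))) (at x)"
proof -
  have "((\<lambda>x::'a. x \<bullet> x) has_derivative (\<lambda>h. 2 * (x \<bullet> h))) (at x)"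
    by (auto intro!: derivative_eq_intros simp: inner_commute)
  then show ?thesis
    using has_derivative_compose[of "\<lambda>x::'a. x \<bullet> x" _ x UNIV f "\<lambda>h. f' * h"] assms
    unfolding has_field_derivative_def by simp
qed

lemma rad_alg_derivative:
  assumes S: "deriv_closed S" and f: "(f :: 'a::euclidean_space \<Rightarrow> real) \<in> rad_alg S"
  shows "\<exists>f'. (\<forall>x. (f has_derivative f' x) (at x)) \<and> (\<forall>i. (\<lambda>x. f' x i) \<in> rad_alg S)"
  using f
proof induction
  case (rad_alg_const k)
  show ?case by (rule exI[of _ "\<lambda>x h. 0"]) (auto intro: rad_alg.intros)
next
  case (rad_alg_coord j)
  show ?case by (rule exI[of _ "\<lambda>x h. h \<bullet> j"]) (auto intro!: rad_alg.intros derivative_eq_intros)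
next
  case (rad_alg_comp f)
  then obtain f' where f': "f' \<in> S" "\<And>t. (f has_real_derivative f' t) (at t)" using S unfolding deriv_closed_def by blast
  show ?case
  proof (intro exI[of _ "\<lambda>x h. f' (x \<bullet> x) * (2 * (x \<bullet> h))"] conjI allI)
    show "((\<lambda>x. f (x \<bullet> x)) has_derivative (\<lambda>h. f' (x \<bullet> x) * (2 * (x \<bullet> h)))) (at x)" for x :: 'a
      by (rule radial_comp_derivative[OF f'(2)])
    show "(\<lambda>x::'a. f' (x \<bullet> x) * (2 * (x \<bullet> i))) \<in> rad_alg S" for i
      by (intro rad_alg.intros f')
  qed
next
  case (rad_alg_add f g)
  then obtain f' g' where *: "\<And>x. (f has_derivative f' x) (at x)" "\<And>i. (\<lambda>x. f' x i) \<in> rad_alg S"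
    "\<And>x. (g has_derivative g' x) (at x)" "\<And>i. (\<lambda>x. g' x i) \<in> rad_alg S" by blast
  show ?case
    by (intro exI[of _ "\<lambda>x h. f' x h + g' x h"] conjI allI has_derivative_add rad_alg.rad_alg_add *)
next
  case (rad_alg_mult f g)
  then obtain f' g' where *: "\<And>x. (f has_derivative f' x) (at x)" "\<And>i. (\<lambda>x. f' x i) \<in> rad_alg S"
    "\<And>x. (g has_derivative g' x) (at x)" "\<And>i. (\<lambda>x. g' x i) \<in> rad_alg S" by blast
  show ?case
    by (intro exI[of _ "\<lambda>x h. f x * g' x h + f' x h * g x"] conjI allI has_derivative_mult rad_alg.rad_alg_add rad_alg.rad_alg_mult * rad_alg_mult.hyps)
qed

lemma rad_alg_smooth:
  assumes S: "deriv_closed S" and f: "f \<in> rad_alg S"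
  shows "smooth_fun f"
  unfolding smooth_fun_def
proof (intro exI[of _ "rad_alg S"] conjI ballI allI f)
  fix g :: "'a \<Rightarrow> real" assume "g \<in> rad_alg S"
  then obtain g' where g': "\<And>x. (g has_derivative g' x) (at x)" "\<And>i. (\<lambda>x. g' x i) \<in> rad_alg S"
    using rad_alg_derivative[OF S] by blast
  show "g differentiable (at x)" for x using g'(1) differentiable_def by blast
  have "frechet_derivative g (at x) = g' x" for x using frechet_derivative_at[OF g'(1)] by simp
  then show "(\<lambda>x. frechet_derivative g (at x) i) \<in> rad_alg S" for i using g'(2) by simp
qed

text \<open>The field \<open>x Z(|x|\<^sup>2) / |x|\<^sup>N\<close> has divergence \<open>2 |x|\<^sup>2\<^sup>-\<^sup>N Z'(|x|\<^sup>2)\<close>.\<close>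

lemma radial_test_field:
  fixes Z z :: "real \<Rightarrow> real"
  assumes z: "z \<in> pos_alg Z" "\<And>t. (Z has_real_derivative z t) (at t)"
    and c: "0 < c" and Z0: "\<And>t. t \<le> c \<Longrightarrow> Z t = 0" "\<And>t. t \<ge> d \<Longrightarrow> Z t = 0"
  defines "\<eta> \<equiv> (\<lambda>t. if t > 0 then t powr (- real DIM('a::euclidean_space) / 2) * Z t else 0)"
  shows "i \<in> Basis \<Longrightarrow> test_fun (\<lambda>x::'a. (x \<bullet> i) * \<eta> (x \<bullet> x))"
    "(\<Sum>i\<in>Basis. frechet_derivative (\<lambda>x::'a. (x \<bullet> i) * \<eta> (x \<bullet> x)) (at x) i) = 2 * norm x powr (2 - real DIM('a)) * z ((norm x)\<^sup>2)"
proof -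
  define n where "n = real DIM('a)"
  define S where "S = {f. (\<forall>t<c. f t = 0) \<and> (\<exists>g\<in>pos_alg Z. \<forall>t>0. f t = g t)}"
  have S: "deriv_closed S" unfolding S_def by (rule deriv_closed_pos_alg[OF z c])
  have \<eta>S: "\<eta> \<in> S"
  proof -
    have "(\<lambda>t. t powr (- n / 2) * Z t) \<in> pos_alg Z" by (intro pos_alg.intros)
    then show ?thesis using Z0(1) unfolding S_def \<eta>_def n_def by auto
  qed
  then obtain \<eta>' where \<eta>': "\<eta>' \<in> S" "\<And>t. (\<eta> has_real_derivative \<eta>' t) (at t)" using S unfolding deriv_closed_def by blast
  show "test_fun (\<lambda>x::'a. (x \<bullet> i) * \<eta> (x \<bullet> x))" for i
    unfolding test_fun_def
  proof
    have "(\<lambda>x::'a. (x \<bullet> i) * \<eta> (x \<bullet> x)) \<in> rad_alg S" by (intro rad_alg.intros \<eta>S)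
    then show "smooth_fun (\<lambda>x::'a. (x \<bullet> i) * \<eta> (x \<bullet> x))" by (rule rad_alg_smooth[OF S])
    have "{x::'a. (x \<bullet> i) * \<eta> (x \<bullet> x) \<noteq> 0} \<subseteq> cball 0 (sqrt \<bar>d\<bar>)"
    proof
      fix x :: 'a assume "x \<in> {x. (x \<bullet> i) * \<eta> (x \<bullet> x) \<noteq> 0}"
      then have "\<not> x \<bullet> x \<ge> d" using Z0(2)[of "x \<bullet> x"] by (auto simp: \<eta>_def split: if_splits)
      then have "norm x \<le> sqrt \<bar>d\<bar>" by (simp add: norm_eq_sqrt_inner)
      then show "x \<in> cball 0 (sqrt \<bar>d\<bar>)" by simp
    qed
    then show "bounded {x::'a. (x \<bullet> i) * \<eta> (x \<bullet> x) \<noteq> 0}" using bounded_cball bounded_subset by blast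
  qed
  have fd: "frechet_derivative (\<lambda>x::'a. (x \<bullet> i) * \<eta> (x \<bullet> x)) (at x) i = \<eta> (x \<bullet> x) + 2 * (x \<bullet> i)\<^sup>2 * \<eta>' (x \<bullet> x)" if i: "i \<in> Basis" for i
  proof -
    have "((\<lambda>x::'a. (x \<bullet> i) * \<eta> (x \<bullet> x)) has_derivative (\<lambda>h. (x \<bullet> i) * (\<eta>' (x \<bullet> x) * (2 * (x \<bullet> h))) + (h \<bullet> i) * \<eta> (x \<bullet> x))) (at x)"
      by (intro has_derivative_mult radial_comp_derivative \<eta>') (auto intro!: derivative_eq_intros)
    from frechet_derivative_at[OF this, symmetric]
    show ?thesis using i by (simp add: power2_eq_square algebra_simps)
  qed
  have sumsq: "(\<Sum>i\<in>Basis. (x \<bullet> i)\<^sup>2) = x \<bullet> x"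
    by (simp add: euclidean_inner[of x x] power2_eq_square)
  have "(\<Sum>i\<in>Basis. frechet_derivative (\<lambda>x::'a. (x \<bullet> i) * \<eta> (x \<bullet> x)) (at x) i)
      = (\<Sum>i\<in>(Basis::'a set). \<eta> (x \<bullet> x) + 2 * (x \<bullet> i)\<^sup>2 * \<eta>' (x \<bullet> x))"
    by (rule sum.cong[OF refl fd])
  also have "\<dots> = n * \<eta> (x \<bullet> x) + 2 * (x \<bullet> x) * \<eta>' (x \<bullet> x)"
    by (simp add: sum.distrib sum_distrib_right[symmetric] sum_distrib_left[symmetric] sumsq n_def)
  also have "\<dots> = 2 * norm x powr (2 - n) * z ((norm x)\<^sup>2)"
  proof (cases "x = 0")
    case True
    then show ?thesis by (simp add: \<eta>_def)
  next
    case False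
    define t where "t = x \<bullet> x"
    have t: "t > 0" using False by (simp add: t_def)
    have nt: "norm x = t powr (1/2)" using t by (simp add: t_def norm_eq_sqrt_inner powr_half_sqrt)
    have "((\<lambda>t. t powr (- n / 2) * Z t) has_real_derivative (- n / 2) * t powr (- n / 2 - 1) * Z t + z t * t powr (- n / 2)) (at t)"
      by (intro DERIV_mult has_real_derivative_powr t z(2))
    moreover have "((\<lambda>t. t powr (- n / 2) * Z t) has_real_derivative \<eta>' t) (at t)"
      by (rule has_field_derivative_transform_within_open[OF \<eta>'(2), where S = "{0<..}"]) (use t in \<open>auto simp: \<eta>_def n_def\<close>)
    \<comment> \<open>The derivative of t^(-n/2) contributes exactly - n times \<eta> to the
      divergence and cancels the term coming from the coordinates; only the derivative of Z
      survives.\<close>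
    ultimately have e: "\<eta>' t = (- n / 2) * t powr (- n / 2 - 1) * Z t + z t * t powr (- n / 2)"
      using DERIV_unique by blast
    have p: "t * t powr (- n / 2 - 1) = t powr (- n / 2)"
      using t by (simp add: powr_diff)
    have "n * \<eta> t + 2 * t * \<eta>' t = n * (t powr (- n / 2) * Z t) + 2 * ((- n / 2) * (t * t powr (- n / 2 - 1)) * Z t + t * (z t * t powr (- n / 2)))"
      unfolding e using t by (simp add: \<eta>_def n_def algebra_simps)
    also have "\<dots> = 2 * (t * t powr (- n / 2)) * z t" unfolding p by simp
    also have "t * t powr (- n / 2) = t powr (1 + - n / 2)" using t by (simp only: powr_add powr_one)
    also have "\<dots> = norm x powr (2 - n)" unfolding nt powr_powr by (rule arg_cong[where f = "(powr) t"]) (simp add: field_simps)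
    finally show ?thesis by (simp add: t_def power2_norm_eq_inner)
  qed
  finally show "(\<Sum>i\<in>Basis. frechet_derivative (\<lambda>x::'a. (x \<bullet> i) * \<eta> (x \<bullet> x)) (at x) i) = 2 * norm x powr (2 - real DIM('a)) * z ((norm x)\<^sup>2)"
    by (simp add: n_def)
qed

section \<open>Radial Sobolev functions from profiles\<close>

definition rad_fun :: "l2 \<Rightarrow> 'a::euclidean_space \<Rightarrow> real" where
  "rad_fun g x = profile (real DIM('a)) g (norm x)"

text \<open>Undoes the factor r^((N-1)/2), so this is the derivative w' of the profile.\<close>

definition rad_deriv :: "real \<Rightarrow> l2 \<Rightarrow> real \<Rightarrow> real" where
  "rad_deriv N g r = fn g r * r powr (-(N-1)/2)"

definition rad_grad :: "l2 \<Rightarrow> 'a::euclidean_space \<Rightarrow> 'a" where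
  "rad_grad g x = (rad_deriv (real DIM('a)) g (norm x) / norm x) *\<^sub>R x"

lemma test_fun_facts:
  fixes \<phi> :: "'a::euclidean_space \<Rightarrow> real"
  assumes \<phi>: "test_fun \<phi>" and i: "i \<in> Basis"
  shows "\<exists>B R. B \<ge> 0 \<and> R \<ge> 0 \<and> (\<forall>x. \<bar>\<phi> x\<bar> \<le> B * indicator (cball 0 R) x)
      \<and> (\<forall>x. \<bar>frechet_derivative \<phi> (at x) i\<bar> \<le> B * indicator (cball 0 R) x)"
    "\<phi> \<in> borel_measurable borel" "(\<lambda>x. frechet_derivative \<phi> (at x) i) \<in> borel_measurable borel"
    "\<And>x. ((\<lambda>t. \<phi> (x + t *\<^sub>R i)) has_real_derivative frechet_derivative \<phi> (at (x + s *\<^sub>R i)) i) (at s)"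
proof -
  let ?d = "\<lambda>x. frechet_derivative \<phi> (at x) i"
  obtain S where S: "\<phi> \<in> S" "\<And>\<psi> x. \<psi> \<in> S \<Longrightarrow> \<psi> differentiable (at x)"
    "\<And>\<psi> i. \<psi> \<in> S \<Longrightarrow> i \<in> Basis \<Longrightarrow> (\<lambda>x. frechet_derivative \<psi> (at x) i) \<in> S"
    using \<phi> unfolding test_fun_def smooth_fun_def by blast
  have cont: "continuous_on UNIV \<psi>" if "\<psi> \<in> S" for \<psi>
    using S(2)[OF that] by (auto intro!: continuous_at_imp_continuous_on differentiable_imp_continuous_within)
  have c: "continuous_on UNIV \<phi>" "continuous_on UNIV ?d" using cont S(1,3) i by blast+
  then show "\<phi> \<in> borel_measurable borel" "?d \<in> borel_measurable borel"
    by (auto intro: borel_measurable_continuous_onI)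
  obtain R0 where R0: "\<And>x. \<phi> x \<noteq> 0 \<Longrightarrow> norm x \<le> R0" using \<phi> unfolding test_fun_def bounded_iff by auto
  define R where "R = max 0 R0"
  have R: "R \<ge> 0" "\<And>x. norm x > R \<Longrightarrow> \<phi> x = 0" using R0 by (force simp: R_def)+
  have d0: "?d x = 0" if x: "norm x > R" for x
  proof -
    have "(\<phi> has_derivative (\<lambda>h. 0)) (at x)"
    proof (rule has_derivative_transform_within_open[of "\<lambda>x. 0" _ x UNIV "- cball 0 R"])
      show "open (- cball 0 R :: 'a set)" by auto
    qed (use x R in auto)
    from frechet_derivative_at[OF this, symmetric] show ?thesis by simp
  qed
  have "bounded (\<phi> ` cball 0 R)" "bounded (?d ` cball 0 R)"
    by (intro compact_imp_bounded compact_continuous_image continuous_on_subset[OF c(1)] continuous_on_subset[OF c(2)]; simp)+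
  then obtain B1 B2 where B: "\<And>x. x \<in> cball 0 R \<Longrightarrow> \<bar>\<phi> x\<bar> \<le> B1" "\<And>x. x \<in> cball 0 R \<Longrightarrow> \<bar>?d x\<bar> \<le> B2"
    unfolding bounded_iff by (metis imageI real_norm_def)
  define B where "B = max 0 (max B1 B2)"
  have "\<bar>\<phi> x\<bar> \<le> B * indicator (cball 0 R) x" "\<bar>?d x\<bar> \<le> B * indicator (cball 0 R) x" for x
    using B(1)[of x] B(2)[of x] R(2)[of x] d0[of x] by (cases "x \<in> cball 0 R"; force simp: B_def)+
  moreover have "B \<ge> 0" by (simp add: B_def)
  ultimately show "\<exists>B R. B \<ge> 0 \<and> R \<ge> 0 \<and> (\<forall>x. \<bar>\<phi> x\<bar> \<le> B * indicator (cball 0 R) x)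
      \<and> (\<forall>x. \<bar>?d x\<bar> \<le> B * indicator (cball 0 R) x)" using R(1) by blast
  fix x
  have "(\<phi> has_derivative frechet_derivative \<phi> (at (x + s *\<^sub>R i))) (at (x + s *\<^sub>R i))"
    using S(1,2) frechet_derivative_works by blast
  moreover have "((\<lambda>t. x + t *\<^sub>R i) has_derivative (\<lambda>t. t *\<^sub>R i)) (at s)"
    by (auto intro!: derivative_eq_intros)
  ultimately have "((\<lambda>t. \<phi> (x + t *\<^sub>R i)) has_derivative (\<lambda>t. frechet_derivative \<phi> (at (x + s *\<^sub>R i)) (t *\<^sub>R i))) (at s)"
    by (rule has_derivative_compose[rotated])
  moreover have "frechet_derivative \<phi> (at (x + s *\<^sub>R i)) (t *\<^sub>R i) = ?d (x + s *\<^sub>R i) * t" for t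
    using linear_frechet_derivative[OF S(2)[OF S(1)]] by (simp add: linear_cmul)
  ultimately show "((\<lambda>t. \<phi> (x + t *\<^sub>R i)) has_real_derivative ?d (x + s *\<^sub>R i)) (at s)"
    unfolding has_field_derivative_def by simp
qed

text \<open>\<open>N\<close>, \<open>cN\<close> and \<open>pd\<close> are parameters tied to the
  dimension by equations, so that the real number \<open>N\<close> can be identified with that of
  \<open>radial_problem\<close> when the two locales are merged.\<close>

locale dim3 =
  fixes dummy :: "'a::euclidean_space itself" and N cN :: real and pd :: "real \<Rightarrow> real"
  assumes dim: "DIM('a) \<ge> 3" and N_def: "N = real DIM('a)"
    and cN_def: "cN = sphere_const TYPE('a)" and pd_def: "pd = polar_density TYPE('a)"
begin

lemma N3: "N \<ge> 3" using dim by (simp add: N_def)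

lemma cN_pos: "cN > 0" unfolding cN_def by (rule sphere_const_pos)

lemma pd_eq: "pd r = (if r > 0 then cN * r powr (N-1) else 0)"
  by (simp add: polar_density_def N_def cN_def pd_def)

lemma pd_nonneg: "pd r \<ge> 0" unfolding pd_def by (rule polar_density_nonneg)

lemma pd_meas [measurable]: "pd \<in> borel_measurable borel" unfolding pd_def by measurable

lemmas polar_nn = polar_nn_integral[where 'a='a, folded pd_def]
lemmas polar_int = polar_integral[where 'a='a, folded pd_def]

lemma rad_fun_meas [measurable]: "(rad_fun g :: 'a \<Rightarrow> real) \<in> borel_measurable borel"
proof -
  have [measurable]: "profile (real DIM('a)) g \<in> borel_measurable borel" using profile_meas[OF N3] by (simp add: N_def)
  show ?thesis unfolding rad_fun_def by measurable
qed

lemma rad_deriv_meas [measurable]: "rad_deriv N g \<in> borel_measurable borel"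
  unfolding rad_deriv_def by measurable

lemma rad_grad_eq: "rad_grad g (x::'a) = (rad_deriv N g (norm x) / norm x) *\<^sub>R x"
  by (simp add: rad_grad_def N_def)

lemma rad_grad_meas [measurable]: "(rad_grad g :: 'a \<Rightarrow> 'a) \<in> borel_measurable borel"
  unfolding rad_grad_eq[abs_def] by measurable

lemma rad_fun_eq: "rad_fun g (x::'a) = profile N g (norm x)"
  by (simp add: rad_fun_def N_def)

lemma rad_fun_add: "rad_fun (g + h) (x::'a) = rad_fun g x + rad_fun h x"
  by (simp add: rad_fun_eq profile_add)

lemma rad_fun_scale: "rad_fun (c *\<^sub>R g) (x::'a) = c * rad_fun g x"
  by (simp add: rad_fun_eq profile_scale)

lemma rad_grad_norm: "norm (rad_grad g (x::'a)) \<le> \<bar>rad_deriv N g (norm x)\<bar>"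
  unfolding rad_grad_eq by (cases "x = 0") auto

text \<open>The order of quantifiers matters: C does not depend on g, so pairing with a fixed \<psi>
  is a bounded functional of g. In polar coordinates \<open>profile_bound\<close> leaves r^(N-1)
  r^(-(N-2)/2) = r^(N/2), integrable near 0.\<close>

lemma rad_fun_test_bound:
  assumes B: "B \<ge> 0" "R \<ge> 0"
  shows "\<exists>C\<ge>0. \<forall>\<psi>::'a \<Rightarrow> real. \<psi> \<in> borel_measurable borel \<longrightarrow> (\<forall>x. \<bar>\<psi> x\<bar> \<le> B * indicator (cball 0 R) x) \<longrightarrow>
    (\<forall>g. integrable lborel (\<lambda>x. rad_fun g x * \<psi> x) \<and> \<bar>\<integral>x. rad_fun g x * \<psi> x \<partial>lborel\<bar> \<le> C * norm g)"
proof -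
  define F where "F r = r powr (-(N-2)/2) * (B * indicator {..R} r)" for r :: real
  have [measurable]: "F \<in> borel_measurable borel" unfolding F_def by measurable
  have F0: "F r \<ge> 0" for r using B by (simp add: F_def)
  have "(\<integral>\<^sup>+x. ennreal (F (norm x)) \<partial>(lborel :: 'a measure)) = (\<integral>\<^sup>+r. ennreal (pd r) * ennreal (F r) \<partial>lborel)"
    by (rule polar_nn) measurable
  also have "\<dots> \<le> (\<integral>\<^sup>+r. ennreal (cN * B) * (ennreal (r powr (N/2)) * indicator {0..R} r) \<partial>lborel)"
  proof (rule nn_integral_mono)
    fix r :: real
    have e: "r powr (N-1) * r powr (-(N-2)/2) = r powr (N/2)"
      unfolding powr_add[symmetric] by (rule arg_cong[where f = "(powr) r"]) (simp add: field_simps)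
    show "ennreal (pd r) * ennreal (F r) \<le> ennreal (cN * B) * (ennreal (r powr (N/2)) * indicator {0..R} r)"
    proof (cases "0 < r \<and> r \<le> R")
      case True
      then have "pd r * F r = cN * B * (r powr (N-1) * r powr (-(N-2)/2))" by (simp add: pd_eq F_def)
      then have "ennreal (pd r) * ennreal (F r) = ennreal (cN * B * r powr (N/2))"
        unfolding e using F0 pd_nonneg by (simp add: ennreal_mult[symmetric])
      then show ?thesis using True B cN_pos by (simp add: ennreal_mult[symmetric])
    next
      case False
      then show ?thesis by (auto simp: pd_eq F_def)
    qed
  qed
  also have "\<dots> = ennreal (cN * B) * ennreal (R powr (N/2 + 1) / (N/2 + 1))"
    by (subst nn_integral_cmult, measurable) (use nn_integral_powr_head[of "N/2" R] N3 B in simp)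
  also have "\<dots> < \<infinity>" by (simp add: ennreal_mult_less_top)
  finally have F_int: "integrable lborel (\<lambda>x::'a. F (norm x))"
    by (intro integrableI_nonneg) (auto simp: F0)
  define C where "C = (\<integral>x. F (norm x) \<partial>(lborel :: 'a measure))"
  have C: "C \<ge> 0" unfolding C_def by (intro integral_nonneg_AE AE_I2 F0)
  have "integrable lborel (\<lambda>x. rad_fun g x * \<psi> x) \<and> \<bar>\<integral>x. rad_fun g x * \<psi> x \<partial>lborel\<bar> \<le> C * norm g"
    if \<psi>: "\<psi> \<in> borel_measurable borel" "\<forall>x. \<bar>\<psi> x\<bar> \<le> B * indicator (cball 0 R) x" for \<psi> :: "'a \<Rightarrow> real" and g
  proof -
    have [measurable]: "\<psi> \<in> borel_measurable borel" by fact
    have bd: "AE x in lborel. norm (rad_fun g (x::'a) * \<psi> x) \<le> norm g * F (norm x)"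
    proof -
      have "AE x in lborel. x \<noteq> (0::'a)" by (rule AE_lborel_singleton)
      then show ?thesis
      proof eventually_elim
        case (elim x)
        have "\<bar>rad_fun g x\<bar> \<le> norm x powr (-(N-2)/2) * norm g"
          unfolding rad_fun_eq using elim by (intro profile_bound[OF N3]) simp
        moreover have "\<bar>\<psi> x\<bar> \<le> B * indicator {..R} (norm x)" using \<psi>(2)[rule_format, of x] by (simp add: indicator_def)
        ultimately have "\<bar>rad_fun g x\<bar> * \<bar>\<psi> x\<bar> \<le> (norm x powr (-(N-2)/2) * norm g) * (B * indicator {..R} (norm x))"
          by (intro mult_mono) auto
        then show ?case by (simp add: F_def abs_mult ac_simps)
      qed
    qed
    have int: "integrable lborel (\<lambda>x. norm g * F (norm (x::'a)))" by (intro integrable_mult_right F_int)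
    have i: "integrable lborel (\<lambda>x. rad_fun g x * \<psi> x)"
      by (rule Bochner_Integration.integrable_bound[OF int]) (measurable, use bd F0 in \<open>auto elim!: eventually_mono\<close>)
    have "\<bar>\<integral>x. rad_fun g x * \<psi> x \<partial>lborel\<bar> \<le> (\<integral>x. norm g * F (norm x) \<partial>(lborel :: 'a measure))"
      unfolding real_norm_def[symmetric]
      by (rule order_trans[OF integral_norm_bound integral_mono_AE]) (use i int bd in auto)
    then show ?thesis using i by (simp add: C_def mult.commute)
  qed
  then show ?thesis using C by blast
qed

lemma rad_grad_test_bound:
  assumes B: "B \<ge> 0" "R \<ge> 0" and i: "i \<in> (Basis :: 'a set)"
  shows "\<exists>C\<ge>0. \<forall>\<psi>::'a \<Rightarrow> real. \<psi> \<in> borel_measurable borel \<longrightarrow> (\<forall>x. \<bar>\<psi> x\<bar> \<le> B * indicator (cball 0 R) x) \<longrightarrow>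
    (\<forall>g. integrable lborel (\<lambda>x. (rad_grad g x \<bullet> i) * \<psi> x) \<and> \<bar>\<integral>x. (rad_grad g x \<bullet> i) * \<psi> x \<partial>lborel\<bar> \<le> C * norm g)"
proof -
  define k where "k r = indicator {0<..R} r * r powr ((N-1)/2)" for r :: real
  have k_meas [measurable]: "k \<in> borel_measurable borel" unfolding k_def by measurable
  have k_sq: "sqint k"
  proof (rule sqint_nn(1)[OF k_meas])
    have "(\<integral>\<^sup>+s. ennreal ((k s)\<^sup>2) \<partial>lborel) \<le> (\<integral>\<^sup>+s. ennreal (s powr (N-1)) * indicator {0..R} s \<partial>lborel)"
      by (rule nn_integral_mono) (auto simp: k_def indicator_def power2_eq_square powr_add[symmetric])
    also have "\<dots> = ennreal (R powr (N - 1 + 1) / (N - 1 + 1))"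
      by (rule nn_integral_powr_head) (use N3 B in auto)
    finally show "(\<integral>\<^sup>+s. ennreal ((k s)\<^sup>2) \<partial>lborel) \<le> ennreal (R powr (N - 1 + 1) / (N - 1 + 1))" .
  qed (use N3 in simp)
  define C where "C = B * cN * norm (mk k)"
  have C: "C \<ge> 0" using B cN_pos by (simp add: C_def)
  have "integrable lborel (\<lambda>x. (rad_grad g x \<bullet> i) * \<psi> x) \<and> \<bar>\<integral>x. (rad_grad g x \<bullet> i) * \<psi> x \<partial>lborel\<bar> \<le> C * norm g"
    if \<psi>: "\<psi> \<in> borel_measurable borel" "\<forall>x. \<bar>\<psi> x\<bar> \<le> B * indicator (cball 0 R) x" for \<psi> :: "'a \<Rightarrow> real" and g
  proof -
    have [measurable]: "\<psi> \<in> borel_measurable borel" by fact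
    define F where "F r = B * (indicator {..R} r * \<bar>rad_deriv N g r\<bar>)" for r
    have [measurable]: "F \<in> borel_measurable borel" unfolding F_def by measurable
    have F0: "F r \<ge> 0" for r using B by (simp add: F_def)
    have pF: "(\<lambda>r. pd r * F r) = (\<lambda>r. (B * cN) * (\<bar>k r\<bar> * \<bar>fn g r\<bar>))"
    proof
      fix r
      show "pd r * F r = (B * cN) * (\<bar>k r\<bar> * \<bar>fn g r\<bar>)"
      proof (cases "0 < r \<and> r \<le> R")
        case True
        have e: "r powr (N-1) * r powr (-(N-1)/2) = r powr ((N-1)/2)"
          unfolding powr_add[symmetric] by (rule arg_cong[where f = "(powr) r"]) (simp add: field_simps)
        have "pd r * F r = B * cN * ((r powr (N-1) * r powr (-(N-1)/2)) * \<bar>fn g r\<bar>)"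
          using True by (simp add: pd_eq F_def rad_deriv_def abs_mult)
        then show ?thesis unfolding e using True by (simp add: k_def)
      qed (auto simp: pd_eq F_def k_def)
    qed
    note cs = sqint_cauchy_schwarz[OF k_sq sqint_fn[of g]]
    have F_int: "integrable lborel (\<lambda>x::'a. F (norm x))"
      by (subst polar_int(1)) (simp, unfold pF, intro integrable_mult_right cs)
    have "(\<integral>x. F (norm x) \<partial>(lborel :: 'a measure)) = (\<integral>r. pd r * F r \<partial>lborel)"
      by (rule polar_int(2)) simp
    also have "\<dots> = B * cN * (\<integral>r. \<bar>k r\<bar> * \<bar>fn g r\<bar> \<partial>lborel)" unfolding pF by simp
    also have "\<dots> \<le> B * cN * (norm (mk k) * norm (mk (fn g)))"
      using B cN_pos by (intro mult_left_mono cs) auto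
    finally have F_le: "(\<integral>x. F (norm x) \<partial>(lborel :: 'a measure)) \<le> C * norm g" by (simp add: C_def mk_fn)
    have bd: "norm ((rad_grad g x \<bullet> i) * \<psi> x) \<le> F (norm x)" for x :: 'a
    proof -
      have "\<bar>rad_grad g x \<bullet> i\<bar> \<le> \<bar>rad_deriv N g (norm x)\<bar>"
        using Basis_le_norm[OF i, of "rad_grad g x"] rad_grad_norm[of g x] by linarith
      moreover have "\<bar>\<psi> x\<bar> \<le> B * indicator {..R} (norm x)" using \<psi>(2)[rule_format, of x] by (simp add: indicator_def)
      ultimately have "\<bar>rad_grad g x \<bullet> i\<bar> * \<bar>\<psi> x\<bar> \<le> \<bar>rad_deriv N g (norm x)\<bar> * (B * indicator {..R} (norm x))"
        by (intro mult_mono) auto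
      then show ?thesis by (simp add: F_def abs_mult ac_simps)
    qed
    have i': "integrable lborel (\<lambda>x. (rad_grad g x \<bullet> i) * \<psi> x)"
      by (rule Bochner_Integration.integrable_bound[OF F_int]) (measurable, use order_trans[OF bd abs_ge_self] in \<open>auto intro!: AE_I2\<close>)
    have "\<bar>\<integral>x. (rad_grad g x \<bullet> i) * \<psi> x \<partial>lborel\<bar> \<le> (\<integral>x. F (norm x) \<partial>(lborel :: 'a measure))"
      unfolding real_norm_def[symmetric]
      by (rule Bochner_Integration.integral_norm_bound_integral[OF i' F_int]) (rule bd)
    then show ?thesis using i' F_le by linarith
  qed
  then show ?thesis using C by blast
qed

lemma rad_grad_AE_cong:
  assumes "AE r in lborel. r > 0 \<longrightarrow> fn g r = v r"
  shows "AE x in lborel. rad_grad g (x::'a) = (v (norm x) * norm x powr (-(N-1)/2) / norm x) *\<^sub>R x"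
proof -
  have "AE x in lborel. fn g (norm (x::'a)) = v (norm x)" by (rule polar_AE) (use assms in auto)
  then show ?thesis by eventually_elim (simp add: rad_grad_eq rad_deriv_def)
qed

text \<open>Its profile is piecewise linear, constant outside [c, d] and 0 beyond d. Pairing with
  ramps yields weighted integrals over intervals, so ramps determine an element on the positive half
  line.\<close>

definition ramp :: "real \<Rightarrow> real \<Rightarrow> real \<Rightarrow> real" where
  "ramp c d r = indicator {c<..<d} r * r powr ((N-1)/2)"

lemma ramp_sqint:
  assumes "0 < c" "c < d"
  shows "sqint (ramp c d)"
proof (rule sqint_nn(1))
  show "ramp c d \<in> borel_measurable borel" unfolding ramp_def by measurable
  have "(\<integral>\<^sup>+s. ennreal ((ramp c d s)\<^sup>2) \<partial>lborel) \<le> (\<integral>\<^sup>+s. ennreal (s powr (N-1)) * indicator {0..d} s \<partial>lborel)"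
    by (rule nn_integral_mono) (use assms in \<open>auto simp: ramp_def indicator_def power2_eq_square powr_add[symmetric]\<close>)
  also have "\<dots> = ennreal (d powr (N - 1 + 1) / (N - 1 + 1))"
    by (rule nn_integral_powr_head) (use N3 assms in auto)
  finally show "(\<integral>\<^sup>+s. ennreal ((ramp c d s)\<^sup>2) \<partial>lborel) \<le> ennreal (d powr (N - 1 + 1) / (N - 1 + 1))" .
qed (use N3 in simp)

lemma profile_ramp:
  assumes cd: "0 < c" "c < d" and r: "r > 0"
  shows "profile N (mk (ramp c d)) r = max c (min r d) - d"
proof -
  have ks: "sqint (tail_kernel (-(N-1)/2) r)" by (rule tail_kernel_sqint(1)) (use N3 r in auto)
  have "profile N (mk (ramp c d)) r = - (\<integral>s. tail_kernel (-(N-1)/2) r s * ramp c d s \<partial>lborel)"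
    using r inner_mk[OF ks ramp_sqint[OF cd]] unfolding profile_def by simp
  also have "(\<integral>s. tail_kernel (-(N-1)/2) r s * ramp c d s \<partial>lborel) = (\<integral>s. indicator {max r c..<d} s \<partial>lborel)"
  proof (rule integral_cong_AE)
    have "AE s in lborel. s \<noteq> c" by (rule AE_lborel_singleton)
    then show "AE s in lborel. tail_kernel (-(N-1)/2) r s * ramp c d s = indicator {max r c..<d} s"
    proof eventually_elim
      case (elim s)
      show ?case
      proof (cases "s \<ge> r \<and> s > 0")
        case True
        have "s powr (-(N-1)/2) * s powr ((N-1)/2) = 1"
          unfolding powr_add[symmetric] minus_divide_left[symmetric] using True by simp
        then show ?thesis using True elim by (auto simp: tail_kernel_def ramp_def indicator_def)
      qed (use r in \<open>auto simp: tail_kernel_def indicator_def\<close>)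
    qed
  qed (auto simp: ramp_def)
  also have "\<dots> = max 0 (d - max r c)"
    by (cases "max r c \<le> d") auto
  finally show ?thesis using cd by (auto simp: max_def min_def)
qed

text \<open>A ramp is a Lipschitz function of |x|, differentiable off the origin and the spheres |x|
  = c and |x| = d. These are null sets, so \<open>integral_derivative_zero\<close> applies to its
  product with \<phi>.\<close>

lemma weak_grad_ramp:
  assumes cd: "0 < c" "c < d" and \<phi>: "test_fun (\<phi> :: 'a \<Rightarrow> real)" and i: "i \<in> Basis"
  shows "(\<integral>x. rad_fun (mk (ramp c d)) x * frechet_derivative \<phi> (at x) i \<partial>lborel)
       + (\<integral>x. (rad_grad (mk (ramp c d)) x \<bullet> i) * \<phi> x \<partial>lborel) = 0"
proof -
  let ?d = "\<lambda>x. frechet_derivative \<phi> (at x) i"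
  let ?g = "mk (ramp c d)"
  note tf = test_fun_facts[OF \<phi> i]
  have [measurable]: "\<phi> \<in> borel_measurable borel" "?d \<in> borel_measurable borel" using tf(2,3) .
  obtain B R where BR: "B \<ge> 0" "R \<ge> 0" "\<And>x. \<bar>\<phi> x\<bar> \<le> B * indicator (cball 0 R) x" "\<And>x. \<bar>?d x\<bar> \<le> B * indicator (cball 0 R) x"
    using tf(1) by blast
  define W where "W r = max c (min r d) - d" for r
  define F where "F x = W (norm x) * \<phi> x" for x
  define f where "f x = W (norm x) * ?d x + (indicator {c<..<d} (norm x) / norm x * (x \<bullet> i)) * \<phi> x" for x
  have [measurable]: "W \<in> borel_measurable borel" unfolding W_def by measurable
  have W_bd: "\<bar>W r\<bar> \<le> d" for r using cd by (auto simp: W_def max_def min_def)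
  have W_lip: "\<bar>W r - W s\<bar> \<le> \<bar>r - s\<bar>" for r s by (auto simp: W_def max_def min_def)
  have \<phi>_bd: "\<bar>\<phi> x\<bar> \<le> B" and d_bd: "\<bar>?d x\<bar> \<le> B" for x
  proof -
    have "B * indicator (cball 0 R) x \<le> B" using BR(1) by (auto simp: indicator_def)
    then show "\<bar>\<phi> x\<bar> \<le> B" "\<bar>?d x\<bar> \<le> B" using BR(3)[of x] BR(4)[of x] by linarith+
  qed
  have ni: "norm i = 1" using i by simp
  have F_int: "integrable lborel F"
  proof (rule Bochner_Integration.integrable_bound)
    show "integrable lborel (\<lambda>x. (d * B) * indicator (cball 0 R) x :: real)"
      by (intro integrable_mult_right integrable_real_indicator) (use emeasure_bounded_finite[OF bounded_cball[of 0 R]] in auto)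
    show "AE x in lborel. norm (F x) \<le> norm ((d * B) * indicator (cball 0 R) x :: real)"
    proof (rule AE_I2)
      fix x
      have "\<bar>F x\<bar> \<le> d * (B * indicator (cball 0 R) x)"
        unfolding F_def abs_mult using cd by (intro mult_mono W_bd BR(3)) auto
      then show "norm (F x) \<le> norm ((d * B) * indicator (cball 0 R) x :: real)" using cd BR(1) by simp
    qed
  qed (unfold F_def, measurable)
  have f_meas: "f \<in> borel_measurable borel" unfolding f_def by measurable
  have lip: "\<bar>F (x + t *\<^sub>R i) - F x\<bar> \<le> t * ((d * B + B) * indicator (cball 0 (R+1)) x)" if t: "0 < t" "t \<le> 1" for x t
  proof (cases "x \<in> cball 0 (R+1)")
    case True
    have "\<exists>z. 0 < z \<and> z < t \<and> \<phi> (x + t *\<^sub>R i) - \<phi> (x + 0 *\<^sub>R i) = (t - 0) * ?d (x + z *\<^sub>R i)"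
      using MVT2[OF t(1) tf(4)] by blast
    then obtain z where "\<phi> (x + t *\<^sub>R i) - \<phi> x = t * ?d (x + z *\<^sub>R i)" by auto
    then have p: "\<bar>\<phi> (x + t *\<^sub>R i) - \<phi> x\<bar> \<le> t * B" using t d_bd by (simp add: abs_mult)
    have "\<bar>norm (x + t *\<^sub>R i) - norm x\<bar> \<le> t" using norm_triangle_ineq3[of "x + t *\<^sub>R i" x] t ni by simp
    then have w: "\<bar>W (norm (x + t *\<^sub>R i)) - W (norm x)\<bar> \<le> t" using W_lip order_trans by blast
    have "F (x + t *\<^sub>R i) - F x = W (norm (x + t *\<^sub>R i)) * (\<phi> (x + t *\<^sub>R i) - \<phi> x) + (W (norm (x + t *\<^sub>R i)) - W (norm x)) * \<phi> x"
      by (simp add: F_def algebra_simps)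
    then have "\<bar>F (x + t *\<^sub>R i) - F x\<bar> \<le> \<bar>W (norm (x + t *\<^sub>R i))\<bar> * \<bar>\<phi> (x + t *\<^sub>R i) - \<phi> x\<bar> + \<bar>W (norm (x + t *\<^sub>R i)) - W (norm x)\<bar> * \<bar>\<phi> x\<bar>"
      unfolding abs_mult[symmetric] by (metis abs_triangle_ineq)
    also have "\<dots> \<le> d * (t * B) + t * B"
      using cd t by (intro add_mono mult_mono W_bd p w \<phi>_bd) auto
    finally show ?thesis using True by (simp add: algebra_simps)
  next
    case False
    then have "norm x > R + 1" by simp
    moreover have "norm x \<le> norm (x + t *\<^sub>R i) + t" using norm_triangle_ineq4[of "x + t *\<^sub>R i" "t *\<^sub>R i"] t ni by simp
    ultimately have "x \<notin> cball 0 R" "x + t *\<^sub>R i \<notin> cball 0 R" using t by auto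
    then have "\<phi> x = 0" "\<phi> (x + t *\<^sub>R i) = 0" using BR(3)[of x] BR(3)[of "x + t *\<^sub>R i"] by auto
    then show ?thesis using False by (simp add: F_def)
  qed
  have "AE x in lborel. norm (x::'a) \<noteq> c \<and> norm x \<noteq> d"
    by (rule polar_AE) (use AE_lborel_singleton[of c] AE_lborel_singleton[of d] in eventually_elim, simp)
  moreover have "AE x in lborel. x \<noteq> (0::'a)" by (rule AE_lborel_singleton)
  ultimately have deriv: "AE x in lborel. ((\<lambda>t. F (x + t *\<^sub>R i)) has_real_derivative f x) (at 0)"
  proof eventually_elim
    case (elim x)
    have W': "(W has_real_derivative indicator {c<..<d} (norm x)) (at (norm x))"
    proof -
      consider "norm x < c" | "c < norm x" "norm x < d" | "norm x > d" using elim by linarith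
      then show ?thesis
      proof cases
        case 1
        then have "((\<lambda>r. c - d) has_real_derivative indicator {c<..<d} (norm x)) (at (norm x))" by simp
        then show ?thesis
          by (rule has_field_derivative_transform_within_open[where S = "{..<c}"]) (use 1 cd in \<open>auto simp: W_def\<close>)
      next
        case 2
        then have "((\<lambda>r. r - d) has_real_derivative indicator {c<..<d} (norm x)) (at (norm x))"
          by (auto intro!: derivative_eq_intros)
        then show ?thesis
          by (rule has_field_derivative_transform_within_open[where S = "{c<..<d}"]) (use 2 cd in \<open>auto simp: W_def\<close>)
      next
        case 3
        then have "((\<lambda>r. 0) has_real_derivative indicator {c<..<d} (norm x)) (at (norm x))" by simp
        then show ?thesis
          by (rule has_field_derivative_transform_within_open[where S = "{d<..}"]) (use 3 cd in \<open>auto simp: W_def\<close>)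
      qed
    qed
    have n': "((\<lambda>t. norm (x + t *\<^sub>R i)) has_real_derivative (x \<bullet> i) / norm x) (at 0)"
    proof -
      have "(norm has_derivative (\<lambda>h. h \<bullet> sgn x)) (at (x + 0 *\<^sub>R i))" using elim(2) by (simp add: has_derivative_norm)
      moreover have "((\<lambda>t. x + t *\<^sub>R i) has_derivative (\<lambda>t. t *\<^sub>R i)) (at 0)"
        by (auto intro!: derivative_eq_intros)
      ultimately have "((\<lambda>t. norm (x + t *\<^sub>R i)) has_derivative (\<lambda>t. (t *\<^sub>R i) \<bullet> sgn x)) (at 0)"
        by (rule has_derivative_compose[rotated])
      moreover have "(\<lambda>t. (t *\<^sub>R i) \<bullet> sgn x) = (*) ((x \<bullet> i) / norm x)"
        by (auto simp: sgn_div_norm fun_eq_iff inner_commute divide_inverse)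
      ultimately show ?thesis unfolding has_field_derivative_def by simp
    qed
    have "((\<lambda>t. W (norm (x + t *\<^sub>R i))) has_real_derivative indicator {c<..<d} (norm x) * ((x \<bullet> i) / norm x)) (at 0)"
      by (rule DERIV_chain2[OF _ n']) (use W' in simp)
    from DERIV_mult[OF this tf(4)[of x 0]]
    show ?case unfolding F_def by (rule DERIV_cong) (simp add: f_def)
  qed
  note main = integral_derivative_zero[OF F_int f_meas lip deriv]
  obtain C1 where C1: "\<And>\<psi> g. \<psi> \<in> borel_measurable borel \<Longrightarrow> (\<forall>x. \<bar>\<psi> x\<bar> \<le> B * indicator (cball 0 R) x) \<Longrightarrow> integrable lborel (\<lambda>x::'a. rad_fun g x * \<psi> x)"
    using rad_fun_test_bound[OF BR(1,2)] by blast
  obtain C2 where C2: "\<And>\<psi> g. \<psi> \<in> borel_measurable borel \<Longrightarrow> (\<forall>x. \<bar>\<psi> x\<bar> \<le> B * indicator (cball 0 R) x) \<Longrightarrow> integrable lborel (\<lambda>x::'a. (rad_grad g x \<bullet> i) * \<psi> x)"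
    using rad_grad_test_bound[OF BR(1,2) i] by blast
  have i1: "integrable lborel (\<lambda>x. rad_fun ?g x * ?d x)" by (rule C1) (use tf BR in auto)
  have i2: "integrable lborel (\<lambda>x. (rad_grad ?g x \<bullet> i) * \<phi> x)" by (rule C2) (use tf BR in auto)
  have g_AE: "AE x in lborel. rad_grad ?g (x::'a) = (ramp c d (norm x) * norm x powr (-(N-1)/2) / norm x) *\<^sub>R x"
    by (rule rad_grad_AE_cong) (use fn_mk[OF ramp_sqint[OF cd]] in \<open>auto elim!: eventually_mono\<close>)
  have "(\<integral>x. rad_fun ?g x * ?d x \<partial>lborel) + (\<integral>x. (rad_grad ?g x \<bullet> i) * \<phi> x \<partial>lborel)
      = (\<integral>x. rad_fun ?g x * ?d x + (rad_grad ?g x \<bullet> i) * \<phi> x \<partial>lborel)"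
    by (rule Bochner_Integration.integral_add[OF i1 i2, symmetric])
  also have "\<dots> = (\<integral>x. f x \<partial>lborel)"
  proof (rule integral_cong_AE)
    have "AE x in lborel. x \<noteq> (0::'a)" by (rule AE_lborel_singleton)
    with g_AE show "AE x in lborel. rad_fun ?g x * ?d x + (rad_grad ?g x \<bullet> i) * \<phi> x = f x"
    proof eventually_elim
      case (elim x)
      have "norm x powr ((N-1)/2) * norm x powr (-(N-1)/2) = 1"
        unfolding powr_add[symmetric] minus_divide_left[symmetric] using elim by simp
      then have "ramp c d (norm x) * norm x powr (-(N-1)/2) = indicator {c<..<d} (norm x)"
        by (simp add: ramp_def)
      then show ?case using elim profile_ramp[OF cd, of "norm x"] by (simp add: f_def W_def rad_fun_eq)
    qed
  qed (use f_meas in measurable)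
  finally show ?thesis using main(2) by simp
qed

text \<open>The defect of the integration by parts formula is a bounded functional of the profile, vanishing on ramps.\<close>

lemma weak_grad_rad:
  assumes \<phi>: "test_fun (\<phi> :: 'a \<Rightarrow> real)" and i: "i \<in> Basis"
  shows "integrable lborel (\<lambda>x. rad_fun g x * frechet_derivative \<phi> (at x) i)"
    "integrable lborel (\<lambda>x. (rad_grad g x \<bullet> i) * \<phi> x)"
    "(\<integral>x. rad_fun g x * frechet_derivative \<phi> (at x) i \<partial>lborel) = - (\<integral>x. (rad_grad g x \<bullet> i) * \<phi> x \<partial>lborel)"
proof -
  let ?d = "\<lambda>x. frechet_derivative \<phi> (at x) i"
  note tf = test_fun_facts[OF \<phi> i]
  have [measurable]: "\<phi> \<in> borel_measurable borel" "?d \<in> borel_measurable borel" using tf(2,3) .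
  obtain B R where BR: "B \<ge> 0" "R \<ge> 0" "\<And>x. \<bar>\<phi> x\<bar> \<le> B * indicator (cball 0 R) x" "\<And>x. \<bar>?d x\<bar> \<le> B * indicator (cball 0 R) x"
    using tf(1) by blast
  obtain C1 where C1: "\<And>g. integrable lborel (\<lambda>x. rad_fun g x * ?d x)" "\<And>g. \<bar>\<integral>x. rad_fun g x * ?d x \<partial>lborel\<bar> \<le> C1 * norm g"
    using rad_fun_test_bound[OF BR(1,2)] tf(3) BR(4) by blast
  obtain C2 where C2: "\<And>g. integrable lborel (\<lambda>x. (rad_grad g x \<bullet> i) * \<phi> x)" "\<And>g. \<bar>\<integral>x. (rad_grad g x \<bullet> i) * \<phi> x \<partial>lborel\<bar> \<le> C2 * norm g"
    using rad_grad_test_bound[OF BR(1,2) i] tf(2) BR(3) by blast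
  show "integrable lborel (\<lambda>x. rad_fun g x * ?d x)" "integrable lborel (\<lambda>x. (rad_grad g x \<bullet> i) * \<phi> x)" using C1 C2 by auto
  define D where "D g = (\<integral>x. rad_fun g x * ?d x \<partial>lborel) + (\<integral>x. (rad_grad g x \<bullet> i) * \<phi> x \<partial>lborel)" for g
  have D_cong: "D g = (\<integral>x. u x * ?d x \<partial>lborel) + (\<integral>x. (v x \<bullet> i) * \<phi> x \<partial>lborel)"
    if "AE x in lborel. rad_fun g x = u x" "AE x in lborel. rad_grad g x = v x" "u \<in> borel_measurable borel" "v \<in> borel_measurable borel" for g u v
  proof -
    have [measurable]: "u \<in> borel_measurable borel" "v \<in> borel_measurable borel" by fact+
    have "(\<integral>x. rad_fun g x * ?d x \<partial>lborel) = (\<integral>x. u x * ?d x \<partial>lborel)"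
      by (rule integral_cong_AE) (measurable, use that(1) in eventually_elim, simp)
    moreover have "(\<integral>x. (rad_grad g x \<bullet> i) * \<phi> x \<partial>lborel) = (\<integral>x. (v x \<bullet> i) * \<phi> x \<partial>lborel)"
      by (rule integral_cong_AE) (measurable, use that(2) in eventually_elim, simp)
    ultimately show ?thesis by (simp add: D_def)
  qed
  have "\<exists>z\<in>UNIV. \<forall>h\<in>UNIV. z \<bullet> h = D h"
  proof (rule riesz_subspace)
    fix g h :: l2 and c :: real
    have "AE x in lborel. rad_grad (g + h) (x::'a) = rad_grad g x + rad_grad h x"
    proof -
      have "AE x in lborel. fn (g + h) (norm (x::'a)) = fn g (norm x) + fn h (norm x)"
        by (rule polar_AE) (use fn_add[of g h] in \<open>auto elim!: eventually_mono\<close>)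
      then show ?thesis by eventually_elim (simp add: rad_grad_eq rad_deriv_def algebra_simps add_divide_distrib flip: scaleR_left_distrib)
    qed
    then have "D (g + h) = (\<integral>x. (rad_fun g x + rad_fun h x) * ?d x \<partial>lborel) + (\<integral>x. ((rad_grad g x + rad_grad h x) \<bullet> i) * \<phi> x \<partial>lborel)"
      by (intro D_cong) (auto simp: rad_fun_add)
    also have "\<dots> = D g + D h"
      unfolding D_def inner_add_left distrib_right
      by (simp add: C1 C2)
    finally show "D (g + h) = D g + D h" .
    have "AE x in lborel. rad_grad (c *\<^sub>R g) (x::'a) = c *\<^sub>R rad_grad g x"
    proof -
      have "AE x in lborel. fn (c *\<^sub>R g) (norm (x::'a)) = c * fn g (norm x)"
        by (rule polar_AE) (use fn_scale[of c g] in \<open>auto elim!: eventually_mono\<close>)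
      then show ?thesis by eventually_elim (simp add: rad_grad_eq rad_deriv_def)
    qed
    then have "D (c *\<^sub>R g) = (\<integral>x. (c * rad_fun g x) * ?d x \<partial>lborel) + (\<integral>x. ((c *\<^sub>R rad_grad g x) \<bullet> i) * \<phi> x \<partial>lborel)"
      by (intro D_cong) (auto simp: rad_fun_scale)
    also have "\<dots> = c * D g"
      unfolding D_def inner_scaleR_left mult.assoc by (simp add: distrib_left)
    finally show "D (c *\<^sub>R g) = c * D g" .
    show "\<bar>D g\<bar> \<le> (C1 + C2) * norm g"
      unfolding D_def using C1(2)[of g] C2(2)[of g] by (simp add: distrib_right)
  qed auto
  then obtain z where z: "\<And>h. z \<bullet> h = D h" by blast
  \<comment> \<open>The functional vanishes on ramps, that is, z is orthogonal to them, so the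
    integrals of \<open>fn z\<close> against t^((N-1)/2) over intervals are 0.\<close>
  have "AE t in lborel. 0 < t \<longrightarrow> fn z t * t powr ((N-1)/2) = 0"
  proof (rule AE_pos_zero_of_intervals)
    fix c d :: real assume cd: "0 < c" "c < d"
    have eq: "(\<lambda>t. indicator {c<..<d} t * (fn z t * t powr ((N-1)/2))) = (\<lambda>t. ramp c d t * fn z t)"
      by (auto simp: ramp_def fun_eq_iff)
    show "integrable lborel (\<lambda>t. indicator {c<..<d} t * (fn z t * t powr ((N-1)/2)))"
      unfolding eq by (intro sqint_mult_integrable ramp_sqint cd sqint_fn)
    have "mk (ramp c d) \<bullet> z = (\<integral>t. ramp c d t * fn z t \<partial>lborel)" by (rule inner_mk_fn[OF ramp_sqint[OF cd]])
    moreover have "mk (ramp c d) \<bullet> z = 0"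
      using weak_grad_ramp[OF cd \<phi> i] z[of "mk (ramp c d)"] unfolding D_def by (simp only: inner_commute)
    ultimately show "(\<integral>t. indicator {c<..<d} t * (fn z t * t powr ((N-1)/2)) \<partial>lborel) = 0" unfolding eq by simp
  qed
  then have z0: "AE t in lborel. 0 < t \<longrightarrow> fn z t = 0" by eventually_elim auto
  \<comment> \<open>z is known to vanish at positive radii. Cutting g off at 0 leaves the function
    unchanged and the gradient unchanged almost everywhere, so D g = D g1 = z . g1 = 0.\<close>
  define g1 where "g1 = mk (\<lambda>t. indicator {0<..} t * fn g t)"
  have sq1: "sqint (\<lambda>t. indicator {0<..} t * fn g t)"
    by (rule sqint_bound[OF sqint_fn[of g]]) (auto simp: indicator_def)
  have fg1: "AE t in lborel. fn g1 t = indicator {0<..} t * fn g t" unfolding g1_def by (rule fn_mk[OF sq1])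
  have "D g1 = D g"
  proof -
    have "rad_fun g1 x = rad_fun g x" for x :: 'a
    proof (cases "x = 0")
      case False
      then have r: "norm x > 0" by simp
      have N2: "N > 2" using N3 by simp
      have "(\<integral>s. tail_kernel (-(N-1)/2) (norm x) s * fn g1 s \<partial>lborel) = (\<integral>s. tail_kernel (-(N-1)/2) (norm x) s * fn g s \<partial>lborel)"
      proof (rule integral_cong_AE)
        show "AE s in lborel. tail_kernel (-(N-1)/2) (norm x) s * fn g1 s = tail_kernel (-(N-1)/2) (norm x) s * fn g s"
          using fg1
        proof eventually_elim
          case (elim s)
          have "s > 0" if "s \<ge> norm x" using that r by linarith
          then show ?case using elim by (auto simp: tail_kernel_def indicator_def)
        qed
      qed measurable
      then show ?thesis unfolding rad_fun_eq profile_integral(2)[OF N2 r] by simp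
    qed (simp add: rad_fun_eq profile_def)
    moreover have "AE x in lborel. rad_grad g1 (x::'a) = (fn g (norm x) * norm x powr (-(N-1)/2) / norm x) *\<^sub>R x"
      by (rule rad_grad_AE_cong) (use fg1 in \<open>auto elim!: eventually_mono\<close>)
    then have "AE x in lborel. rad_grad g1 (x::'a) = rad_grad g x" by (simp add: rad_grad_eq rad_deriv_def)
    ultimately show ?thesis unfolding D_def[of g] by (intro D_cong) auto
  qed
  moreover have "D g1 = 0"
  proof -
    have "D g1 = (\<integral>t. (indicator {0<..} t * fn g t) * fn z t \<partial>lborel)"
      unfolding z[symmetric] g1_def using inner_mk_fn[OF sq1, of z] by (simp add: inner_commute)
    also have "\<dots> = (\<integral>t. 0 \<partial>(lborel :: real measure))"
      by (rule integral_cong_AE) (measurable, use z0 in eventually_elim, auto simp: indicator_def)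
    finally show ?thesis by simp
  qed
  ultimately show "(\<integral>x. rad_fun g x * ?d x \<partial>lborel) = - (\<integral>x. (rad_grad g x \<bullet> i) * \<phi> x \<partial>lborel)"
    unfolding D_def by linarith
qed

end

section \<open>Profiles as Sobolev functions, and pairing with square-integrable fields\<close>

context dim3 begin

lemma rad_fun_meas_lebesgue: "(rad_fun g :: 'a \<Rightarrow> real) \<in> borel_measurable lebesgue"
  using rad_fun_meas by (intro measurable_completion) simp

lemma rad_grad_meas_lebesgue [measurable]: "(rad_grad g :: 'a \<Rightarrow> 'a) \<in> borel_measurable lebesgue"
  using rad_grad_meas by (intro measurable_completion) simp

lemma rad_fun_radial: "radial (rad_fun g :: 'a \<Rightarrow> real)"
  by (simp add: radial_def rad_fun_eq)

lemma pd_rad_deriv_sq: "r > 0 \<Longrightarrow> pd r * (rad_deriv N g r * rad_deriv N h r) = cN * (fn g r * fn h r)"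
proof -
  assume r: "r > 0"
  have "r powr (N-1) * (r powr (-(N-1)/2) * r powr (-(N-1)/2)) = r powr (N - 1 + (-(N-1)/2 + -(N-1)/2))"
    unfolding powr_add ..
  also have "N - 1 + (-(N-1)/2 + -(N-1)/2) = 0" by (simp add: field_simps)
  finally have "r powr (N-1) * (r powr (-(N-1)/2) * r powr (-(N-1)/2)) = 1" using r by simp
  moreover have "pd r * (rad_deriv N g r * rad_deriv N h r)
      = cN * (fn g r * fn h r) * (r powr (N-1) * (r powr (-(N-1)/2) * r powr (-(N-1)/2)))"
    using r by (simp add: pd_eq rad_deriv_def)
  ultimately show ?thesis by simp
qed

lemma rad_grad_inner: "rad_grad g (x::'a) \<bullet> rad_grad h x = (if x = 0 then 0 else rad_deriv N g (norm x) * rad_deriv N h (norm x))"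
  by (simp add: rad_grad_eq dot_square_norm power2_eq_square)

lemma rad_grad_inner_integral:
  "integrable lborel (\<lambda>x::'a. rad_grad g x \<bullet> rad_grad h x)"
  "(\<integral>x. rad_grad g x \<bullet> rad_grad h x \<partial>(lborel :: 'a measure)) = cN * (\<integral>r. indicator {0<..} r * (fn g r * fn h r) \<partial>lborel)"
proof -
  define F where "F r = rad_deriv N g r * rad_deriv N h r" for r
  have F_meas: "F \<in> borel_measurable borel" unfolding F_def by measurable
  have AE: "AE x in lborel. rad_grad g (x::'a) \<bullet> rad_grad h x = F (norm x)"
    using AE_lborel_singleton[of "0::'a"] by eventually_elim (simp add: rad_grad_inner F_def)
  have eq: "(\<lambda>r. pd r * F r) = (\<lambda>r. cN * (indicator {0<..} r * (fn g r * fn h r)))"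
  proof
    fix r show "pd r * F r = cN * (indicator {0<..} r * (fn g r * fn h r))"
      using pd_rad_deriv_sq[of r g h] by (cases "r > 0") (auto simp: F_def pd_eq)
  qed
  have int: "integrable lborel (\<lambda>r. cN * (indicator {0<..} r * (fn g r * fn h r)))"
  proof (intro integrable_mult_right)
    have i: "integrable lborel (\<lambda>r. fn g r * fn h r)" by (intro sqint_mult_integrable sqint_fn)
    show "integrable lborel (\<lambda>r. indicator {0<..} r * (fn g r * fn h r))"
      by (rule Bochner_Integration.integrable_bound[OF i]) (auto simp: indicator_def)
  qed
  have iF: "integrable lborel (\<lambda>x::'a. F (norm x))" unfolding polar_int(1)[OF F_meas] eq by (rule int)
  have m: "(\<lambda>x::'a. rad_grad g x \<bullet> rad_grad h x) \<in> borel_measurable lborel" "(\<lambda>x::'a. F (norm x)) \<in> borel_measurable lborel"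
    using F_meas by measurable
  show "integrable lborel (\<lambda>x::'a. rad_grad g x \<bullet> rad_grad h x)"
    using iF integrable_cong_AE[OF m AE] by simp
  show "(\<integral>x. rad_grad g x \<bullet> rad_grad h x \<partial>(lborel :: 'a measure)) = cN * (\<integral>r. indicator {0<..} r * (fn g r * fn h r) \<partial>lborel)"
    unfolding integral_cong_AE[OF m AE] polar_int(2)[OF F_meas] eq by simp
qed

lemma rad_grad_sq_integrable: "integrable lborel (\<lambda>x::'a. (norm (rad_grad g x))\<^sup>2)"
  using rad_grad_inner_integral(1)[of g g] by (simp add: power2_norm_eq_inner)

text \<open>The pointwise bound is applied to |w|^(q-2) only; at the critical exponent this gives
  exactly r^-2, and what remains is Hardy's integral.\<close>

lemma rad_fun_crit_integrable: "integrable lborel (\<lambda>x::'a. \<bar>rad_fun g x\<bar> powr crit_exp TYPE('a))"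
proof -
  define q where "q = crit_exp TYPE('a)"
  have q: "q > 2" "-(N-2)/2 * (q - 2) = -2"
    using N3 unfolding q_def crit_exp_def N_def[symmetric] by (auto simp: field_simps)
  have [measurable]: "profile N g \<in> borel_measurable borel" by (rule profile_meas[OF N3])
  define F where "F r = \<bar>profile N g r\<bar> powr q" for r
  have [measurable]: "F \<in> borel_measurable borel" unfolding F_def by measurable
  have le: "pd r * F r \<le> cN * norm g powr (q-2) * (r powr (N-3) * (profile N g r)\<^sup>2)" for r
  proof (cases "r > 0")
    case True
    let ?w = "\<bar>profile N g r\<bar>"
    have "?w powr q = ?w powr (q-2) * ?w powr 2" unfolding powr_add[symmetric] by simp
    also have "?w powr 2 = (profile N g r)\<^sup>2" by (cases "?w = 0") (auto simp: powr_numeral)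
    also have "?w powr (q-2) \<le> (r powr (-(N-2)/2) * norm g) powr (q-2)"
      using q by (intro powr_mono2 profile_bound[OF N3 True]) auto
    also have "(r powr (-(N-2)/2) * norm g) powr (q-2) = r powr (-2) * norm g powr (q-2)"
      using q(2) by (simp add: powr_mult powr_powr)
    finally have "?w powr q \<le> r powr (-2) * norm g powr (q-2) * (profile N g r)\<^sup>2" by (simp add: mult_right_mono)
    then have "pd r * F r \<le> (cN * r powr (N-1)) * (r powr (-2) * norm g powr (q-2) * (profile N g r)\<^sup>2)"
      using True cN_pos by (auto simp: pd_eq F_def intro!: mult_left_mono)
    also have "\<dots> = cN * norm g powr (q-2) * ((r powr (N-1) * r powr (-2)) * (profile N g r)\<^sup>2)" by simp
    also have "r powr (N-1) * r powr (-2) = r powr (N-3)" by (simp add: powr_add[symmetric])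
    finally show ?thesis .
  qed (simp add: pd_eq profile_def)
  have i: "integrable lborel (\<lambda>r. cN * norm g powr (q-2) * (r powr (N-3) * (profile N g r)\<^sup>2))"
  proof (intro integrable_mult_right integrableI_nonneg)
    show "(\<integral>\<^sup>+r. ennreal (r powr (N-3) * (profile N g r)\<^sup>2) \<partial>lborel) < \<infinity>"
      using le_less_trans[OF profile_hardy[OF N3, of g]] by simp
  qed auto
  have "integrable lborel (\<lambda>r. pd r * F r)"
    by (rule Bochner_Integration.integrable_bound[OF i])
      (measurable, use le pd_nonneg in \<open>auto intro!: AE_I2 order_trans[OF _ abs_ge_self] simp: F_def\<close>)
  then have "integrable lborel (\<lambda>x::'a. F (norm x))" by (subst polar_int(1)) simp_all
  then show ?thesis by (simp add: F_def q_def rad_fun_eq)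
qed

lemma D12_rad: "D12 (rad_fun g :: 'a \<Rightarrow> real) (rad_grad g)"
  unfolding D12_def weak_grad_def
proof (intro conjI allI impI ballI rad_fun_meas_lebesgue rad_grad_meas_lebesgue)
  show "integrable lebesgue (\<lambda>x::'a. \<bar>rad_fun g x\<bar> powr crit_exp TYPE('a))"
    by (subst lebesgue_integral_lborel(1)) (measurable, rule rad_fun_crit_integrable)
  show "integrable lebesgue (\<lambda>x::'a. (norm (rad_grad g x))\<^sup>2)"
    by (subst lebesgue_integral_lborel(1)) (measurable, rule rad_grad_sq_integrable)
  fix \<phi> :: "'a \<Rightarrow> real" and i :: 'a assume \<phi>: "test_fun \<phi>" and i: "i \<in> Basis"
  have [measurable]: "\<phi> \<in> borel_measurable borel" "(\<lambda>x. frechet_derivative \<phi> (at x) i) \<in> borel_measurable borel"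
    using test_fun_facts[OF \<phi> i] by auto
  have m: "(\<lambda>x. rad_fun g x * frechet_derivative \<phi> (at x) i) \<in> borel_measurable borel"
    "(\<lambda>x. (rad_grad g x \<bullet> i) * \<phi> x) \<in> borel_measurable borel" by measurable
  note w = weak_grad_rad[OF \<phi> i, of g]
  show "integrable lebesgue (\<lambda>x. rad_fun g x * frechet_derivative \<phi> (at x) i)"
    using w(1) lebesgue_integral_lborel(1)[OF m(1)] by simp
  show "integrable lebesgue (\<lambda>x. (rad_grad g x \<bullet> i) * \<phi> x)"
    using w(2) lebesgue_integral_lborel(1)[OF m(2)] by simp
  show "(\<integral>x. rad_fun g x * frechet_derivative \<phi> (at x) i \<partial>lebesgue) = - (\<integral>x. (rad_grad g x \<bullet> i) * \<phi> x \<partial>lebesgue)"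
    using w(3) lebesgue_integral_lborel(2)[OF m(1)] lebesgue_integral_lborel(2)[OF m(2)] by simp
qed

lemma rad_grad_add_AE: "AE x in lborel. rad_grad (g + h) (x::'a) = rad_grad g x + rad_grad h x"
proof -
  have "AE x in lborel. fn (g + h) (norm (x::'a)) = fn g (norm x) + fn h (norm x)"
    by (rule polar_AE) (use fn_add[of g h] in \<open>auto elim!: eventually_mono\<close>)
  then show ?thesis by eventually_elim (simp add: rad_grad_eq rad_deriv_def algebra_simps add_divide_distrib flip: scaleR_left_distrib)
qed

lemma rad_grad_scale_AE: "AE x in lborel. rad_grad (c *\<^sub>R g) (x::'a) = c *\<^sub>R rad_grad g x"
proof -
  have "AE x in lborel. fn (c *\<^sub>R g) (norm (x::'a)) = c * fn g (norm x)"
    by (rule polar_AE) (use fn_scale[of c g] in \<open>auto elim!: eventually_mono\<close>)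
  then show ?thesis by eventually_elim (simp add: rad_grad_eq rad_deriv_def)
qed

lemma rad_grad_pairing_integrable:
  assumes H: "(H :: 'a \<Rightarrow> 'a) \<in> borel_measurable lebesgue" "integrable lebesgue (\<lambda>x. (norm (H x))\<^sup>2)"
  shows "integrable lebesgue (\<lambda>x. rad_grad g x \<bullet> H x)"
    "\<bar>\<integral>x. rad_grad g x \<bullet> H x \<partial>lebesgue\<bar> \<le> (cN * (norm g)\<^sup>2 + (\<integral>x. (norm (H x))\<^sup>2 \<partial>lebesgue)) / 2"
proof -
  have [measurable]: "H \<in> borel_measurable lebesgue" by fact
  have i1: "integrable lebesgue (\<lambda>x::'a. (norm (rad_grad g x))\<^sup>2)"
    by (subst lebesgue_integral_lborel(1)) (measurable, rule rad_grad_sq_integrable)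
  have i: "integrable lebesgue (\<lambda>x. ((norm (rad_grad g x))\<^sup>2 + (norm (H x))\<^sup>2) / 2)"
    using i1 H(2) by auto
  have bd: "\<bar>rad_grad g x \<bullet> H x\<bar> \<le> ((norm (rad_grad g x))\<^sup>2 + (norm (H x))\<^sup>2) / 2" for x
  proof -
    have "2 * (norm (rad_grad g x) * norm (H x)) \<le> (norm (rad_grad g x))\<^sup>2 + (norm (H x))\<^sup>2"
      using sum_squares_bound[of "norm (rad_grad g x)" "norm (H x)"] by (simp only: mult.assoc)
    then show ?thesis using Cauchy_Schwarz_ineq2[of "rad_grad g x" "H x"] by argo
  qed
  show int: "integrable lebesgue (\<lambda>x. rad_grad g x \<bullet> H x)"
    by (rule Bochner_Integration.integrable_bound[OF i]) (measurable, use order_trans[OF bd abs_ge_self] in \<open>auto intro!: AE_I2\<close>)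
  have "\<bar>\<integral>x. rad_grad g x \<bullet> H x \<partial>lebesgue\<bar> \<le> (\<integral>x. ((norm (rad_grad g x))\<^sup>2 + (norm (H x))\<^sup>2) / 2 \<partial>lebesgue)"
    unfolding real_norm_def[symmetric]
    by (rule Bochner_Integration.integral_norm_bound_integral[OF int i]) (simp only: real_norm_def bd)
  also have "\<dots> = ((\<integral>x. (norm (rad_grad g (x::'a)))\<^sup>2 \<partial>lebesgue) + (\<integral>x. (norm (H x))\<^sup>2 \<partial>lebesgue)) / 2"
    using i1 H(2) by simp
  also have "(\<integral>x. (norm (rad_grad g (x::'a)))\<^sup>2 \<partial>lebesgue) = cN * (\<integral>r. indicator {0<..} r * (fn g r * fn g r) \<partial>lborel)"
    using rad_grad_inner_integral(2)[of g g] by (subst lebesgue_integral_lborel(2)) (measurable, simp add: power2_norm_eq_inner)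
  also have "\<dots> \<le> cN * (norm g)\<^sup>2"
  proof (rule mult_left_mono)
    have i0: "integrable lborel (\<lambda>r. fn g r * fn g r)" by (intro sqint_mult_integrable sqint_fn)
    have "(\<integral>r. indicator {0<..} r * (fn g r * fn g r) \<partial>lborel) \<le> (\<integral>r. fn g r * fn g r \<partial>lborel)"
    proof (rule integral_mono[OF _ i0])
      show "integrable lborel (\<lambda>r. indicator {0<..} r * (fn g r * fn g r))"
        by (rule Bochner_Integration.integrable_bound[OF i0]) (auto simp: indicator_def)
    qed (auto simp: indicator_def)
    then show "(\<integral>r. indicator {0<..} r * (fn g r * fn g r) \<partial>lborel) \<le> (norm g)\<^sup>2"
      by (simp add: power2_norm_eq_inner inner_l2)
  qed (use cN_pos in simp)
  finally show "\<bar>\<integral>x. rad_grad g x \<bullet> H x \<partial>lebesgue\<bar> \<le> (cN * (norm g)\<^sup>2 + (\<integral>x. (norm (H x))\<^sup>2 \<partial>lebesgue)) / 2"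
    by (simp add: divide_right_mono)
qed

text \<open>g plays the part of the radial component of H averaged over spheres. Producing it by
  Riesz' theorem avoids integration over spheres and requires of H only measurability and square
  integrability.\<close>

lemma rad_grad_pairing_rep:
  assumes H: "(H :: 'a \<Rightarrow> 'a) \<in> borel_measurable lebesgue" "integrable lebesgue (\<lambda>x. (norm (H x))\<^sup>2)"
  shows "\<exists>g. \<forall>\<zeta>. (\<integral>x. rad_grad \<zeta> x \<bullet> H x \<partial>lebesgue) = cN * (g \<bullet> \<zeta>)"
proof -
  have [measurable]: "H \<in> borel_measurable lebesgue" by fact
  define L where "L g = (\<integral>x. rad_grad g x \<bullet> H x \<partial>lebesgue)" for g
  define C where "C = (cN + (\<integral>x. (norm (H x))\<^sup>2 \<partial>lebesgue)) / 2"
  note pi = rad_grad_pairing_integrable[OF H]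
  have add: "L (g + h) = L g + L h" for g h
  proof -
    have "L (g + h) = (\<integral>x. rad_grad g x \<bullet> H x + rad_grad h x \<bullet> H x \<partial>lebesgue)"
      unfolding L_def
    proof (rule integral_cong_AE)
      show "AE x in lebesgue. rad_grad (g + h) x \<bullet> H x = rad_grad g x \<bullet> H x + rad_grad h x \<bullet> H x"
        using AE_completion[OF rad_grad_add_AE[of g h]] by eventually_elim (simp add: inner_add_left)
    qed (intro borel_measurable_add borel_measurable_integrable[OF pi(1)])+
    also have "\<dots> = L g + L h" unfolding L_def by (rule Bochner_Integration.integral_add[OF pi(1) pi(1)])
    finally show ?thesis .
  qed
  have scale: "L (c *\<^sub>R g) = c * L g" for c g
  proof -
    have "L (c *\<^sub>R g) = (\<integral>x. c * (rad_grad g x \<bullet> H x) \<partial>lebesgue)"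
      unfolding L_def
    proof (rule integral_cong_AE)
      show "AE x in lebesgue. rad_grad (c *\<^sub>R g) x \<bullet> H x = c * (rad_grad g x \<bullet> H x)"
        using AE_completion[OF rad_grad_scale_AE[of c g]] by eventually_elim simp
    qed (intro borel_measurable_times borel_measurable_const borel_measurable_integrable[OF pi(1)])+
    then show ?thesis unfolding L_def by simp
  qed
  \<comment> \<open>The estimate for the pairing is not homogeneous in g, so it is used on a vector
    of norm 1 and then scaled.\<close>
  have bound: "\<bar>L g\<bar> \<le> C * norm g" for g
  proof (cases "g = 0")
    case True
    then show ?thesis using scale[of 0 0] by simp
  next
    case False
    then have n: "norm g > 0" by simp
    define u where "u = (1 / norm g) *\<^sub>R g"
    have "norm u = 1" using n by (simp add: u_def)
    then have "\<bar>L u\<bar> \<le> C" using pi(2)[of u] by (simp add: L_def C_def)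
    moreover have "L g = norm g * L u" using scale[of "norm g" u] n by (simp add: u_def)
    ultimately show ?thesis using n by (simp add: abs_mult mult.commute)
  qed
  obtain z where z: "\<And>h. z \<bullet> h = L h"
    using riesz_subspace[of UNIV L C, OF subspace_UNIV closed_UNIV add scale bound] by blast
  have "L h = cN * (((1 / cN) *\<^sub>R z) \<bullet> h)" for h using z[of h] cN_pos by simp
  then show ?thesis unfolding L_def by blast
qed

end

text \<open>z is a test density in the variable t = |x|^2 and Z its primitive. That Z vanishes again
  beyond d encodes that z has total mass 0.\<close>

locale radial_test = dim3 dummy N cN pd
  for dummy :: "'a::euclidean_space itself" and N cN :: real and pd :: "real \<Rightarrow> real" +
  fixes Z z :: "real \<Rightarrow> real" and c d :: real
  assumes z: "z \<in> pos_alg Z" "\<And>t. (Z has_real_derivative z t) (at t)"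
    and c: "0 < c" and cd: "c < d" and Z0: "\<And>t. t \<le> c \<Longrightarrow> Z t = 0" "\<And>t. t \<ge> d \<Longrightarrow> Z t = 0"
    and z_meas: "z \<in> borel_measurable borel"
begin

text \<open>x eta(|x|^2) is the test field, \<open>divg\<close> its divergence as a function of r =
  |x|, and \<open>zeta\<close> represents the element of l2 whose radial gradient is this
  field.\<close>

definition "eta t = (if t > 0 then t powr (- N / 2) * Z t else 0)"
definition "divg r = 2 * r powr (2 - N) * z (r\<^sup>2)"
definition "zeta r = (if r > 0 then r powr ((N+1)/2) * eta (r\<^sup>2) else 0)"

lemma eta_cont: "continuous_on {0<..} eta"
proof -
  have "continuous_on {0<..} (\<lambda>t. t powr (- N / 2) * Z t)"
    by (intro continuous_intros continuous_at_imp_continuous_on) (auto intro: DERIV_isCont[OF z(2)])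
  then show ?thesis by (rule continuous_on_eq) (auto simp: eta_def)
qed

lemma zeta_sqint: "sqint zeta"
proof -
  have "continuous_on {0<..} (\<lambda>r. r powr ((N+1)/2) * eta (r\<^sup>2))"
    by (intro continuous_intros continuous_on_compose2[OF eta_cont]) auto
  then have m: "zeta \<in> borel_measurable borel" and c0: "continuous_on {0<..} (\<lambda>r. r powr ((N+1)/2) * eta (r\<^sup>2))"
    unfolding zeta_def by (auto intro: measurable_positive_part)
  have "integrable lborel (\<lambda>r. indicator {sqrt c..sqrt d} r *\<^sub>R (r powr ((N+1)/2) * eta (r\<^sup>2))\<^sup>2)"
    by (intro borel_integrable_compact continuous_intros continuous_on_subset[OF c0]) (use c in \<open>auto intro: less_le_trans[of 0 "sqrt c"]\<close>)
  moreover have "(\<lambda>r. indicator {sqrt c..sqrt d} r *\<^sub>R (r powr ((N+1)/2) * eta (r\<^sup>2))\<^sup>2) = (\<lambda>r. (zeta r)\<^sup>2)"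
  proof
    fix r :: real
    show "indicator {sqrt c..sqrt d} r *\<^sub>R (r powr ((N+1)/2) * eta (r\<^sup>2))\<^sup>2 = (zeta r)\<^sup>2"
    proof (cases "r \<in> {sqrt c..sqrt d}")
      case True
      then have "r > 0" using c by (auto intro: less_le_trans[of 0 "sqrt c"])
      then show ?thesis using True by (simp add: zeta_def)
    next
      case False
      have "zeta r = 0"
      proof (cases "r > 0")
        case True
        then have "r < sqrt c \<or> r > sqrt d" using False by auto
        then have "r\<^sup>2 \<le> c \<or> r\<^sup>2 \<ge> d"
        proof
          assume "r < sqrt c"
          then have "r\<^sup>2 \<le> (sqrt c)\<^sup>2" using True by (intro power_mono) auto
          then show ?thesis using c by simp
        next
          assume "r > sqrt d"
          then have "(sqrt d)\<^sup>2 \<le> r\<^sup>2" using c cd by (intro power_mono) auto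
          then show ?thesis using c cd by simp
        qed
        then show ?thesis using Z0 by (auto simp: zeta_def eta_def)
      qed (simp add: zeta_def)
      then show ?thesis using False by simp
    qed
  qed
  ultimately show ?thesis using m by (simp add: sqint_def)
qed

lemma rad_grad_zeta: "AE x in lborel. rad_grad (mk zeta) (x::'a) = eta (x \<bullet> x) *\<^sub>R x"
proof -
  have "AE x in lborel. rad_grad (mk zeta) (x::'a) = (zeta (norm x) * norm x powr (-(N-1)/2) / norm x) *\<^sub>R x"
    by (rule rad_grad_AE_cong) (use fn_mk[OF zeta_sqint] in \<open>auto elim!: eventually_mono\<close>)
  moreover have "AE x in lborel. x \<noteq> (0::'a)" by (rule AE_lborel_singleton)
  ultimately show ?thesis
  proof eventually_elim
    case (elim x)
    let ?r = "norm x"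
    have r: "?r > 0" using elim by simp
    have "?r powr ((N+1)/2) * ?r powr (-(N-1)/2) = ?r powr 1"
      unfolding powr_add[symmetric] by (rule arg_cong[where f = "(powr) (norm x)"]) (simp add: field_simps)
    then have "?r powr ((N+1)/2) * ?r powr (-(N-1)/2) = ?r" using r by simp
    moreover have "zeta ?r * ?r powr (-(N-1)/2) / ?r = (?r powr ((N+1)/2) * ?r powr (-(N-1)/2)) * eta (?r\<^sup>2) / ?r"
      using r by (simp add: zeta_def)
    ultimately have "zeta ?r * ?r powr (-(N-1)/2) / ?r = eta (?r\<^sup>2)" using r by simp
    then show ?case using elim by (simp add: power2_norm_eq_inner)
  qed
qed

text \<open>Summing the defining identities of the weak gradient over the components of the test
  field gives the divergence formula for u.\<close>

lemma weak_grad_test: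
  assumes w: "weak_grad (u :: 'a \<Rightarrow> real) P" and P2: "integrable lebesgue (\<lambda>x. (norm (P x))\<^sup>2)"
  shows "integrable lebesgue (\<lambda>x. u x * divg (norm x))"
    "(\<integral>x. u x * divg (norm x) \<partial>lebesgue) = - (\<integral>x. rad_grad (mk zeta) x \<bullet> P x \<partial>lebesgue)"
proof -
  define \<phi> where "\<phi> i x = (x \<bullet> i) * eta (x \<bullet> x)" for i x :: 'a
  have rt1: "test_fun (\<phi> i)" if "i \<in> Basis" for i
    unfolding \<phi>_def[abs_def] eta_def unfolding N_def by (rule radial_test_field(1)[OF z c]) (use Z0 that in auto)
  have rt2: "(\<Sum>i\<in>Basis. frechet_derivative (\<phi> i) (at x) i) = 2 * norm x powr (2 - N) * z ((norm x)\<^sup>2)" for x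
    unfolding \<phi>_def[abs_def] eta_def unfolding N_def by (rule radial_test_field(2)[OF z c]) (use Z0 in auto)
  have PM: "P \<in> borel_measurable lebesgue" using w by (simp add: weak_grad_def)
  have wi: "integrable lebesgue (\<lambda>x. u x * frechet_derivative (\<phi> i) (at x) i)"
    "integrable lebesgue (\<lambda>x. (P x \<bullet> i) * \<phi> i x)"
    "(\<integral>x. u x * frechet_derivative (\<phi> i) (at x) i \<partial>lebesgue) = - (\<integral>x. (P x \<bullet> i) * \<phi> i x \<partial>lebesgue)" if "i \<in> Basis" for i
    using w rt1[OF that] that unfolding weak_grad_def by blast+
  have dsum: "u x * divg (norm x) = (\<Sum>i\<in>Basis. u x * frechet_derivative (\<phi> i) (at x) i)" for x
    using rt2[of x] by (simp add: divg_def sum_distrib_left[symmetric])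
  have psum: "(\<Sum>i\<in>Basis. (P x \<bullet> i) * \<phi> i x) = eta (x \<bullet> x) *\<^sub>R x \<bullet> P x" for x
    by (simp add: \<phi>_def euclidean_inner[of x "P x"] sum_distrib_left ac_simps)
  show "integrable lebesgue (\<lambda>x. u x * divg (norm x))" unfolding dsum by (intro Bochner_Integration.integrable_sum wi)
  have "(\<integral>x. u x * divg (norm x) \<partial>lebesgue) = (\<Sum>i\<in>Basis. - (\<integral>x. (P x \<bullet> i) * \<phi> i x \<partial>lebesgue))"
    unfolding dsum by (subst Bochner_Integration.integral_sum) (auto simp: wi)
  also have "\<dots> = - (\<integral>x. (\<Sum>i\<in>Basis. (P x \<bullet> i) * \<phi> i x) \<partial>lebesgue)"
    by (subst Bochner_Integration.integral_sum) (auto simp: wi sum_negf)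
  also have "(\<integral>x. (\<Sum>i\<in>Basis. (P x \<bullet> i) * \<phi> i x) \<partial>lebesgue) = (\<integral>x. rad_grad (mk zeta) x \<bullet> P x \<partial>lebesgue)"
  proof (rule integral_cong_AE)
    show "(\<lambda>x. \<Sum>i\<in>Basis. (P x \<bullet> i) * \<phi> i x) \<in> borel_measurable lebesgue"
      by (intro borel_measurable_sum borel_measurable_integrable wi)
    show "(\<lambda>x. rad_grad (mk zeta) x \<bullet> P x) \<in> borel_measurable lebesgue"
      by (rule borel_measurable_integrable[OF rad_grad_pairing_integrable(1)[OF PM P2]])
    show "AE x in lebesgue. (\<Sum>i\<in>Basis. (P x \<bullet> i) * \<phi> i x) = rad_grad (mk zeta) x \<bullet> P x"
      using AE_completion[OF rad_grad_zeta] by eventually_elim (simp add: psum)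
  qed
  finally show "(\<integral>x. u x * divg (norm x) \<partial>lebesgue) = - (\<integral>x. rad_grad (mk zeta) x \<bullet> P x \<partial>lebesgue)" .
qed

text \<open>Testing \<open>h\<close> and the profile of its radial gradient against one and the same radial field gives the same
  value, so their difference is orthogonal to every test density of total mass zero, i.e. it is constant.\<close>

lemma profile_defect_zero:
  assumes h: "D12 (h :: 'a \<Rightarrow> real) H" and k: "k \<in> borel_measurable borel" "AE x in lebesgue. h x = k (norm x)"
    and g: "\<And>\<zeta>. (\<integral>x. rad_grad \<zeta> x \<bullet> H x \<partial>lebesgue) = cN * (g \<bullet> \<zeta>)"
  shows "(\<integral>r. indicator {0<..} r * ((k r - profile N g r) * (2 * r * z (r\<^sup>2))) \<partial>lborel) = 0"
proof -
  have [measurable]: "profile N g \<in> borel_measurable borel" by (rule profile_meas[OF N3])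
  note [measurable] = k(1) z_meas
  define F where "F r = (k r - profile N g r) * divg r" for r
  have F_meas: "F \<in> borel_measurable borel" unfolding F_def divg_def by measurable
  have hw: "weak_grad h H" "integrable lebesgue (\<lambda>x. (norm (H x))\<^sup>2)" using h by (auto simp: D12_def)
  have rw: "weak_grad (rad_fun g :: 'a \<Rightarrow> real) (rad_grad g)" "integrable lebesgue (\<lambda>x::'a. (norm (rad_grad g x))\<^sup>2)"
    using D12_rad[of g] by (auto simp: D12_def)
  have "(\<integral>x. rad_grad (mk zeta) (x::'a) \<bullet> rad_grad g x \<partial>lebesgue) = (\<integral>x. rad_grad (mk zeta) (x::'a) \<bullet> rad_grad g x \<partial>lborel)"
    by (rule lebesgue_integral_lborel(2)) measurable
  also have "\<dots> = cN * (\<integral>r. indicator {0<..} r * (fn (mk zeta) r * fn g r) \<partial>lborel)"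
    by (rule rad_grad_inner_integral(2))
  also have "(\<integral>r. indicator {0<..} r * (fn (mk zeta) r * fn g r) \<partial>lborel) = (\<integral>r. zeta r * fn g r \<partial>lborel)"
  proof (rule integral_cong_AE)
    show "(\<lambda>r. zeta r * fn g r) \<in> borel_measurable lborel" using sqintD(2)[OF zeta_sqint] by measurable
    show "AE r in lborel. indicator {0<..} r * (fn (mk zeta) r * fn g r) = zeta r * fn g r"
      using fn_mk[OF zeta_sqint] by eventually_elim (auto simp: indicator_def zeta_def)
  qed measurable
  also have "\<dots> = g \<bullet> mk zeta" using inner_mk_fn[OF zeta_sqint, of g] by (simp add: inner_commute)
  finally have rg: "(\<integral>x. rad_grad (mk zeta) (x::'a) \<bullet> rad_grad g x \<partial>lebesgue) = cN * (g \<bullet> mk zeta)" .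
  note t1 = weak_grad_test[OF hw] and t2 = weak_grad_test[OF rw]
  have "(\<integral>x. h x * divg (norm x) - rad_fun g x * divg (norm x) \<partial>lebesgue) = 0"
    unfolding Bochner_Integration.integral_diff[OF t1(1) t2(1)] t1(2) t2(2) rg g by simp
  also have "(\<integral>x. h x * divg (norm x) - rad_fun g x * divg (norm x) \<partial>lebesgue) = (\<integral>x. F (norm (x::'a)) \<partial>lebesgue)"
  proof (rule integral_cong_AE)
    show "(\<lambda>x. h x * divg (norm x) - rad_fun g x * divg (norm x)) \<in> borel_measurable lebesgue"
      by (intro borel_measurable_diff borel_measurable_integrable t1(1) t2(1))
    show "AE x in lebesgue. h x * divg (norm x) - rad_fun g x * divg (norm x) = F (norm x)"
      using k(2) by eventually_elim (simp add: F_def rad_fun_eq algebra_simps)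
    have "(\<lambda>x::'a. F (norm x)) \<in> borel_measurable borel" using F_meas by measurable
    then show "(\<lambda>x::'a. F (norm x)) \<in> borel_measurable lebesgue" by (intro measurable_completion) simp
  qed
  also have "(\<integral>x. F (norm (x::'a)) \<partial>lebesgue) = (\<integral>x. F (norm (x::'a)) \<partial>lborel)"
    by (rule lebesgue_integral_lborel(2)) (use F_meas in measurable)
  also have "\<dots> = (\<integral>r. pd r * F r \<partial>lborel)" by (rule polar_int(2)[OF F_meas])
  also have "(\<lambda>r. pd r * F r) = (\<lambda>r. cN * (indicator {0<..} r * ((k r - profile N g r) * (2 * r * z (r\<^sup>2)))))"
  proof
    fix r
    show "pd r * F r = cN * (indicator {0<..} r * ((k r - profile N g r) * (2 * r * z (r\<^sup>2))))"
    proof (cases "r > 0")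
      case True
      have "r powr (N-1) * r powr (2-N) = r powr 1" unfolding powr_add[symmetric] by simp
      then have "r powr (N-1) * r powr (2-N) = r" using True by simp
      moreover have "pd r * F r = cN * ((k r - profile N g r) * (2 * (r powr (N-1) * r powr (2-N)) * z (r\<^sup>2)))"
        using True by (simp add: pd_eq F_def divg_def)
      ultimately show ?thesis using True by simp
    qed (simp add: pd_eq)
  qed
  finally show ?thesis using cN_pos by simp
qed

end

section \<open>Structure of radial Sobolev functions\<close>

context dim3 begin

text \<open>Subtracting a multiple of a fixed reference bump gives a density of mass 0, whose
  pairing with the defect between k and the profile vanishes. So the pairing with a bump is
  proportional to its mass, with a factor independent of the bump: the constant by which the two
  functions may differ.\<close>

lemma bump_defect:
  assumes h: "D12 (h :: 'a \<Rightarrow> real) H" and k: "k \<in> borel_measurable borel" "AE x in lebesgue. h x = k (norm x)"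
    and g: "\<And>\<zeta>. (\<integral>x. rad_grad \<zeta> x \<bullet> H x \<partial>lebesgue) = cN * (g \<bullet> \<zeta>)"
    and loc: "\<And>c d. 0 < c \<Longrightarrow> integrable lborel (\<lambda>r. indicator {c..d} r * k r)"
    and e: "\<epsilon> > 0" and cd: "0 < c" "c < d"
  shows "(\<integral>r. indicator {0<..} r * ((k r - profile N g r) * (2 * r * bump \<epsilon> c d (r\<^sup>2))) \<partial>lborel)
    = (\<integral>t. bump \<epsilon> c d t \<partial>lborel) / (\<integral>t. bump 1 1 2 t \<partial>lborel)
      * (\<integral>r. indicator {0<..} r * ((k r - profile N g r) * (2 * r * bump 1 1 2 (r\<^sup>2))) \<partial>lborel)"
proof -
  have [measurable]: "profile N g \<in> borel_measurable borel" by (rule profile_meas[OF N3])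
  note [measurable] = k(1)
  have bc: "continuous_on A (bump \<epsilon> c d)" "continuous_on A (bump 1 1 2)" for A
    by (rule continuous_on_subset[OF bump_cont[OF e] subset_UNIV], rule continuous_on_subset[OF bump_cont[OF zero_less_one] subset_UNIV])
  have [measurable]: "bump \<epsilon> c d \<in> borel_measurable borel" "bump 1 1 2 \<in> borel_measurable borel"
    using bc by (auto intro: borel_measurable_continuous_onI)
  have bump_int: "integrable lborel (bump \<epsilon> c d)" if "\<epsilon> > 0" for \<epsilon> c d
  proof (rule Bochner_Integration.integrable_bound[of lborel "indicator {c<..<d} :: real \<Rightarrow> real"])
    show "integrable lborel (indicator {c<..<d} :: real \<Rightarrow> real)" by (rule integrable_real_indicator) (use emeasure_bounded_finite[OF bounded_box[where 'a=real]] in \<open>auto simp: box_real\<close>)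
    show "bump \<epsilon> c d \<in> borel_measurable lborel" using borel_measurable_continuous_onI[OF bump_cont[OF that]] by simp
    show "AE t in lborel. norm (bump \<epsilon> c d t) \<le> norm (indicator {c<..<d} t :: real)"
      using bump_bounds[OF that] by (intro AE_I2) simp
  qed
  define T2 where "T2 = (\<integral>t. bump 1 1 2 t \<partial>lborel)"
  have T2: "T2 > 0"
  proof -
    have "T2 \<ge> 0" unfolding T2_def by (intro integral_nonneg_AE AE_I2 bump_bounds(1)) simp
    moreover have "T2 \<noteq> 0"
    proof
      assume "T2 = 0"
      then have "AE t in lborel. bump 1 1 2 t = 0"
        unfolding T2_def by (subst (asm) integral_nonneg_eq_0_iff_AE[OF bump_int]) (auto simp: bump_bounds)
      then have "AE t in lborel. t \<notin> {1<..<2::real}"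
        by eventually_elim (use bump_pos[of 1 _ 2 1] in fastforce)
      then have "emeasure lborel {1<..<2::real} = 0"
        by (subst (asm) AE_iff_null_sets[symmetric]) (auto dest: null_setsD1)
      then show False by simp
    qed
    ultimately show ?thesis by simp
  qed
  \<comment> \<open>The quotient of the masses, so that z below has total mass 0 and its primitive
    vanishes beyond both supports.\<close>
  define lam where "lam = (\<integral>t. bump \<epsilon> c d t \<partial>lborel) / T2"
  define z where "z t = bump \<epsilon> c d t + (- lam) * bump 1 1 2 t" for t
  define m where "m = min c 1"
  define M where "M = max d 2"
  have mM: "0 < m" "m < M" using cd by (auto simp: m_def M_def)
  have z_out: "z t = 0" if "t \<le> m \<or> t \<ge> M" for t
    using that by (auto simp: z_def m_def M_def bump_outside)
  have z_cont: "continuous_on A z" for A unfolding z_def by (intro continuous_intros bc)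
  have z_int: "integrable lborel z" unfolding z_def using bump_int[OF e] bump_int[of 1] by auto
  have z_total: "(\<integral>t. z t \<partial>lborel) = 0"
    unfolding z_def using bump_int[OF e, of c d] bump_int[of 1 1 2] T2 by (simp add: lam_def T2_def)
  interpret rt: radial_test dummy N cN pd "Fprim z" z m M
  proof
    show "z \<in> pos_alg (Fprim z)"
    proof -
      have "(\<lambda>t. flat \<epsilon> 1 (1 * t + - c) * flat \<epsilon> 1 ((-1) * t + d) + (- lam) * (flat 1 1 (1 * t + - 1) * flat 1 1 ((-1) * t + 2))) \<in> pos_alg (Fprim z)"
        by (intro pos_alg.intros e zero_less_one)
      moreover have "(\<lambda>t. flat \<epsilon> 1 (1 * t + - c) * flat \<epsilon> 1 ((-1) * t + d) + (- lam) * (flat 1 1 (1 * t + - 1) * flat 1 1 ((-1) * t + 2))) = z"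
        by (simp add: fun_eq_iff z_def bump_def)
      ultimately show ?thesis by simp
    qed
    show "(Fprim z has_real_derivative z t) (at t)" for t
      by (rule Fprim_DERIV[OF z_cont]) (use z_out mM in auto)
    show "Fprim z t = 0" if "t \<le> m" for t
    proof -
      have "integral {0..t} z = integral {0..t} (\<lambda>_. 0)" by (rule integral_cong) (use that z_out in auto)
      then show ?thesis by (simp add: Fprim_def)
    qed
    show "Fprim z t = 0" if t: "t \<ge> M" for t
    proof -
      have "set_integrable lborel {0..t} z" by (rule borel_integrable_atLeastAtMost'[OF z_cont])
      then have "integral {0..t} z = (\<integral>s. indicator {0..t} s *\<^sub>R z s \<partial>lborel)"
        unfolding set_lebesgue_integral_def[symmetric] by (rule set_borel_integral_eq_integral(2)[symmetric])
      also have "(\<lambda>s. indicator {0..t} s *\<^sub>R z s) = z"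
      proof
        fix s
        show "indicator {0..t} s *\<^sub>R z s = z s"
          using z_out[of s] mM t by (cases "s \<in> {0..t}") auto
      qed
      finally show ?thesis using z_total by (simp add: Fprim_def)
    qed
    show "z \<in> borel_measurable borel" unfolding z_def by measurable
  qed (use mM in auto)
  have prod_int: "integrable lborel (\<lambda>r. indicator {0<..} r * ((k r - profile N g r) * (2 * r * bump \<epsilon>' c' d' (r\<^sup>2))))"
    if e': "\<epsilon>' > 0" and cd': "0 < c'" "c' < d'" for \<epsilon>' c' d'
  proof (rule Bochner_Integration.integrable_bound)
    have "integrable lborel (\<lambda>r. indicator {sqrt c'..sqrt d'} r *\<^sub>R profile N g r)"
      by (intro borel_integrable_compact continuous_on_subset[OF profile_continuous[OF N3]]) (use cd' in \<open>auto intro: less_le_trans[of 0 "sqrt c'"]\<close>)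
    then have "integrable lborel (\<lambda>r. indicator {sqrt c'..sqrt d'} r * k r - indicator {sqrt c'..sqrt d'} r * profile N g r)"
      using loc[of "sqrt c'" "sqrt d'"] cd' by (intro Bochner_Integration.integrable_diff) auto
    then show "integrable lborel (\<lambda>r. (2 * sqrt d') * (indicator {sqrt c'..sqrt d'} r * k r - indicator {sqrt c'..sqrt d'} r * profile N g r))"
      by (intro integrable_mult_right)
    have [measurable]: "bump \<epsilon>' c' d' \<in> borel_measurable borel" by (rule borel_measurable_continuous_onI[OF bump_cont[OF e']])
    show "(\<lambda>r. indicator {0<..} r * ((k r - profile N g r) * (2 * r * bump \<epsilon>' c' d' (r\<^sup>2)))) \<in> borel_measurable lborel" by measurable
    show "AE r in lborel. norm (indicator {0<..} r * ((k r - profile N g r) * (2 * r * bump \<epsilon>' c' d' (r\<^sup>2))))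
      \<le> norm ((2 * sqrt d') * (indicator {sqrt c'..sqrt d'} r * k r - indicator {sqrt c'..sqrt d'} r * profile N g r))"
    proof (rule AE_I2)
      fix r :: real
      show "norm (indicator {0<..} r * ((k r - profile N g r) * (2 * r * bump \<epsilon>' c' d' (r\<^sup>2))))
      \<le> norm ((2 * sqrt d') * (indicator {sqrt c'..sqrt d'} r * k r - indicator {sqrt c'..sqrt d'} r * profile N g r))"
      proof (cases "r > 0 \<and> c' < r\<^sup>2 \<and> r\<^sup>2 < d'")
        case True
        then have r: "sqrt c' \<le> r" "r \<le> sqrt d'" "r > 0"
          using real_le_lsqrt[of r c'] real_le_rsqrt[of r d'] cd' by auto
        have b: "0 \<le> bump \<epsilon>' c' d' (r\<^sup>2)" "bump \<epsilon>' c' d' (r\<^sup>2) \<le> 1"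
          by (rule bump_bounds(1)[OF e'], rule order_trans[OF bump_bounds(2)[OF e']]) (simp add: indicator_def)
        have "2 * r * bump \<epsilon>' c' d' (r\<^sup>2) \<le> 2 * sqrt d' * 1" using r b cd' by (intro mult_mono) auto
        then have "\<bar>k r - profile N g r\<bar> * (2 * r * bump \<epsilon>' c' d' (r\<^sup>2)) \<le> \<bar>k r - profile N g r\<bar> * (2 * sqrt d')"
          by (intro mult_left_mono) auto
        then show ?thesis using r b cd' by (simp add: abs_mult mult.commute[of "2 * sqrt d'"])
      next
        case False
        then have "indicator {0<..} r * ((k r - profile N g r) * (2 * r * bump \<epsilon>' c' d' (r\<^sup>2))) = 0"
          by (auto simp: bump_outside)
        then show ?thesis by (simp only: norm_zero) simp
      qed
    qed
  qed
  have "0 = (\<integral>r. indicator {0<..} r * ((k r - profile N g r) * (2 * r * z (r\<^sup>2))) \<partial>lborel)"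
    by (rule rt.profile_defect_zero[OF h k g, symmetric])
  also have "\<dots> = (\<integral>r. indicator {0<..} r * ((k r - profile N g r) * (2 * r * bump \<epsilon> c d (r\<^sup>2)))
      - lam * (indicator {0<..} r * ((k r - profile N g r) * (2 * r * bump 1 1 2 (r\<^sup>2)))) \<partial>lborel)"
    by (rule Bochner_Integration.integral_cong[OF refl]) (simp add: z_def algebra_simps)
  also have "\<dots> = (\<integral>r. indicator {0<..} r * ((k r - profile N g r) * (2 * r * bump \<epsilon> c d (r\<^sup>2))) \<partial>lborel)
      - lam * (\<integral>r. indicator {0<..} r * ((k r - profile N g r) * (2 * r * bump 1 1 2 (r\<^sup>2))) \<partial>lborel)"
    by (subst Bochner_Integration.integral_diff) (auto intro!: integrable_mult_right prod_int e cd)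
  finally show ?thesis by (simp add: lam_def T2_def)
qed

text \<open>The pairings with test fields determine h only up to an additive constant. Membership in
  the critical Lebesgue space excludes a nonzero constant, as profiles tend to 0 at
  infinity.\<close>

theorem radial_structure:
  assumes h: "D12 (h :: 'a \<Rightarrow> real) H" and rad: "radial h"
  shows "\<exists>g. (AE x in lebesgue. h x = rad_fun g x) \<and> (\<forall>\<zeta>. (\<integral>x. rad_grad \<zeta> x \<bullet> H x \<partial>lebesgue) = cN * (g \<bullet> \<zeta>))"
proof -
  have h_meas: "h \<in> borel_measurable lebesgue" and h_int: "integrable lebesgue (\<lambda>x. \<bar>h x\<bar> powr crit_exp TYPE('a))"
    and H: "H \<in> borel_measurable lebesgue" "integrable lebesgue (\<lambda>x. (norm (H x))\<^sup>2)"
    using h by (auto simp: D12_def weak_grad_def)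
  obtain g where g: "\<And>\<zeta>. (\<integral>x. rad_grad \<zeta> x \<bullet> H x \<partial>lebesgue) = cN * (g \<bullet> \<zeta>)"
    using rad_grad_pairing_rep[OF H] by blast
  obtain k where k: "k \<in> borel_measurable borel" "AE x in lebesgue. h x = k (norm x)"
    using radial_borel[OF h_meas rad] by blast
  note [measurable] = k(1)
  define q where "q = crit_exp TYPE('a)"
  have q: "q > 2" using N3 unfolding q_def crit_exp_def N_def[symmetric] by (auto simp: field_simps)
  have kq: "integrable lborel (\<lambda>x::'a. \<bar>k (norm x)\<bar> powr q)"
  proof -
    have m: "(\<lambda>x::'a. \<bar>k (norm x)\<bar> powr q) \<in> borel_measurable borel" by measurable
    have "AE x in lebesgue. \<bar>h x\<bar> powr q = \<bar>k (norm x)\<bar> powr q" using k(2) by eventually_elim simp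
    moreover have "(\<lambda>x. \<bar>h x\<bar> powr q) \<in> borel_measurable lebesgue"
      using borel_measurable_integrable[OF h_int] by (simp add: q_def)
    moreover have "(\<lambda>x::'a. \<bar>k (norm x)\<bar> powr q) \<in> borel_measurable lebesgue" using m by (intro measurable_completion) simp
    ultimately have "integrable lebesgue (\<lambda>x::'a. \<bar>k (norm x)\<bar> powr q)"
      using h_int integrable_cong_AE[of "\<lambda>x. \<bar>h x\<bar> powr q" lebesgue "\<lambda>x. \<bar>k (norm x)\<bar> powr q"] by (simp add: q_def)
    then show ?thesis using lebesgue_integral_lborel(1)[OF m] by simp
  qed
  \<comment> \<open>|k| <= 1 + |k|^q, and the polar density is bounded below on [c, d], so
    integrability over a shell descends to the radii.\<close>
  have loc: "integrable lborel (\<lambda>r. indicator {c..d} r * k r)" if c: "0 < c" for c d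
  proof -
    have "integrable lborel (\<lambda>x::'a. indicator {c..d} (norm x) * \<bar>k (norm x)\<bar>)"
    proof (rule Bochner_Integration.integrable_bound)
      show "integrable lborel (\<lambda>x::'a. indicator (cball 0 d) x + \<bar>k (norm x)\<bar> powr q)"
        by (intro Bochner_Integration.integrable_add kq integrable_real_indicator) (use emeasure_bounded_finite[OF bounded_cball[of "0::'a" d]] in auto)
      show "AE x in lborel. norm (indicator {c..d} (norm (x::'a)) * \<bar>k (norm x)\<bar>) \<le> norm (indicator (cball 0 d) x + \<bar>k (norm x)\<bar> powr q)"
      proof (rule AE_I2)
        fix x :: 'a
        have "\<bar>k (norm x)\<bar> \<le> 1 + \<bar>k (norm x)\<bar> powr q"
        proof (cases "\<bar>k (norm x)\<bar> \<le> 1")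
          case False
          then have "\<bar>k (norm x)\<bar> powr 1 \<le> \<bar>k (norm x)\<bar> powr q" using q by (intro powr_mono) auto
          then show ?thesis using False by simp
        qed (simp add: add_increasing2)
        then show "norm (indicator {c..d} (norm x) * \<bar>k (norm x)\<bar>) \<le> norm (indicator (cball 0 d) x + \<bar>k (norm x)\<bar> powr q)"
          by (auto simp: indicator_def)
      qed
    qed measurable
    then have i: "integrable lborel (\<lambda>r. pd r * (indicator {c..d} r * \<bar>k r\<bar>))"
      by (subst (asm) polar_int(1)) auto
    have i2: "integrable lborel (\<lambda>r. (1 / (cN * c powr (N-1))) * (pd r * (indicator {c..d} r * \<bar>k r\<bar>)))"
      by (intro integrable_mult_right i)
    show ?thesis
    proof (rule Bochner_Integration.integrable_bound[OF i2])
      show "AE r in lborel. norm (indicator {c..d} r * k r) \<le> norm ((1 / (cN * c powr (N-1))) * (pd r * (indicator {c..d} r * \<bar>k r\<bar>)))"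
      proof (rule AE_I2)
        fix r
        show "norm (indicator {c..d} r * k r) \<le> norm ((1 / (cN * c powr (N-1))) * (pd r * (indicator {c..d} r * \<bar>k r\<bar>)))"
        proof (cases "r \<in> {c..d}")
          case True
          have p: "cN * c powr (N-1) > 0" using cN_pos c by simp
          have "cN * c powr (N-1) \<le> pd r" using True c N3 cN_pos by (auto simp: pd_eq intro!: mult_left_mono powr_mono2)
          then have "1 \<le> (1 / (cN * c powr (N-1))) * pd r" using p by (simp add: field_simps)
          then have "1 * \<bar>k r\<bar> \<le> (1 / (cN * c powr (N-1))) * pd r * \<bar>k r\<bar>" by (intro mult_right_mono) auto
          moreover have "(1 / (cN * c powr (N-1))) * pd r \<ge> 0" using p pd_nonneg by simp
          ultimately show ?thesis using True cN_pos pd_nonneg[of r] by (simp add: abs_mult)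
        qed simp
      qed
    qed measurable
  qed
  have [measurable]: "profile N g \<in> borel_measurable borel" by (rule profile_meas[OF N3])
  define y where "y r = k r - profile N g r" for r
  have [measurable]: "y \<in> borel_measurable borel" unfolding y_def by measurable
  have y_loc: "integrable lborel (\<lambda>r. indicator {c..d} r * y r)" if "0 < c" for c d
  proof -
    have "integrable lborel (\<lambda>r. indicator {c..d} r *\<^sub>R profile N g r)"
      by (intro borel_integrable_compact continuous_on_subset[OF profile_continuous[OF N3]]) (use that in auto)
    then show ?thesis using loc[OF that, of d] unfolding y_def right_diff_distrib
      by (intro Bochner_Integration.integrable_diff) auto
  qed
  define C0 where "C0 = (\<integral>r. indicator {0<..} r * (y r * (2 * r * bump 1 1 2 (r\<^sup>2))) \<partial>lborel) / (\<integral>t. bump 1 1 2 t \<partial>lborel)"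
  \<comment> \<open>Letting \<epsilon> tend to 0 in \<open>bump_defect\<close> replaces bumps in the
    variable r^2 by indicators, and d^2 - c^2 is the mass of the indicator of (c^2, d^2).\<close>
  have step: "(\<integral>r. indicator {c<..<d} r * (y r * (2 * r)) \<partial>lborel) = C0 * (d\<^sup>2 - c\<^sup>2)" if cd: "0 < c" "c < d" for c d
  proof -
    define \<epsilon> where "\<epsilon> n = 1 / real (Suc n)" for n
    have e: "\<epsilon> n > 0" for n by (simp add: \<epsilon>_def)
    have e0: "\<epsilon> \<longlonglongrightarrow> 0" unfolding \<epsilon>_def using LIMSEQ_Suc[OF lim_1_over_n] by simp
    have cd2: "0 < c\<^sup>2" "c\<^sup>2 < d\<^sup>2" using cd by (auto intro!: power_strict_mono)
    have bm [measurable]: "bump (\<epsilon> n) a b \<in> borel_measurable borel" for n a b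
      by (rule borel_measurable_continuous_onI[OF bump_cont[OF e]])
    have eq: "(\<integral>r. indicator {0<..} r * (y r * (2 * r * bump (\<epsilon> n) (c\<^sup>2) (d\<^sup>2) (r\<^sup>2))) \<partial>lborel)
      = (\<integral>t. bump (\<epsilon> n) (c\<^sup>2) (d\<^sup>2) t \<partial>lborel) * C0" for n
      using bump_defect[OF h k g loc e cd2, of n] unfolding y_def C0_def by simp
    have ind: "indicator {0<..} r * (indicator {c\<^sup>2<..<d\<^sup>2} (r\<^sup>2) :: real) = indicator {c<..<d} r" for r :: real
    proof (cases "r > 0")
      case True
      have "c\<^sup>2 < r\<^sup>2 \<longleftrightarrow> c < r" using True cd power_strict_mono[of c r 2] power2_less_imp_less[of c r] by auto
      moreover have "r\<^sup>2 < d\<^sup>2 \<longleftrightarrow> r < d" using True cd power_strict_mono[of r d 2] power2_less_imp_less[of r d] by auto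
      ultimately show ?thesis using True by (simp add: indicator_def)
    next
      case False
      then show ?thesis using cd by (auto simp: indicator_def)
    qed
    have lim: "(\<lambda>n. \<integral>r. indicator {0<..} r * (y r * (2 * r * bump (\<epsilon> n) (c\<^sup>2) (d\<^sup>2) (r\<^sup>2))) \<partial>lborel)
      \<longlonglongrightarrow> (\<integral>r. indicator {c<..<d} r * (y r * (2 * r)) \<partial>lborel)"
    proof (rule integral_dominated_convergence)
      show "integrable lborel (\<lambda>r. (2 * d) * \<bar>indicator {c..d} r * y r\<bar>)"
        by (intro integrable_mult_right integrable_abs y_loc cd)
      show "AE r in lborel. (\<lambda>n. indicator {0<..} r * (y r * (2 * r * bump (\<epsilon> n) (c\<^sup>2) (d\<^sup>2) (r\<^sup>2)))) \<longlonglongrightarrow> indicator {c<..<d} r * (y r * (2 * r))"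
      proof (rule AE_I2)
        fix r :: real
        have "(\<lambda>n. indicator {0<..} r * (y r * (2 * r * bump (\<epsilon> n) (c\<^sup>2) (d\<^sup>2) (r\<^sup>2)))) \<longlonglongrightarrow> indicator {0<..} r * (y r * (2 * r * indicator {c\<^sup>2<..<d\<^sup>2} (r\<^sup>2)))"
          by (intro tendsto_intros bump_tendsto e e0)
        also have "indicator {0<..} r * (y r * (2 * r * indicator {c\<^sup>2<..<d\<^sup>2} (r\<^sup>2))) = indicator {c<..<d} r * (y r * (2 * r))"
          unfolding ind[symmetric] by simp
        finally show "(\<lambda>n. indicator {0<..} r * (y r * (2 * r * bump (\<epsilon> n) (c\<^sup>2) (d\<^sup>2) (r\<^sup>2)))) \<longlonglongrightarrow> indicator {c<..<d} r * (y r * (2 * r))" .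
      qed
      fix n
      show "AE r in lborel. norm (indicator {0<..} r * (y r * (2 * r * bump (\<epsilon> n) (c\<^sup>2) (d\<^sup>2) (r\<^sup>2)))) \<le> (2 * d) * \<bar>indicator {c..d} r * y r\<bar>"
      proof (rule AE_I2)
        fix r :: real
        show "norm (indicator {0<..} r * (y r * (2 * r * bump (\<epsilon> n) (c\<^sup>2) (d\<^sup>2) (r\<^sup>2)))) \<le> (2 * d) * \<bar>indicator {c..d} r * y r\<bar>"
        proof (cases "c < r \<and> r < d")
          case True
          have b: "0 \<le> bump (\<epsilon> n) (c\<^sup>2) (d\<^sup>2) (r\<^sup>2)" by (rule bump_bounds(1)[OF e])
          have "bump (\<epsilon> n) (c\<^sup>2) (d\<^sup>2) (r\<^sup>2) \<le> 1"
            by (rule order_trans[OF bump_bounds(2)[OF e]]) (simp add: indicator_def)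
          then have "2 * r * bump (\<epsilon> n) (c\<^sup>2) (d\<^sup>2) (r\<^sup>2) \<le> 2 * d * 1" using True cd b by (intro mult_mono) auto
          then have "\<bar>y r\<bar> * (2 * r * bump (\<epsilon> n) (c\<^sup>2) (d\<^sup>2) (r\<^sup>2)) \<le> \<bar>y r\<bar> * (2 * d)" by (intro mult_left_mono) auto
          then show ?thesis using True cd b by (simp add: abs_mult ac_simps)
        next
          case False
          then have "indicator {c<..<d} r = (0::real)" by auto
          then have "indicator {0<..} r * (indicator {c\<^sup>2<..<d\<^sup>2} (r\<^sup>2) :: real) = 0" using ind[of r] by simp
          then have "r \<le> 0 \<or> \<not> (c\<^sup>2 < r\<^sup>2 \<and> r\<^sup>2 < d\<^sup>2)" by (auto simp: indicator_def split: if_splits)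
          then have "indicator {0<..} r * (y r * (2 * r * bump (\<epsilon> n) (c\<^sup>2) (d\<^sup>2) (r\<^sup>2))) = 0"
            by (auto simp: bump_outside)
          then show ?thesis using cd by (simp only: norm_zero) simp
        qed
      qed
    qed measurable
    note lim1 = lim[unfolded eq]
    have "(\<lambda>n. \<integral>t. bump (\<epsilon> n) (c\<^sup>2) (d\<^sup>2) t \<partial>lborel) \<longlonglongrightarrow> (\<integral>t. indicator {c\<^sup>2<..<d\<^sup>2} t \<partial>lborel)"
    proof (rule integral_dominated_convergence)
      show "integrable lborel (indicator {c\<^sup>2<..<d\<^sup>2} :: real \<Rightarrow> real)" by (rule integrable_real_indicator) (use emeasure_bounded_finite[OF bounded_box[where 'a=real]] in \<open>auto simp: box_real\<close>)
      show "AE t in lborel. (\<lambda>n. bump (\<epsilon> n) (c\<^sup>2) (d\<^sup>2) t) \<longlonglongrightarrow> indicator {c\<^sup>2<..<d\<^sup>2} t"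
        by (intro AE_I2 bump_tendsto e e0)
      show "AE t in lborel. norm (bump (\<epsilon> n) (c\<^sup>2) (d\<^sup>2) t) \<le> indicator {c\<^sup>2<..<d\<^sup>2} t" for n
        using bump_bounds[OF e] by (intro AE_I2) simp
    qed measurable
    then have lim2: "(\<lambda>n. (\<integral>t. bump (\<epsilon> n) (c\<^sup>2) (d\<^sup>2) t \<partial>lborel) * C0) \<longlonglongrightarrow> (d\<^sup>2 - c\<^sup>2) * C0"
      using cd2 by (intro tendsto_mult_right) (simp add: measure_def)
    show ?thesis using LIMSEQ_unique[OF lim1 lim2] by (simp only: mult.commute)
  qed
  have "AE r in lborel. 0 < r \<longrightarrow> (y r - C0) * (2 * r) = 0"
  proof (rule AE_pos_zero_of_intervals)
    fix c d :: real assume cd: "0 < c" "c < d"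
    have i1: "integrable lborel (\<lambda>r. indicator {c<..<d} r * (y r * (2 * r)))"
    proof (rule Bochner_Integration.integrable_bound)
      show "integrable lborel (\<lambda>r. (2 * d) * (indicator {c..d} r * y r))"
        by (intro integrable_mult_right y_loc cd)
      show "AE r in lborel. norm (indicator {c<..<d} r * (y r * (2 * r))) \<le> norm ((2 * d) * (indicator {c..d} r * y r))"
      proof (rule AE_I2)
        fix r
        show "norm (indicator {c<..<d} r * (y r * (2 * r))) \<le> norm ((2 * d) * (indicator {c..d} r * y r))"
          using cd mult_left_mono[of r d "\<bar>y r\<bar>"] by (auto simp: indicator_def abs_mult ac_simps)
      qed
    qed measurable
    have i2: "integrable lborel (\<lambda>r. indicator {c<..<d} r * (2 * r))"
      by (rule Bochner_Integration.integrable_bound[of lborel "\<lambda>r. (2 * d) * indicator {c<..<d} r"])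
        (intro integrable_mult_right integrable_real_indicator, use cd in \<open>auto simp: indicator_def\<close>)
    have v2: "(\<integral>r. indicator {c<..<d} r * (2 * r) \<partial>lborel) = d\<^sup>2 - c\<^sup>2"
    proof -
      have "(\<integral>r. indicator {c<..<d} r * (2 * r) \<partial>lborel) = (\<integral>r. (2 * r) * indicator {c..d} r \<partial>lborel)"
      proof (rule integral_cong_AE)
        show "AE r in lborel. indicator {c<..<d} r * (2 * r) = (2 * r) * indicator {c..d} r"
          using AE_lborel_singleton[of c] AE_lborel_singleton[of d] by eventually_elim (auto simp: indicator_def)
      qed measurable
      also have "\<dots> = d\<^sup>2 - c\<^sup>2"
        by (rule integral_FTC_Icc_real) (use cd in \<open>auto intro!: derivative_eq_intros continuous_intros\<close>)
      finally show ?thesis .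
    qed
    have eq: "(\<lambda>r. indicator {c<..<d} r * ((y r - C0) * (2 * r))) = (\<lambda>r. indicator {c<..<d} r * (y r * (2 * r)) - C0 * (indicator {c<..<d} r * (2 * r)))"
      by (simp add: fun_eq_iff algebra_simps)
    show "integrable lborel (\<lambda>r. indicator {c<..<d} r * ((y r - C0) * (2 * r)))"
      unfolding eq by (intro Bochner_Integration.integrable_diff i1 integrable_mult_right i2)
    show "(\<integral>r. indicator {c<..<d} r * ((y r - C0) * (2 * r)) \<partial>lborel) = 0"
      unfolding eq using i1 i2 by (simp add: step[OF cd] v2)
  qed
  then have yC: "AE r in lborel. r > 0 \<longrightarrow> k r = profile N g r + C0"
    by eventually_elim (auto simp: y_def)
  have kC: "AE x in lborel. k (norm (x::'a)) = rad_fun g x + C0"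
    unfolding rad_fun_eq by (rule polar_AE[OF yC])
  \<comment> \<open>Otherwise |k| is at least |C0| / 2 outside a ball, and integrability of |k|^q
    would give the complement of that ball finite volume.\<close>
  have "C0 = 0"
  proof (rule ccontr)
    assume C0: "C0 \<noteq> 0"
    have "\<forall>\<^sub>F r in at_top. \<bar>profile N g r\<bar> < \<bar>C0\<bar> / 2"
      using tendstoD[OF profile_tendsto_0[OF N3], of "\<bar>C0\<bar> / 2" g] C0 by (simp add: dist_real_def)
    then obtain R where R: "\<And>r. r \<ge> R \<Longrightarrow> \<bar>profile N g r\<bar> < \<bar>C0\<bar> / 2" unfolding eventually_at_top_linorder by blast
    have "integrable lborel (\<lambda>x. indicator (- cball 0 R) (x::'a) * ((\<bar>C0\<bar> / 2) powr q))"
    proof (rule Bochner_Integration.integrable_bound[OF kq])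
      show "AE x in lborel. norm (indicator (- cball 0 R) (x::'a) * ((\<bar>C0\<bar> / 2) powr q)) \<le> norm (\<bar>k (norm x)\<bar> powr q)"
        using kC
      proof eventually_elim
        case (elim x)
        show ?case
        proof (cases "x \<in> cball 0 R")
          case False
          then have "\<bar>rad_fun g x\<bar> < \<bar>C0\<bar> / 2" unfolding rad_fun_eq by (intro R) simp
          then have "\<bar>C0\<bar> / 2 \<le> \<bar>k (norm x)\<bar>" unfolding elim by linarith
          then have "(\<bar>C0\<bar> / 2) powr q \<le> \<bar>k (norm x)\<bar> powr q" using q by (intro powr_mono2) auto
          then show ?thesis using False by simp
        qed simp
      qed
    qed measurable
    then have "integrable lborel (\<lambda>x. (indicator (- cball 0 R) (x::'a) * ((\<bar>C0\<bar> / 2) powr q)) / ((\<bar>C0\<bar> / 2) powr q))"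
      by (rule integrable_divide)
    then have "integrable lborel (indicator (- cball 0 R) :: 'a \<Rightarrow> real)" using C0 by simp
    then have f1: "emeasure lborel (- cball 0 R :: 'a set) < \<infinity>"
      by (simp add: integrable_indicator_iff)
    have f2: "emeasure lborel (cball 0 R :: 'a set) < \<infinity>" by (rule emeasure_bounded_finite) simp
    have "emeasure lborel (cball 0 R \<union> - cball 0 R :: 'a set) \<le> emeasure lborel (cball 0 R :: 'a set) + emeasure lborel (- cball 0 R :: 'a set)"
      by (rule emeasure_subadditive) auto
    also have "\<dots> < \<infinity>" using f1 f2 by simp
    finally have "emeasure lborel (UNIV :: 'a set) < \<infinity>" by (simp only: Compl_partition)
    then show False using emeasure_lborel_UNIV[where 'a='a] by (simp only: less_irrefl)
  qed
  then have "AE x in lebesgue. k (norm (x::'a)) = rad_fun g x" using AE_completion[OF kC] by simp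
  with k(2) have "AE x in lebesgue. h x = rad_fun g x" by eventually_elim simp
  then show ?thesis using g by blast
qed

end

section \<open>Radial solutions\<close>

context dim3 begin

text \<open>The origin is left out because V and K are controlled on the positive half line only and
  may take any value at 0.\<close>

lemma radial_lebesgue_integral:
  fixes h :: "'a \<Rightarrow> real"
  assumes F: "(\<lambda>r. if r > 0 then F r else 0) \<in> borel_measurable borel"
    and h: "AE x in lebesgue. x \<noteq> 0 \<longrightarrow> h x = F (norm x)"
  shows "integrable lebesgue h \<longleftrightarrow> integrable lborel (\<lambda>r. if r > 0 then r powr (N-1) * F r else 0)"
    "(\<integral>x. h x \<partial>lebesgue) = cN * (\<integral>r. (if r > 0 then r powr (N-1) * F r else 0) \<partial>lborel)"
proof -
  define F0 where "F0 r = (if r > 0 then F r else 0)" for r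
  have [measurable]: "F0 \<in> borel_measurable borel" using F unfolding F0_def .
  have m: "(\<lambda>x::'a. F0 (norm x)) \<in> borel_measurable borel" by measurable
  then have m1: "(\<lambda>x::'a. F0 (norm x)) \<in> borel_measurable lebesgue" by (intro measurable_completion) simp
  have "AE x in lebesgue. x \<noteq> (0::'a)" by (intro AE_completion AE_lborel_singleton)
  with h have AE: "AE x in lebesgue. F0 (norm x) = h x"
    by eventually_elim (auto simp: F0_def)
  have hm: "h \<in> borel_measurable lebesgue" by (rule borel_measurable_AE[OF m1 AE])
  have eq: "(\<lambda>r. pd r * F0 r) = (\<lambda>r. cN * (if r > 0 then r powr (N-1) * F r else 0))"
    by (auto simp: fun_eq_iff pd_eq F0_def)
  have "integrable lebesgue h \<longleftrightarrow> integrable lebesgue (\<lambda>x::'a. F0 (norm x))"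
    using AE by (intro integrable_cong_AE hm m1) (auto elim!: eventually_mono)
  also have "\<dots> \<longleftrightarrow> integrable lborel (\<lambda>r. cN * (if r > 0 then r powr (N-1) * F r else 0))"
    unfolding lebesgue_integral_lborel(1)[OF m] by (subst polar_int(1)) (simp_all only: eq \<open>F0 \<in> borel_measurable borel\<close>)
  finally show "integrable lebesgue h \<longleftrightarrow> integrable lborel (\<lambda>r. if r > 0 then r powr (N-1) * F r else 0)"
    using cN_pos by simp
  have "(\<integral>x. h x \<partial>lebesgue) = (\<integral>x. F0 (norm (x::'a)) \<partial>lebesgue)"
    using AE by (intro integral_cong_AE hm m1) (auto elim!: eventually_mono)
  also have "\<dots> = (\<integral>r. cN * (if r > 0 then r powr (N-1) * F r else 0) \<partial>lborel)"
    unfolding lebesgue_integral_lborel(2)[OF m] by (subst polar_int(2)) (simp_all only: eq \<open>F0 \<in> borel_measurable borel\<close>)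
  finally show "(\<integral>x. h x \<partial>lebesgue) = cN * (\<integral>r. (if r > 0 then r powr (N-1) * F r else 0) \<partial>lborel)" by simp
qed

end

locale radial_setting = dim3 dummy N cN pd + radial_problem N a0 a b0 b V K f q1 q2 Cf \<theta> c0 c1 t1
  for dummy :: "'a::euclidean_space itself" and N cN :: real and pd :: "real \<Rightarrow> real"
    and a0 a b0 b :: real and V K f :: "real \<Rightarrow> real" and q1 q2 Cf \<theta> c0 c1 t1 :: real
begin

lemma V_profile_meas: "(\<lambda>r. if r > 0 then V r * profile N x r * profile N y r else 0) \<in> borel_measurable borel"
  by (intro measurable_positive_part continuous_intros V_cont profile_continuous[OF N])

lemma V_weight_meas:
  "(\<lambda>r. if r > 0 then r powr (N-1) * (V r * profile N x r * profile N y r) else 0) \<in> borel_measurable lborel"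
  by (simp only: measurable_lborel2, intro measurable_positive_part continuous_intros V_cont profile_continuous[OF N]) auto

lemma H1Vr_rad:
  assumes u: "u \<in> E" shows "H1Vr V (rad_fun (fst u) :: 'a \<Rightarrow> real) (rad_grad (fst u))"
proof -
  have "integrable lborel (\<lambda>r. if r > 0 then r powr (N-1) * (V r * w u r * w u r) else 0)"
  proof (rule integrableI_nonneg)
    show "(\<lambda>r. if r > 0 then r powr (N-1) * (V r * w u r * w u r) else 0) \<in> borel_measurable lborel"
      by (rule V_weight_meas)
    show "AE r in lborel. 0 \<le> (if r > 0 then r powr (N-1) * (V r * w u r * w u r) else 0)"
      using V_nonneg by (auto simp: mult.assoc intro!: AE_I2)
    have "(\<integral>\<^sup>+r. ennreal (if r > 0 then r powr (N-1) * (V r * w u r * w u r) else 0) \<partial>lborel)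
      = (\<integral>\<^sup>+r. ennreal (V r * r powr (N-1) * (w u r)\<^sup>2) \<partial>lborel)"
      by (intro nn_integral_cong) (auto simp: profile_def power2_eq_square ac_simps)
    then show "(\<integral>\<^sup>+r. ennreal (if r > 0 then r powr (N-1) * (V r * w u r * w u r) else 0) \<partial>lborel) < \<infinity>"
      unfolding V_energy[OF u] by simp
  qed
  then have "integrable lebesgue (\<lambda>x::'a. V (norm x) * (rad_fun (fst u) x)\<^sup>2)"
    by (subst radial_lebesgue_integral(1)[OF V_profile_meas[of "fst u" "fst u"]])
      (auto simp: rad_fun_eq power2_eq_square mult.assoc)
  then show ?thesis unfolding H1Vr_def H1V_def using D12_rad rad_fun_radial by blast
qed

text \<open>Every admissible test function is almost everywhere the function of an element of
  \<open>E\<close>, so that criticality in \<open>E\<close> covers the definition of a radial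
  solution. Of H only its pairings with radial gradients are recorded, and the gradient of the
  solution is one of these.\<close>

lemma H1Vr_energy:
  assumes h: "H1Vr V (h :: 'a \<Rightarrow> real) H"
  shows "\<exists>e\<in>E. (AE x in lebesgue. h x = rad_fun (fst e) x) \<and> (\<forall>\<zeta>. (\<integral>x. rad_grad \<zeta> x \<bullet> H x \<partial>lebesgue) = cN * (fst e \<bullet> \<zeta>))"
proof -
  have h': "D12 h H" "radial h" "integrable lebesgue (\<lambda>x. V (norm x) * (h x)\<^sup>2)"
    using h by (auto simp: H1Vr_def H1V_def)
  obtain g where g: "AE x in lebesgue. h x = rad_fun g x" "\<And>\<zeta>. (\<integral>x. rad_grad \<zeta> x \<bullet> H x \<partial>lebesgue) = cN * (g \<bullet> \<zeta>)"
    using radial_structure[OF h'(1,2)] by blast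
  define v where "v r = (if r > 0 then sqrt (V r * r powr (N-1)) * profile N g r else 0)" for r
  have "v \<in> borel_measurable borel"
    unfolding v_def by (intro measurable_positive_part continuous_intros V_cont profile_continuous[OF N]) auto
  moreover have "integrable lborel (\<lambda>r. if r > 0 then r powr (N-1) * (V r * profile N g r * profile N g r) else 0)"
    using h'(3) by (subst (asm) radial_lebesgue_integral(1)[OF V_profile_meas[of g g]])
      (use g(1) in \<open>auto simp: rad_fun_eq power2_eq_square mult.assoc elim!: eventually_mono\<close>)
  moreover have "(\<lambda>r. if r > 0 then r powr (N-1) * (V r * profile N g r * profile N g r) else 0) = (\<lambda>r. (v r)\<^sup>2)"
    using V_nonneg by (auto simp: fun_eq_iff v_def power_mult_distrib) (simp add: power2_eq_square)
  ultimately have v: "sqint v" by (simp add: sqint_def)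
  have "(g, mk v) \<in> E"
    using fn_mk[OF v] unfolding energy_space_def v_def by (simp only: mem_Collect_eq fst_conv snd_conv)
  then show ?thesis using g by (intro bexI[of _ "(g, mk v)"]) auto
qed

theorem radial_solution_exists:
  "\<exists>u :: 'a \<Rightarrow> real. radial_solution V K f u \<and> (\<forall>x. u x \<ge> 0) \<and> \<not> (AE x in lebesgue. u x = 0)"
proof -
  obtain u where u: "u \<in> E" "u \<noteq> 0" "\<And>r. w u r \<ge> 0"
    "\<And>h. h \<in> E \<Longrightarrow> u \<bullet> h = (\<integral>r. kk r * f (w u r) * w h r \<partial>lborel)"
    using nonneg_critical_point by blast
  define U where "U = (rad_fun (fst u) :: 'a \<Rightarrow> real)"
  have [measurable]: "U \<in> borel_measurable borel" unfolding U_def by measurable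
  have wm [measurable]: "w e \<in> borel_measurable borel" for e by (rule profile_meas[OF N])
  \<comment> \<open>If U vanished, so would the right side of the equation tested with u, giving u .
    u = 0; thus nontriviality in \<open>E\<close> passes to the function.\<close>
  have "\<not> (AE x in lebesgue. U x = 0)"
  proof
    assume "AE x in lebesgue. U x = 0"
    then have "AE x::'a in lborel. w u (norm x) = 0" by (simp add: AE_completion_iff U_def rad_fun_eq)
    then have "AE r in lborel. r > 0 \<longrightarrow> w u r = 0" by (rule polar_AE_converse[rotated]) measurable
    then have "AE r in lborel. w u r = 0" by eventually_elim (auto simp: profile_def)
    then have "(\<integral>r. kk r * f (w u r) * w u r \<partial>lborel) = 0"
      by (intro integral_eq_zero_AE) (auto elim!: eventually_mono)
    then have "u \<bullet> u = 0" using u(4)[OF u(1)] by simp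
    then show False using u(2) by simp
  qed
  moreover have "U x \<ge> 0" for x using u(3) by (simp add: U_def rad_fun_eq)
  moreover have "radial_solution V K f U"
    unfolding radial_solution_def
  proof (intro exI[of _ "rad_grad (fst u)"] conjI allI impI)
    show "H1Vr V U (rad_grad (fst u))" unfolding U_def by (rule H1Vr_rad[OF u(1)])
    fix h :: "'a \<Rightarrow> real" and H assume "H1Vr V h H"
    then obtain e where e: "e \<in> E" "AE x in lebesgue. h x = rad_fun (fst e) x"
      "\<And>\<zeta>. (\<integral>x. rad_grad \<zeta> x \<bullet> H x \<partial>lebesgue) = cN * (fst e \<bullet> \<zeta>)"
      using H1Vr_energy by blast
    have Kc: "continuous_on {0<..} (\<lambda>r. K r * f (w u r) * w e r)"
      by (intro continuous_intros K_cont profile_continuous[OF N] continuous_on_compose2[OF f_cont]) auto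
    have K_AE: "AE x in lebesgue. x \<noteq> 0 \<longrightarrow> K (norm x) * f (U x) * h x = K (norm x) * f (w u (norm x)) * w e (norm x)"
      using e(2) by eventually_elim (simp add: U_def rad_fun_eq)
    note Kint = radial_lebesgue_integral[OF measurable_positive_part[OF Kc] K_AE]
    have K_eq: "(\<lambda>r. if r > 0 then r powr (N-1) * (K r * f (w u r) * w e r) else 0) = (\<lambda>r. kk r * f (w u r) * w e r)"
      by (simp add: fun_eq_iff kk_def)
    show "integrable lebesgue (\<lambda>x. K (norm x) * f (U x) * h x)"
      unfolding Kint(1) K_eq by (rule kk_f_integrable[OF u(1) e(1)])
    have V_AE: "AE x in lebesgue. x \<noteq> 0 \<longrightarrow> V (norm x) * U x * h x = V (norm x) * w u (norm x) * w e (norm x)"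
      using e(2) by eventually_elim (simp add: U_def rad_fun_eq)
    have "(\<integral>r. (if r > 0 then r powr (N-1) * (V r * w u r * w e r) else 0) \<partial>lborel) = (\<integral>r. fn (snd u) r * fn (snd e) r \<partial>lborel)"
    proof (rule integral_cong_AE)
      show "(\<lambda>r. if r > 0 then r powr (N-1) * (V r * w u r * w e r) else 0) \<in> borel_measurable lborel"
        by (rule V_weight_meas)
      show "AE r in lborel. (if r > 0 then r powr (N-1) * (V r * w u r * w e r) else 0) = fn (snd u) r * fn (snd e) r"
        using energy_spaceD[OF u(1)] energy_spaceD[OF e(1)]
      proof eventually_elim
        case (elim r)
        have "r > 0 \<Longrightarrow> sqrt (V r * r powr (N-1)) * sqrt (V r * r powr (N-1)) = V r * r powr (N-1)"
          using V_nonneg[of r] by simp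
        then show ?case unfolding elim by (simp add: ac_simps)
      qed
    qed measurable
    then have "(\<integral>x. V (norm x) * U x * h x \<partial>lebesgue) = cN * (snd u \<bullet> snd e)"
      unfolding radial_lebesgue_integral(2)[OF V_profile_meas V_AE] by (simp only: inner_l2)
    moreover have "(\<integral>x. rad_grad (fst u) x \<bullet> H x \<partial>lebesgue) = cN * (fst u \<bullet> fst e)"
      unfolding e(3) by (simp add: inner_commute)
    moreover have "(\<integral>x. K (norm x) * f (U x) * h x \<partial>lebesgue) = cN * (u \<bullet> e)"
      unfolding Kint(2) K_eq u(4)[OF e(1)] ..
    ultimately show "(\<integral>x. rad_grad (fst u) x \<bullet> H x \<partial>lebesgue) + (\<integral>x. V (norm x) * U x * h x \<partial>lebesgue)
      = (\<integral>x. K (norm x) * f (U x) * h x \<partial>lebesgue)"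
      by (simp add: inner_prod_def algebra_simps)
  qed
  ultimately show ?thesis by blast
qed

end


text \<open>Multiplied by 4 the claim is q D < A. For D > 0 this bounds q from above, hence
  \<open>q_up\<close>; for D < 0 division reverses it into a lower bound, hence the last entry of
  \<open>q_low\<close>.\<close>

lemma I1_exponent_gap:
  assumes N: "N \<ge> 3" and b0: "ereal b0 > b_under N a0" and q: "q \<in> I1 N a0 b0"
  shows "b0 - min a0 (-2) - (q-2) * (2*N-2 + min a0 (-2)) / 4 > 0"
proof -
  define D where "D = 2*N-2 + min a0 (-2)"
  define A where "A = 2 * (2*N-2 + 2*b0 - min a0 (-2))"
  have "q * D < A"
  proof (cases "a0 \<ge> -2")
    case True
    then have "q < 2*(N+b0)/(N-2)" using q N by (simp add: I1_def q_up_def)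
    then show ?thesis using N True by (simp add: D_def A_def pos_less_divide_eq algebra_simps min_def)
  next
    case False
    then have DA: "D = 2*N-2+a0" "A = 2*(2*N-2+2*b0-a0)" by (auto simp: D_def A_def)
    consider "D = 0" | "D < 0" | "D > 0" by linarith
    then show ?thesis
    proof cases
      \<comment> \<open>At the threshold a0 = -(2N-2) the exponent q drops out and A = 4 (b0 - a0),
        which is positive by the assumption on b0.\<close>
      case 1
      then have "a0 = -(2*N-2)" using DA by simp
      then show ?thesis using 1 b0 False DA by (simp add: b_under_def)
    next
      case 2
      then have "A / D < q" using q DA by (simp add: I1_def q_low_def)
      then show ?thesis using 2 by (simp add: neg_divide_less_eq)
    next
      case 3
      then have "q < A / D" using q DA False by (auto simp: I1_def q_up_def split: if_splits)
      then show ?thesis using 3 by (simp add: pos_less_divide_eq)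
    qed
  qed
  moreover have "b0 - min a0 (-2) - (q-2) * D / 4 = (A - q * D) / 4" by (simp add: D_def A_def field_simps)
  ultimately show ?thesis by (simp add: D_def)
qed

text \<open>Since 2N - 2 + max(a, -2) is always positive, the condition is a lower bound on q in all
  cases.\<close>

lemma I2_exponent_gap:
  assumes N: "N \<ge> 3" and q: "q \<in> I2 N a b"
  shows "max a (-2) - b + (q-2) * (2*N-2 + max a (-2)) / 4 > 0"
proof (cases "a \<le> -2")
  case True
  then have "2*(N+b)/(N-2) < q" using q by (simp add: I2_def q_low2_def)
  then show ?thesis using N True by (simp add: pos_divide_less_eq algebra_simps max_def)
next
  case False
  then have "2*(2*N-2+2*b-a)/(2*N-2+a) < q" using q by (simp add: I2_def q_low2_def)
  then have "2*(2*N-2+2*b-a) < q * (2*N-2+a)" using N False by (simp add: pos_divide_less_eq)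
  moreover have "a - b + (q-2) * (2*N-2+a) / 4 = (q * (2*N-2+a) - 2*(2*N-2+2*b-a)) / 4" by (simp add: field_simps)
  ultimately show ?thesis using False by (simp add: max_def)
qed

lemma power_growth_of_SUP:
  assumes "(SUP t\<in>{0<..}. ereal (\<bar>f t\<bar> / min (t powr p) (t powr q))) < \<infinity>"
  shows "\<exists>C\<ge>0. \<forall>t>0. \<bar>f t\<bar> \<le> C * min (t powr p) (t powr q)"
proof -
  obtain C where C: "(SUP t\<in>{0<..}. ereal (\<bar>f t\<bar> / min (t powr p) (t powr q))) < ereal C"
    using ereal_dense2[OF assms] by blast
  have le: "\<bar>f t\<bar> / min (t powr p) (t powr q) \<le> C" if "t > 0" for t
  proof -
    have "ereal (\<bar>f t\<bar> / min (t powr p) (t powr q)) \<le> (SUP t\<in>{0<..}. ereal (\<bar>f t\<bar> / min (t powr p) (t powr q)))"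
      using that by (intro SUP_upper) simp
    then have "ereal (\<bar>f t\<bar> / min (t powr p) (t powr q)) < ereal C" using C by (rule le_less_trans)
    then show ?thesis by simp
  qed
  have "\<bar>f t\<bar> \<le> C * min (t powr p) (t powr q)" if "t > 0" for t
  proof -
    have "min (t powr p) (t powr q) > 0" using that by simp
    then show ?thesis using le[OF that] by (simp only: pos_divide_le_eq)
  qed
  moreover have "C \<ge> 0" using le[of 1] by simp
  ultimately show ?thesis by blast
qed

text \<open>The Ambrosetti-Rabinowitz inequality says that F t / t^\<theta> is nondecreasing beyond
  t1.\<close>

lemma superquadratic_growth:
  assumes F: "\<And>t. t > 0 \<Longrightarrow> (F has_real_derivative f t) (at t)"
    and t1: "t1 > 0" and AR: "\<And>t. t \<ge> t1 \<Longrightarrow> \<theta> * F t \<le> f t * t" and t: "t \<ge> t1"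
  shows "F t \<ge> F t1 * t1 powr - \<theta> * t powr \<theta>"
proof -
  have "F t1 * t1 powr - \<theta> \<le> F t * t powr - \<theta>"
  proof (rule DERIV_nonneg_imp_nondecreasing[OF t])
    fix s assume s: "t1 \<le> s" "s \<le> t"
    then have s0: "s > 0" using t1 by simp
    have "((\<lambda>s. F s * s powr - \<theta>) has_real_derivative F s * (- \<theta> * s powr (- \<theta> - 1)) + f s * s powr - \<theta>) (at s)"
      using DERIV_mult[OF F[OF s0] has_real_derivative_powr[OF s0, of "- \<theta>"]] by (simp add: ac_simps)
    moreover have "F s * (- \<theta> * s powr (- \<theta> - 1)) + f s * s powr - \<theta> = (f s * s - \<theta> * F s) * s powr (- \<theta> - 1)"
      using s0 by (simp add: powr_diff field_simps)
    moreover have "\<dots> \<ge> 0" using AR[OF s(1)] by (intro mult_nonneg_nonneg) auto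
    ultimately show "\<exists>y. ((\<lambda>s. F s * s powr - \<theta>) has_real_derivative y) (at s) \<and> 0 \<le> y" by metis
  qed
  then have "F t1 * t1 powr - \<theta> * t powr \<theta> \<le> F t * t powr - \<theta> * t powr \<theta>" by (rule mult_right_mono) simp
  also have "\<dots> = F t" using t t1 by (simp add: powr_add[symmetric] mult.assoc)
  finally show ?thesis .
qed

lemma radial_solution_cong:
  assumes "radial_solution V K g u" "\<And>x. g (u x) = f (u x)"
  shows "radial_solution V K f u"
  using assms unfolding radial_solution_def by simp

text \<open>Common form of the two cases: c0 = 0 corresponds to (f4)-(f5), and a general c0 to (f6),
  where the integrability of K pays for it.\<close>

lemma radial_solution_of_AR:
  fixes V K f :: "real \<Rightarrow> real" and a0 a b0 b q1 q2 \<theta> c0 t1 :: real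
  defines "N \<equiv> real DIM('a::euclidean_space)"
  assumes dim: "DIM('a) \<ge> 3"
    and weights: "radial_weights N a0 a b0 b V K"
    and b0: "ereal b0 > b_under N a0"
    and f: "continuous_on UNIV f" "f 0 = 0"
    and q: "q1 > 2" "q2 > 2" "q1 \<in> I1 N a0 b0" "q2 \<in> I2 N a b"
    and growth: "(SUP t\<in>{0<..}. ereal (\<bar>f t\<bar> / min (t powr (q1 - 1)) (t powr (q2 - 1)))) < \<infinity>"
    and \<theta>: "\<theta> > 2" and t1: "t1 > 0" "Fprim f t1 > 0" "\<And>t. t \<ge> t1 \<Longrightarrow> \<theta> * Fprim f t \<le> f t * t"
    and c0: "c0 \<ge> 0" "c0 > 0 \<Longrightarrow> integrable lebesgue (\<lambda>x::'a. K (norm x))"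
    and AR: "\<And>t. t \<ge> 0 \<Longrightarrow> \<theta> * Fprim f t \<le> f t * t + c0" "\<And>t. t \<ge> 0 \<Longrightarrow> Fprim f t \<ge> - c0"
  shows "\<exists>u :: 'a \<Rightarrow> real. radial_solution V K f u \<and> (\<forall>x. u x \<ge> 0) \<and> \<not> (AE x in lebesgue. u x = 0)"
proof -
  interpret radial_weights N a0 a b0 b V K by (rule weights)
  interpret dim3 "TYPE('a)" N "sphere_const TYPE('a)" "polar_density TYPE('a)"
    by unfold_locales (simp_all add: dim N_def)
  \<comment> \<open>Truncation of f at 0, as \<open>f_nonpos\<close> demands. The solution obtained
    is nonnegative, where g and f agree, so it solves the original equation.\<close>
  define g where "g t = f (max t 0)" for t
  have g_cont: "continuous_on UNIV g"
    unfolding g_def by (intro continuous_on_compose2[OF f(1)] continuous_intros) auto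
  have g_eq: "g t = f t" if "t \<ge> 0" for t using that by (simp add: g_def max_def)
  have g_nonpos: "g t = 0" if "t \<le> 0" for t using that f(2) by (simp add: g_def max_def)
  have G_eq: "Fprim g t = Fprim f t" if "t \<ge> 0" for t
    unfolding Fprim_def by (rule integral_cong) (simp add: g_eq)
  have G_neg: "Fprim g t = 0" if "t < 0" for t using that by (simp add: Fprim_def)
  obtain C where C: "C \<ge> 0" "\<And>t. t > 0 \<Longrightarrow> \<bar>f t\<bar> \<le> C * min (t powr (q1 - 1)) (t powr (q2 - 1))"
    using power_growth_of_SUP[OF growth] by blast
  have "integrable lborel (\<lambda>r. c0 * (if r > 0 then K r * r powr (N-1) else 0))"
  proof (cases "c0 = 0")
    case False
    then have "integrable lebesgue (\<lambda>x::'a. K (norm x))" using c0 by simp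
    then have "integrable lborel (\<lambda>r. if r > 0 then r powr (N-1) * K r else 0)"
      by (subst (asm) radial_lebesgue_integral(1)[OF measurable_positive_part[OF K_cont]]) auto
    then show ?thesis by (intro integrable_mult_right) (simp only: mult.commute)
  qed simp
  then interpret radial_setting "TYPE('a)" N "sphere_const TYPE('a)" "polar_density TYPE('a)" a0 a b0 b V K g q1 q2 C \<theta> c0
    "Fprim f t1 * t1 powr - \<theta>" t1
  proof unfold_locales
    fix t :: real
    show "\<bar>g t\<bar> \<le> C * min (t powr (q1-1)) (t powr (q2-1))" if "t > 0" using C(2)[OF that] that by (simp add: g_eq)
    show "b0 - al0 - (q1-2) * (2*N-2+al0)/4 > 0" unfolding al0_def by (rule I1_exponent_gap[OF N b0 q(3)])
    show "al1 - b + (q2-2) * (2*N-2+al1)/4 > 0" unfolding al1_def by (rule I2_exponent_gap[OF N q(4)])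
    show "\<theta> * Fprim g t \<le> g t * t + c0" "Fprim g t \<ge> - c0"
      using AR[of t] c0(1) by (cases "t \<ge> 0"; simp add: g_eq G_eq G_neg g_nonpos)+
    show "Fprim g t \<ge> Fprim f t1 * t1 powr - \<theta> * t powr \<theta>" if t: "t \<ge> t1"
      using superquadratic_growth[of "Fprim g" g t1 \<theta> t, OF Fprim_DERIV[OF g_cont g_nonpos] t1(1) _ t]
        t1 by (simp add: g_eq G_eq)
  qed (use g_cont g_nonpos q C \<theta> c0 t1 in auto)
  obtain u :: "'a \<Rightarrow> real" where u: "radial_solution V K g u" "\<And>x. u x \<ge> 0" "\<not> (AE x in lebesgue. u x = 0)"
    using radial_solution_exists by blast
  have "radial_solution V K f u" by (rule radial_solution_cong[OF u(1)]) (simp add: g_eq u(2))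
  then show ?thesis using u by blast
qed

theorem mainTheorem1:
  fixes V K :: "real \<Rightarrow> real" and a0 a b0 b :: real
  defines "N \<equiv> real DIM('a::euclidean_space)"
  assumes dim: "DIM('a) \<ge> 3"
    and V_cont: "continuous_on {0<..} V" and V_nonneg: "\<forall>r>0. V r \<ge> 0"
    and V0: "Liminf (at_right 0) (\<lambda>r. ereal (V r / r powr a0)) > 0"
    and Vinf: "Liminf at_top (\<lambda>r. ereal (V r / r powr a)) > 0"
    and K_cont: "continuous_on {0<..} K" and K_pos: "\<forall>r>0. K r > 0"
    and K0: "Limsup (at_right 0) (\<lambda>r. ereal (K r / r powr b0)) < \<infinity>"
    and Kinf: "Limsup at_top (\<lambda>r. ereal (K r / r powr b)) < \<infinity>"
    and b0: "ereal b0 > b_under N a0"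
  shows
    "(\<forall>f :: real \<Rightarrow> real. continuous_on UNIV f \<and> f 0 = 0 \<and>
        (\<exists>q1 q2. q1 > 2 \<and> q2 > 2 \<and> q1 \<in> I1 N a0 b0 \<and> q2 \<in> I2 N a b \<and>
           (SUP t\<in>{0<..}. ereal (\<bar>f t\<bar> / min (t powr (q1 - 1)) (t powr (q2 - 1)))) < \<infinity>) \<and>
        (\<exists>\<theta>>2. \<forall>t>0. 0 \<le> \<theta> * Fprim f t \<and> \<theta> * Fprim f t \<le> f t * t) \<and>
        (\<exists>t0>0. Fprim f t0 > 0)
      \<longrightarrow> (\<exists>u :: 'a \<Rightarrow> real. radial_solution V K f u \<and> (\<forall>x. u x \<ge> 0) \<and>
             \<not> (AE x in lebesgue. u x = 0)))
     \<and>
     (integrable lebesgue (\<lambda>x::'a. K (norm x)) \<longrightarrow>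
      (\<forall>f :: real \<Rightarrow> real. continuous_on UNIV f \<and> f 0 = 0 \<and>
        (\<exists>q1 q2. q1 > 2 \<and> q2 > 2 \<and> q1 \<in> I1 N a0 b0 \<and> q2 \<in> I2 N a b \<and>
           (SUP t\<in>{0<..}. ereal (\<bar>f t\<bar> / min (t powr (q1 - 1)) (t powr (q2 - 1)))) < \<infinity>) \<and>
        (\<exists>\<theta>>2. \<exists>t0>0. \<forall>t\<ge>t0. 0 < \<theta> * Fprim f t \<and> \<theta> * Fprim f t \<le> f t * t)
      \<longrightarrow> (\<exists>u :: 'a \<Rightarrow> real. radial_solution V K f u \<and> (\<forall>x. u x \<ge> 0) \<and>
             \<not> (AE x in lebesgue. u x = 0))))"
proof (intro conjI allI impI; elim conjE exE)
  have weights: "radial_weights (real DIM('a)) a0 a b0 b V K"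
    using assms by unfold_locales auto
  note solution = radial_solution_of_AR[OF dim weights b0[unfolded N_def]]
  have F0: "Fprim f 0 = 0" for f by (simp add: Fprim_def)
  {
    fix f :: "real \<Rightarrow> real" and q1 q2 \<theta> t0
    assume f: "continuous_on UNIV f" "f 0 = 0" and q: "q1 > 2" "q2 > 2" "q1 \<in> I1 N a0 b0" "q2 \<in> I2 N a b"
      and growth: "(SUP t\<in>{0<..}. ereal (\<bar>f t\<bar> / min (t powr (q1 - 1)) (t powr (q2 - 1)))) < \<infinity>"
      and \<theta>: "\<theta> > 2" and AR: "\<forall>t>0. 0 \<le> \<theta> * Fprim f t \<and> \<theta> * Fprim f t \<le> f t * t"
      and t0: "t0 > 0" "Fprim f t0 > 0"
    have AR': "0 \<le> \<theta> * Fprim f t" "\<theta> * Fprim f t \<le> f t * t" if "t \<ge> 0" for t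
      using AR that F0 f(2) by (cases "t = 0"; simp)+
    have "Fprim f t \<ge> 0" if "t \<ge> 0" for t using AR'(1)[OF that] \<theta> by (simp add: zero_le_mult_iff)
    then show "\<exists>u :: 'a \<Rightarrow> real. radial_solution V K f u \<and> (\<forall>x. u x \<ge> 0) \<and> \<not> (AE x in lebesgue. u x = 0)"
      using AR' t0 by (intro solution[OF f q[unfolded N_def] growth \<theta> t0, of 0]) auto
  next
    fix f :: "real \<Rightarrow> real" and q1 q2 \<theta> t0
    assume K: "integrable lebesgue (\<lambda>x::'a. K (norm x))"
      and f: "continuous_on UNIV f" "f 0 = 0" and q: "q1 > 2" "q2 > 2" "q1 \<in> I1 N a0 b0" "q2 \<in> I2 N a b"
      and growth: "(SUP t\<in>{0<..}. ereal (\<bar>f t\<bar> / min (t powr (q1 - 1)) (t powr (q2 - 1)))) < \<infinity>"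
      and \<theta>: "\<theta> > 2" and t0: "t0 > 0" and AR: "\<forall>t\<ge>t0. 0 < \<theta> * Fprim f t \<and> \<theta> * Fprim f t \<le> f t * t"
    have Fpos: "Fprim f t > 0" if "t \<ge> t0" for t using AR that \<theta> by (simp add: zero_less_mult_iff)
    have fc: "continuous_on {0..t0} f" using f(1) continuous_on_subset by blast
    have Fc: "continuous_on {0..t0} (Fprim f)"
      unfolding Fprim_def[abs_def] by (intro indefinite_integral_continuous_1 integrable_continuous_interval fc)
    \<comment> \<open>Below t0 condition (f6) says nothing; a bound of both quantities on the
      compact interval [0, t0] serves as c0.\<close>
    have "bounded ((\<lambda>t. \<bar>\<theta> * Fprim f t - f t * t\<bar> + \<bar>Fprim f t\<bar>) ` {0..t0})"
      by (intro compact_imp_bounded compact_continuous_image continuous_intros fc Fc) auto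
    then obtain B where "\<forall>x\<in>(\<lambda>t. \<bar>\<theta> * Fprim f t - f t * t\<bar> + \<bar>Fprim f t\<bar>) ` {0..t0}. norm x \<le> B"
      unfolding bounded_iff by blast
    then have B: "\<bar>\<theta> * Fprim f t - f t * t\<bar> + \<bar>Fprim f t\<bar> \<le> B" if "t \<in> {0..t0}" for t using that by auto
    have B0: "B \<ge> 0" using B[of 0] t0 by simp
    have "\<theta> * Fprim f t \<le> f t * t + B" "Fprim f t \<ge> - B" if "t \<ge> 0" for t
    proof -
      have "\<theta> * Fprim f t \<le> f t * t + B \<and> Fprim f t \<ge> - B"
      proof (cases "t \<le> t0")
        case True
        then show ?thesis using B[of t] that by (simp add: abs_if split: if_splits)
      next
        case False
        then have "\<theta> * Fprim f t \<le> f t * t" "Fprim f t > 0" using AR Fpos by auto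
        then show ?thesis using B0 by linarith
      qed
      then show "\<theta> * Fprim f t \<le> f t * t + B" "Fprim f t \<ge> - B" by auto
    qed
    then show "\<exists>u :: 'a \<Rightarrow> real. radial_solution V K f u \<and> (\<forall>x. u x \<ge> 0) \<and> \<not> (AE x in lebesgue. u x = 0)"
      using AR t0 Fpos B0 K by (intro solution[OF f q[unfolded N_def] growth \<theta> t0, of B]) auto
  }
qed

end
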